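(* Let $\mathcal{G}$ be a genus of positive definite unimodular hermitian lattices over the imaginary-quadratic field $K$, and let $[\mathfrak{a}]\in\mathcal{C}_K$ be an ideal class such that the partial genus $\mathcal{G}_{[\mathfrak{a}]}$ is nonempty. Then $$\operatorname{mass}(\mathcal{G})=\frac{h_K}{2^{t-1}}\cdot \operatorname{mass}(\mathcal{G}_{[\mathfrak{a}]}).$$ In particular, the partial masses $\operatorname{mass}(\mathcal{G}_{[\mathfrak{b}]})$ are equal for all classes $[\mathfrak{b}]$ in the ideal genus of $[\mathfrak{a}]$.
   Context: $K=\mathbb{Q}(\sqrt{D})$ with $D<0$ squarefree, $\mathfrak{o}$ its ring of integers, $d_K$ its discriminant, $\mathcal{C}_K$ its class group, $h_K$ its class number, and $t$ the number of distinct primes dividing $d_K$. A hermitian space $(V,h)$ is a finite-dimensional $K$-vector space with a form $h$ linear in the first argument and $h(x,y)=\overline{h(y,x)}$; it is (positive) definite if $h(x,x)>0$ for $x\neq 0$. A lattice $L$ on $V$ is a finitely generated $\mathfrak{o}$-submodule with $KL=V$; it can be written $L=\mathfrak{a}_1x_1+\dots+\mathfrak{a}_nx_n$ with fractional ideals $\mathfrak{a}_i$ and a basis $x_i$, and its Steinitz class is $\mathfrak{st}(L)=[\mathfrak{a}_1\cdots\mathfrak{a}_n]$. $L$ is unimodular if $L=L^\#:=\{x\in V: h(x,L)\subseteq\mathfrak{o}\}$. $U(V)$ is the unitary group, $U(L)=\{\sigma\in U(V):\sigma(L)=L\}$. The genus of $L$ is the set of lattices $N$ on $V$ with $N_p\cong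 L_p$ (over $\mathfrak{o}\otimes\mathbb{Z}_p$) for all primes $p$. For a genus $\mathcal{G}$, $\operatorname{mass}(\mathcal{G})=\sum_i 1/|U(L_i)|$ over representatives $L_i$ of the isometry classes in $\mathcal{G}$. The partial genus $\mathcal{G}_{[\mathfrak{a}]}$ is the set of lattices in $\mathcal{G}$ with Steinitz class $[\mathfrak{a}]$, and $\operatorname{mass}(\mathcal{G}_{[\mathfrak{a}]})=\sum_i 1/|U(L_i)|$ over representatives of the isometry classes in $\mathcal{G}_{[\mathfrak{a}]}$. Two classes $[\mathfrak{a}],[\mathfrak{b}]$ lie in the same ideal genus if $[\mathfrak{a}][\mathfrak{b}]^{-1}\in\mathcal{C}_K^2$. *)

theory Defs
  imports
    "HOL-Analysis.Infinite_Sum"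
    "HOL-Algebra.Coset"
    "HOL-Algebra.FiniteProduct"
    "HOL-Computational_Algebra.Computational_Algebra"
begin

section \<open>Imaginary quadratic fields\<close>

text \<open>
  The field \<open>K\<close> is the whole type \<open>'k\<close>, and \<open>s\<close> is a chosen square root of \<open>D\<close> in it.
  A \<open>K\<close>-vector space \<open>V\<close> is the whole type \<open>'v\<close> with a scalar multiplication \<open>smul\<close>.
\<close>

definition imag_quadratic_field :: "int \<Rightarrow> 'k::field_char_0 \<Rightarrow> bool" where
  "imag_quadratic_field D s \<longleftrightarrow>
     D < 0 \<and> squarefree D \<and> s\<^sup>2 = of_int D \<and> (\<forall>x. \<exists>a b. x = of_rat a + of_rat b * s)"

definition conjug :: "'k::field_char_0 \<Rightarrow> 'k \<Rightarrow> 'k" where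
  "conjug s x = (THE y. \<exists>a b. x = of_rat a + of_rat b * s \<and> y = of_rat a - of_rat b * s)"

definition int_ring :: "'k::field_char_0 set" where
  "int_ring = {x. algebraic_int x}"

definition integral_basis :: "'k::field_char_0 \<Rightarrow> 'k \<Rightarrow> bool" where
  "integral_basis w1 w2 \<longleftrightarrow>
     int_ring = {of_int m * w1 + of_int n * w2 | m n. True} \<and>
     (\<forall>m n. of_int m * w1 + of_int n * w2 = 0 \<longrightarrow> m = 0 \<and> n = 0)"

definition field_disc :: "'k::field_char_0 \<Rightarrow> int" where
  "field_disc s = (THE d. \<exists>w1 w2. integral_basis w1 w2 \<and>
      of_int d = (w1 * conjug s w2 - w2 * conjug s w1)\<^sup>2)"

definition num_ramified :: "'k::field_char_0 \<Rightarrow> nat" where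
  "num_ramified s = card {p::nat. prime p \<and> int p dvd field_disc s}"

section \<open>Lattices, fractional ideals and the class group\<close>

definition o_span :: "('k::field_char_0 \<Rightarrow> 'v::ab_group_add \<Rightarrow> 'v) \<Rightarrow> 'v set \<Rightarrow> 'v set" where
  "o_span smul X =
     {\<Sum>x\<in>F. smul (c x) x | F c. finite F \<and> F \<subseteq> X \<and> (\<forall>x\<in>F. c x \<in> int_ring)}"

definition is_lattice :: "('k::field_char_0 \<Rightarrow> 'v::ab_group_add \<Rightarrow> 'v) \<Rightarrow> 'v set \<Rightarrow> bool" where
  "is_lattice smul L \<longleftrightarrow>
     (\<exists>X. finite X \<and> L = o_span smul X) \<and> module.span smul L = UNIV"

definition fractional_ideal :: "'k::field_char_0 set \<Rightarrow> bool" where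
  "fractional_ideal a \<longleftrightarrow> (\<exists>X. finite X \<and> a = o_span (*) X) \<and> a \<noteq> {0}"

definition ideal_group :: "'k::field_char_0 set monoid" where
  "ideal_group =
     \<lparr>carrier = {a. fractional_ideal a},
      mult = (\<lambda>a b. o_span (*) {x * y | x y. x \<in> a \<and> y \<in> b}),
      one = int_ring\<rparr>"

definition principal_ideals :: "'k::field_char_0 set set" where
  "principal_ideals = {(\<lambda>x. c * x) ` int_ring | c. c \<noteq> 0}"

definition class_group :: "'k::field_char_0 set set monoid" where
  "class_group = ideal_group Mod principal_ideals"

definition class_number :: "'k::field_char_0 itself \<Rightarrow> nat" where
  "class_number _ = Coset.order (class_group :: 'k set set monoid)"

definition ideal_class :: "'k::field_char_0 set \<Rightarrow> 'k set set" where
  "ideal_class a = principal_ideals #>\<^bsub>ideal_group\<^esub> a"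

definition same_ideal_genus :: "'k::field_char_0 set set \<Rightarrow> 'k set set \<Rightarrow> bool" where
  "same_ideal_genus A B \<longleftrightarrow>
     A \<otimes>\<^bsub>class_group\<^esub> inv\<^bsub>class_group\<^esub> B
       \<in> {C \<otimes>\<^bsub>class_group\<^esub> C | C. C \<in> carrier class_group}"

definition steinitz_class ::
  "('k::field_char_0 \<Rightarrow> 'v::ab_group_add \<Rightarrow> 'v) \<Rightarrow> 'v set \<Rightarrow> 'k set set" where
  "steinitz_class smul L = (THE C. \<exists>B a.
      finite B \<and> \<not> module.dependent smul B \<and> module.span smul B = UNIV \<and>
      (\<forall>x\<in>B. fractional_ideal (a x)) \<and>
      L = {\<Sum>x\<in>B. smul (c x) x | c. \<forall>x\<in>B. c x \<in> a x} \<and>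
      C = ideal_class (finprod ideal_group a B))"

section \<open>Hermitian spaces\<close>

definition hermitian_space ::
  "'k::field_char_0 \<Rightarrow> ('k \<Rightarrow> 'v::ab_group_add \<Rightarrow> 'v) \<Rightarrow> ('v \<Rightarrow> 'v \<Rightarrow> 'k) \<Rightarrow> bool" where
  "hermitian_space s smul h \<longleftrightarrow>
     (\<exists>B. finite_dimensional_vector_space smul B) \<and>
     (\<forall>y. Vector_Spaces.linear smul (*) (\<lambda>x. h x y)) \<and>
     (\<forall>x y. h x y = conjug s (h y x))"

text \<open>
  The values \<open>h x x\<close> of a hermitian form are fixed by conjugation, hence rational; the type
  \<open>'k\<close> carries no order, so positivity is that of the corresponding rational number.
\<close>

definition positive_definite :: "('v::ab_group_add \<Rightarrow> 'v \<Rightarrow> 'k::field_char_0) \<Rightarrow> bool" where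
  "positive_definite h \<longleftrightarrow> (\<forall>x. x \<noteq> 0 \<longrightarrow> (\<exists>q. q > 0 \<and> h x x = of_rat q))"

definition dual_lattice :: "('v \<Rightarrow> 'v \<Rightarrow> 'k::field_char_0) \<Rightarrow> 'v set \<Rightarrow> 'v set" where
  "dual_lattice h L = {x. \<forall>y\<in>L. h x y \<in> int_ring}"

definition unimodular :: "('v \<Rightarrow> 'v \<Rightarrow> 'k::field_char_0) \<Rightarrow> 'v set \<Rightarrow> bool" where
  "unimodular h L \<longleftrightarrow> L = dual_lattice h L"

definition unitary_group ::
  "('k::field_char_0 \<Rightarrow> 'v::ab_group_add \<Rightarrow> 'v) \<Rightarrow> ('v \<Rightarrow> 'v \<Rightarrow> 'k) \<Rightarrow> ('v \<Rightarrow> 'v) set" where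
  "unitary_group smul h =
     {\<sigma>. Vector_Spaces.linear smul smul \<sigma> \<and> bij \<sigma> \<and> (\<forall>x y. h (\<sigma> x) (\<sigma> y) = h x y)}"

definition lattice_aut ::
  "('k::field_char_0 \<Rightarrow> 'v::ab_group_add \<Rightarrow> 'v) \<Rightarrow> ('v \<Rightarrow> 'v \<Rightarrow> 'k) \<Rightarrow> 'v set \<Rightarrow> ('v \<Rightarrow> 'v) set" where
  "lattice_aut smul h L = {\<sigma> \<in> unitary_group smul h. \<sigma> ` L = L}"

section \<open>Local completions\<close>

text \<open>
  The local objects at a prime \<open>p\<close> are \<open>p\<close>-adic completions: \<open>V\<^sub>p = V \<otimes> \<rat>\<^sub>p\<close> is the set of
  \<open>p\<close>-adic Cauchy sequences in \<open>V\<close> modulo null sequences, and the completion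
  \<open>L\<^sub>p = L \<otimes> \<int>\<^sub>p\<close> of a finitely generated module consists of the classes represented by a
  sequence in \<open>L\<close>.  Everything is applied to \<open>V\<close> and, with scalar multiplication
  \<open>(*)\<close>, to \<open>K\<close> itself, where \<open>int_ring\<close> yields \<open>\<oo> \<otimes> \<int>\<^sub>p\<close>.

  The neighbourhoods of \<open>0\<close> in the \<open>p\<close>-adic topology are the localizations \<open>L\<^sub>(\<^sub>p\<^sub>)\<close> inside \<open>V\<close>
  of all lattices \<open>L\<close>; as \<open>p^k L\<close> is again a lattice, they are arbitrarily small.  Without
  inverting the integers prime to \<open>p\<close> the completion would be larger than \<open>V \<otimes> \<rat>\<^sub>p\<close>.
\<close>

definition localization ::
  "('k::field_char_0 \<Rightarrow> 'v::ab_group_add \<Rightarrow> 'v) \<Rightarrow> nat \<Rightarrow> 'v set \<Rightarrow> 'v set" where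
  "localization smul p L = {v. \<exists>u::int. \<not> int p dvd u \<and> smul (of_int u) v \<in> L}"

definition padic_null ::
  "('k::field_char_0 \<Rightarrow> 'v::ab_group_add \<Rightarrow> 'v) \<Rightarrow> nat \<Rightarrow> (nat \<Rightarrow> 'v) \<Rightarrow> bool" where
  "padic_null smul p x \<longleftrightarrow>
     (\<forall>L. is_lattice smul L \<longrightarrow> (\<exists>M. \<forall>n\<ge>M. x n \<in> localization smul p L))"

definition padic_Cauchy ::
  "('k::field_char_0 \<Rightarrow> 'v::ab_group_add \<Rightarrow> 'v) \<Rightarrow> nat \<Rightarrow> (nat \<Rightarrow> 'v) \<Rightarrow> bool" where
  "padic_Cauchy smul p x \<longleftrightarrow>
     (\<forall>L. is_lattice smul L \<longrightarrow>
        (\<exists>M. \<forall>m\<ge>M. \<forall>n\<ge>M. x m - x n \<in> localization smul p L))"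

definition padic_class ::
  "('k::field_char_0 \<Rightarrow> 'v::ab_group_add \<Rightarrow> 'v) \<Rightarrow> nat \<Rightarrow> (nat \<Rightarrow> 'v) \<Rightarrow> (nat \<Rightarrow> 'v) set" where
  "padic_class smul p x = {y. padic_Cauchy smul p y \<and> padic_null smul p (\<lambda>n. x n - y n)}"

definition padic_completion ::
  "('k::field_char_0 \<Rightarrow> 'v::ab_group_add \<Rightarrow> 'v) \<Rightarrow> nat \<Rightarrow> 'v set \<Rightarrow> (nat \<Rightarrow> 'v) set set" where
  "padic_completion smul p L = {padic_class smul p x | x. padic_Cauchy smul p x \<and> range x \<subseteq> L}"

text \<open>
  The operations on completions are computed on representatives; the union is over a family
  with a single member.
\<close>

definition loc_add ::
  "('k::field_char_0 \<Rightarrow> 'v::ab_group_add \<Rightarrow> 'v) \<Rightarrow> nat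
     \<Rightarrow> (nat \<Rightarrow> 'v) set \<Rightarrow> (nat \<Rightarrow> 'v) set \<Rightarrow> (nat \<Rightarrow> 'v) set" where
  "loc_add smul p X Y = (\<Union>x\<in>X. \<Union>y\<in>Y. padic_class smul p (\<lambda>n. x n + y n))"

definition loc_scale ::
  "('k::field_char_0 \<Rightarrow> 'v::ab_group_add \<Rightarrow> 'v) \<Rightarrow> nat
     \<Rightarrow> (nat \<Rightarrow> 'k) set \<Rightarrow> (nat \<Rightarrow> 'v) set \<Rightarrow> (nat \<Rightarrow> 'v) set" where
  "loc_scale smul p A X = (\<Union>a\<in>A. \<Union>x\<in>X. padic_class smul p (\<lambda>n. smul (a n) (x n)))"

definition loc_form ::
  "('v \<Rightarrow> 'v \<Rightarrow> 'k::field_char_0) \<Rightarrow> nat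
     \<Rightarrow> (nat \<Rightarrow> 'v) set \<Rightarrow> (nat \<Rightarrow> 'v) set \<Rightarrow> (nat \<Rightarrow> 'k) set" where
  "loc_form h p X Y = (\<Union>x\<in>X. \<Union>y\<in>Y. padic_class (*) p (\<lambda>n. h (x n) (y n)))"

definition locally_isometric ::
  "('k::field_char_0 \<Rightarrow> 'v::ab_group_add \<Rightarrow> 'v) \<Rightarrow> ('v \<Rightarrow> 'v \<Rightarrow> 'k) \<Rightarrow> nat
     \<Rightarrow> 'v set \<Rightarrow> 'v set \<Rightarrow> bool" where
  "locally_isometric smul h p N L \<longleftrightarrow>
     (\<exists>\<phi>. bij_betw \<phi> (padic_completion smul p N) (padic_completion smul p L) \<and>
        (\<forall>X \<in> padic_completion smul p N. \<forall>Y \<in> padic_completion smul p N.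
           \<phi> (loc_add smul p X Y) = loc_add smul p (\<phi> X) (\<phi> Y) \<and>
           loc_form h p (\<phi> X) (\<phi> Y) = loc_form h p X Y) \<and>
        (\<forall>A \<in> padic_completion (*) p int_ring. \<forall>X \<in> padic_completion smul p N.
           \<phi> (loc_scale smul p A X) = loc_scale smul p A (\<phi> X)))"

section \<open>Genera and masses\<close>

definition genus ::
  "('k::field_char_0 \<Rightarrow> 'v::ab_group_add \<Rightarrow> 'v) \<Rightarrow> ('v \<Rightarrow> 'v \<Rightarrow> 'k) \<Rightarrow> 'v set \<Rightarrow> 'v set set" where
  "genus smul h L =
     {N. is_lattice smul N \<and> (\<forall>p. prime p \<longrightarrow> locally_isometric smul h p N L)}"

definition partial_genus ::
  "('k::field_char_0 \<Rightarrow> 'v::ab_group_add \<Rightarrow> 'v) \<Rightarrow> 'v set set \<Rightarrow> 'k set set \<Rightarrow> 'v set set" where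
  "partial_genus smul G A = {N \<in> G. steinitz_class smul N = A}"

definition isometry_classes ::
  "('k::field_char_0 \<Rightarrow> 'v::ab_group_add \<Rightarrow> 'v) \<Rightarrow> ('v \<Rightarrow> 'v \<Rightarrow> 'k) \<Rightarrow> 'v set set \<Rightarrow> 'v set set set"
  where
  "isometry_classes smul h G =
     G // {(L, N). L \<in> G \<and> N \<in> G \<and> (\<exists>\<sigma> \<in> unitary_group smul h. \<sigma> ` L = N)}"

definition mass ::
  "('k::field_char_0 \<Rightarrow> 'v::ab_group_add \<Rightarrow> 'v) \<Rightarrow> ('v \<Rightarrow> 'v \<Rightarrow> 'k) \<Rightarrow> 'v set set \<Rightarrow> real" where
  "mass smul h G =
     (\<Sum>\<^sub>\<infinity>C \<in> isometry_classes smul h G. 1 / real (card (lattice_aut smul h (SOME L. L \<in> C))))"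

end

(*
Let L be unimodular.  A second lattice N in the genus of L has st(N) = st(L) [I] with
I conj(I) = o (compare the ideals generated by determinants of n-tuples), and Hilbert 90 for ideals
gives I = b / conj(b), so that [I] = [b]^2 because b conj(b) is principal.  Hence the Steinitz
classes of a genus lie in one coset of the group of squares C^2.

Conversely let P be a split prime of residue degree one, lying over p.  Call N a P-neighbour of L if
the intersection of L and N is of index p in both, with quotients o/P and o/conj(P).  Then N lies in
the genus of L, st(N) and st(L) differ by the factor [P]^2, and L has as many P-neighbours as
conj(P)-neighbours, namely the number of hyperplanes of F_p^n.  Counting in two ways the isometries g
for which L and g N are neighbours, with L and N running over representatives, shows that
the partial genera of [a] and [a] [P]^2 have the same mass.  Inert and ramified primes have
principal squares, so the [P]^2 generate C^2, and mass(G) = |C^2| mass(G_[a]).  Genus theory (every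
2-torsion class contains an ambiguous ideal) gives |C[2]| = 2^(t-1), whence |C^2| = h / 2^(t-1).

The masses are first formed in ennreal: this way the finiteness of the number of isometry classes
is never needed.
*)
theory Submission
  imports Defs "Jordan_Normal_Form.Determinant" "HOL-Analysis.Infinite_Set_Sum"
begin

section \<open>Imaginary quadratic fields: conjugation, norm and trace\<close>

text \<open>The double count works because both degrees equal the number of hyperplanes of F_p^n,
  which depends on n and p alone: \<open>P\<close> and conj(P) give the same value, and it cancels
  once it is positive. Two obstacles shape the rest. Local isometries are bare bijections between
  sets of classes of Cauchy sequences. A neighbour is put into the genus by a global isometry of V,
  a quasi-reflection with factor conj(b) / b, used at p only; conversely, unimodularity spreads over
  the genus by reading integrality off constant sequences in localizations inside V. And lattices
  are compared through the ideal of their determinants instead of indices: it is det(x) a_1 ... a_n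
  for every pseudo-basis, is multiplied by P on a sublattice with quotient o / P, and tells nested
  lattices apart. Ideal arithmetic rests on Hurwitz's identity that I conj(I) is generated by a
  rational number; it supplies inverses, norms and the descent to split primes. Where prime
  exponents would be compared, the uniqueness of square roots of ideals is used.\<close>

locale imag_quad =
  fixes D :: int and s :: "'k::field_char_0"
  assumes iqf: "imag_quadratic_field D s"
begin

lemma D_neg: "D < 0" and D_sqf: "squarefree D" and s_sq: "s\<^sup>2 = of_int D"
  using iqf by (auto simp: imag_quadratic_field_def)

lemma rep_ex: "\<exists>a b. x = of_rat a + of_rat b * s"
  using iqf by (auto simp: imag_quadratic_field_def)

lemma s_mult_s: "s * s = of_rat (of_int D)"
  using s_sq by (simp add: power2_eq_square)

lemma s_not_rat: "s \<noteq> of_rat a"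
proof
  assume "s = of_rat a"
  then have "of_rat (a * a) = (of_rat (of_int D) :: 'k)"
    using s_mult_s by (simp add: of_rat_mult)
  then have "a * a = of_int D" by (simp only: of_rat_eq_iff)
  moreover have "(of_int D :: rat) < 0" using D_neg by simp
  ultimately show False using zero_le_square[of a] by linarith
qed

lemma rep_unique:
  assumes "of_rat a + of_rat b * s = of_rat a' + of_rat b' * s"
  shows "a = a'" "b = b'"
proof -
  have *: "of_rat (b' - b) * s = (of_rat (a - a') :: 'k)"
    using assms by (simp add: of_rat_diff algebra_simps)
  show "b = b'"
  proof (rule ccontr)
    assume "b \<noteq> b'"
    then have "s = of_rat ((a - a') / (b' - b))"
      using * by (simp add: of_rat_divide field_simps of_rat_diff)
    then show False using s_not_rat by blast
  qed
  then show "a = a'" using assms by simp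
qed

definition rp :: "'k \<Rightarrow> rat" where "rp x = (SOME a. \<exists>b. x = of_rat a + of_rat b * s)"
definition ip :: "'k \<Rightarrow> rat" where "ip x = (SOME b. x = of_rat (rp x) + of_rat b * s)"

lemma rep: "x = of_rat (rp x) + of_rat (ip x) * s"
proof -
  have "\<exists>b. x = of_rat (rp x) + of_rat b * s"
    unfolding rp_def by (rule someI_ex) (rule rep_ex)
  then show ?thesis unfolding ip_def by (rule someI_ex)
qed

lemma rp_eq [simp]: "rp (of_rat a + of_rat b * s) = a"
  and ip_eq [simp]: "ip (of_rat a + of_rat b * s) = b"
  using rep_unique rep[of "of_rat a + of_rat b * s"] by metis+

lemma conjug_eq: "conjug s x = of_rat (rp x) - of_rat (ip x) * s"
  unfolding conjug_def
proof (rule the_equality)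
  show "\<exists>a b. x = of_rat a + of_rat b * s \<and>
      of_rat (rp x) - of_rat (ip x) * s = of_rat a - of_rat b * s"
    using rep[of x] by blast
qed auto

abbreviation cj where "cj \<equiv> conjug s"

lemma cj_rep [simp]: "cj (of_rat a + of_rat b * s) = of_rat a - of_rat b * s"
  by (simp add: conjug_eq)

lemma rp_rat [simp]: "rp (of_rat a) = a" and ip_rat [simp]: "ip (of_rat a) = 0"
  using rp_eq[of a 0] ip_eq[of a 0] by simp_all

lemma rp_add: "rp (x + y) = rp x + rp y" and ip_add: "ip (x + y) = ip x + ip y"
proof -
  have "x + y = of_rat (rp x + rp y) + of_rat (ip x + ip y) * s"
    by (subst rep[of x], subst rep[of y]) (simp add: of_rat_add algebra_simps)
  then show "rp (x + y) = rp x + rp y" "ip (x + y) = ip x + ip y" by (metis rp_eq, metis ip_eq)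
qed

lemma mult_rep: "x * y = of_rat (rp x * rp y + of_int D * ip x * ip y) + of_rat (rp x * ip y + ip x * rp y) * s"
proof -
  have "x * y = (of_rat (rp x) + of_rat (ip x) * s) * (of_rat (rp y) + of_rat (ip y) * s)"
    using rep by simp
  also have "\<dots> = of_rat (rp x) * of_rat (rp y) + of_rat (ip x) * of_rat (ip y) * (s * s)
     + (of_rat (rp x) * of_rat (ip y) + of_rat (ip x) * of_rat (rp y)) * s"
    by (simp add: algebra_simps)
  finally show ?thesis unfolding s_mult_s by (simp add: of_rat_add of_rat_mult algebra_simps)
qed

lemma rp_mult: "rp (x * y) = rp x * rp y + of_int D * ip x * ip y"
  and ip_mult: "ip (x * y) = rp x * ip y + ip x * rp y"
  using mult_rep[of x y] by (metis rp_eq, metis ip_eq)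

lemma rp_cj [simp]: "rp (cj x) = rp x" and ip_cj [simp]: "ip (cj x) = - ip x"
  using rp_eq[of "rp x" "- ip x"] ip_eq[of "rp x" "- ip x"]
  by (simp_all add: conjug_eq of_rat_minus)

lemma eqI_rep: "rp x = rp y \<Longrightarrow> ip x = ip y \<Longrightarrow> x = y"
  using rep by metis

lemma cj_add [simp]: "cj (x + y) = cj x + cj y"
  by (rule eqI_rep) (simp_all add: rp_add ip_add)
lemma cj_mult [simp]: "cj (x * y) = cj x * cj y"
  by (rule eqI_rep) (simp_all add: rp_mult ip_mult)
lemma cj_cj [simp]: "cj (cj x) = x"
  by (rule eqI_rep) simp_all
lemma cj_rat [simp]: "cj (of_rat a) = of_rat a"
  by (rule eqI_rep) simp_all
lemma cj_int [simp]: "cj (of_int a) = of_int a"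
  using cj_rat[of "of_int a"] by simp
lemma cj_nat [simp]: "cj (of_nat a) = of_nat a"
  using cj_int[of "int a"] by simp
lemma cj_0 [simp]: "cj 0 = 0" and cj_1 [simp]: "cj 1 = 1"
  using cj_int[of 0] cj_int[of 1] by simp_all
lemma cj_minus [simp]: "cj (- x) = - cj x"
  using cj_mult[of "of_int (-1)" x] cj_int[of "-1"] by simp
lemma cj_diff [simp]: "cj (x - y) = cj x - cj y"
  using cj_add[of x "- y"] by simp
lemma cj_inject [simp]: "cj x = cj y \<longleftrightarrow> x = y"
  by (metis cj_cj)
lemma cj_eq_0 [simp]: "cj x = 0 \<longleftrightarrow> x = 0"
  using cj_inject[of x 0] by simp
lemma cj_inverse [simp]: "cj (inverse x) = inverse (cj x)"
  by (cases "x = 0") (auto intro!: inverse_unique[symmetric] simp flip: cj_mult)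
lemma cj_divide [simp]: "cj (x / y) = cj x / cj y"
  by (simp add: divide_inverse)

text \<open>Norm and trace take values in \<open>rat\<close> because \<open>'k\<close> carries no
  order, while minimality and finiteness arguments need the norm to be positive.\<close>

definition nrm :: "'k \<Rightarrow> rat" where "nrm x = rp x * rp x - of_int D * (ip x * ip x)"
definition tr :: "'k \<Rightarrow> rat" where "tr x = 2 * rp x"

lemma nrm_eq: "x * cj x = of_rat (nrm x)"
  by (rule eqI_rep) (simp_all add: rp_mult ip_mult nrm_def)
lemma tr_eq: "x + cj x = of_rat (tr x)"
  by (rule eqI_rep) (simp_all add: rp_add ip_add tr_def)
lemma nrm_mult [simp]: "nrm (x * y) = nrm x * nrm y"
proof -
  have "of_rat (nrm (x * y)) = (of_rat (nrm x * nrm y) :: 'k)"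
    by (simp add: nrm_eq[symmetric] of_rat_mult mult_ac)
  then show ?thesis by simp
qed
lemma nrm_nonneg: "nrm x \<ge> 0"
proof -
  have "of_int D * (ip x * ip x) \<le> 0"
    using D_neg by (intro mult_nonpos_nonneg) simp_all
  then show ?thesis unfolding nrm_def using zero_le_square[of "rp x"] by linarith
qed
lemma nrm_0 [simp]: "nrm 0 = 0" using nrm_eq[of 0] by simp
lemma nrm_eq_0 [simp]: "nrm x = 0 \<longleftrightarrow> x = 0"
  using nrm_eq[of x] by auto
lemma nrm_pos: "x \<noteq> 0 \<Longrightarrow> nrm x > 0"
  using nrm_nonneg[of x] nrm_eq_0[of x] by linarith
lemma nrm_cj [simp]: "nrm (cj x) = nrm x" by (simp add: nrm_def)
lemma tr_cj [simp]: "tr (cj x) = tr x" by (simp add: tr_def)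
lemma nrm_rat [simp]: "nrm (of_rat a) = a * a" by (simp add: nrm_def)
lemma nrm_int [simp]: "nrm (of_int a) = of_int a * of_int a"
  using nrm_rat[of "of_int a"] by simp
lemma nrm_1 [simp]: "nrm 1 = 1" using nrm_int[of 1] by simp
lemma nrm_power: "nrm (x ^ n) = nrm x ^ n" by (induction n) auto
lemma nrm_add: "nrm (x + y) = nrm x + tr (x * cj y) + nrm y"
  by (simp add: nrm_def tr_def rp_add ip_add rp_mult algebra_simps)
lemma tr_rat_mult: "tr (of_rat q * x) = q * tr x"
  by (simp add: tr_def rp_mult)

lemma cj_fixed: "cj x = x \<Longrightarrow> x = of_rat (rp x)"
proof -
  assume "cj x = x"
  then have "ip x = - ip x" by (metis ip_cj)
  then have "ip x = 0" by simp
  then show ?thesis using rep[of x] by simp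
qed

lemma root_quad: "x * x - of_rat (tr x) * x + of_rat (nrm x) = 0"
  by (simp add: tr_eq[symmetric] nrm_eq[symmetric] algebra_simps)

section \<open>Algebraic integers recognised by trace and norm\<close>

text \<open>The powers of an algebraic integer lie in the finitely generated group Z[x], so one
  integer \<open>d\<close> clears all their denominators with respect to 1 and \<open>s\<close>.
  Powers of \<open>x + 1\<close> lie in the same group; they are included because the trace is
  recovered from the norms of \<open>x\<close> and \<open>x + 1\<close>.\<close>

lemma power_lattice_bounded:
  assumes "algebraic_int x"
  obtains d :: int where "d \<noteq> 0" "\<And>k. \<exists>m n. of_int d * x ^ k = of_int m + of_int n * s"
    and "\<And>k. \<exists>m n. of_int d * (x + 1) ^ k = of_int m + of_int n * s"
proof -
  obtain P where P: "poly (map_poly of_int P) x = 0" "lead_coeff P = (1::int)"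
    using assms unfolding algebraic_int_altdef_ipoly by blast
  define N where "N = degree P"
  have "N > 0"
  proof (rule ccontr)
    assume "\<not> N > 0"
    then have "P = 1" using P(2) unfolding N_def
      by (metis degree_eq_zeroE gr0I lead_coeff_pCons(2) one_pCons pCons_0_0)
    then show False using P(1) by simp
  qed
  have xN: "x ^ N = - (\<Sum>i<N. of_int (coeff P i) * x ^ i)"
  proof -
    have "0 = (\<Sum>i\<le>N. of_int (coeff P i) * x ^ i)"
      using P(1) unfolding poly_altdef by (simp add: N_def degree_map_poly coeff_map_poly)
    also have "\<dots> = (\<Sum>i<N. of_int (coeff P i) * x ^ i) + x ^ N"
      using P(2) by (simp add: N_def lessThan_Suc_atMost[symmetric])
    finally show ?thesis by (simp add: eq_neg_iff_add_eq_0 add.commute)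
  qed
  \<comment> \<open>\<open>W\<close> is Z[x]; the monic equation makes the first \<open>N\<close>
    powers of \<open>x\<close> sufficient as generators.\<close>
  define W where "W = {\<Sum>i<N. of_int (c i) * x ^ i | c. True}"
  have W_add: "u + v \<in> W" if "u \<in> W" "v \<in> W" for u v
  proof -
    from that obtain c c' where "u = (\<Sum>i<N. of_int (c i) * x ^ i)" "v = (\<Sum>i<N. of_int (c' i) * x ^ i)"
      unfolding W_def by blast
    then have "u + v = (\<Sum>i<N. of_int (c i + c' i) * x ^ i)"
      by (simp add: sum.distrib algebra_simps)
    then show ?thesis unfolding W_def by (intro CollectI exI[of _ "\<lambda>i. c i + c' i"]) simp
  qed
  have W_scale: "of_int m * u \<in> W" if "u \<in> W" for u m
  proof -
    from that obtain c where "u = (\<Sum>i<N. of_int (c i) * x ^ i)"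
      unfolding W_def by blast
    then have "of_int m * u = (\<Sum>i<N. of_int (m * c i) * x ^ i)"
      by (simp add: sum_distrib_left algebra_simps)
    then show ?thesis unfolding W_def by (intro CollectI exI[of _ "\<lambda>i. m * c i"]) simp
  qed
  have W_sum: "finite A \<Longrightarrow> (\<And>i. i \<in> A \<Longrightarrow> f i \<in> W) \<Longrightarrow> sum f A \<in> W" for A and f :: "nat \<Rightarrow> 'k"
  proof (induction A rule: finite_induct)
    case empty
    show ?case unfolding W_def by (intro CollectI exI[of _ "\<lambda>_. 0"]) simp
  qed (auto intro: W_add)
  have W_pow: "x ^ i \<in> W" if "i < N" for i
  proof -
    have "x ^ i = (\<Sum>j<N. of_int (if j = i then 1 else 0) * x ^ j)"
      using that by (simp add: if_distrib[of of_int] if_distrib[of "\<lambda>u. u * _"] cong: if_cong)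
    then show ?thesis unfolding W_def by (intro CollectI exI[of _ "\<lambda>j. if j = i then 1 else 0"]) simp
  qed
  have xNW: "x ^ N \<in> W"
  proof -
    have "(\<Sum>i<N. of_int (coeff P i) * x ^ i) \<in> W" by (intro W_sum W_scale W_pow) auto
    from W_scale[OF this, of "-1"] show ?thesis using xN by simp
  qed
  have W_x: "x * u \<in> W" if "u \<in> W" for u
  proof -
    from that obtain c where u: "u = (\<Sum>i<N. of_int (c i) * x ^ i)"
      unfolding W_def by blast
    have "x * u = (\<Sum>i<N. of_int (c i) * x ^ Suc i)" by (simp add: u sum_distrib_left mult_ac)
    also have "\<dots> \<in> W"
    proof (intro W_sum W_scale)
      fix i assume "i \<in> {..<N}"
      then show "x ^ Suc i \<in> W" using W_pow[of "Suc i"] xNW by (cases "Suc i = N") auto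
    qed auto
    finally show ?thesis .
  qed
  have one_W: "1 \<in> W" using W_pow[OF \<open>N > 0\<close>] by simp
  have pw: "x ^ k \<in> W" for k
    by (induction k) (auto intro: one_W W_x)
  have pw1: "(x + 1) ^ k \<in> W" for k
    by (induction k) (auto intro: one_W W_x W_add simp: distrib_right)
  \<comment> \<open>One denominator for finitely many powers, built by multiplying in the
    denominators of both coordinates of \<open>x ^ M\<close>.\<close>
  have "\<exists>e::int. e \<noteq> 0 \<and> (\<forall>i<M. \<exists>m n. of_int e * x ^ i = of_int m + of_int n * s)" for M
  proof (induction M)
    case 0
    have "(1::int) \<noteq> 0" by simp
    then show ?case by blast
  next
    case (Suc M)
    then obtain e where e: "e \<noteq> 0" "\<forall>i<M. \<exists>m n. of_int e * x ^ i = of_int m + of_int n * s" by blast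
    obtain a b where ab: "quotient_of (rp (x ^ M)) = (a, b)" by fastforce
    obtain a' b' where ab': "quotient_of (ip (x ^ M)) = (a', b')" by fastforce
    have b: "b > 0" "b' > 0" using quotient_of_denom_pos ab ab' by blast+
    have r: "rp (x ^ M) = of_int a / of_int b" "ip (x ^ M) = of_int a' / of_int b'"
      using quotient_of_div ab ab' by blast+
    have xM: "x ^ M = of_int a / of_int b + of_int a' / of_int b' * s"
      using rep[of "x ^ M"] unfolding r by (simp add: of_rat_divide)
    show ?case
    proof (rule exI[of _ "e * b * b'"], intro conjI allI impI)
      show "e * b * b' \<noteq> 0" using e b by simp
      fix i assume "i < Suc M"
      show "\<exists>m n. of_int (e * b * b') * x ^ i = of_int m + of_int n * s"
      proof (cases "i = M")
        case True
        have "of_int (e * b * b') * x ^ i = of_int (e * b' * a) + of_int (e * b * a') * s"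
          unfolding True xM using b by (simp add: field_simps)
        then show ?thesis by blast
      next
        case False
        then obtain m n where mn: "of_int e * x ^ i = of_int m + of_int n * s" using e \<open>i < Suc M\<close> by force
        have "of_int (e * b * b') * x ^ i = of_int b * of_int b' * (of_int e * x ^ i)" by simp
        also have "\<dots> = of_int (b * b' * m) + of_int (b * b' * n) * s"
          unfolding mn by (simp add: algebra_simps)
        finally show ?thesis by blast
      qed
    qed
  qed
  then obtain e :: int where e: "e \<noteq> 0" "\<forall>i<N. \<exists>m n. of_int e * x ^ i = of_int m + of_int n * s"
    by meson
  have *: "\<exists>m n. of_int e * u = of_int m + of_int n * s" if "u \<in> W" for u
  proof -
    from that obtain c where u: "u = (\<Sum>i<N. of_int (c i) * x ^ i)"
      unfolding W_def by blast
    from e obtain m n where mn: "\<forall>i<N. of_int e * x ^ i = of_int (m i) + of_int (n i) * s" by metis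
    have "of_int e * u = (\<Sum>i<N. of_int (c i) * (of_int e * x ^ i))"
      by (simp add: u sum_distrib_left mult_ac)
    also have "\<dots> = (\<Sum>i<N. of_int (c i) * (of_int (m i) + of_int (n i) * s))"
      using mn by simp
    also have "\<dots> = of_int (\<Sum>i<N. c i * m i) + of_int (\<Sum>i<N. c i * n i) * s"
      by (simp add: algebra_simps sum.distrib sum_distrib_left)
    finally show ?thesis by blast
  qed
  show thesis by (rule that[OF e(1)]) (use * pw pw1 in blast)+
qed

text \<open>In lowest terms a / b, every power of \<open>b\<close> divides \<open>d\<close>, which
  is impossible for b > 1.\<close>

lemma rat_int_if_powers_bounded:
  assumes d: "(d::int) \<noteq> 0" and k: "\<And>k. of_int d * r ^ k \<in> (\<int>::rat set)"
  shows "r \<in> \<int>"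
proof -
  obtain a b where ab: "quotient_of r = (a, b)" by fastforce
  have b: "b > 0" using quotient_of_denom_pos ab by blast
  have cop: "coprime a b" using quotient_of_coprime ab by blast
  have r: "r = of_int a / of_int b" using quotient_of_div ab by blast
  have dv: "b ^ k dvd d" for k
  proof -
    from k[of k] obtain m where "of_int d * r ^ k = of_int m" by (auto elim: Ints_cases)
    then have "(of_int (d * a ^ k) :: rat) = of_int (m * b ^ k)"
      using b by (simp add: r power_divide field_simps)
    then have "d * a ^ k = m * b ^ k" by (simp only: of_int_eq_iff)
    then have "b ^ k dvd d * a ^ k" by simp
    moreover have "coprime (b ^ k) (a ^ k)" using cop by (simp add: coprime_commute)
    ultimately show ?thesis by (simp add: coprime_dvd_mult_left_iff)
  qed
  have "b = 1"
  proof (rule ccontr)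
    assume "b \<noteq> 1"
    then have "b \<ge> 2" using b by simp
    have "int (nat \<bar>d\<bar>) < 2 ^ nat \<bar>d\<bar>" by (metis of_nat_less_two_power)
    also have "(2::int) ^ nat \<bar>d\<bar> \<le> b ^ nat \<bar>d\<bar>" using \<open>b \<ge> 2\<close> by (intro power_mono) auto
    also have "\<dots> \<le> \<bar>d\<bar>" using dvd_imp_le_int[OF d dv[of "nat \<bar>d\<bar>"]] b by simp
    finally show False by simp
  qed
  then show ?thesis using r by simp
qed

lemma algebraic_int_iff: "algebraic_int x \<longleftrightarrow> tr x \<in> \<int> \<and> nrm x \<in> \<int>"
proof
  assume "algebraic_int x"
  then obtain d :: int where d: "d \<noteq> 0" "\<And>k. \<exists>m n. of_int d * x ^ k = of_int m + of_int n * s"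
    "\<And>k. \<exists>m n. of_int d * (x + 1) ^ k = of_int m + of_int n * s"
    using power_lattice_bounded by blast
  have *: "nrm y \<in> \<int>" if y: "\<And>k. \<exists>m n. of_int d * y ^ k = of_int m + of_int n * s" for y
  proof (rule rat_int_if_powers_bounded)
    \<comment> \<open>The norm is quadratic, so the common denominator \<open>d\<close> of the
      powers enters squared.\<close>
    show "d * d \<noteq> 0" using d by simp
    fix k
    obtain m n where mn: "of_int d * y ^ k = of_int m + of_int n * s" using y by blast
    have "of_int (d * d) * nrm y ^ k = nrm (of_int d * y ^ k)" by (simp add: nrm_power)
    also have "\<dots> = nrm (of_rat (of_int m) + of_rat (of_int n) * s)" by (simp add: mn)
    also have "\<dots> = of_int (m * m - D * (n * n))" unfolding nrm_def rp_eq ip_eq by simp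
    finally show "of_int (d * d) * nrm y ^ k \<in> \<int>" by (metis Ints_of_int)
  qed
  have 1: "nrm x \<in> \<int>" using * d(2) by blast
  have 2: "nrm (x + 1) \<in> \<int>" using * d(3) by blast
  have "tr x = nrm (x + 1) - nrm x - 1" using nrm_add[of x 1] by simp
  then show "tr x \<in> \<int> \<and> nrm x \<in> \<int>" using 1 2 by simp
next
  assume "tr x \<in> \<int> \<and> nrm x \<in> \<int>"
  then obtain t n where tn: "tr x = of_int t" "nrm x = of_int n" by (auto elim!: Ints_cases)
  show "algebraic_int x"
  proof (rule algebraic_int.intros)
    show "lead_coeff [:of_int n, - of_int t, 1 :: 'k:] = 1" by simp
    show "poly [:of_int n, - of_int t, 1:] x = 0"
      using root_quad[of x] tn by (simp add: algebra_simps)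
    show "\<forall>i. coeff [:of_int n, - of_int t, 1 :: 'k:] i \<in> \<int>"
      by (auto simp: coeff_pCons split: nat.split)
  qed
qed

end

section \<open>The ring of integers and its modules\<close>

context imag_quad
begin

abbreviation Ok :: "'k set" where "Ok \<equiv> int_ring"

lemma O_iff: "x \<in> Ok \<longleftrightarrow> tr x \<in> \<int> \<and> nrm x \<in> \<int>"
  by (simp add: int_ring_def algebraic_int_iff)

definition om :: 'k where "om = (if D mod 4 = 1 then (1 + s) / 2 else s)"

lemma rp_int_om: "rp (of_int m + of_int n * om) = of_int m + (if D mod 4 = 1 then of_int n / 2 else 0)"
  and ip_int_om: "ip (of_int m + of_int n * om) = (if D mod 4 = 1 then of_int n / 2 else of_int n)"
proof -
  have "of_int m + of_int n * om = of_rat (of_int m + (if D mod 4 = 1 then of_int n / 2 else 0))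
      + of_rat (if D mod 4 = 1 then of_int n / 2 else of_int n) * s"
    by (simp add: om_def of_rat_add of_rat_divide field_simps)
  then show "rp (of_int m + of_int n * om) = of_int m + (if D mod 4 = 1 then of_int n / 2 else 0)"
    "ip (of_int m + of_int n * om) = (if D mod 4 = 1 then of_int n / 2 else of_int n)"
    by (simp_all only: rp_eq ip_eq)
qed

text \<open>The squared denominator of \<open>y\<close> divides \<open>D\<close>, hence is a unit
  because \<open>D\<close> is squarefree.\<close>

lemma rat_int_if_sqf_mult_square_int:
  assumes "of_int D * (y * y) \<in> (\<int>::rat set)"
  shows "y \<in> \<int>"
proof -
  obtain a b where ab: "quotient_of y = (a, b)" by fastforce
  have b: "b > 0" using quotient_of_denom_pos ab by blast
  have cop: "coprime a b" using quotient_of_coprime ab by blast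
  have y: "y = of_int a / of_int b" using quotient_of_div ab by blast
  obtain m where "of_int D * (y * y) = of_int m" using assms by (auto elim: Ints_cases)
  then have "(of_int (D * (a * a)) :: rat) = of_int (m * (b * b))"
    using b by (simp add: y field_simps)
  then have "D * (a * a) = m * (b * b)" by (simp only: of_int_eq_iff)
  then have "b\<^sup>2 dvd D * a\<^sup>2" by (simp add: power2_eq_square)
  moreover have "coprime (b\<^sup>2) (a\<^sup>2)" using cop by (simp add: coprime_commute)
  ultimately have "b\<^sup>2 dvd D" by (simp add: coprime_dvd_mult_left_iff)
  then have "is_unit b" using D_sqf by (rule squarefreeD[rotated])
  then have "b = 1" using b by auto
  then show ?thesis using y by simp
qed

lemma D_mod_4: "D mod 4 = 1 \<or> D mod 4 = 2 \<or> D mod 4 = 3"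
proof -
  have "D mod 4 \<noteq> 0"
  proof
    assume "D mod 4 = 0"
    then have "2\<^sup>2 dvd D" by auto
    then have "is_unit (2::int)" using D_sqf by (rule squarefreeD[rotated])
    then show False by simp
  qed
  then show ?thesis by presburger
qed

lemma square_mod_4: "(t * t) mod (4::int) = (if even t then 0 else 1)"
proof (cases "even t")
  case True
  then obtain u where "t = 2 * u" by blast
  then have "t * t = 4 * (u * u)" by simp
  then show ?thesis using True by simp
next
  case False
  then obtain u where "t = 2 * u + 1" using oddE by blast
  then have "\<exists>w. t * t = 4 * w + 1" by (intro exI[of _ "u * u + u"]) (simp add: algebra_simps)
  then obtain w where "t * t = 4 * w + 1" by blast
  then have "t * t mod 4 = 1" by presburger
  then show ?thesis using False by simp
qed

lemma O_eq: "Ok = {of_int m + of_int n * om | m n. True}"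
proof (intro subset_antisym subsetI)
  fix x :: 'k assume "x \<in> Ok"
  then obtain t c where tc: "tr x = of_int t" "nrm x = of_int c"
    by (auto simp: O_iff elim!: Ints_cases)
  have r: "rp x = of_int t / 2" using tc by (simp add: tr_def)
  have "of_int D * ((2 * ip x) * (2 * ip x)) = (of_int (t * t - 4 * c) :: rat)"
    using tc(2) by (simp add: nrm_def r field_simps)
  then have "of_int D * ((2 * ip x) * (2 * ip x)) \<in> \<int>" by (simp only: Ints_of_int)
  then have "2 * ip x \<in> \<int>" by (rule rat_int_if_sqf_mult_square_int)
  then obtain n where n: "2 * ip x = of_int n" by (auto elim: Ints_cases)
  have i: "ip x = of_int n / 2" using n by simp
  have "(of_int (t * t - D * (n * n)) :: rat) = of_int (4 * c)"
    using tc(2) by (simp add: nrm_def r i field_simps)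
  then have tn: "t * t = D * (n * n) + 4 * c" by (simp only: of_int_eq_iff)
  \<comment> \<open>Modulo 4 the equation t^2 = D n^2 + 4 c decides the parities: odd values of
    \<open>t\<close> or \<open>n\<close> occur only when \<open>D\<close> is 1 modulo 4, and then
    together.\<close>
  have m4: "(t * t) mod 4 = (D mod 4) * ((n * n) mod 4) mod 4"
    unfolding tn by (simp add: mod_mult_eq)
  show "x \<in> {of_int m + of_int n * om | m n. True}"
  proof (cases "D mod 4 = 1")
    case True
    have "even t \<longleftrightarrow> even n" using m4 True by (simp add: square_mod_4 split: if_splits)
    then have "even (t - n)" by simp
    then obtain m where "t - n = 2 * m" by blast
    then have m: "t = n + 2 * m" by simp
    have "x = of_int m + of_int n * om"
      by (rule eqI_rep; subst rp_int_om ip_int_om) (auto simp: True r i m field_simps)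
    then show ?thesis by blast
  next
    case False
    have "even t \<and> even n"
      using m4 False D_mod_4 by (auto simp: square_mod_4 split: if_splits)
    then obtain a b where ab: "t = 2 * a" "n = 2 * b" by blast
    have "x = of_int a + of_int b * om"
      by (rule eqI_rep; subst rp_int_om ip_int_om) (auto simp: False r i ab)
    then show ?thesis by blast
  qed
next
  fix x :: 'k assume "x \<in> {of_int m + of_int n * om | m n. True}"
  then obtain m n where x: "x = of_int m + of_int n * om" by blast
  show "x \<in> Ok"
  proof (cases "D mod 4 = 1")
    case True
    then obtain q where q: "D = 4 * q + 1" by (metis mod_mult_div_eq add.commute)
    have "tr x = of_int (2 * m + n)" unfolding tr_def x rp_int_om using True by simp
    moreover have "nrm x = of_int (m * m + m * n - q * (n * n))"
      unfolding nrm_def x rp_int_om ip_int_om using True by (simp add: q field_simps)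
    ultimately show ?thesis unfolding O_iff by (metis Ints_of_int)
  next
    case False
    have "tr x = of_int (2 * m)" unfolding tr_def x rp_int_om using False by simp
    moreover have "nrm x = of_int (m * m - D * (n * n))"
      unfolding nrm_def x rp_int_om ip_int_om using False by simp
    ultimately show ?thesis unfolding O_iff by (metis Ints_of_int)
  qed
qed

lemma om_sq: "\<exists>a b. om * om = of_int a + of_int b * om"
proof (cases "D mod 4 = 1")
  case True
  then obtain q where q: "D = 4 * q + 1" by (metis mod_mult_div_eq add.commute)
  have ss: "s * s = 4 * of_int q + 1" using s_sq q by (simp add: power2_eq_square)
  have "(1 + s) * (1 + s) = 1 + 2 * s + (4 * of_int q + 1)"
    unfolding ss[symmetric] by (simp add: algebra_simps)
  then have "om * om = of_int q + of_int 1 * om" using True by (simp add: om_def field_simps)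
  then show ?thesis by blast
next
  case False
  have "om * om = of_int D + of_int 0 * om" using False s_sq by (simp add: om_def power2_eq_square)
  then show ?thesis by blast
qed

lemma O_add [intro]: assumes "x \<in> Ok" "y \<in> Ok" shows "x + y \<in> Ok"
proof -
  obtain a b c d where "x = of_int a + of_int b * om" "y = of_int c + of_int d * om"
    using assms unfolding O_eq by blast
  then have "x + y = of_int (a + c) + of_int (b + d) * om" by (simp add: algebra_simps)
  then show ?thesis unfolding O_eq by blast
qed

lemma O_mult [intro]: assumes "x \<in> Ok" "y \<in> Ok" shows "x * y \<in> Ok"
proof -
  obtain a b c d where *: "x = of_int a + of_int b * om" "y = of_int c + of_int d * om"
    using assms unfolding O_eq by blast
  obtain e f where ef: "om * om = of_int e + of_int f * om" using om_sq by blast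
  have "x * y = of_int (a * c) + of_int (a * d + b * c) * om + of_int (b * d) * (om * om)"
    by (simp add: * algebra_simps)
  also have "\<dots> = of_int (a * c + b * d * e) + of_int (a * d + b * c + b * d * f) * om"
    unfolding ef by (simp add: algebra_simps)
  finally show ?thesis unfolding O_eq by blast
qed

lemma O_int [simp, intro]: "of_int m \<in> Ok" by (simp add: int_ring_def)
lemma O_nat [simp, intro]: "of_nat m \<in> Ok" by (simp add: int_ring_def)
lemma O_0 [simp, intro]: "0 \<in> Ok" and O_1 [simp, intro]: "1 \<in> Ok" by (simp_all add: int_ring_def)
lemma O_om [simp, intro]: "om \<in> Ok"
proof -
  have "om = of_int 0 + of_int 1 * om" by simp
  then show ?thesis unfolding O_eq by blast
qed
lemma O_minus [intro]: "x \<in> Ok \<Longrightarrow> - x \<in> Ok" by (simp add: int_ring_def)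
lemma O_diff [intro]: "x \<in> Ok \<Longrightarrow> y \<in> Ok \<Longrightarrow> x - y \<in> Ok"
  using O_add[of x "- y"] O_minus by simp
lemma O_cj [simp]: "cj x \<in> Ok \<longleftrightarrow> x \<in> Ok" by (simp add: O_iff)
lemma O_cj_image [simp]: "cj ` Ok = Ok"
  by (metis O_cj cj_cj image_eqI subsetI subset_antisym image_subsetI)
lemma O_rat: "of_rat q \<in> Ok \<longleftrightarrow> q \<in> \<int>"
proof
  assume "of_rat q \<in> Ok"
  then have "of_rat q \<in> (\<int> :: 'k set)"
    unfolding int_ring_def using rational_algebraic_int_is_int[of "of_rat q :: 'k"] by simp
  then obtain m where "of_rat q = (of_rat (of_int m) :: 'k)" by (auto elim: Ints_cases)
  then show "q \<in> \<int>" unfolding of_rat_eq_iff by simp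
qed (auto elim: Ints_cases)
lemma O_nrm: "x \<in> Ok \<Longrightarrow> nrm x \<in> \<int>" and O_tr: "x \<in> Ok \<Longrightarrow> tr x \<in> \<int>"
  by (simp_all add: O_iff)
lemma O_root: assumes "x * x \<in> Ok" shows "x \<in> Ok"
proof -
  have "algebraic_int (x * x)" using assms by (simp add: int_ring_def)
  then have "algebraic_int x"
    by (rule algebraic_int_root[where p = "monom 1 2"]) (simp_all add: poly_monom power2_eq_square degree_monom_eq)
  then show ?thesis by (simp add: int_ring_def)
qed

lemma int_multiple_in_O: "\<exists>m. m > 0 \<and> of_int m * x \<in> Ok"
proof -
  obtain a b where ab: "quotient_of (rp x) = (a, b)" by fastforce
  obtain a' b' where ab': "quotient_of (ip x) = (a', b')" by fastforce
  have b: "b > 0" "b' > 0" using quotient_of_denom_pos ab ab' by blast+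
  have r: "rp x = of_int a / of_int b" "ip x = of_int a' / of_int b'"
    using quotient_of_div ab ab' by blast+
  have sO: "s \<in> Ok" by (rule O_root) (use s_sq in \<open>simp add: power2_eq_square\<close>)
  have "x = of_int a / of_int b + of_int a' / of_int b' * s"
    using rep[of x] unfolding r by (simp add: of_rat_divide)
  then have "of_int (b * b') * x = of_int (a * b') + of_int (a' * b) * s"
    using b by (simp add: field_simps)
  also have "\<dots> \<in> Ok" using sO by (intro O_add O_mult) auto
  finally show ?thesis using b by (metis mult_pos_pos)
qed

lemma int_multiple_in_O_finite:
  assumes "finite X" shows "\<exists>m. m > 0 \<and> (\<forall>x\<in>X. of_int m * x \<in> Ok)"
  using assms
proof (induction X)
  case empty show ?case by (rule exI[of _ 1]) simp
next
  case (insert x X)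
  obtain m where m: "m > 0" "\<forall>x\<in>X. of_int m * x \<in> Ok" using insert by blast
  obtain n where n: "n > 0" "of_int n * x \<in> Ok" using int_multiple_in_O by blast
  have "of_int (m * n) * y = of_int m * (of_int n * y)" "of_int (m * n) * y = of_int n * (of_int m * y)" for y :: 'k
    by simp_all
  then have "\<forall>y\<in>insert x X. of_int (m * n) * y \<in> Ok"
    using m(2) n(2) by (metis O_int O_mult insertE)
  then show ?case using m n by (metis mult_pos_pos)
qed

text \<open>Finite generation of submodules and finiteness of the class group are both reduced to
  this finite set of residues.\<close>

lemma O_reps:
  assumes m: "m \<noteq> 0"
  shows "\<exists>C. finite C \<and> C \<subseteq> Ok \<and> (\<forall>x\<in>Ok. \<exists>c\<in>C. \<exists>d\<in>Ok. x = c + of_int m * d)"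
proof -
  define C where "C = (\<lambda>(i, j). of_int i + of_int j * om) ` ({0..<\<bar>m\<bar>} \<times> {0..<\<bar>m\<bar>})"
  have finC: "finite C" unfolding C_def by simp
  have CO: "C \<subseteq> Ok" unfolding C_def by (auto intro!: O_add O_mult)
  have C: "\<exists>c\<in>C. \<exists>d\<in>Ok. x = c + of_int m * d" if x: "x \<in> Ok" for x
  proof -
    obtain a b where ab: "x = of_int a + of_int b * om" using x unfolding O_eq by blast
    have "a = a mod \<bar>m\<bar> + m * (sgn m * (a div \<bar>m\<bar>))" for a
      by (metis add.commute mod_mult_div_eq mult.assoc abs_sgn)
    then have e: "of_int (a mod \<bar>m\<bar>) + of_int m * of_int (sgn m * (a div \<bar>m\<bar>)) = (of_int a :: 'k)" for a
      by (metis of_int_add of_int_mult)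
    have "x = (of_int (a mod \<bar>m\<bar>) + of_int (b mod \<bar>m\<bar>) * om)
        + of_int m * (of_int (sgn m * (a div \<bar>m\<bar>)) + of_int (sgn m * (b div \<bar>m\<bar>)) * om)"
      unfolding ab e[symmetric, of a] e[symmetric, of b] by (simp only: distrib_left distrib_right mult_ac add_ac)
    moreover have "of_int (a mod \<bar>m\<bar>) + of_int (b mod \<bar>m\<bar>) * om \<in> C"
      unfolding C_def using m by (intro image_eqI[of _ _ "(a mod \<bar>m\<bar>, b mod \<bar>m\<bar>)"]) auto
    moreover have "of_int (sgn m * (a div \<bar>m\<bar>)) + of_int (sgn m * (b div \<bar>m\<bar>)) * om \<in> Ok"
      by (intro O_add O_mult O_int O_om)
    ultimately show ?thesis by blast
  qed
  show ?thesis using finC CO C by blast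
qed

end

text \<open>Submodules over the ring of integers. The scalar multiplication is a parameter so that
  lattices in V and ideals in K share one theory.\<close>

definition osub :: "('k::field_char_0 \<Rightarrow> 'v::ab_group_add \<Rightarrow> 'v) \<Rightarrow> 'v set \<Rightarrow> bool" where
  "osub smul M \<longleftrightarrow> 0 \<in> M \<and> (\<forall>x\<in>M. \<forall>y\<in>M. x + y \<in> M) \<and> (\<forall>c\<in>int_ring. \<forall>x\<in>M. smul c x \<in> M)"

definition fg :: "('k::field_char_0 \<Rightarrow> 'v::ab_group_add \<Rightarrow> 'v) \<Rightarrow> 'v set \<Rightarrow> bool" where
  "fg smul M \<longleftrightarrow> (\<exists>X. finite X \<and> M = o_span smul X)"

locale iq_space = imag_quad D s + vector_space smul
  for D and s :: "'k::field_char_0" and smul :: "'k \<Rightarrow> 'v::ab_group_add \<Rightarrow> 'v"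
begin

lemma osub_0: "osub smul M \<Longrightarrow> 0 \<in> M"
  and osub_add: "osub smul M \<Longrightarrow> x \<in> M \<Longrightarrow> y \<in> M \<Longrightarrow> x + y \<in> M"
  and osub_scale: "osub smul M \<Longrightarrow> c \<in> Ok \<Longrightarrow> x \<in> M \<Longrightarrow> smul c x \<in> M"
  by (auto simp: osub_def)
lemma osub_minus: "osub smul M \<Longrightarrow> x \<in> M \<Longrightarrow> - x \<in> M"
  using osub_scale[of M "-1" x] O_minus[OF O_1] by (simp add: scale_minus_left)
lemma osub_diff: "osub smul M \<Longrightarrow> x \<in> M \<Longrightarrow> y \<in> M \<Longrightarrow> x - y \<in> M"
  using osub_add[of M x "- y"] osub_minus by simp
lemma osub_sum: "osub smul M \<Longrightarrow> (\<And>i. i \<in> A \<Longrightarrow> f i \<in> M) \<Longrightarrow> sum f A \<in> M"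
  by (induction A rule: infinite_finite_induct) (auto intro: osub_0 osub_add)

lemma osub_o_span: "osub smul (o_span smul X)"
  unfolding osub_def
proof (intro conjI ballI)
  show "0 \<in> o_span smul X" unfolding o_span_def by (intro CollectI exI[of _ "{}"]) simp
next
  fix x y assume "x \<in> o_span smul X" "y \<in> o_span smul X"
  then obtain F c F' c' where F: "finite F" "F \<subseteq> X" "\<forall>x\<in>F. c x \<in> Ok" "x = (\<Sum>x\<in>F. smul (c x) x)"
    and F': "finite F'" "F' \<subseteq> X" "\<forall>x\<in>F'. c' x \<in> Ok" "y = (\<Sum>x\<in>F'. smul (c' x) x)"
    unfolding o_span_def by blast
  define d where "d x = (if x \<in> F then c x else 0) + (if x \<in> F' then c' x else 0)" for x
  have "(\<Sum>x\<in>F \<union> F'. smul (d x) x) = (\<Sum>x\<in>F \<union> F'. smul (if x \<in> F then c x else 0) x)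
     + (\<Sum>x\<in>F \<union> F'. smul (if x \<in> F' then c' x else 0) x)"
    by (simp add: d_def scale_left_distrib sum.distrib)
  also have "(\<Sum>x\<in>F \<union> F'. smul (if x \<in> F then c x else 0) x) = x"
    unfolding F(4) using F(1) F'(1) by (intro sum.mono_neutral_cong_right) auto
  also have "(\<Sum>x\<in>F \<union> F'. smul (if x \<in> F' then c' x else 0) x) = y"
    unfolding F'(4) using F(1) F'(1) by (intro sum.mono_neutral_cong_right) auto
  finally show "x + y \<in> o_span smul X"
    unfolding o_span_def using F F' by (intro CollectI exI[of _ "F \<union> F'"] exI[of _ d]) (auto simp: d_def)
next
  fix e x assume e: "e \<in> Ok" and "x \<in> o_span smul X"
  then obtain F c where F: "finite F" "F \<subseteq> X" "\<forall>x\<in>F. c x \<in> Ok" "x = (\<Sum>x\<in>F. smul (c x) x)"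
    unfolding o_span_def by blast
  have "smul e x = (\<Sum>x\<in>F. smul (e * c x) x)"
    by (simp add: F(4) scale_sum_right)
  then show "smul e x \<in> o_span smul X"
    unfolding o_span_def using F e by (intro CollectI exI[of _ F] exI[of _ "\<lambda>x. e * c x"]) auto
qed

lemma o_span_base: "x \<in> X \<Longrightarrow> x \<in> o_span smul X"
  unfolding o_span_def by (intro CollectI exI[of _ "{x}"] exI[of _ "\<lambda>_. 1"]) auto

lemma o_span_least: "osub smul M \<Longrightarrow> X \<subseteq> M \<Longrightarrow> o_span smul X \<subseteq> M"
  unfolding o_span_def by (auto intro!: osub_sum osub_scale)

lemma o_span_finite:
  assumes "finite X"
  shows "o_span smul X = {\<Sum>x\<in>X. smul (c x) x | c. \<forall>x\<in>X. c x \<in> Ok}"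
proof (intro subset_antisym subsetI)
  fix y assume "y \<in> o_span smul X"
  then obtain F c where F: "finite F" "F \<subseteq> X" "\<forall>x\<in>F. c x \<in> Ok" "y = (\<Sum>x\<in>F. smul (c x) x)"
    unfolding o_span_def by blast
  have "y = (\<Sum>x\<in>X. smul (if x \<in> F then c x else 0) x)"
    unfolding F(4) using F assms by (intro sum.mono_neutral_cong_left) auto
  then show "y \<in> {\<Sum>x\<in>X. smul (c x) x | c. \<forall>x\<in>X. c x \<in> Ok}"
    using F(3) by (intro CollectI exI[of _ "\<lambda>x. if x \<in> F then c x else 0"]) auto
qed (use assms in \<open>auto simp: o_span_def\<close>)

lemma fg_osub: "fg smul M \<Longrightarrow> osub smul M"
  unfolding fg_def using osub_o_span by blast

text \<open>This takes the place of the noetherian property. \<open>M\<close> is caught between m L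
  and \<open>L\<close>, so it is generated by the multiples m x of generators of \<open>L\<close>
  together with those of the finitely many combinations with residues modulo \<open>m\<close> as
  coefficients that lie in \<open>M\<close>.\<close>

lemma fg_between:
  assumes L: "fg smul L" and M: "osub smul M" "M \<subseteq> L" and m: "m \<noteq> 0"
    and mL: "\<And>x. x \<in> L \<Longrightarrow> smul (of_int m) x \<in> M"
  shows "fg smul M"
proof -
  obtain X where X: "finite X" "L = o_span smul X" using L unfolding fg_def by blast
  obtain C where finC: "finite C" and CO: "C \<subseteq> Ok"
    and C: "\<And>x. x \<in> Ok \<Longrightarrow> \<exists>c\<in>C. \<exists>d\<in>Ok. x = c + of_int m * d"
    using O_reps[OF m] by metis
  define F where "F = (\<lambda>c. \<Sum>x\<in>X. smul (c x) x) ` (X \<rightarrow>\<^sub>E C)"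
  have finF: "finite F" unfolding F_def using X(1) finC by (intro finite_imageI finite_PiE) auto
  define Y where "Y = smul (of_int m) ` X \<union> (F \<inter> M)"
  have "M \<subseteq> o_span smul Y"
  proof
    fix y assume "y \<in> M"
    then have "y \<in> o_span smul X" using M X by blast
    then obtain c where c: "y = (\<Sum>x\<in>X. smul (c x) x)" "\<forall>x\<in>X. c x \<in> Ok"
      unfolding o_span_finite[OF X(1)] by blast
    have "\<forall>x\<in>X. \<exists>e d. e \<in> C \<and> d \<in> Ok \<and> c x = e + of_int m * d" using C c(2) by blast
    then obtain e d where ed: "\<forall>x\<in>X. e x \<in> C \<and> d x \<in> Ok \<and> c x = e x + of_int m * d x" by metis
    define r where "r = (\<Sum>x\<in>X. smul (e x) x)"
    define q where "q = (\<Sum>x\<in>X. smul (d x) (smul (of_int m) x))"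
    have y: "y = r + q"
      unfolding c(1) r_def q_def sum.distrib[symmetric] using ed
      by (intro sum.cong) (auto simp: scale_left_distrib mult.commute)
    have "q = smul (of_int m) (\<Sum>x\<in>X. smul (d x) x)"
      by (simp add: q_def scale_sum_right mult.commute)
    moreover have "(\<Sum>x\<in>X. smul (d x) x) \<in> L"
      unfolding X(2) o_span_finite[OF X(1)] using ed by blast
    ultimately have "q \<in> M" using mL by simp
    then have "r \<in> M" using osub_diff[OF M(1) \<open>y \<in> M\<close> \<open>q \<in> M\<close>] y by simp
    moreover have "r \<in> F" unfolding F_def r_def
      using ed by (intro image_eqI[of _ _ "restrict e X"]) (auto intro!: sum.cong)
    ultimately have "r \<in> o_span smul Y" by (intro o_span_base) (simp add: Y_def)
    have Y: "smul (of_int m) x \<in> o_span smul Y" if "x \<in> X" for x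
      using that by (intro o_span_base) (auto simp: Y_def)
    have "q \<in> o_span smul Y" unfolding q_def
      by (rule osub_sum[OF osub_o_span], rule osub_scale[OF osub_o_span]) (use ed Y in auto)
    with \<open>r \<in> o_span smul Y\<close> show "y \<in> o_span smul Y" unfolding y by (intro osub_add[OF osub_o_span])
  qed
  moreover have "o_span smul Y \<subseteq> M"
  proof (rule o_span_least[OF M(1)])
    show "Y \<subseteq> M" unfolding Y_def using mL o_span_base X(2) by blast
  qed
  moreover have "finite Y" unfolding Y_def using finF X(1) by simp
  ultimately show ?thesis unfolding fg_def by blast
qed

end

section \<open>The group of fractional ideals\<close>

text \<open>The field is a space over itself, so every lemma on submodules becomes one on ideals
  under the prefix \<open>K\<close>.\<close>

sublocale imag_quad \<subseteq> K: iq_space D s "(*)"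
  by unfold_locales

context imag_quad
begin

declare K.scale_scale [simp del]

abbreviation osubK :: "'k set \<Rightarrow> bool" where "osubK \<equiv> osub (*)"
abbreviation frac :: "'k set \<Rightarrow> bool" where "frac \<equiv> fractional_ideal"

definition imul :: "'k set \<Rightarrow> 'k set \<Rightarrow> 'k set" where
  "imul I J = o_span (*) {x * y | x y. x \<in> I \<and> y \<in> J}"
definition pr :: "'k \<Rightarrow> 'k set" where "pr c = (\<lambda>x. c * x) ` Ok"

lemma ideal_group_simps [simp]:
  "carrier ideal_group = {I. frac I}" "mult ideal_group = imul" "one ideal_group = Ok"
  by (auto simp: ideal_group_def imul_def fun_eq_iff)

lemma frac_iff: "frac I \<longleftrightarrow> fg (*) I \<and> I \<noteq> {0}"
  by (auto simp: fractional_ideal_def fg_def)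
lemma frac_osub: "frac I \<Longrightarrow> osubK I" by (simp add: frac_iff K.fg_osub)
lemma frac_nonzero: assumes "frac I" obtains x where "x \<in> I" "x \<noteq> 0"
  using assms K.osub_0[OF frac_osub[OF assms]] unfolding frac_iff by blast

lemma osub_imul: "osubK (imul I J)" unfolding imul_def by (rule K.osub_o_span)
lemma imulI: "x \<in> I \<Longrightarrow> y \<in> J \<Longrightarrow> x * y \<in> imul I J"
  unfolding imul_def by (rule K.o_span_base) blast
lemma imul_least: "osubK M \<Longrightarrow> (\<And>x y. x \<in> I \<Longrightarrow> y \<in> J \<Longrightarrow> x * y \<in> M) \<Longrightarrow> imul I J \<subseteq> M"
  unfolding imul_def by (rule K.o_span_least) auto
lemma imul_mono: "I \<subseteq> I' \<Longrightarrow> J \<subseteq> J' \<Longrightarrow> imul I J \<subseteq> imul I' J'"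
  by (rule imul_least[OF osub_imul]) (auto intro: imulI)
lemma imul_comm: "imul I J = imul J I"
  unfolding imul_def by (rule arg_cong[where f = "o_span (*)"]) (auto intro: mult.commute)

lemma osub_colon: assumes "osubK M" shows "osubK {z. \<forall>k\<in>J. z * k \<in> M}"
  using assms unfolding osub_def by (auto simp: distrib_right mult.assoc)

lemma imul_assoc_le: "imul (imul I J) H \<subseteq> imul I (imul J H)"
proof (rule imul_least[OF osub_imul])
  fix z k assume z: "z \<in> imul I J" and k: "k \<in> H"
  have "imul I J \<subseteq> {z. \<forall>k\<in>H. z * k \<in> imul I (imul J H)}"
    by (rule imul_least[OF osub_colon[OF osub_imul]]) (auto simp: mult.assoc intro!: imulI)
  then show "z * k \<in> imul I (imul J H)" using z k by blast
qed

lemma imul_assoc: "imul (imul I J) H = imul I (imul J H)"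
proof
  have "imul I (imul J H) = imul (imul H J) I" by (metis imul_comm)
  also have "\<dots> \<subseteq> imul H (imul J I)" by (rule imul_assoc_le)
  also have "\<dots> = imul (imul I J) H" by (metis imul_comm)
  finally show "imul I (imul J H) \<subseteq> imul (imul I J) H" .
qed (rule imul_assoc_le)

lemma osub_O: "osubK Ok" by (auto simp: osub_def)

lemma osub_cmult: "osubK I \<Longrightarrow> osubK ((\<lambda>x. c * x) ` I)"
  unfolding osub_def by (auto simp: distrib_left[symmetric] intro!: image_eqI[where f = "\<lambda>x. c * x"])

lemma osub_pr: "osubK (pr c)" unfolding pr_def by (rule osub_cmult[OF osub_O])
lemma prI: "c \<in> pr c" unfolding pr_def using O_1 by force
lemma pr_subset: "osubK I \<Longrightarrow> pr c \<subseteq> I \<longleftrightarrow> c \<in> I"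
  using prI[of c] unfolding pr_def osub_def by (auto simp: mult.commute)
lemma pr_1 [simp]: "pr 1 = Ok" by (simp add: pr_def)
lemma pr_mem: "c \<noteq> 0 \<Longrightarrow> x \<in> pr c \<longleftrightarrow> x / c \<in> Ok"
  unfolding pr_def by (auto intro: image_eqI[of _ _ "x / c"])

lemma imul_pr: assumes "osubK I" shows "imul (pr c) I = (\<lambda>x. c * x) ` I"
proof
  show "imul (pr c) I \<subseteq> (\<lambda>x. c * x) ` I"
    by (rule imul_least[OF osub_cmult[OF assms]])
      (use assms in \<open>auto simp: pr_def osub_def mult.assoc\<close>)
  show "(\<lambda>x. c * x) ` I \<subseteq> imul (pr c) I" using imulI[OF prI] by blast
qed

lemma imul_pr_pr [simp]: "imul (pr a) (pr b) = pr (a * b)"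
  by (simp add: imul_pr osub_pr) (simp add: pr_def image_image mult.assoc)

lemma imul_O [simp]: "osubK I \<Longrightarrow> imul Ok I = I"
  using imul_pr[of I 1] by simp

lemma frac_denom: assumes "frac I" obtains m :: int where "m > 0" "\<And>x. x \<in> I \<Longrightarrow> of_int m * x \<in> Ok"
proof -
  obtain X where X: "finite X" "I = o_span (*) X" using assms by (auto simp: fractional_ideal_def)
  obtain m where m: "m > 0" "\<forall>x\<in>X. of_int m * x \<in> Ok" using int_multiple_in_O_finite[OF X(1)] by blast
  have "osubK {x. of_int m * x \<in> Ok}"
    unfolding osub_def by (auto simp: distrib_left mult.left_commute)
  then have "I \<subseteq> {x. of_int m * x \<in> Ok}" unfolding X(2) by (rule K.o_span_least) (use m in auto)
  then show thesis using that m(1) by blast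
qed

text \<open>The norm of \<open>x\<close> is the multiple of \<open>x\<close> by its conjugate;
  clearing denominators turns it into an integer.\<close>

lemma osub_contains_int:
  assumes "osubK I" "x \<in> I" "x \<noteq> 0" obtains m :: int where "m > 0" "of_int m \<in> I"
proof -
  obtain k where k: "k > 0" "of_int k * cj x \<in> Ok" using int_multiple_in_O by blast
  obtain a b where ab: "quotient_of (of_int k * nrm x) = (a, b)" by fastforce
  have b: "b > 0" using quotient_of_denom_pos ab by blast
  have r: "of_int k * nrm x = of_int a / of_int b" using quotient_of_div ab by blast
  have "of_int k * nrm x > 0" using k nrm_pos[OF assms(3)] by simp
  then have a: "a > 0" using b unfolding r by (simp add: zero_less_divide_iff)
  have "of_int b * (of_int k * cj x) * x \<in> I"
    using k(2) by (intro K.osub_scale[OF assms(1) _ assms(2)] O_mult[OF O_int k(2)])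
  also have "of_int b * (of_int k * cj x) * x = of_int b * of_rat (of_int k * nrm x)"
    by (simp add: of_rat_mult nrm_eq[symmetric] mult_ac)
  also have "\<dots> = of_int a" using b by (simp add: r of_rat_divide)
  finally show thesis using that a by blast
qed

text \<open>Bounded denominators place \<open>I\<close> inside the ideal generated by 1 / m, and a
  positive integer \<open>k\<close> in \<open>I\<close> puts the multiple of that ideal by k m
  inside \<open>I\<close>; so \<open>fg_between\<close> applies.\<close>

lemma fracI:
  assumes "osubK I" "x \<in> I" "x \<noteq> 0" "m \<noteq> 0" "\<And>x. x \<in> I \<Longrightarrow> of_int m * x \<in> Ok"
  shows "frac I"
proof -
  obtain k :: int where k: "k > 0" "of_int k \<in> I" using osub_contains_int assms(1-3) by blast
  have "fg (*) I"
  proof (rule K.fg_between[where L = "pr (1 / of_int m)" and m = "k * m"])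
    have "pr (1 / of_int m) = o_span (*) {1 / of_int m}"
      unfolding pr_def by (subst K.o_span_finite) (auto simp: mult.commute)
    then show "fg (*) (pr (1 / of_int m))" unfolding fg_def by blast
    show "osubK I" by fact
    show "I \<subseteq> pr (1 / of_int m)" using assms(4,5) by (auto simp: pr_mem mult.commute)
    show "k * m \<noteq> 0" using k assms by simp
    fix x assume "x \<in> pr (1 / of_int m :: 'k)"
    then have "of_int m * x \<in> Ok" using assms(4) by (simp add: pr_mem mult.commute)
    then have "of_int m * x * of_int k \<in> I" using K.osub_scale[OF assms(1) _ k(2)] by blast
    then show "of_int (k * m) * x \<in> I" by (simp add: mult_ac)
  qed
  then show ?thesis using assms(2,3) by (auto simp: frac_iff)
qed

lemma frac_O: "frac Ok" by (rule fracI[OF osub_O O_1, of 1]) auto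
lemma frac_sub: "osubK J \<Longrightarrow> x \<in> J \<Longrightarrow> x \<noteq> 0 \<Longrightarrow> frac I \<Longrightarrow> J \<subseteq> I \<Longrightarrow> frac J"
  by (metis frac_denom fracI less_irrefl subsetD)

lemma frac_imul: assumes "frac I" "frac J" shows "frac (imul I J)"
proof -
  obtain x y where xy: "x \<in> I" "x \<noteq> 0" "y \<in> J" "y \<noteq> 0" using assms frac_nonzero by metis
  obtain m :: int where m: "m > 0" "\<And>x. x \<in> I \<Longrightarrow> of_int m * x \<in> Ok" using frac_denom[OF assms(1)] by blast
  obtain n :: int where n: "n > 0" "\<And>x. x \<in> J \<Longrightarrow> of_int n * x \<in> Ok" using frac_denom[OF assms(2)] by blast
  have sub: "imul I J \<subseteq> {z. of_int (m * n) * z \<in> Ok}"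
  proof (rule imul_least)
    show "osubK {z. of_int (m * n) * z \<in> Ok}"
      unfolding osub_def by (auto simp: distrib_left mult.left_commute)
    fix x y assume "x \<in> I" "y \<in> J"
    then have "(of_int m * x) * (of_int n * y) \<in> Ok" using m n by blast
    then show "x * y \<in> {z. of_int (m * n) * z \<in> Ok}" by (simp add: mult_ac)
  qed
  show ?thesis
    by (rule fracI[OF osub_imul imulI[OF xy(1,3)], of "m * n"]) (use xy sub m n in auto)
qed

lemma frac_pr: "c \<noteq> 0 \<Longrightarrow> frac (pr c)"
proof -
  assume c: "c \<noteq> 0"
  obtain m where m: "m > 0" "of_int m * c \<in> Ok" using int_multiple_in_O by blast
  show ?thesis
  proof (rule fracI[OF osub_pr prI c, of m])
    fix x assume "x \<in> pr c"
    then obtain y where "x = c * y" "y \<in> Ok" by (auto simp: pr_def)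
    then show "of_int m * x \<in> Ok" using m by (simp add: O_mult mult.assoc[symmetric])
  qed (use m in auto)
qed

lemma osub_cj: "osubK I \<Longrightarrow> osubK (cj ` I)"
  unfolding osub_def
proof (intro conjI ballI; (elim conjE)?)
  assume "0 \<in> I" then show "0 \<in> cj ` I" by (intro image_eqI[of _ _ 0]) auto
next
  fix x y assume "\<forall>x\<in>I. \<forall>y\<in>I. x + y \<in> I" "x \<in> cj ` I" "y \<in> cj ` I"
  then obtain a b where "x = cj a" "y = cj b" "a + b \<in> I" by auto
  then show "x + y \<in> cj ` I" by (intro image_eqI[of _ _ "a + b"]) auto
next
  fix c x assume "\<forall>c\<in>Ok. \<forall>x\<in>I. c * x \<in> I" "c \<in> Ok" "x \<in> cj ` I"
  then obtain a where "x = cj a" "a \<in> I" "cj c \<in> Ok" by auto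
  then have "x = cj a" "cj c * a \<in> I" using \<open>\<forall>c\<in>Ok. \<forall>x\<in>I. c * x \<in> I\<close> by auto
  then show "c * x \<in> cj ` I" by (intro image_eqI[of _ _ "cj c * a"]) auto
qed

lemma cj_cj_image [simp]: "cj ` cj ` I = I" by (simp add: image_image)
lemma cj_mem: "x \<in> cj ` I \<longleftrightarrow> cj x \<in> I"
  by (metis cj_cj image_iff)
lemma cj_image_subset: "cj ` I \<subseteq> J \<longleftrightarrow> I \<subseteq> cj ` J"
  by (metis cj_cj_image image_mono)

lemma frac_cj: assumes "frac I" shows "frac (cj ` I)"
proof -
  obtain x where x: "x \<in> I" "x \<noteq> 0" using assms frac_nonzero by metis
  obtain m :: int where m: "m > 0" "\<And>x. x \<in> I \<Longrightarrow> of_int m * x \<in> Ok" using frac_denom[OF assms(1)] by blast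
  show ?thesis
  proof (rule fracI[OF osub_cj[OF frac_osub[OF assms]], of "cj x" m])
    fix y assume "y \<in> cj ` I"
    then obtain z where "y = cj z" "z \<in> I" by blast
    then have "of_int m * z \<in> Ok" using m by blast
    then have "cj (of_int m * z) \<in> Ok" by (simp only: O_cj)
    then show "of_int m * y \<in> Ok" using \<open>y = cj z\<close> by simp
  qed (use x m in auto)
qed

lemma cj_imul_le: "cj ` imul I J \<subseteq> imul (cj ` I) (cj ` J)"
  unfolding cj_image_subset
  by (rule imul_least[OF osub_cj[OF osub_imul]]) (auto simp: cj_mem intro!: imulI)

lemma cj_imul: "cj ` imul I J = imul (cj ` I) (cj ` J)"
  using cj_imul_le[of I J] cj_imul_le[of "cj ` I" "cj ` J"] cj_image_subset by auto

lemma cj_pr [simp]: "cj ` pr c = pr (cj c)"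
  unfolding pr_def by (metis (no_types, lifting) O_cj_image cj_mult image_cong image_image)

(* Hurwitz: the rationals in I * conj I form a cyclic group, and its generator divides every
   product x * cj y because it divides the trace and its square divides the norm. *)
lemma ideal_norm:
  assumes "frac I" shows "\<exists>g>0. imul I (cj ` I) = pr (of_rat g)"
proof -
  define J where "J = imul I (cj ` I)"
  have fJ: "frac J" unfolding J_def by (intro frac_imul frac_cj assms)
  have oJ: "osubK J" by (rule frac_osub[OF fJ])
  obtain m :: int where m: "m > 0" "\<And>x. x \<in> J \<Longrightarrow> of_int m * x \<in> Ok" using frac_denom[OF fJ] by blast
  have mZ: "\<exists>k. of_int m * q = of_int k" if "of_rat q \<in> J" for q
  proof -
    have "of_rat (of_int m * q) \<in> Ok" using m(2)[OF that] by (simp add: of_rat_mult)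
    then show ?thesis unfolding O_rat by (auto elim: Ints_cases)
  qed
  \<comment> \<open>Multiplication by \<open>m\<close> makes every rational element of
    \<open>J\<close> an integer, so a smallest positive one exists.\<close>
  define P where "P n \<longleftrightarrow> n > 0 \<and> of_rat (of_nat n / of_int m) \<in> J" for n :: nat
  obtain x where x: "x \<in> J" "x \<noteq> 0" using frac_nonzero[OF fJ] .
  obtain k :: int where k: "k > 0" "of_int k \<in> J" using osub_contains_int[OF oJ x] .
  have "P (nat (k * m))" unfolding P_def using k m(1) by simp
  define n where "n = (LEAST n. P n)"
  have n: "P n" unfolding n_def by (rule LeastI) fact
  define g where "g = (of_nat n / of_int m :: rat)"
  have g: "g > 0" "of_rat g \<in> J" using n m(1) unfolding P_def g_def by auto
  have gdvd: "q / g \<in> \<int>" if q: "of_rat q \<in> J" for q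
  proof -
    define r where "r = q - of_int \<lfloor>q / g\<rfloor> * g"
    have r: "0 \<le> r" "r < g"
      unfolding r_def using g(1) floor_divide_lower[OF g(1), of q] floor_divide_upper[OF g(1), of q]
      by (auto simp: algebra_simps)
    have rJ: "of_rat r \<in> J"
      using K.osub_diff[OF oJ q K.osub_scale[OF oJ O_int[of "\<lfloor>q / g\<rfloor>"] g(2)]]
      by (simp add: r_def of_rat_diff of_rat_mult)
    obtain k where k: "of_int m * r = of_int k" using mZ[OF rJ] by blast
    have rk: "r = of_int k / of_int m" using k m(1) by (simp add: field_simps)
    have "r = 0"
    proof (rule ccontr)
      assume "r \<noteq> 0"
      then have "r > 0" using r by simp
      then have "k > 0" using m(1) unfolding rk by (simp add: zero_less_divide_iff)
      then have "P (nat k)" using rJ unfolding P_def rk by simp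
      then have "n \<le> nat k" unfolding n_def by (rule Least_le)
      then have "g \<le> r" unfolding g_def rk using m(1) \<open>k > 0\<close> by (simp add: divide_right_mono)
      then show False using r by simp
    qed
    then have "q / g = of_int \<lfloor>q / g\<rfloor>" using g(1) by (simp add: r_def field_simps)
    then show ?thesis by (metis Ints_of_int)
  qed
  have gdiv: "z / of_rat g \<in> Ok" if "tr z / g \<in> \<int>" "nrm z / (g * g) \<in> \<int>" for z
  proof -
    have eq: "z / of_rat g = of_rat (1 / g) * z" by (simp add: of_rat_divide)
    have "tr (z / of_rat g) = tr z / g" unfolding eq tr_rat_mult by simp
    moreover have "nrm (z / of_rat g) = nrm z / (g * g)" unfolding eq nrm_mult nrm_rat by simp
    ultimately show ?thesis unfolding O_iff using that by simp
  qed
  have "J = pr (of_rat g)"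
  proof
    show "pr (of_rat g) \<subseteq> J" using pr_subset[OF oJ] g by blast
    have "imul I (cj ` I) \<subseteq> pr (of_rat g)"
    proof (rule imul_least[OF osub_pr])
      fix x z assume x: "x \<in> I" and "z \<in> cj ` I"
      then obtain y where z: "z = cj y" "y \<in> I" by blast
      have *: "a * cj b \<in> J" if "a \<in> I" "b \<in> I" for a b
        unfolding J_def using that by (intro imulI) auto
      have "of_rat (tr (x * cj y)) = x * cj y + y * cj x" unfolding tr_eq[symmetric] by simp
      then have "tr (x * cj y) / g \<in> \<int>"
        using x z * by (intro gdvd) (auto intro: K.osub_add[OF oJ])
      moreover have "nrm (x * cj y) / (g * g) = (nrm x / g) * (nrm y / g)" by simp
      moreover have "nrm x / g \<in> \<int>" "nrm y / g \<in> \<int>"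
        using *[OF x x] *[OF z(2) z(2)] by (auto intro: gdvd simp: nrm_eq)
      then have "(nrm x / g) * (nrm y / g) \<in> \<int>" by (rule Ints_mult)
      ultimately show "x * z \<in> pr (of_rat g)"
        using g(1) gdiv[of "x * cj y"] by (simp add: pr_mem z)
    qed
    then show "J \<subseteq> pr (of_rat g)" unfolding J_def .
  qed
  then show ?thesis using g J_def by blast
qed

text \<open>The inverse is conj(I) divided by the rational generator of I conj(I). Here Hurwitz's
  identity makes the fractional ideals a group.\<close>

lemma frac_inverse: assumes "frac I" shows "\<exists>J. frac J \<and> imul J I = Ok"
proof -
  obtain g where g: "g > 0" "imul I (cj ` I) = pr (of_rat g)" using ideal_norm[OF assms] by blast
  define J where "J = imul (pr (of_rat (1 / g))) (cj ` I)"
  have "imul J I = imul (pr (of_rat (1 / g))) (imul I (cj ` I))"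
    unfolding J_def by (simp only: imul_assoc imul_comm[of "cj ` I"])
  also have "\<dots> = Ok" using g by (simp add: of_rat_mult[symmetric])
  finally have "imul J I = Ok" .
  moreover have "frac J" unfolding J_def using g by (intro frac_imul frac_pr frac_cj assms) simp
  ultimately show ?thesis by blast
qed

end

sublocale imag_quad \<subseteq> IG: comm_group "ideal_group :: 'k set monoid"
proof (rule comm_groupI, goal_cases)
  case (6 x) then show ?case using frac_inverse by auto
next
  case (4 x y) then show ?case using imul_comm by auto
next
  case (5 x) then show ?case using frac_osub by auto
qed (auto simp: frac_imul frac_O imul_assoc)

context imag_quad
begin

lemma principal_ideals_eq: "principal_ideals = {pr c | c. c \<noteq> 0}"
  by (simp add: principal_ideals_def pr_def)

lemma inv_pr: "c \<noteq> 0 \<Longrightarrow> inv\<^bsub>ideal_group\<^esub> (pr c) = pr (1 / c)"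
  by (rule IG.inv_equality) (auto simp: frac_pr)

lemma principal_subgroup: "subgroup principal_ideals (ideal_group :: 'k set monoid)"
proof (rule IG.subgroupI)
  show "principal_ideals \<subseteq> carrier (ideal_group :: 'k set monoid)" by (auto simp: principal_ideals_eq frac_pr)
  have "pr 1 \<in> principal_ideals" unfolding principal_ideals_eq by (intro CollectI exI[of _ 1]) simp
  then show "principal_ideals \<noteq> ({} :: 'k set set)" by blast
  show "inv\<^bsub>ideal_group\<^esub> I \<in> principal_ideals" if I: "I \<in> principal_ideals" for I :: "'k set"
  proof -
    obtain c where "I = pr c" "c \<noteq> 0" using I by (auto simp: principal_ideals_eq)
    then show ?thesis unfolding principal_ideals_eq using inv_pr[of c] by (intro CollectI exI[of _ "1 / c"]) auto
  qed
  show "I \<otimes>\<^bsub>ideal_group\<^esub> J \<in> principal_ideals"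
    if I: "I \<in> principal_ideals" and J: "J \<in> principal_ideals" for I J :: "'k set"
  proof -
    obtain c d where "I = pr c" "c \<noteq> 0" "J = pr d" "d \<noteq> 0" using I J by (auto simp: principal_ideals_eq)
    then show ?thesis unfolding principal_ideals_eq by (intro CollectI exI[of _ "c * d"]) auto
  qed
qed

lemma principal_normal: "principal_ideals \<lhd> (ideal_group :: 'k set monoid)"
  by (rule IG.subgroup_imp_normal[OF principal_subgroup])

end

sublocale imag_quad \<subseteq> CG: comm_group "class_group :: 'k set set monoid"
  unfolding class_group_def by (rule IG.abelian_FactGroup[OF principal_subgroup])

context imag_quad
begin

abbreviation icl :: "'k set \<Rightarrow> 'k set set" where "icl \<equiv> ideal_class"

lemma class_carrier: "carrier class_group = icl ` {I. frac I}"
  by (auto simp: class_group_def FactGroup_def RCOSETS_def ideal_class_def)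
lemma icl_carrier [simp]: "frac I \<Longrightarrow> icl I \<in> carrier class_group" by (simp add: class_carrier)

lemma icl_mult: "frac I \<Longrightarrow> frac J \<Longrightarrow> icl I \<otimes>\<^bsub>class_group\<^esub> icl J = icl (imul I J)"
  using normal.rcos_sum[OF principal_normal, of I J]
  by (simp add: class_group_def FactGroup_def ideal_class_def)

lemma icl_one: "icl Ok = \<one>\<^bsub>class_group\<^esub>"
  using IG.coset_mult_one[of principal_ideals] subgroup.subset[OF principal_subgroup]
  by (simp add: class_group_def FactGroup_def ideal_class_def)

lemma icl_eq_iff: assumes "frac I" "frac J" shows "icl I = icl J \<longleftrightarrow> (\<exists>c. c \<noteq> 0 \<and> I = imul (pr c) J)"
proof
  assume "icl I = icl J"
  then have "I \<in> principal_ideals #>\<^bsub>ideal_group\<^esub> J"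
    using IG.rcos_self[OF _ principal_subgroup, of I] assms by (simp add: ideal_class_def)
  then show "\<exists>c. c \<noteq> 0 \<and> I = imul (pr c) J"
    by (auto simp: r_coset_def principal_ideals_eq)
next
  assume "\<exists>c. c \<noteq> 0 \<and> I = imul (pr c) J"
  then have "I \<in> principal_ideals #>\<^bsub>ideal_group\<^esub> J" by (auto simp: r_coset_def principal_ideals_eq)
  then show "icl I = icl J"
    using IG.repr_independence[OF _ _ principal_subgroup, of I J] assms by (simp add: ideal_class_def)
qed

lemma icl_pr_mult: "c \<noteq> 0 \<Longrightarrow> frac I \<Longrightarrow> icl (imul (pr c) I) = icl I"
  by (subst icl_eq_iff) (auto intro: frac_imul frac_pr)
lemma icl_pr: "c \<noteq> 0 \<Longrightarrow> icl (pr c) = \<one>\<^bsub>class_group\<^esub>"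
  using icl_pr_mult[of c Ok] imul_comm[of "pr c" Ok] by (simp add: osub_pr icl_one frac_O)

lemma icl_cj_mult: assumes "frac I" shows "icl I \<otimes>\<^bsub>class_group\<^esub> icl (cj ` I) = \<one>\<^bsub>class_group\<^esub>"
proof -
  obtain g where g: "g > 0" "imul I (cj ` I) = pr (of_rat g)" using ideal_norm[OF assms] by blast
  then show ?thesis using icl_mult[OF assms frac_cj[OF assms]] icl_pr[of "of_rat g"] by simp
qed

lemma icl_cj: "frac I \<Longrightarrow> icl (cj ` I) = inv\<^bsub>class_group\<^esub> (icl I)"
  using icl_cj_mult[of I] CG.inv_equality[of "icl (cj ` I)" "icl I"] CG.m_comm[of "icl I" "icl (cj ` I)"]
  by (simp add: frac_cj)

(* Hilbert 90 for ideals: b = o + c works. *)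
lemma hilbert90_ideal:
  assumes c: "frac I" and n1: "imul I (cj ` I) = Ok"
  obtains B where "frac B" "I = imul B (inv\<^bsub>ideal_group\<^esub> (cj ` B))" "imul I (cj ` B) = B"
proof -
  define B where "B = {a + x | a x. a \<in> Ok \<and> x \<in> I}"
  have oI: "osubK I" by (rule frac_osub[OF c])
  have oB: "osubK B" unfolding osub_def
  proof (intro conjI ballI)
    have "0 + 0 \<in> B" unfolding B_def using K.osub_0[OF oI] O_0 by blast
    then show "0 \<in> B" by simp
  next
    fix x y assume "x \<in> B" "y \<in> B"
    then obtain a b u v where *: "x = a + u" "y = b + v" "a \<in> Ok" "b \<in> Ok" "u \<in> I" "v \<in> I" unfolding B_def by blast
    then have "x + y = (a + b) + (u + v)" by simp
    then show "x + y \<in> B" unfolding B_def using * K.osub_add[OF oI] O_add by blast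
  next
    fix r x assume r: "r \<in> Ok" and "x \<in> B"
    then obtain a u where *: "x = a + u" "a \<in> Ok" "u \<in> I" unfolding B_def by blast
    then have "r * x = (r * a) + (r * u)" by (simp add: distrib_left)
    then show "r * x \<in> B" unfolding B_def using * r K.osub_scale[OF oI] O_mult by blast
  qed
  have OB: "Ok \<subseteq> B" unfolding B_def using K.osub_0[OF oI] by force
  have IB: "I \<subseteq> B" unfolding B_def using O_0 by force
  obtain m :: int where m: "m > 0" "\<And>x. x \<in> I \<Longrightarrow> of_int m * x \<in> Ok" using frac_denom[OF c] by blast
  have fB: "frac B"
  proof (rule fracI[OF oB, of 1 m])
    show "1 \<in> B" using OB O_1 by blast
    fix x assume "x \<in> B"
    then obtain a u where *: "x = a + u" "a \<in> Ok" "u \<in> I" unfolding B_def by blast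
    then show "of_int m * x \<in> Ok" using m(2) by (auto simp: distrib_left)
  qed (use m in auto)
  \<comment> \<open>I conj(o + I) = I + I conj(I) = I + o, since \<open>I\<close> has norm
    one.\<close>
  have "imul I (cj ` B) = B"
  proof
    show "imul I (cj ` B) \<subseteq> B"
    proof (rule imul_least[OF oB])
      fix x z assume x: "x \<in> I" and "z \<in> cj ` B"
      then obtain a u where z: "z = cj a + cj u" "a \<in> Ok" "u \<in> I" unfolding B_def by auto
      have "x * cj u \<in> Ok" using imulI[OF x, of "cj u" "cj ` I"] z n1 by auto
      moreover have "cj a * x \<in> I" using z x K.osub_scale[OF oI] by simp
      ultimately have "x * cj u + cj a * x \<in> B" unfolding B_def by blast
      then show "x * z \<in> B" by (simp add: z algebra_simps)
    qed
    show "B \<subseteq> imul I (cj ` B)"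
    proof
      fix x assume "x \<in> B"
      then obtain a u where *: "x = a + u" "a \<in> Ok" "u \<in> I" unfolding B_def by blast
      have "1 \<in> cj ` B" using OB O_1 by (auto simp: cj_mem)
      then have "u * 1 \<in> imul I (cj ` B)" using * by (intro imulI) auto
      moreover have "a \<in> imul I (cj ` B)"
        using n1 *(2) imul_mono[OF order_refl image_mono[OF IB], of I cj] by blast
      ultimately show "x \<in> imul I (cj ` B)" using * K.osub_add[OF osub_imul] by simp
    qed
  qed
  moreover from this have "I = imul B (inv\<^bsub>ideal_group\<^esub> (cj ` B))"
    using IG.inv_solve_right[of I B "cj ` B"] c fB frac_cj[OF fB] by simp
  ultimately show thesis using that fB by blast
qed

end

section \<open>The class group: finiteness and genus theory\<close>

lemma card_const_fibres:
  assumes "finite A" "\<And>y. y \<in> f ` A \<Longrightarrow> card {x \<in> A. f x = y} = k"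
  shows "card A = k * card (f ` A)"
proof -
  have "card A = (\<Sum>y\<in>f ` A. card {x \<in> A. f x = y})"
    using assms(1) sum.image_gen[of A "\<lambda>_. 1::nat" f] by simp
  also have "\<dots> = (\<Sum>y\<in>f ` A. k)" using assms(2) by (intro sum.cong) auto
  finally show ?thesis by (simp add: mult.commute)
qed

lemma squarefree_int: "squarefree (n::nat) \<Longrightarrow> squarefree (int n)"
proof (rule squarefreeI)
  fix x :: int assume n: "squarefree n" and "x\<^sup>2 dvd int n"
  then have "int ((nat \<bar>x\<bar>)\<^sup>2) dvd int n" by simp
  then have "(nat \<bar>x\<bar>)\<^sup>2 dvd n" by (simp only: int_dvd_int_iff)
  then have "is_unit (nat \<bar>x\<bar>)" using n by (rule squarefreeD[rotated])
  then show "is_unit x" by simp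
qed

lemma squarefree_eq_if_ratio_square:
  assumes n: "squarefree (n::nat)" "n > 0" and m: "squarefree m" "m > 0" and b: "of_nat n = b * b * (of_nat m :: rat)"
  shows "n = m"
proof -
  obtain u v where uv: "quotient_of b = (u, v)" by fastforce
  have v: "v > 0" using quotient_of_denom_pos uv by blast
  have cop: "coprime u v" using quotient_of_coprime uv by blast
  have br: "b = of_int u / of_int v" using quotient_of_div uv by blast
  have "(of_int (int n * (v * v)) :: rat) = of_int (u * u * int m)"
    using b v unfolding br by (simp add: field_simps)
  then have eq: "int n * v\<^sup>2 = u\<^sup>2 * int m" by (simp only: of_int_eq_iff power2_eq_square)
  have cop2: "coprime (u\<^sup>2) (v\<^sup>2)" using cop by simp
  have "v\<^sup>2 dvd u\<^sup>2 * int m" unfolding eq[symmetric] by simp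
  then have "v\<^sup>2 dvd int m" using cop2 by (simp add: coprime_dvd_mult_right_iff coprime_commute)
  moreover have "squarefree (int m)" using m(1) by (rule squarefree_int)
  ultimately have "is_unit v" by (rule squarefreeD[rotated])
  then have v1: "v = 1" using v by auto
  have "u\<^sup>2 dvd int n" using eq v1 by simp
  moreover have "squarefree (int n)" using n(1) by (rule squarefree_int)
  ultimately have "is_unit u" by (rule squarefreeD[rotated])
  then have "u\<^sup>2 = 1" by (metis abs_1 power2_abs power_one zdvd1_eq)
  then show ?thesis using eq v1 by simp
qed

context imag_quad
begin

section \<open>Finiteness of the class number\<close>

text \<open>Dirichlet's box principle: the fractional parts of the coordinates of t x for 0 \<le> t
  \<le> N^2 fall into N^2 boxes of side 1 / N, and the difference of two multiples in one box is an
  element of the ring up to an error of norm below 1.\<close>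

lemma nrm_small_multiple:
  obtains M :: nat where "\<And>x. \<exists>t\<in>{1..M}. \<exists>w\<in>Ok. nrm (of_nat t * x - w) < 1"
proof -
  \<comment> \<open>The coordinates u, v of the error satisfy u^2 N < 1 and v^2 N < 1, so its norm
    u^2 - D v^2 is at most (1 - D) / N; 2 - D is the least integer \<open>N\<close> for which this
    bound is below 1.\<close>
  define N where "N = nat (2 - D)"
  have N: "of_nat N = (2 - of_int D :: rat)" "N \<ge> 1"
    using D_neg by (simp_all add: N_def)
  have sO: "s \<in> Ok" by (rule O_root) (use s_sq in \<open>simp add: power2_eq_square\<close>)
  have "\<exists>t\<in>{1..N * N}. \<exists>w\<in>Ok. nrm (of_nat t * x - w) < 1" for x
  proof -
    define fr where "fr q = q - of_int \<lfloor>q\<rfloor>" for q :: rat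
    have fr: "0 \<le> fr q" "fr q < 1" for q unfolding fr_def by linarith+
    define box where "box t = (nat \<lfloor>of_nat N * fr (of_nat t * rp x)\<rfloor>, nat \<lfloor>of_nat N * fr (of_nat t * ip x)\<rfloor>)" for t :: nat
    have fl: "nat \<lfloor>of_nat N * fr q\<rfloor> < N" for q
    proof -
      have "of_nat N * fr q < of_nat N" using fr[of q] N(2) by simp
      then have "\<lfloor>of_nat N * fr q\<rfloor> < int N" by linarith
      then show ?thesis using N(2) by linarith
    qed
    have "box ` {0..N * N} \<subseteq> {..<N} \<times> {..<N}" unfolding box_def using fl by auto
    then have "card (box ` {0..N * N}) \<le> N * N"
      by (metis card_cartesian_product card_lessThan card_mono finite_SigmaI finite_lessThan)
    then have "\<not> inj_on box {0..N * N}"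
      by (intro pigeonhole) simp
    then obtain t1 t2 where t: "t1 \<le> N * N" "t2 < t1" "box t1 = box t2"
      unfolding inj_on_def by (metis atLeastAtMost_iff linorder_neqE_nat)
    have close: "\<bar>fr a - fr b\<bar> * of_nat N < 1" if "nat \<lfloor>of_nat N * fr a\<rfloor> = nat \<lfloor>of_nat N * fr b\<rfloor>" for a b
    proof -
      have "0 \<le> of_nat N * fr a" "0 \<le> of_nat N * fr b" using fr by auto
      then have "0 \<le> \<lfloor>of_nat N * fr a\<rfloor>" "0 \<le> \<lfloor>of_nat N * fr b\<rfloor>" by (simp_all only: zero_le_floor)
      then have "\<lfloor>of_nat N * fr a\<rfloor> = \<lfloor>of_nat N * fr b\<rfloor>" using that by (metis eq_nat_nat_iff)
      then have "\<bar>of_nat N * fr a - of_nat N * fr b\<bar> < 1" by linarith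
      moreover have "\<bar>of_nat N * fr a - of_nat N * fr b\<bar> = \<bar>fr a - fr b\<bar> * of_nat N"
        by (simp add: abs_mult mult.commute flip: right_diff_distrib)
      ultimately show ?thesis by simp
    qed
    obtain e1 e2 f1 f2 where ef: "fr (of_nat t1 * rp x) = of_nat t1 * rp x - of_int e1"
      "fr (of_nat t2 * rp x) = of_nat t2 * rp x - of_int e2"
      "fr (of_nat t1 * ip x) = of_nat t1 * ip x - of_int f1"
      "fr (of_nat t2 * ip x) = of_nat t2 * ip x - of_int f2"
      unfolding fr_def by blast
    define a b where "a = e1 - e2" and "b = f1 - f2"
    define w where "w = of_int a + of_int b * s"
    define u v where "u = fr (of_nat t1 * rp x) - fr (of_nat t2 * rp x)"
      and "v = fr (of_nat t1 * ip x) - fr (of_nat t2 * ip x)"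
    have "of_nat (t1 - t2) * (of_rat (rp x) + of_rat (ip x) * s) - w = of_rat u + of_rat v * s"
      using t(2) unfolding w_def u_def v_def a_def b_def ef
      by (simp add: of_nat_diff of_rat_diff of_rat_mult of_rat_add algebra_simps)
    then have "of_nat (t1 - t2) * x - w = of_rat u + of_rat v * s" using rep[of x] by simp
    then have n: "nrm (of_nat (t1 - t2) * x - w) = u * u - of_int D * (v * v)" by (simp add: nrm_def)
    have uv: "\<bar>u\<bar> * of_nat N < 1" "\<bar>v\<bar> * of_nat N < 1"
      using close t(3) unfolding u_def v_def box_def by auto
    have sq: "z * z * of_nat N < 1" if "\<bar>z\<bar> * of_nat N < 1" for z :: rat
    proof -
      have "\<bar>z\<bar> * 1 \<le> \<bar>z\<bar> * of_nat N" using N(2) by (intro mult_left_mono) simp_all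
      then have "\<bar>z\<bar> \<le> 1" using that by linarith
      then have "\<bar>z\<bar> * (\<bar>z\<bar> * of_nat N) \<le> 1 * (\<bar>z\<bar> * of_nat N)" by (intro mult_right_mono) auto
      then show ?thesis using that by (simp flip: mult.assoc abs_mult)
    qed
    have "(u * u - of_int D * (v * v)) * of_nat N = u * u * of_nat N + (- of_int D) * (v * v * of_nat N)"
      by (simp add: algebra_simps)
    also have "\<dots> \<le> 1 + (- of_int D) * 1"
      using sq[OF uv(1)] sq[OF uv(2)] D_neg by (intro add_mono mult_left_mono) auto
    also have "\<dots> < of_nat N" using N by simp
    finally have "(u * u - of_int D * (v * v)) * of_nat N < 1 * of_nat N" by simp
    then have "u * u - of_int D * (v * v) < 1" by (rule mult_right_less_imp_less) simp
    moreover have "w \<in> Ok" unfolding w_def using sO by (intro O_add O_mult) auto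
    moreover have "t1 - t2 \<in> {1..N * N}" using t by auto
    ultimately show ?thesis using n by metis
  qed
  then show thesis by (rule that)
qed

text \<open>For a nonzero \<open>b\<close> in \<open>I\<close> of minimal norm, each quotient x / b
  becomes integral after multiplication by some t \<le> M: the remainder lies in \<open>I\<close>
  and is smaller than \<open>b\<close>, so it is 0. Hence (F / b) I with F = M! is integral and
  contains \<open>F\<close>.\<close>

lemma class_representative_bounded:
  obtains F :: int where "F > 0"
    "\<And>I. frac I \<Longrightarrow> \<exists>B. frac B \<and> icl B = icl I \<and> B \<subseteq> Ok \<and> of_int F \<in> B"
proof -
  obtain M :: nat where M: "\<And>x. \<exists>t\<in>{1..M}. \<exists>w\<in>Ok. nrm (of_nat t * x - w) < 1"
    using nrm_small_multiple by blast
  define F where "F = int (fact M)"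
  have "\<exists>B. frac B \<and> icl B = icl I \<and> B \<subseteq> Ok \<and> of_int F \<in> B" if I: "frac I" for I
  proof -
    have oI: "osubK I" by (rule frac_osub[OF I])
    obtain m :: int where m: "m > 0" "\<And>x. x \<in> I \<Longrightarrow> of_int m * x \<in> Ok" using frac_denom[OF I] by blast
    \<comment> \<open>Norms on a fractional ideal become natural numbers after scaling by its
      denominator \<open>m\<close>, so a minimum exists.\<close>
    define sz where "sz x = nat \<lfloor>nrm (of_int m * x)\<rfloor>" for x
    have sz: "of_nat (sz x) = nrm (of_int m * x)" if x: "x \<in> I" for x
    proof -
      obtain k where k: "nrm (of_int m * x) = of_int k" using O_nrm[OF m(2)[OF x]] by (auto elim: Ints_cases)
      then have "k \<ge> 0" using nrm_nonneg[of "of_int m * x"] by (simp only: of_int_0_le_iff)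
      then show ?thesis unfolding sz_def k by simp
    qed
    obtain b0 where "b0 \<in> I \<and> b0 \<noteq> 0" using frac_nonzero[OF I] by blast
    then obtain b where b: "b \<in> I" "b \<noteq> 0" "\<And>y. y \<in> I \<Longrightarrow> y \<noteq> 0 \<Longrightarrow> sz b \<le> sz y"
      using ex_has_least_nat[of "\<lambda>y. y \<in> I \<and> y \<noteq> 0" b0 sz] by blast
    have min: "y = 0" if y: "y \<in> I" "nrm y < nrm b" for y
    proof (rule ccontr)
      assume "y \<noteq> 0"
      then have "of_nat (sz b) \<le> (of_nat (sz y) :: rat)" using b(3) y by simp
      then have "nrm (of_int m * b) \<le> nrm (of_int m * y)" using sz b y by simp
      then show False using y m(1) by simp
    qed
    have key: "of_int F * x / b \<in> Ok" if x: "x \<in> I" for x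
    proof -
      obtain t w where tw: "t \<in> {1..M}" "w \<in> Ok" "nrm (of_nat t * (x / b) - w) < 1" using M by blast
      have "of_nat t * x - w * b = (of_nat t * (x / b) - w) * b" using b by (simp add: field_simps)
      then have "nrm (of_nat t * x - w * b) = nrm (of_nat t * (x / b) - w) * nrm b" by (metis nrm_mult)
      also have "\<dots> < 1 * nrm b" using tw(3) nrm_pos[OF b(2)] by (intro mult_strict_right_mono) auto
      finally have "of_nat t * x - w * b = 0"
        using x b tw by (intro min) (auto intro!: K.osub_diff[OF oI] K.osub_scale[OF oI])
      then have e: "of_nat t * x / b = w" using b by (simp add: field_simps)
      have "t dvd fact M" using tw(1) by (intro dvd_fact) auto
      then obtain k where "fact M = t * k" by blast
      then have "of_int F * x / b = of_nat k * (of_nat t * x / b)" by (simp add: F_def)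
      then show ?thesis unfolding e using tw by auto
    qed
    define B where "B = imul (pr (of_int F / b)) I"
    have B: "B = (\<lambda>x. of_int F / b * x) ` I" unfolding B_def by (rule imul_pr[OF oI])
    have F: "of_int F / b \<noteq> 0" using b unfolding F_def by simp
    have "frac B" unfolding B_def using F I by (intro frac_imul frac_pr)
    moreover have "icl B = icl I" unfolding B_def by (rule icl_pr_mult[OF F I])
    moreover have "B \<subseteq> Ok" unfolding B using key by auto
    moreover have "of_int F \<in> B" unfolding B using b by (intro image_eqI[of _ _ b]) auto
    ultimately show ?thesis by blast
  qed
  moreover have "F > 0" by (simp add: F_def)
  ultimately show thesis using that by blast
qed

text \<open>An ideal of the ring that contains \<open>F\<close> is determined by which of the
  finitely many residues modulo \<open>F\<close> it contains.\<close>

lemma finite_class_group: "finite (carrier (class_group :: 'k set set monoid))"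
proof -
  obtain F :: int where F: "F > 0"
    "\<And>I. frac I \<Longrightarrow> \<exists>B. frac B \<and> icl B = icl I \<and> B \<subseteq> Ok \<and> of_int F \<in> B"
    using class_representative_bounded by blast
  obtain C where C: "finite C" "C \<subseteq> Ok" "\<And>x. x \<in> Ok \<Longrightarrow> \<exists>c\<in>C. \<exists>d\<in>Ok. x = c + of_int F * d"
    using O_reps[of F] F(1) by auto
  define \<B> where "\<B> = {B. osubK B \<and> B \<subseteq> Ok \<and> of_int F \<in> B}"
  have "inj_on (\<lambda>B. B \<inter> C) \<B>"
  proof (rule inj_onI)
    have le: "A \<subseteq> B" if AB: "A \<in> \<B>" "B \<in> \<B>" "A \<inter> C = B \<inter> C" for A B
    proof
      fix x assume x: "x \<in> A"
      then obtain c d where cd: "c \<in> C" "d \<in> Ok" "x = c + of_int F * d" using C(3) AB(1) unfolding \<B>_def by blast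
      have "of_int F * d \<in> A" "of_int F * d \<in> B"
        using that cd K.osub_scale[of _ d "of_int F"] unfolding \<B>_def by (auto simp: mult.commute)
      then have "c \<in> A" using K.osub_diff[of A x "of_int F * d"] x cd that(1) unfolding \<B>_def by auto
      then have "c \<in> B" using cd that(3) by blast
      then show "x \<in> B" using K.osub_add[of B c] \<open>of_int F * d \<in> B\<close> cd that(2) unfolding \<B>_def by auto
    qed
    fix A B assume "A \<in> \<B>" "B \<in> \<B>" "A \<inter> C = B \<inter> C"
    then show "A = B" using le[of A B] le[of B A] by auto
  qed
  moreover have "finite ((\<lambda>B. B \<inter> C) ` \<B>)"
    by (rule finite_subset[of _ "Pow C"]) (use C(1) in auto)
  ultimately have "finite \<B>" by (rule finite_imageD[rotated])
  moreover have "carrier class_group \<subseteq> icl ` \<B>"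
  proof
    fix c :: "'k set set" assume "c \<in> carrier class_group"
    then obtain I where I: "frac I" "c = icl I" unfolding class_carrier by blast
    then obtain B where "frac B" "icl B = icl I" "B \<subseteq> Ok" "of_int F \<in> B" using F(2) by blast
    then show "c \<in> icl ` \<B>" unfolding \<B>_def using I frac_osub by auto
  qed
  ultimately show ?thesis by (meson finite_imageI finite_subset)
qed

section \<open>The discriminant and the ramified primes\<close>

definition disc where "disc = (if D mod 4 = 1 then D else 4 * D)"

lemma om_disc: "(cj om - om)\<^sup>2 = of_int disc"
proof -
  have "cj om - om = (if D mod 4 = 1 then - s else - 2 * s)"
  proof -
    have "cj s = - s" using cj_rep[of 0 1] by simp
    moreover have "cj 2 = 2" using cj_int[of 2] by simp
    ultimately show ?thesis by (simp add: om_def field_simps)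
  qed
  then show ?thesis using s_sq by (simp add: disc_def power_mult_distrib)
qed

lemma om_indep: "of_int m + of_int n * om = of_int m' + of_int n' * om \<longleftrightarrow> m = m' \<and> n = n'"
proof
  assume "of_int m + of_int n * om = of_int m' + of_int n' * om"
  then have "rp (of_int m + of_int n * om) = rp (of_int m' + of_int n' * om)"
    "ip (of_int m + of_int n * om) = ip (of_int m' + of_int n' * om)" by simp_all
  then show "m = m' \<and> n = n'" unfolding rp_int_om ip_int_om by (auto split: if_splits)
qed auto

lemma field_disc_eq: "field_disc s = disc"
  unfolding field_disc_def
proof (rule the_equality)
  have "integral_basis 1 om"
    unfolding integral_basis_def using O_eq om_indep[of _ _ 0 0] by simp
  then show "\<exists>w1 w2. integral_basis w1 w2 \<and> of_int disc = (w1 * cj w2 - w2 * cj w1)\<^sup>2"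
    using om_disc by (intro exI[of _ 1] exI[of _ om]) simp
next
  fix d assume "\<exists>w1 w2. integral_basis w1 w2 \<and> of_int d = (w1 * cj w2 - w2 * cj w1)\<^sup>2"
  then obtain w1 w2 where w: "integral_basis w1 w2" and d: "of_int d = (w1 * cj w2 - w2 * cj w1)\<^sup>2" by blast
  have Ow: "Ok = {of_int m * w1 + of_int n * w2 | m n. True}" using w unfolding integral_basis_def by blast
  have "of_int 1 * w1 + of_int 0 * w2 \<in> Ok" "of_int 0 * w1 + of_int 1 * w2 \<in> Ok"
    unfolding Ow by blast+
  then have "w1 \<in> Ok" "w2 \<in> Ok" by simp_all
  then obtain a b c e where w12: "w1 = of_int a + of_int b * om" "w2 = of_int c + of_int e * om"
    unfolding O_eq by blast
  obtain p q where pq: "1 = of_int p * w1 + of_int q * w2" using O_1 unfolding Ow by blast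
  obtain x y where xy: "om = of_int x * w1 + of_int y * w2" using O_om unfolding Ow by blast
  have "of_int (p * a + q * c) + of_int (p * b + q * e) * om = of_int 1 + of_int 0 * om"
    using pq unfolding w12 by (simp add: algebra_simps)
  then have 1: "p * a + q * c = 1" "p * b + q * e = 0" unfolding om_indep by auto
  have "of_int (x * a + y * c) + of_int (x * b + y * e) * om = of_int 0 + of_int 1 * om"
    using xy unfolding w12 by (simp add: algebra_simps)
  then have 2: "x * a + y * c = 0" "x * b + y * e = 1" unfolding om_indep by auto
  \<comment> \<open>The two factors are the determinants of the transition matrices between the
    bases. Both are therefore 1 or -1, and the discriminant sees only the square.\<close>
  have "(p * y - q * x) * (a * e - b * c) = (p * a + q * c) * (x * b + y * e) - (p * b + q * e) * (x * a + y * c)"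
    by (simp add: algebra_simps)
  then have "(p * y - q * x) * (a * e - b * c) = 1" using 1 2 by simp
  then have "a * e - b * c = 1 \<or> a * e - b * c = -1" using zmult_eq_1_iff by metis
  then have dd: "(a * e - b * c)\<^sup>2 = 1" by auto
  have "w1 * cj w2 - w2 * cj w1 = of_int (a * e - b * c) * (cj om - om)"
    unfolding w12 by (simp add: algebra_simps)
  then have "of_int d = (of_int ((a * e - b * c)\<^sup>2 * disc) :: 'k)"
    using d om_disc by (simp add: power_mult_distrib)
  then show "d = disc" unfolding dd of_int_eq_iff by simp
qed

definition ramified :: "nat set" where "ramified = {p. prime p \<and> int p dvd disc}"

lemma num_ramified_eq: "num_ramified s = card ramified"
  by (simp add: num_ramified_def field_disc_eq ramified_def)

lemma finite_ramified: "finite ramified"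
proof -
  have "disc \<noteq> 0" using D_neg by (simp add: disc_def)
  have "p \<in> {1..nat \<bar>disc\<bar>}" if "p \<in> ramified" for p
    using that \<open>disc \<noteq> 0\<close> dvd_imp_le_int[of disc "int p"] prime_gt_0_nat[of p] unfolding ramified_def by auto
  then have "ramified \<subseteq> {1..nat \<bar>disc\<bar>}" by blast
  then show ?thesis using finite_subset by blast
qed

lemma ramified_iff: "p \<in> ramified \<longleftrightarrow> prime p \<and> (int p dvd D \<or> p = 2 \<and> D mod 4 \<noteq> 1)"
proof -
  have "int p dvd 4 \<longleftrightarrow> p = 2" if "prime p"
  proof
    assume "int p dvd 4"
    then have "p dvd 2 * 2" by (metis int_dvd_int_iff mult_2 numeral_Bit0 of_nat_numeral)
    then show "p = 2" using that by (metis prime_dvd_mult_iff primes_dvd_imp_eq two_is_prime_nat)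
  qed auto
  moreover have "int p dvd 4 * D \<longleftrightarrow> int p dvd 4 \<or> int p dvd D" if "prime p"
    using that by (intro prime_dvd_mult_iff) simp
  ultimately show ?thesis by (auto simp: ramified_def disc_def)
qed

section \<open>Ideals with a given square, and ambiguous ideals\<close>

text \<open>Integral closedness enters here: the square of each element of \<open>H\<close> is
  integral, hence so is the element. Through \<open>square_inject\<close> an ideal is then
  determined by its square.\<close>

lemma square_trivial: assumes "frac H" "imul H H = Ok" shows "H = Ok"
proof
  show "H \<subseteq> Ok"
  proof
    fix x assume "x \<in> H"
    then have "x * x \<in> Ok" using imulI[of x H x H] assms(2) by blast
    then show "x \<in> Ok" by (rule O_root)
  qed
  then have "imul H H \<subseteq> imul Ok H" by (rule imul_mono) simp
  then show "Ok \<subseteq> H" using assms frac_osub by simp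
qed

lemma square_inject: assumes "frac I" "frac J" "imul I I = imul J J" shows "I = J"
proof -
  define H where "H = imul I (inv\<^bsub>ideal_group\<^esub> J)"
  have iJ: "frac (inv\<^bsub>ideal_group\<^esub> J)" using IG.inv_closed[of J] assms by simp
  have fH: "frac H" unfolding H_def by (intro frac_imul assms iJ)
  have J1: "imul J (inv\<^bsub>ideal_group\<^esub> J) = Ok" using IG.r_inv[of J] assms by simp
  have "imul H H = imul (imul I I) (imul (inv\<^bsub>ideal_group\<^esub> J) (inv\<^bsub>ideal_group\<^esub> J))"
    unfolding H_def by (metis imul_assoc imul_comm)
  also have "\<dots> = imul (imul J (inv\<^bsub>ideal_group\<^esub> J)) (imul J (inv\<^bsub>ideal_group\<^esub> J))"
    unfolding assms(3) by (metis imul_assoc imul_comm)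
  finally have "H = Ok" using square_trivial[OF fH] unfolding J1 using frac_osub[OF frac_O] by simp
  then show ?thesis using IG.inv_equality[of I "inv\<^bsub>ideal_group\<^esub> J"] iJ assms
    unfolding H_def by (simp add: IG.inv_inv)
qed

lemma pr_eq_iff: assumes "a \<noteq> 0" "b \<noteq> 0" shows "pr a = pr b \<longleftrightarrow> a / b \<in> Ok \<and> b / a \<in> Ok"
  using assms by (metis osub_pr pr_mem pr_subset subset_antisym order_refl)

lemma unit_nrm: assumes "e \<in> Ok" "1 / e \<in> Ok" "e \<noteq> 0" shows "nrm e = 1"
proof -
  obtain m where m: "nrm e = of_int m" using O_nrm[OF assms(1)] by (auto elim: Ints_cases)
  obtain n where n: "nrm (1 / e) = of_int n" using O_nrm[OF assms(2)] by (auto elim: Ints_cases)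
  have "nrm e * nrm (1 / e) = 1" using assms(3) by (simp flip: nrm_mult)
  then have "of_int (m * n) = (of_int 1 :: rat)" using m n by simp
  then have "m * n = 1" by (simp only: of_int_eq_iff)
  moreover have "m > 0" using m nrm_pos[OF assms(3)] by simp
  ultimately show ?thesis using m zmult_eq_1_iff by auto
qed

(* c = [I] with I^2 principal: I / conj I = (g) with g of norm 1, so g = conj d / d, and d I is
   stable under conjugation; its square is then generated by a rational number. *)
lemma two_torsion_class_root:
  assumes c: "c \<in> carrier class_group" "c \<otimes>\<^bsub>class_group\<^esub> c = \<one>\<^bsub>class_group\<^esub>"
  obtains J m where "frac J" "icl J = c" "squarefree (m::nat)" "m > 0" "imul J J = pr (of_nat m)"
proof -
  obtain I where I: "frac I" "c = icl I" using c(1) unfolding class_carrier by blast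
  have "icl (cj ` I) = icl I"
    using icl_cj[OF I(1)] c I CG.inv_equality[of c c] by simp
  then obtain g where g: "g \<noteq> 0" "I = imul (pr g) (cj ` I)"
    using icl_eq_iff[OF I(1) frac_cj[OF I(1)]] by metis
  have "cj ` I = imul (pr (cj g)) I"
    using arg_cong[OF g(2), of "\<lambda>X. cj ` X"] by (simp add: cj_imul)
  then have "I = imul (pr g) (imul (pr (cj g)) I)" using g(2) by simp
  also have "\<dots> = imul (pr (g * cj g)) I" by (simp flip: imul_assoc)
  finally have "pr (g * cj g) = Ok"
    using I(1) g IG.r_cancel_one'[of I "pr (g * cj g)"] by (simp add: frac_pr)
  then have "pr (g * cj g) = pr 1" by simp
  then have u: "g * cj g \<in> Ok" "1 / (g * cj g) \<in> Ok" using g pr_eq_iff[of "g * cj g" 1] by auto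
  have "nrm (g * cj g) = 1" by (rule unit_nrm[OF u]) (use g in simp)
  then have "nrm g * nrm g = 1" by simp
  then have ng: "nrm g = 1" using nrm_nonneg[of g] by (metis mult_cancel_right1 one_power2 power2_eq_iff_nonneg power2_eq_square zero_le_one)
  \<comment> \<open>Hilbert 90 for elements: 1 + conj(g) works unless it vanishes, and for g = -1
    the root \<open>s\<close> does.\<close>
  obtain d where d: "d \<noteq> 0" "d * g = cj d"
  proof (cases "g = -1")
    case True
    have "cj s = - s" using cj_rep[of 0 1] by simp
    then show thesis using that[of s] True s_not_rat[of 0] by simp
  next
    case False
    have "(1 + cj g) * g = 1 + g" using nrm_eq[of g] ng by (simp add: algebra_simps)
    moreover have "1 + cj g \<noteq> 0" using False by (metis add_eq_0_iff cj_1 cj_cj cj_minus)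
    ultimately show thesis using that[of "1 + cj g"] by simp
  qed
  define J where "J = imul (pr d) I"
  have fJ: "frac J" unfolding J_def using d I by (intro frac_imul frac_pr)
  have "J = imul (pr d) (imul (pr g) (cj ` I))" unfolding J_def using g(2) by simp
  also have "\<dots> = imul (pr (cj d)) (cj ` I)" by (simp add: d(2) flip: imul_assoc)
  finally have J: "cj ` J = J" unfolding J_def by (simp add: cj_imul)
  obtain q where q: "q > 0" "imul J J = pr (of_rat q)" using ideal_norm[OF fJ] J by auto
  obtain a b where ab: "quotient_of q = (a, b)" by fastforce
  have b: "b > 0" using quotient_of_denom_pos ab by blast
  have r: "q = of_int a / of_int b" using quotient_of_div ab by blast
  then have a: "a > 0" using q(1) b by (simp add: zero_less_divide_iff)
  \<comment> \<open>The quotient a / b and the product a b differ by the square b^2, so after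
    scaling \<open>J\<close> its square is generated by an integer, whose square part k^2 is divided
    out as well.\<close>
  define n where "n = nat (a * b)"
  have n: "n > 0" unfolding n_def using a b by simp
  define k where "k = square_part n"
  have nk: "n = squarefree_part n * k\<^sup>2" unfolding k_def by (rule squarefree_decompose)
  have k: "k > 0" using n nk by (metis gr0I mult_0_right zero_power2)
  have m: "squarefree (squarefree_part n)" "squarefree_part n > 0"
    using squarefree_squarefree_part[of n] n nk by (auto intro: Nat.gr0I)
  define J' where "J' = imul (pr (of_int b / of_nat k)) J"
  have fJ': "frac J'" unfolding J'_def using b k fJ by (intro frac_imul frac_pr) auto
  have "imul J' J' = imul (imul (pr (of_int b / of_nat k)) (pr (of_int b / of_nat k))) (imul J J)"
    unfolding J'_def by (metis imul_assoc imul_comm)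
  also have "\<dots> = pr (of_int b / of_nat k * (of_int b / of_nat k) * of_rat q)" unfolding q(2) by simp
  also have "of_int b / of_nat k * (of_int b / of_nat k) * of_rat q = (of_nat (squarefree_part n) :: 'k)"
  proof -
    have "int n = a * b" unfolding n_def using a b by simp
    then have "(of_nat n :: 'k) = of_int a * of_int b" by (metis of_int_mult of_int_of_nat_eq)
    then have e: "of_nat (squarefree_part n) * (of_nat k)\<^sup>2 = of_int a * (of_int b :: 'k)" using nk by (metis of_nat_mult of_nat_power)
    have "of_int b / of_nat k * (of_int b / of_nat k) * of_rat q = of_int a * of_int b / ((of_nat k)\<^sup>2 :: 'k)"
      unfolding r using b k by (simp add: of_rat_divide power2_eq_square)
    also have "\<dots> = of_nat (squarefree_part n)" using k unfolding e[symmetric] by simp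
    finally show ?thesis .
  qed
  finally have "imul J' J' = pr (of_nat (squarefree_part n))" .
  moreover have "icl J' = c"
    unfolding J'_def J_def I(2) using b k d I by (simp add: icl_pr_mult frac_imul frac_pr)
  ultimately show thesis using that fJ' m by blast
qed

lemma int_div_in_O: assumes "(of_int a / of_int b :: 'k) \<in> Ok" "b \<noteq> 0" shows "b dvd a"
proof -
  have "of_rat (of_int a / of_int b) \<in> Ok" using assms by (simp add: of_rat_divide)
  then obtain k where "of_int a / of_int b = (of_int k :: rat)" unfolding O_rat by (auto elim: Ints_cases)
  then have "(of_int a :: rat) = of_int (b * k)" using assms(2) by (simp add: field_simps)
  then show ?thesis by (simp only: of_int_eq_iff) simp
qed

text \<open>If \<open>p\<close> were unramified, \<open>J\<close> would lie in (p) and its square in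
  (p^2), against the squarefreeness of \<open>m\<close>. Indeed \<open>J\<close> is stable under
  conjugation, being the unique root of a stable ideal, so traces and norms of its elements are
  divisible by \<open>p\<close>; with \<open>p\<close> prime to the discriminant this forces both
  coordinates of the element to be divisible by \<open>p\<close>.\<close>

lemma ramified_if_root:
  assumes J: "frac J" "imul J J = pr (of_nat m)" and m: "squarefree (m::nat)" "m > 0"
    and p: "prime p" "p dvd m"
  shows "p \<in> ramified"
proof (rule ccontr)
  assume "p \<notin> ramified"
  then have nr: "\<not> int p dvd D" "p = 2 \<Longrightarrow> D mod 4 = 1" using p(1) by (auto simp: ramified_iff)
  have pp: "prime (int p)" using p(1) by simp
  have p0: "of_int (int p) \<noteq> (0::'k)" using p(1) by auto
  have m0: "of_nat m \<noteq> (0::'k)" using m by simp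
  have "imul (cj ` J) (cj ` J) = pr (of_nat m)" using arg_cong[OF J(2), of "\<lambda>X. cj ` X"] by (simp add: cj_imul)
  then have cjJ: "cj ` J = J" using square_inject[OF frac_cj[OF J(1)] J(1)] J(2) by simp
  have oJ: "osubK J" by (rule frac_osub[OF J(1)])
  have dvd: "int p dvd k" if "of_int k \<in> imul J J" for k
  proof -
    have "of_int k / of_int (int m) \<in> Ok" using that m0 unfolding J(2) by (simp add: pr_mem)
    then have "int m dvd k" by (rule int_div_in_O) (use m in simp)
    then show ?thesis using p(2) by (meson dvd_trans int_dvd_int_iff)
  qed
  have "J \<subseteq> pr (of_int (int p))"
  proof
    fix x assume x: "x \<in> J"
    have cx: "cj x \<in> J" using x cjJ by blast
    have "x * x \<in> pr (of_nat m)" using imulI[OF x x] J(2) by simp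
    then have "x * x \<in> Ok" unfolding pr_def by (auto intro: O_mult[OF O_nat])
    then have xO: "x \<in> Ok" by (rule O_root)
    then obtain a b where ab: "x = of_int a + of_int b * om" unfolding O_eq by blast
    obtain t where t: "tr x = of_int t" using O_tr[OF xO] by (auto elim: Ints_cases)
    obtain n where n: "nrm x = of_int n" using O_nrm[OF xO] by (auto elim: Ints_cases)
    have "of_int t \<in> J" using K.osub_add[OF oJ x cx] unfolding tr_eq t by simp
    then have "of_int (t * t) \<in> imul J J" using imulI[of "of_int t" J "of_int t" J] by simp
    then have pt: "int p dvd t" using dvd pp by (metis prime_dvd_mult_iff)
    have "x * cj x \<in> imul J J" by (rule imulI[OF x cx])
    then have pn: "int p dvd n" using dvd unfolding nrm_eq n by simp
    have "int p dvd a \<and> int p dvd b"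
    proof (cases "D mod 4 = 1")
      case True
      then obtain q where q: "D = 4 * q + 1" by (metis mod_mult_div_eq add.commute)
      have "(of_int t :: rat) = of_int (2 * a + b)" unfolding t[symmetric] tr_def ab rp_int_om using True by simp
      then have t': "t = 2 * a + b" by (simp only: of_int_eq_iff)
      have "(of_int n :: rat) = of_int (a * a + a * b - q * (b * b))"
        unfolding n[symmetric] nrm_def ab rp_int_om ip_int_om using True by (simp add: q field_simps)
      then have n': "n = a * a + a * b - q * (b * b)" by (simp only: of_int_eq_iff)
      have "t * t - 4 * n = D * (b * b)" unfolding t' n' q by (simp add: algebra_simps)
      then have "int p dvd D * (b * b)" using pt pn by (metis dvd_diff dvd_mult dvd_mult2)
      then have pseudo_basis: "int p dvd b" using nr(1) pp by (metis prime_dvd_mult_iff)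
      have "a * a = n - b * (a - q * b)" unfolding n' by (simp add: algebra_simps)
      then have "int p dvd a * a" using pn pseudo_basis by (metis dvd_diff dvd_mult2)
      then show ?thesis using pseudo_basis pp by (metis prime_dvd_mult_iff)
    next
      case False
      have "(of_int t :: rat) = of_int (2 * a)" unfolding t[symmetric] tr_def ab rp_int_om using False by simp
      then have t': "t = 2 * a" by (simp only: of_int_eq_iff)
      have "(of_int n :: rat) = of_int (a * a - D * (b * b))"
        unfolding n[symmetric] nrm_def ab rp_int_om ip_int_om using False by simp
      then have n': "n = a * a - D * (b * b)" by (simp only: of_int_eq_iff)
      have "p \<noteq> 2" using nr False by blast
      then have "\<not> int p dvd 2" using pp by (metis int_dvd_int_iff of_nat_numeral p(1) primes_dvd_imp_eq two_is_prime_nat)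
      then have pa: "int p dvd a" using pt t' pp by (metis prime_dvd_mult_iff)
      have "D * (b * b) = a * a - n" unfolding n' by simp
      then have "int p dvd D * (b * b)" using pa pn by (metis dvd_diff dvd_mult2)
      then show ?thesis using pa nr(1) pp by (metis prime_dvd_mult_iff)
    qed
    then obtain a' b' where "a = int p * a'" "b = int p * b'" by (auto elim!: dvdE)
    then have "x = of_int (int p) * (of_int a' + of_int b' * om)" unfolding ab by (simp add: algebra_simps)
    moreover have "of_int a' + of_int b' * om \<in> Ok" by (intro O_add O_mult) auto
    ultimately show "x \<in> pr (of_int (int p))" unfolding pr_def by blast
  qed
  then have "imul J J \<subseteq> imul (pr (of_int (int p))) (pr (of_int (int p)))" by (intro imul_mono)
  then have "of_nat m \<in> pr (of_int (int p) * of_int (int p))" unfolding J(2) imul_pr_pr using prI by blast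
  then have "of_int (int m) / of_int (int p * int p) \<in> Ok" using p0 by (subst (asm) pr_mem) auto
  then have "int p * int p dvd int m" by (rule int_div_in_O) (use p0 in auto)
  then have "p\<^sup>2 dvd m" by (simp flip: of_nat_mult add: power2_eq_square)
  then have "p dvd 1" by (rule squarefreeD[OF m(1)])
  then show False using p(1) by simp
qed

end

context imag_quad
begin

text \<open>For P = (p, b) the square is p (p, b, b^2 / p), and \<open>xyz\<close> says that the
  second factor is the whole ring.\<close>

lemma ideal_root_generators:
  assumes p: "p > 0" and b: "b \<in> Ok" "b * b / of_nat p \<in> Ok"
    and xyz: "x \<in> Ok" "y \<in> Ok" "z \<in> Ok" "of_nat p * x + b * y + b * b / of_nat p * z = 1"
  shows "\<exists>P. frac P \<and> imul P P = pr (of_nat p)"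
proof -
  have p0: "of_nat p \<noteq> (0::'k)" using p by simp
  define P where "P = {of_nat p * u + b * v | u v. u \<in> Ok \<and> v \<in> Ok}"
  have oP: "osubK P" unfolding osub_def
  proof (intro conjI ballI)
    have "of_nat p * 0 + b * 0 \<in> P" unfolding P_def by blast
    then show "0 \<in> P" by simp
  next
    fix g h assume "g \<in> P" "h \<in> P"
    then obtain u v u' v' where *: "g = of_nat p * u + b * v" "h = of_nat p * u' + b * v'"
      "u \<in> Ok" "v \<in> Ok" "u' \<in> Ok" "v' \<in> Ok" unfolding P_def by blast
    then have "g + h = of_nat p * (u + u') + b * (v + v')" by (simp add: algebra_simps)
    then show "g + h \<in> P" unfolding P_def using * O_add by blast
  next
    fix c g assume c: "c \<in> Ok" and "g \<in> P"
    then obtain u v where *: "g = of_nat p * u + b * v" "u \<in> Ok" "v \<in> Ok" unfolding P_def by blast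
    then have "c * g = of_nat p * (c * u) + b * (c * v)" by (simp add: algebra_simps)
    then show "c * g \<in> P" unfolding P_def using * c O_mult by blast
  qed
  have "of_nat p * 1 + b * 0 \<in> P" "of_nat p * 0 + b * 1 \<in> P" unfolding P_def by blast+
  then have pseudo_basis: "of_nat p \<in> P" "b \<in> P" by simp_all
  have PO: "P \<subseteq> Ok" unfolding P_def using b by auto
  have fP: "frac P" by (rule fracI[OF oP pseudo_basis(1) p0, of 1]) (use PO in auto)
  have "imul P P = pr (of_nat p)"
  proof
    show "imul P P \<subseteq> pr (of_nat p)"
    proof (rule imul_least[OF osub_pr])
      fix g h assume "g \<in> P" "h \<in> P"
      then obtain u v u' v' where *: "g = of_nat p * u + b * v" "h = of_nat p * u' + b * v'"
        "u \<in> Ok" "v \<in> Ok" "u' \<in> Ok" "v' \<in> Ok" unfolding P_def by blast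
      have "g * h / of_nat p = of_nat p * (u * u') + b * (u * v' + v * u') + (b * b / of_nat p) * (v * v')"
        unfolding * using p0 by (simp add: field_simps)
      also have "\<dots> \<in> Ok" by (intro O_add O_mult[OF O_nat] O_mult[OF b(1)] O_mult[OF b(2)] O_mult[of u] O_mult[of v] *)
      finally show "g * h \<in> pr (of_nat p)" using p0 by (simp add: pr_mem)
    qed
    have "of_nat p = of_nat p * (of_nat p * x + b * y + b * b / of_nat p * z)" unfolding xyz(4) by simp
    also have "\<dots> = x * (of_nat p * of_nat p) + y * (of_nat p * b) + z * (b * b)"
      using p0 by (simp add: field_simps)
    also have "\<dots> \<in> imul P P"
      by (intro K.osub_add[OF osub_imul] K.osub_scale[OF osub_imul] imulI pseudo_basis xyz)
    finally show "pr (of_nat p) \<subseteq> imul P P" by (simp add: pr_subset osub_imul)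
  qed
  then show ?thesis using fP by blast
qed

lemma s_in_O: "s \<in> Ok"
  by (rule O_root) (use s_sq in \<open>simp add: power2_eq_square\<close>)

text \<open>The second generator is \<open>s\<close> when \<open>p\<close> divides \<open>D\<close>,
  where squarefreeness makes D / p prime to \<open>p\<close>. It is 1 + s when p = 2 and D = 4 k +
  3, where (1 + s)^2 / 2 = (2 k + 2) + s.\<close>

lemma root_of_ramified:
  assumes "p \<in> ramified" shows "\<exists>P. frac P \<and> imul P P = pr (of_nat p)"
proof -
  have p: "prime p" "p > 0" using assms by (auto simp: ramified_iff prime_gt_0_nat)
  have ss: "s * s = of_int D" using s_sq by (simp add: power2_eq_square)
  show ?thesis
  proof (cases "int p dvd D")
    case True
    then obtain q where q: "D = int p * q" by blast
    have "coprime (int p) q"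
    proof (rule prime_imp_coprime)
      show "\<not> int p dvd q"
      proof
        assume "int p dvd q"
        then have "(int p)\<^sup>2 dvd D" unfolding q power2_eq_square by simp
        then have "is_unit (int p)" using D_sqf by (rule squarefreeD[rotated])
        then show False using p by simp
      qed
    qed (use p in simp)
    then obtain u v where uv: "u * int p + v * q = 1" using coprime_iff_gcd_eq_1 bezout_int by metis
    have e: "s * s / of_nat p = of_int q" using p unfolding ss q by simp
    have "of_nat p * of_int u + s * 0 + s * s / of_nat p * of_int v = (of_int (u * int p + v * q) :: 'k)"
      unfolding e by (simp add: mult.commute)
    then show ?thesis
      using p uv s_in_O e by (intro ideal_root_generators[of p s "of_int u" 0 "of_int v"]) auto
  next
    case False
    then have p2: "p = 2" "D mod 4 = 3" using assms D_mod_4 unfolding ramified_iff by auto presburger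
    obtain k where k: "D = 4 * k + 3" using p2(2) by (metis mod_mult_div_eq add.commute)
    have e: "(1 + s) * (1 + s) / of_nat p = of_int (2 * k + 2) + s"
    proof -
      have "(1 + s) * (1 + s) = 1 + 2 * s + s * s" by (simp add: algebra_simps)
      also have "\<dots> = 2 * (of_int (2 * k + 2) + s)" unfolding ss k by (simp add: algebra_simps)
      finally have f: "(1 + s) * (1 + s) = 2 * (of_int (2 * k + 2) + s)" .
      show ?thesis unfolding f p2 by simp
    qed
    have "of_nat p * of_int (k + 1) + (1 + s) * 1 + (1 + s) * (1 + s) / of_nat p * of_int (-1) = 1"
      unfolding e unfolding p2 by (simp add: algebra_simps)
    then show ?thesis
      using p s_in_O by (intro ideal_root_generators[of p "1 + s" "of_int (k + 1)" 1 "of_int (-1)"])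
        (auto simp only: e intro!: O_add)
  qed
qed

lemma imul_interchange: "imul (imul A B) (imul C E) = imul (imul A C) (imul B E)"
proof -
  have "imul (imul A B) (imul C E) = imul A (imul (imul B C) E)" by (simp only: imul_assoc)
  also have "\<dots> = imul A (imul (imul C B) E)" by (simp only: imul_comm)
  finally show ?thesis by (simp only: imul_assoc)
qed

definition prd :: "nat set \<Rightarrow> nat" where "prd U = \<Prod>U"

lemma prd_pos: "U \<subseteq> ramified \<Longrightarrow> prd U > 0"
  unfolding prd_def by (rule prod_pos) (auto simp: ramified_def prime_gt_0_nat)

lemma prd_squarefree: assumes "U \<subseteq> ramified" shows "squarefree (prd U)"
  unfolding prd_def
proof (rule squarefree_prod_coprime)
  fix a b assume "a \<in> U" "b \<in> U" "a \<noteq> b"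
  then show "coprime a b" using assms by (intro primes_coprime) (auto simp: ramified_def)
next
  fix a assume "a \<in> U"
  then show "squarefree a" using assms by (intro squarefree_prime) (auto simp: ramified_def)
qed

lemma prd_dvd_iff: assumes "U \<subseteq> ramified" "prime p" shows "p dvd prd U \<longleftrightarrow> p \<in> U"
proof -
  have fin: "finite U" using assms finite_ramified finite_subset by blast
  show ?thesis unfolding prd_def
  proof
    assume "p dvd \<Prod>U"
    then obtain q where "q \<in> U" "p dvd q"
      using prime_dvd_prod_iff[OF fin assms(2), of "\<lambda>x. x"] by auto
    then show "p \<in> U" using assms by (metis ramified_def mem_Collect_eq primes_dvd_imp_eq subsetD)
  qed (use fin in \<open>rule dvd_prodI\<close>)
qed

lemma prd_inject: "U \<subseteq> ramified \<Longrightarrow> V \<subseteq> ramified \<Longrightarrow> prd U = prd V \<Longrightarrow> U = V"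
  by (metis (no_types, lifting) ramified_def mem_Collect_eq prd_dvd_iff subsetD subsetI subset_antisym)

lemma prd_of_squarefree:
  assumes "squarefree m" "m > 0" "\<And>p. prime p \<Longrightarrow> p dvd m \<Longrightarrow> p \<in> ramified"
  obtains U where "U \<subseteq> ramified" "prd U = m"
proof
  show "prime_factors m \<subseteq> ramified" using assms(3) by auto
  have "m = (\<Prod>p\<in>prime_factors m. p ^ multiplicity p m)"
    using assms(2) prime_factorization_nat by blast
  also have "\<dots> = \<Prod>(prime_factors m)"
    using assms(1,2) squarefree_factorial_semiring'[of m] by (intro prod.cong) (auto simp: squarefree_factorial_semiring'')
  finally show "prd (prime_factors m) = m" by (simp add: prd_def)
qed

lemma root_exists: assumes "U \<subseteq> ramified" shows "\<exists>P. frac P \<and> imul P P = pr (of_nat (prd U))"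
proof -
  have "finite U" using assms finite_ramified finite_subset by blast
  then show ?thesis using assms
  proof (induction U)
    case empty
    show ?case using frac_O frac_osub[OF frac_O] by (intro exI[of _ Ok]) (simp add: prd_def)
  next
    case (insert p U)
    then obtain P where P: "frac P" "imul P P = pr (of_nat (prd U))" by auto
    obtain Q where Q: "frac Q" "imul Q Q = pr (of_nat p)" using root_of_ramified[of p] insert.prems by blast
    have "imul (imul Q P) (imul Q P) = imul (imul Q Q) (imul P P)" by (rule imul_interchange)
    also have "\<dots> = pr (of_nat (prd (insert p U)))"
      using insert unfolding P Q by (simp add: prd_def)
    finally show ?case using frac_imul[OF Q(1) P(1)] by blast
  qed
qed

text \<open>The ambiguous ideal whose square is generated by the product of the primes in
  \<open>U\<close>; by \<open>square_inject\<close> there is just one.\<close>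

definition rt :: "nat set \<Rightarrow> 'k set" where "rt U = (SOME P. frac P \<and> imul P P = pr (of_nat (prd U)))"

lemma rt: assumes "U \<subseteq> ramified" shows "frac (rt U)" "imul (rt U) (rt U) = pr (of_nat (prd U))"
  using someI_ex[OF root_exists[OF assms]] unfolding rt_def by auto

lemma rt_unique: "U \<subseteq> ramified \<Longrightarrow> frac P \<Longrightarrow> imul P P = pr (of_nat (prd U)) \<Longrightarrow> rt U = P"
  using square_inject[of "rt U" P] rt[of U] by simp

lemma prd_sym_diff:
  assumes "U \<subseteq> ramified" "V \<subseteq> ramified"
  shows "prd U * prd V = prd (U \<inter> V) * prd (U \<inter> V) * prd (sym_diff U V)"
proof -
  have fin: "finite U" "finite V" using assms finite_ramified finite_subset by blast+
  have "\<Prod>U = \<Prod>(U \<inter> V) * \<Prod>(U - V)" using fin prod.Int_Diff[of U id V] by simp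
  moreover have "\<Prod>V = \<Prod>(U \<inter> V) * \<Prod>(V - U)" using fin prod.Int_Diff[of V id U] by (simp add: Int_commute)
  moreover have "\<Prod>(sym_diff U V) = \<Prod>(U - V) * \<Prod>(V - U)"
    using fin by (intro prod.union_disjoint) auto
  ultimately show ?thesis by (simp add: prd_def mult_ac)
qed

text \<open>Both sides have the same square. As the extra factor is principal, U \<mapsto> [rt U] is
  a homomorphism with respect to symmetric difference.\<close>

lemma rt_mult:
  assumes "U \<subseteq> ramified" "V \<subseteq> ramified"
  shows "imul (rt U) (rt V) = imul (pr (of_nat (prd (U \<inter> V)))) (rt (sym_diff U V))"
proof (rule square_inject)
  have S: "sym_diff U V \<subseteq> ramified" "U \<inter> V \<subseteq> ramified" using assms by auto
  show "frac (imul (rt U) (rt V))" by (intro frac_imul rt assms)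
  show "frac (imul (pr (of_nat (prd (U \<inter> V)))) (rt (sym_diff U V)))"
    using prd_pos[OF S(2)] by (intro frac_imul rt S frac_pr) simp
  have "imul (imul (rt U) (rt V)) (imul (rt U) (rt V)) = imul (imul (rt U) (rt U)) (imul (rt V) (rt V))"
    by (rule imul_interchange)
  also have "\<dots> = pr (of_nat (prd U * prd V))" unfolding rt(2)[OF assms(1)] rt(2)[OF assms(2)] by simp
  also have "\<dots> = imul (imul (pr (of_nat (prd (U \<inter> V)))) (pr (of_nat (prd (U \<inter> V))))) (imul (rt (sym_diff U V)) (rt (sym_diff U V)))"
    unfolding rt(2)[OF S(1)] prd_sym_diff[OF assms] by simp
  also have "\<dots> = imul (imul (pr (of_nat (prd (U \<inter> V)))) (rt (sym_diff U V)))
      (imul (pr (of_nat (prd (U \<inter> V)))) (rt (sym_diff U V)))" by (rule imul_interchange)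
  finally show "imul (imul (rt U) (rt V)) (imul (rt U) (rt V)) = \<dots>" .
qed

lemma icl_rt_square: assumes "U \<subseteq> ramified" shows "icl (rt U) \<otimes>\<^bsub>class_group\<^esub> icl (rt U) = \<one>\<^bsub>class_group\<^esub>"
  using icl_mult[OF rt(1)[OF assms] rt(1)[OF assms]] icl_pr[of "of_nat (prd U)"] prd_pos[OF assms]
  by (simp add: rt(2)[OF assms])

lemma icl_rt_eq_iff:
  assumes "U \<subseteq> ramified" "V \<subseteq> ramified"
  shows "icl (rt U) = icl (rt V) \<longleftrightarrow> icl (rt (sym_diff U V)) = \<one>\<^bsub>class_group\<^esub>"
proof -
  have S: "sym_diff U V \<subseteq> ramified" "U \<inter> V \<subseteq> ramified" using assms by auto
  have "icl (rt (sym_diff U V)) = icl (rt U) \<otimes>\<^bsub>class_group\<^esub> icl (rt V)"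
    unfolding icl_mult[OF rt(1)[OF assms(1)] rt(1)[OF assms(2)]] rt_mult[OF assms]
    using prd_pos[OF S(2)] by (intro icl_pr_mult[symmetric] rt S) simp
  moreover have "icl (rt U) \<otimes>\<^bsub>class_group\<^esub> icl (rt V) = \<one>\<^bsub>class_group\<^esub> \<longleftrightarrow> icl (rt U) = icl (rt V)"
    using icl_rt_square[OF assms(2)] icl_carrier[OF rt(1)[OF assms(1)]] icl_carrier[OF rt(1)[OF assms(2)]]
    by (metis CG.right_cancel)
  ultimately show ?thesis by simp
qed

(* The trace t of a unit satisfies t^2 - 4 = D (2b)^2 <= 0, so |t| <= 2; t = 0 forces D = -1. *)
lemma unit_cases:
  assumes e: "e \<in> Ok" "nrm e = 1"
  obtains (square) u where "nrm u = 1" "e = u * u" | (neg) u where "nrm u = 1" "e = - (u * u)"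
    | (i) "D = -1" "e = s \<or> e = - s"
proof -
  obtain t where t: "tr e = of_int t" using O_tr[OF e(1)] by (auto elim: Ints_cases)
  have root: "e * e = of_int t * e - 1" using root_quad[of e] t e(2) by (simp add: algebra_simps)
  have rp: "rp e = of_int t / 2" using t by (simp add: tr_def)
  have eq: "of_int D * ((2 * ip e) * (2 * ip e)) = of_int (t * t - 4)"
    using e(2) by (simp add: nrm_def rp field_simps)
  have "of_int D * ((2 * ip e) * (2 * ip e)) \<le> 0" using D_neg by (intro mult_nonpos_nonneg) auto
  then have "t * t \<le> 4" unfolding eq of_int_le_0_iff by simp
  then have "\<bar>t\<bar> \<le> 2" using abs_le_square_iff[of t 2] by (simp add: power2_eq_square)
  then consider "t = 2" | "t = -2" | "t = 1" | "t = -1" | "t = 0" by linarith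
  then show thesis
  proof cases
    case 1
    then have "(e - 1) * (e - 1) = 0" using root by (simp add: algebra_simps)
    then have "e = 1 * 1" by simp
    then show thesis using square[of 1] by simp
  next
    case 2
    have "(e + 1) * (e + 1) = e * e + 2 * e + 1" by (simp add: algebra_simps)
    then have "(e + 1) * (e + 1) = 0" using 2 unfolding root by simp
    then have "e = - (1 * 1)" by (simp add: eq_neg_iff_add_eq_0)
    then show thesis using neg[of 1] by simp
  next
    \<comment> \<open>Here \<open>e\<close> is a primitive sixth root of unity, with e^4 = -e; for t
      = -1 it is a primitive cube root of unity, with e^4 = e.\<close>
    case 3
    then have r: "e * e = e - 1" using root by simp
    have "(e * e) * (e * e) = (e - 1) * (e - 1)" unfolding r ..
    also have "\<dots> = e * e - 2 * e + 1" by (simp add: algebra_simps)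
    also have "\<dots> = - e" unfolding r by simp
    finally have "e = - ((e * e) * (e * e))" by simp
    moreover have "nrm (e * e) = 1" using e by simp
    ultimately show thesis using neg by blast
  next
    case 4
    then have r: "e * e = - e - 1" using root by simp
    have "(e * e) * (e * e) = (- e - 1) * (- e - 1)" unfolding r ..
    also have "\<dots> = e * e + 2 * e + 1" by (simp add: algebra_simps)
    also have "\<dots> = e" unfolding r by simp
    finally have "e = (e * e) * (e * e)" by simp
    moreover have "nrm (e * e) = 1" using e by simp
    ultimately show thesis using square by blast
  next
    case 5
    have n: "of_int D * (ip e * ip e) = -1" using e(2) 5 rp by (simp add: nrm_def)
    have "of_int D * (ip e * ip e) \<in> \<int>" unfolding n by simp
    then have "ip e \<in> \<int>" by (rule rat_int_if_sqf_mult_square_int)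
    then obtain k where k: "ip e = of_int k" by (auto elim: Ints_cases)
    have "(of_int (D * (k * k)) :: rat) = of_int (-1)" using n k by simp
    then have "D * (k * k) = -1" by (simp only: of_int_eq_iff)
    then have "(- D) * (k * k) = 1" by simp
    then have D: "D = -1" "k * k = 1" using D_neg zmult_eq_1_iff[of "- D" "k * k"] by auto
    then have "k = 1 \<or> k = -1" using zmult_eq_1_iff by auto
    then have "e = s \<or> e = - s" using rep[of e] rp 5 k by auto
    then show thesis using i D by blast
  qed
qed

section \<open>Principal ambiguous ideals\<close>

text \<open>The generator of the square of the nontrivial principal ambiguous ideal: (s)^2 = (D) in
  general, but for D = -1 the root \<open>s\<close> is a unit and (1 + s)^2 = (2) takes its
  place.\<close>

definition n0 :: nat where "n0 = (if D = -1 then 2 else nat (- D))"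

lemma n0: "squarefree n0" "n0 > 1" "prime p \<Longrightarrow> p dvd n0 \<Longrightarrow> p \<in> ramified"
proof -
  show "n0 > 1" using D_neg by (simp add: n0_def)
  show "squarefree n0"
  proof (cases "D = -1")
    case True
    then show ?thesis unfolding n0_def by (simp add: squarefree_prime)
  next
    case False
    have "squarefree (nat (- D))"
    proof (rule squarefreeI)
      fix x :: nat assume "x\<^sup>2 dvd nat (- D)"
      then have "int (x\<^sup>2) dvd - D" using D_neg by (metis int_dvd_int_iff int_nat_eq less_imp_le neg_0_less_iff_less)
      then have "(int x)\<^sup>2 dvd D" by simp
      then have "is_unit (int x)" using D_sqf by (rule squarefreeD[rotated])
      then show "is_unit x" by simp
    qed
    then show ?thesis using False by (simp add: n0_def)
  qed
  show "p \<in> ramified" if p: "prime p" "p dvd n0"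
  proof (cases "D = -1")
    case True
    then have "p = 2" using p by (metis n0_def primes_dvd_imp_eq two_is_prime_nat)
    then show ?thesis using True unfolding ramified_iff by simp
  next
    case False
    then have "int p dvd - D" using p D_neg
      by (metis int_dvd_int_iff int_nat_eq less_imp_le n0_def neg_0_less_iff_less)
    then show ?thesis using p by (simp add: ramified_iff)
  qed
qed

lemma cj_s [simp]: "cj s = - s" using cj_rep[of 0 1] by simp

text \<open>The generator satisfies conj(a) = e a with a unit \<open>e\<close>. If \<open>e\<close>
  is u^2 or -u^2 with \<open>u\<close> of norm 1, then u a is rational or a rational multiple of
  \<open>s\<close>; as its norm \<open>n\<close> is squarefree, \<open>n\<close> is 1 or -D. The
  units s and -s for D = -1 give n = 2.\<close>

lemma principal_root_cases:
  assumes n: "squarefree n" "n > 0" and a: "a \<noteq> 0" "pr a = cj ` pr a" "pr (a * a) = pr (of_nat n)"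
  shows "n = 1 \<or> n = n0"
proof -
  have ss: "s * s = of_int D" using s_sq by (simp add: power2_eq_square)
  have s0: "s \<noteq> 0" using s_not_rat[of 0] by simp
  have na: "nrm a = of_nat n"
  proof -
    have "of_nat n \<noteq> (0::'k)" using n by simp
    then have q: "a * a / of_nat n \<in> Ok" "of_nat n / (a * a) \<in> Ok" using a(1,3) pr_eq_iff[of "a * a" "of_nat n"] by auto
    have 1: "nrm (a * a / of_nat n) = 1" by (rule unit_nrm) (use q a n in auto)
    have 2: "nrm (of_nat n) * nrm (a * a / of_nat n) = nrm a * nrm a"
      using n by (simp flip: nrm_mult)
    have "nrm a * nrm a = of_nat n * of_nat n" unfolding 2[symmetric] 1 using nrm_int[of "int n"] by simp
    then show ?thesis using nrm_nonneg[of a] by (metis of_nat_0_le_iff power2_eq_iff_nonneg power2_eq_square)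
  qed
  define e where "e = cj a / a"
  have ca: "cj a \<noteq> 0" using a by simp
  have eO: "e \<in> Ok" "nrm e = 1"
  proof -
    have "pr (cj a) = pr a" using a(2) by simp
    then have *: "e \<in> Ok" "1 / e \<in> Ok" unfolding e_def using pr_eq_iff[OF ca a(1)] by auto
    show "e \<in> Ok" by fact
    show "nrm e = 1" by (rule unit_nrm[OF *]) (use a in \<open>simp add: e_def\<close>)
  qed
  have ea: "cj a = e * a" using a by (simp add: e_def)
  have nq: "n = 1" if b: "cj b = b" "nrm b = of_nat n" for b
  proof -
    have "b = of_rat (rp b)" using cj_fixed[OF b(1)] .
    then have "of_nat n = rp b * rp b * of_nat 1" using b(2) nrm_rat[of "rp b"] by simp
    then show ?thesis by (intro squarefree_eq_if_ratio_square) (use n in auto)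
  qed
  have nns: "n = nat (- D)" if b: "cj b = - b" "nrm b = of_nat n" for b
  proof -
    have "cj (b / s) = b / s" using b by simp
    then obtain q where q: "b / s = of_rat q" using cj_fixed by blast
    then have "b = of_rat q * s" using s0 by (simp add: field_simps)
    then have "of_rat (nrm b) = (of_rat q * s) * cj (of_rat q * s)" using nrm_eq[of b] by simp
    also have "\<dots> = - (of_rat (q * q) * (s * s))" by (simp add: of_rat_mult)
    also have "\<dots> = of_rat (- (q * q * of_int D))" unfolding ss by (simp add: of_rat_mult of_rat_minus)
    finally have "nrm b = - (q * q * of_int D)" by (simp only: of_rat_eq_iff)
    then have "of_nat n = q * q * of_nat (nat (- D))" using b(2) D_neg by simp
    moreover have "squarefree (nat (- D))"
    proof (cases "D = -1")
      case False
      then show ?thesis using n0(1) by (simp add: n0_def)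
    qed simp
    ultimately show ?thesis using D_neg by (intro squarefree_eq_if_ratio_square) (use n in auto)
  qed
  have cu: "cj u * u = 1" if "nrm u = 1" for u using nrm_eq[of u] that by (simp add: mult.commute)
  show ?thesis using eO
  proof (cases rule: unit_cases)
    case (square u)
    have "cj (u * a) = (cj u * u) * (u * a)" unfolding cj_mult ea square by (simp add: mult_ac)
    then have "cj (u * a) = u * a" using cu[OF square(1)] by simp
    moreover have "nrm (u * a) = of_nat n" using square na by simp
    ultimately show ?thesis using nq by blast
  next
    case (neg u)
    have "cj (u * a) = - ((cj u * u) * (u * a))" unfolding cj_mult ea neg by (simp add: mult_ac)
    then have "cj (u * a) = - (u * a)" using cu[OF neg(1)] by simp
    moreover have "nrm (u * a) = of_nat n" using neg na by simp
    ultimately have "n = nat (- D)" using nns by blast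
    \<comment> \<open>For D = -1 this is the alternative n = 1, otherwise n =
      \<open>n0\<close>.\<close>
    then show ?thesis by (auto simp: n0_def)
  next
    case i
    have r: "rp (cj a) = rp (e * a)" using ea by simp
    have rs: "rp s = 0" "ip s = 1" using rp_eq[of 0 1] ip_eq[of 0 1] by simp_all
    have rms: "rp (- s) = 0" "ip (- s) = -1" using rp_eq[of 0 "-1"] ip_eq[of 0 "-1"] by (simp_all add: of_rat_minus)
    have "rp a = - ip a \<or> rp a = ip a" using i(2) r by (auto simp: rp_mult rs rms i(1))
    then have "of_nat n = rp a * rp a * of_nat 2" using na i(1) unfolding nrm_def by auto
    then have "n = 2" by (intro squarefree_eq_if_ratio_square) (use n in \<open>auto simp: squarefree_prime\<close>)
    then show ?thesis using i(1) unfolding n0_def by simp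
  qed
qed

lemma icl_eq_one_iff: "frac I \<Longrightarrow> icl I = \<one>\<^bsub>class_group\<^esub> \<longleftrightarrow> (\<exists>c. c \<noteq> 0 \<and> I = pr c)"
  using icl_eq_iff[of I Ok] by (simp add: icl_one[symmetric] frac_O imul_comm[of _ Ok] osub_pr)

lemma rt_principal_iff:
  assumes U: "U \<subseteq> ramified" shows "icl (rt U) = \<one>\<^bsub>class_group\<^esub> \<longleftrightarrow> prd U = 1 \<or> prd U = n0"
proof
  assume "icl (rt U) = \<one>\<^bsub>class_group\<^esub>"
  then obtain a where a: "a \<noteq> 0" "rt U = pr a" using icl_eq_one_iff rt(1)[OF U] by blast
  have 1: "pr (a * a) = pr (of_nat (prd U))" using rt(2)[OF U] a by simp
  have "imul (cj ` rt U) (cj ` rt U) = pr (of_nat (prd U))"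
    using arg_cong[OF rt(2)[OF U], of "\<lambda>X. cj ` X"] by (simp add: cj_imul)
  then have "pr a = cj ` pr a" using rt_unique[OF U frac_cj[OF rt(1)[OF U]]] a by simp
  then show "prd U = 1 \<or> prd U = n0"
    using principal_root_cases[OF prd_squarefree[OF U] prd_pos[OF U] a(1) _ 1] by simp
next
  have ss: "s * s = of_int D" using s_sq by (simp add: power2_eq_square)
  have s0: "s \<noteq> 0" using s_not_rat[of 0] by simp
  assume "prd U = 1 \<or> prd U = n0"
  then have "\<exists>c. c \<noteq> 0 \<and> pr (c * c) = pr (of_nat (prd U))"
  proof
    assume "prd U = 1" then show ?thesis by (intro exI[of _ 1]) simp
  next
    assume n: "prd U = n0"
    show ?thesis
    proof (cases "D = -1")
      case True
      have e: "(1 + s) * (1 + s) = 2 * s" using ss True by (simp add: algebra_simps)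
      have "2 * s / 2 \<in> Ok" "2 / (2 * s) \<in> Ok"
      proof -
        have "2 / (2 * s) = - s" using ss True s0 by (simp add: field_simps)
        then show "2 / (2 * s) \<in> Ok" using s_in_O by auto
        show "2 * s / 2 \<in> Ok" using s_in_O by simp
      qed
      then have "pr (2 * s) = pr 2" using s0 by (subst pr_eq_iff) auto
      moreover have "1 + s \<noteq> 0" using e s0 by auto
      ultimately show ?thesis using n True e unfolding n0_def by (intro exI[of _ "1 + s"]) simp
    next
      case False
      have "of_int D / of_nat n0 = (-1 :: 'k)" "of_nat n0 / of_int D = (-1 :: 'k)"
        using False D_neg by (simp_all add: n0_def of_nat_nat)
      then have "pr (of_int D) = pr (of_nat n0)" using D_neg n0(2) by (subst pr_eq_iff) auto
      then show ?thesis using n ss s0 by (intro exI[of _ s]) simp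
    qed
  qed
  then obtain c where c: "c \<noteq> 0" "pr (c * c) = pr (of_nat (prd U))" by blast
  then have "rt U = pr c" using rt_unique[OF U frac_pr[OF c(1)]] by simp
  then show "icl (rt U) = \<one>\<^bsub>class_group\<^esub>" using icl_pr c by simp
qed

section \<open>Counting the 2-torsion and the squares of the class group\<close>

definition two_torsion :: "'k set set set" where
  "two_torsion = {c \<in> carrier class_group. c \<otimes>\<^bsub>class_group\<^esub> c = \<one>\<^bsub>class_group\<^esub>}"
definition class_squares :: "'k set set set" where
  "class_squares = {c \<otimes>\<^bsub>class_group\<^esub> c | c. c \<in> carrier class_group}"

lemma rt_image: "(\<lambda>U. icl (rt U)) ` Pow ramified = two_torsion"
proof (intro subset_antisym subsetI)
  fix c assume "c \<in> (\<lambda>U. icl (rt U)) ` Pow ramified"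
  then obtain U where U: "U \<subseteq> ramified" "c = icl (rt U)" by blast
  then show "c \<in> two_torsion" using icl_rt_square[OF U(1)] icl_carrier[OF rt(1)[OF U(1)]] unfolding two_torsion_def by blast
next
  fix c assume "c \<in> two_torsion"
  then have "c \<in> carrier class_group" "c \<otimes>\<^bsub>class_group\<^esub> c = \<one>\<^bsub>class_group\<^esub>" unfolding two_torsion_def by auto
  then obtain J m where J: "frac J" "icl J = c" "squarefree (m::nat)" "m > 0" "imul J J = pr (of_nat m)"
    using two_torsion_class_root by blast
  obtain U where U: "U \<subseteq> ramified" "prd U = m"
    using prd_of_squarefree[OF J(3,4)] ramified_if_root[OF J(1,5,3,4)] by blast
  then have "rt U = J" using rt_unique J by simp
  then show "c \<in> (\<lambda>U. icl (rt U)) ` Pow ramified" using U J by blast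
qed

text \<open>Every fibre of U \<mapsto> [rt U] has two elements, \<open>U\<close> and its symmetric
  difference with the set \<open>S0\<close> of primes dividing \<open>n0\<close>.\<close>

lemma card_two_torsion: "2 ^ num_ramified s = 2 * card two_torsion"
proof -
  obtain S0 where S0: "S0 \<subseteq> ramified" "prd S0 = n0" using prd_of_squarefree[of n0] n0 by auto
  have S0ne: "S0 \<noteq> {}" using S0 n0(2) by (auto simp: prd_def)
  have "card (Pow ramified) = 2 * card ((\<lambda>U. icl (rt U)) ` Pow ramified)"
  proof (rule card_const_fibres)
    show "finite (Pow ramified)" using finite_ramified by simp
    fix y assume "y \<in> (\<lambda>U. icl (rt U)) ` Pow ramified"
    then obtain U where U: "U \<subseteq> ramified" "y = icl (rt U)" by blast
    have eq: "V \<in> {U, sym_diff U S0} \<longleftrightarrow> V \<in> Pow ramified \<and> icl (rt V) = y" for V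
    proof
      assume "V \<in> {U, sym_diff U S0}"
      then have V: "V \<subseteq> ramified" "sym_diff V U = {} \<or> sym_diff V U = S0" using U S0 by auto
      then have "prd (sym_diff V U) = 1 \<or> prd (sym_diff V U) = n0" using S0 by (auto simp: prd_def)
      moreover have "sym_diff V U \<subseteq> ramified" using V U by auto
      ultimately show "V \<in> Pow ramified \<and> icl (rt V) = y"
        using icl_rt_eq_iff[OF V(1) U(1)] rt_principal_iff[of "sym_diff V U"] V U by auto
    next
      assume "V \<in> Pow ramified \<and> icl (rt V) = y"
      then have V: "V \<subseteq> ramified" "icl (rt V) = icl (rt U)" using U by auto
      have S: "sym_diff V U \<subseteq> ramified" using V U by auto
      then have "prd (sym_diff V U) = 1 \<or> prd (sym_diff V U) = n0"
        using icl_rt_eq_iff[OF V(1) U(1)] rt_principal_iff[OF S] V by simp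
      then have "prd (sym_diff V U) = prd {} \<or> prd (sym_diff V U) = prd S0"
        using S0 by (simp add: prd_def)
      then have "sym_diff V U = {} \<or> sym_diff V U = S0"
        using prd_inject[OF S] S0 by blast
      then show "V \<in> {U, sym_diff U S0}" by blast
    qed
    have "{x \<in> Pow ramified. icl (rt x) = y} = {U, sym_diff U S0}"
      by (rule Set.set_eqI) (simp only: eq mem_Collect_eq)
    moreover have "U \<noteq> sym_diff U S0" using S0ne by blast
    ultimately show "card {x \<in> Pow ramified. icl (rt x) = y} = 2" by simp
  qed
  then show ?thesis by (simp add: card_Pow finite_ramified rt_image num_ramified_eq)
qed

text \<open>The fibres of squaring are the cosets of the 2-torsion.\<close>

lemma card_class_squares: "class_number TYPE('k) = card two_torsion * card class_squares"
proof -
  let ?C = "carrier (class_group :: 'k set set monoid)"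
  have im: "(\<lambda>c. c \<otimes>\<^bsub>class_group\<^esub> c) ` ?C = class_squares" unfolding class_squares_def by blast
  have "card ?C = card two_torsion * card ((\<lambda>c. c \<otimes>\<^bsub>class_group\<^esub> c) ` ?C)"
  proof (rule card_const_fibres[OF finite_class_group])
    fix y assume "y \<in> (\<lambda>c. c \<otimes>\<^bsub>class_group\<^esub> c) ` ?C"
    then obtain a where a: "a \<in> ?C" "y = a \<otimes>\<^bsub>class_group\<^esub> a" by blast
    have sq: "(a \<otimes>\<^bsub>class_group\<^esub> c) \<otimes>\<^bsub>class_group\<^esub> (a \<otimes>\<^bsub>class_group\<^esub> c) = y \<otimes>\<^bsub>class_group\<^esub> (c \<otimes>\<^bsub>class_group\<^esub> c)"
      if "c \<in> ?C" for c using a that by (simp add: CG.m_ac)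
    have "bij_betw (\<lambda>c. a \<otimes>\<^bsub>class_group\<^esub> c) two_torsion {x \<in> ?C. x \<otimes>\<^bsub>class_group\<^esub> x = y}"
    proof (rule bij_betwI[where g = "\<lambda>x. inv\<^bsub>class_group\<^esub> a \<otimes>\<^bsub>class_group\<^esub> x"])
      show "(\<lambda>c. a \<otimes>\<^bsub>class_group\<^esub> c) \<in> two_torsion \<rightarrow> {x \<in> ?C. x \<otimes>\<^bsub>class_group\<^esub> x = y}"
        using sq a unfolding two_torsion_def by auto
      show "(\<lambda>x. inv\<^bsub>class_group\<^esub> a \<otimes>\<^bsub>class_group\<^esub> x) \<in> {x \<in> ?C. x \<otimes>\<^bsub>class_group\<^esub> x = y} \<rightarrow> two_torsion"
      proof
        fix x assume "x \<in> {x \<in> ?C. x \<otimes>\<^bsub>class_group\<^esub> x = y}"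
        then have x: "x \<in> ?C" "x \<otimes>\<^bsub>class_group\<^esub> x = y" by auto
        let ?c = "inv\<^bsub>class_group\<^esub> a \<otimes>\<^bsub>class_group\<^esub> x"
        have c: "?c \<in> ?C" using x a by simp
        have "a \<otimes>\<^bsub>class_group\<^esub> ?c = x" using x a by (simp flip: CG.m_assoc)
        then have "y = y \<otimes>\<^bsub>class_group\<^esub> (?c \<otimes>\<^bsub>class_group\<^esub> ?c)" using sq[OF c] x by simp
        then have "?c \<otimes>\<^bsub>class_group\<^esub> ?c = \<one>\<^bsub>class_group\<^esub>"
          using a c CG.r_cancel_one'[of y "?c \<otimes>\<^bsub>class_group\<^esub> ?c"] CG.l_cancel_one'[of y "?c \<otimes>\<^bsub>class_group\<^esub> ?c"] by auto
        then show "?c \<in> two_torsion" using c unfolding two_torsion_def by simp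
      qed
    qed (use a in \<open>auto simp: two_torsion_def simp flip: CG.m_assoc\<close>)
    then show "card {x \<in> ?C. x \<otimes>\<^bsub>class_group\<^esub> x = y} = card two_torsion"
      by (rule bij_betw_same_card[symmetric])
  qed
  then show ?thesis unfolding im class_number_def Coset.order_def .
qed

lemma card_class_squares_real: "real (card class_squares) = real (class_number TYPE('k)) / 2 ^ (num_ramified s - 1)"
proof -
  \<comment> \<open>The subtraction t - 1 on natural numbers is harmless: 2^t is even by
    \<open>card_two_torsion\<close>, so t > 0.\<close>
  have "num_ramified s \<noteq> 0"
  proof
    assume "num_ramified s = 0"
    then have "(1::nat) = 2 * card two_torsion" using card_two_torsion by simp
    then show False by presburger
  qed
  then obtain k where k: "num_ramified s = Suc k" using not0_implies_Suc by blast
  then have "card two_torsion = 2 ^ k" using card_two_torsion by simp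
  then show ?thesis unfolding card_class_squares k by simp
qed

end

section \<open>Pseudo-bases and the Steinitz class\<close>

text \<open>The basis is indexed by the numbers below \<open>n\<close> so that the coordinates of an
  n-tuple form a square matrix.\<close>

locale fd_space = iq_space D s smul
  for D and s :: "'k::field_char_0" and smul :: "'k \<Rightarrow> 'v::ab_group_add \<Rightarrow> 'v" +
  fixes bs :: "nat \<Rightarrow> 'v" and n :: nat
  assumes bs_inj: "inj_on bs {..<n}"
    and bs_indep: "independent (bs ` {..<n})"
    and bs_span: "span (bs ` {..<n}) = UNIV"
begin

definition co :: "'v \<Rightarrow> nat \<Rightarrow> 'k" where "co v j = representation (bs ` {..<n}) v (bs j)"

lemma co_expand: "(\<Sum>j<n. smul (co v j) (bs j)) = v"
proof -
  have "(\<Sum>b\<in>bs ` {..<n}. smul (representation (bs ` {..<n}) v b) b) = v"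
    by (rule sum_representation_eq[OF bs_indep]) (auto simp: bs_span)
  then show ?thesis by (simp add: sum.reindex[OF bs_inj] co_def)
qed

lemma co_add [simp]: "co (u + v) j = co u j + co v j"
  unfolding co_def by (subst representation_add[OF bs_indep]) (auto simp: bs_span)
lemma co_scale [simp]: "co (smul c v) j = c * co v j"
  unfolding co_def by (subst representation_scale[OF bs_indep]) (auto simp: bs_span)
lemma co_0 [simp]: "co 0 j = 0" using co_scale[of 0 0 j] by simp
lemma co_sum [simp]: "co (sum f A) j = (\<Sum>i\<in>A. co (f i) j)"
  by (induction A rule: infinite_finite_induct) simp_all
lemma co_bs: "i < n \<Longrightarrow> j < n \<Longrightarrow> co (bs i) j = (if i = j then 1 else 0)"
  unfolding co_def
  by (subst representation_basis[OF bs_indep]) (use bs_inj in \<open>auto simp: inj_on_def\<close>)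
lemma co_eqI: "(\<And>j. j < n \<Longrightarrow> co u j = co v j) \<Longrightarrow> u = v"
  by (metis (no_types, lifting) co_expand lessThan_iff sum.cong)

definition cm :: "(nat \<Rightarrow> 'v) \<Rightarrow> 'k Matrix.mat" where "cm v = Matrix.mat n n (\<lambda>(i, j). co (v i) j)"
definition coord_det :: "(nat \<Rightarrow> 'v) \<Rightarrow> 'k" where "coord_det v = Determinant.det (cm v)"

lemma cm_carrier [simp]: "cm v \<in> carrier_mat n n" by (simp add: cm_def)

lemma coord_det_cong: "(\<And>i. i < n \<Longrightarrow> v i = w i) \<Longrightarrow> coord_det v = coord_det w"
  unfolding coord_det_def cm_def by (rule arg_cong[where f = Determinant.det]) (auto intro!: eq_matI)

lemma coord_det_comb:
  assumes "\<And>i. i < n \<Longrightarrow> v i = (\<Sum>j<n. smul (a i j) (w j))"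
  shows "coord_det v = Determinant.det (Matrix.mat n n (\<lambda>(i, j). a i j)) * coord_det w"
proof -
  have "cm v = Matrix.mat n n (\<lambda>(i, j). a i j) * cm w"
    by (rule eq_matI) (auto simp: cm_def assms scalar_prod_def lessThan_atLeast0 intro!: sum.cong)
  then show ?thesis unfolding coord_det_def by (simp add: Determinant.det_mult[of _ n])
qed

lemma coord_det_bs: "coord_det bs = 1"
proof -
  have "cm bs = 1\<^sub>m n" by (rule eq_matI) (auto simp: cm_def co_bs)
  then show ?thesis by (simp add: coord_det_def)
qed

lemma coord_det_scale_row: assumes "i < n" shows "coord_det (v(i := smul c x)) = c * coord_det (v(i := x))"
proof -
  have "cm (v(i := smul c x)) = multrow i c (cm (v(i := x)))"
    by (rule eq_matI) (auto simp: cm_def mat_multrow_def)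
  then show ?thesis unfolding coord_det_def using assms by (simp add: det_multrow)
qed

lemma coord_det_add_row: assumes "i < n" "j \<noteq> i" shows "coord_det (v(j := smul c (v i) + v j)) = coord_det v"
proof -
  have "cm (v(j := smul c (v i) + v j)) = addrow c j i (cm v)"
    using assms by (intro eq_matI) (auto simp: cm_def mat_addrow_def)
  then show ?thesis unfolding coord_det_def using assms by (simp add: det_addrow)
qed

lemma coord_det_elim:
  assumes "finite S" "i < n" "i \<notin> S"
  shows "coord_det (\<lambda>j. if j \<in> S then v j - smul (d j) (v i) else v j) = coord_det v"
  using assms
proof (induction S)
  case (insert k S)
  let ?w = "\<lambda>j. if j \<in> S then v j - smul (d j) (v i) else v j"
  have "(\<lambda>j. if j \<in> insert k S then v j - smul (d j) (v i) else v j) = ?w(k := smul (- d k) (?w i) + ?w k)"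
    using insert by (auto simp: fun_eq_iff scale_minus_left)
  moreover have "coord_det \<dots> = coord_det ?w" using insert by (intro coord_det_add_row) auto
  ultimately show ?case using insert by simp
qed simp

definition is_basis :: "(nat \<Rightarrow> 'v) \<Rightarrow> bool" where
  "is_basis x \<longleftrightarrow> inj_on x {..<n} \<and> independent (x ` {..<n}) \<and> span (x ` {..<n}) = UNIV"

lemma is_basis_expand: assumes "is_basis x" shows "\<exists>c. v = (\<Sum>i<n. smul (c i) (x i))"
proof -
  have "v \<in> span (x ` {..<n})" using assms by (simp add: is_basis_def)
  then obtain u where "v = (\<Sum>b\<in>x ` {..<n}. smul (u b) b)" using span_finite[of "x ` {..<n}"] by auto
  also have "\<dots> = (\<Sum>i<n. smul (u (x i)) (x i))" using assms by (simp add: is_basis_def sum.reindex)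
  finally show ?thesis by (rule exI[of _ "\<lambda>i. u (x i)"])
qed

lemma is_basis_unique:
  assumes "is_basis x" "(\<Sum>i<n. smul (c i) (x i)) = (\<Sum>i<n. smul (d i) (x i))" "i < n"
  shows "c i = d i"
proof -
  define u where "u b = c (the_inv_into {..<n} x b) - d (the_inv_into {..<n} x b)" for b
  have inj: "inj_on x {..<n}" using assms by (simp add: is_basis_def)
  have "(\<Sum>b\<in>x ` {..<n}. smul (u b) b) = (\<Sum>i<n. smul (c i) (x i) - smul (d i) (x i))"
    by (simp add: sum.reindex inj u_def the_inv_into_f_f scale_left_diff_distrib)
  also have "\<dots> = 0" using assms(2) by (simp add: sum_subtractf)
  finally have "u (x i) = 0"
    using assms(1,3) independentD[of "x ` {..<n}" "x ` {..<n}" u "x i"] by (auto simp: is_basis_def)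
  then show ?thesis using inj assms(3) by (simp add: u_def the_inv_into_f_f)
qed

lemma is_basis_coord_det: assumes "is_basis x" shows "coord_det x \<noteq> 0"
proof -
  have "\<forall>i. \<exists>c. bs i = (\<Sum>j<n. smul (c j) (x j))" using is_basis_expand[OF assms] by blast
  then obtain a where "\<And>i. bs i = (\<Sum>j<n. smul (a i j) (x j))" by metis
  then have "coord_det bs = Determinant.det (Matrix.mat n n (\<lambda>(i, j). a i j)) * coord_det x" by (intro coord_det_comb)
  then show ?thesis using coord_det_bs by auto
qed

definition iprod :: "(nat \<Rightarrow> 'k set) \<Rightarrow> 'k set" where "iprod a = finprod ideal_group a {..<n}"

lemma finprod_frac: "(\<And>i. i \<in> S \<Longrightarrow> frac (a i)) \<Longrightarrow> frac (finprod ideal_group a S)"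
  using IG.finprod_closed[of a S] by (auto simp: Pi_iff)

lemma finprod_mem:
  assumes "finite S" "\<And>i. i \<in> S \<Longrightarrow> frac (a i)" "\<And>i. i \<in> S \<Longrightarrow> c i \<in> a i"
  shows "prod c S \<in> finprod ideal_group a S"
  using assms
proof (induction S)
  case (insert i S)
  then have "finprod ideal_group a (insert i S) = imul (a i) (finprod ideal_group a S)"
    by (subst IG.finprod_insert) auto
  then show ?case using insert by (auto intro: imulI)
qed simp

text \<open>A linear containment need only be checked on products of one element per factor. The
  multiplier \<open>z\<close> is part of the induction: it absorbs the element taken from the factor
  just split off.\<close>

lemma finprod_least:
  assumes "finite S" "osubK M"
  shows "(\<And>i. i \<in> S \<Longrightarrow> frac (a i)) \<Longrightarrow> (\<And>c. (\<And>i. i \<in> S \<Longrightarrow> c i \<in> a i) \<Longrightarrow> z * prod c S \<in> M)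
    \<Longrightarrow> y \<in> finprod ideal_group a S \<Longrightarrow> z * y \<in> M"
  using assms(1)
proof (induction S arbitrary: y z)
  case empty
  then show ?case using K.osub_scale[OF assms(2), of y z] by (auto simp: mult.commute)
next
  case (insert i S)
  have eq: "finprod ideal_group a (insert i S) = imul (a i) (finprod ideal_group a S)"
    using insert by (subst IG.finprod_insert) auto
  have osubM: "osubK {y. z * y \<in> M}"
    using assms(2) unfolding osub_def by (auto simp: distrib_left mult.left_commute)
  have "imul (a i) (finprod ideal_group a S) \<subseteq> {y. z * y \<in> M}"
  proof (rule imul_least[OF osubM])
    fix u v assume u: "u \<in> a i" and v: "v \<in> finprod ideal_group a S"
    have "(z * u) * v \<in> M"
    proof (rule insert.IH[OF _ _ v])
      fix c assume c: "\<And>j. j \<in> S \<Longrightarrow> c j \<in> a j"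
      have "prod (c(i := u)) (insert i S) = u * prod c S"
        using insert.hyps by (subst prod.insert) (auto intro!: prod.cong)
      moreover have "z * prod (c(i := u)) (insert i S) \<in> M"
        by (rule insert.prems(2)) (use u c in auto)
      ultimately show "z * u * prod c S \<in> M" by (simp add: mult.assoc)
    qed (use insert in auto)
    then show "u * v \<in> {y. z * y \<in> M}" by (simp add: mult.assoc)
  qed
  then show ?case using insert.prems eq by blast
qed

section \<open>Determinant ideals\<close>

definition pseudo_basis :: "(nat \<Rightarrow> 'v) \<Rightarrow> (nat \<Rightarrow> 'k set) \<Rightarrow> 'v set \<Rightarrow> bool" where
  "pseudo_basis x a L \<longleftrightarrow> is_basis x \<and> (\<forall>i<n. frac (a i)) \<and> L = {\<Sum>i<n. smul (c i) (x i) | c. \<forall>i<n. c i \<in> a i}"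

text \<open>The top exterior power of \<open>L\<close>, read in the coordinates of
  \<open>bs\<close>. No pseudo-basis enters, which makes the Steinitz class well defined; and being
  an ideal, not only a class, it compares different lattices on the same space.\<close>

definition det_ideal :: "'v set \<Rightarrow> 'k set" where
  "det_ideal L = o_span (*) {coord_det v | v. \<forall>i<n. v i \<in> L}"

lemma osub_det_ideal: "osubK (det_ideal L)" unfolding det_ideal_def by (rule K.osub_o_span)
lemma det_ideal_mem: "(\<And>i. i < n \<Longrightarrow> v i \<in> L) \<Longrightarrow> coord_det v \<in> det_ideal L"
  unfolding det_ideal_def by (rule K.o_span_base) blast
lemma det_ideal_least: "osubK M \<Longrightarrow> (\<And>v. (\<And>i. i < n \<Longrightarrow> v i \<in> L) \<Longrightarrow> coord_det v \<in> M) \<Longrightarrow> det_ideal L \<subseteq> M"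
  unfolding det_ideal_def by (rule K.o_span_least) auto
lemma det_ideal_mono: "M \<subseteq> L \<Longrightarrow> det_ideal M \<subseteq> det_ideal L"
  by (rule det_ideal_least[OF osub_det_ideal]) (auto intro: det_ideal_mem)

lemma det_mem_iprod:
  assumes "\<And>i. i < n \<Longrightarrow> frac (a i)" "\<And>i j. i < n \<Longrightarrow> j < n \<Longrightarrow> A i j \<in> a j"
  shows "Determinant.det (Matrix.mat n n (\<lambda>(i, j). A i j)) \<in> iprod a"
proof -
  have o: "osubK (iprod a)" unfolding iprod_def by (intro frac_osub finprod_frac) (use assms in auto)
  have "Determinant.det (Matrix.mat n n (\<lambda>(i, j). A i j)) = (\<Sum>p\<in>{p. p permutes {0..<n}}. signof p * (\<Prod>i = 0..<n. A i (p i)))"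
    by (subst det_def'[of _ n]) (auto intro!: sum.cong arg_cong2[where f = "(*)"] prod.cong dest: permutes_in_image)
  also have "\<dots> \<in> iprod a"
  proof (rule K.osub_sum[OF o])
    fix p assume "p \<in> {p. p permutes {0..<n}}"
    then have p: "p permutes {..<n}" by (simp add: lessThan_atLeast0)
    \<comment> \<open>The product is reordered by columns, since the entries of column
      \<open>j\<close> are those that lie in \<open>a j\<close>.\<close>
    have "(\<Prod>i = 0..<n. A i (p i)) = (\<Prod>i<n. A (inv_into UNIV p (p i)) (p i))"
      using p by (simp add: lessThan_atLeast0 permutes_inverses)
    also have "\<dots> = (\<Prod>j<n. A (inv_into UNIV p j) j)"
      by (rule prod.permute[OF p, of "\<lambda>j. A (inv_into UNIV p j) j", unfolded o_def, symmetric])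
    also have "\<dots> \<in> iprod a" unfolding iprod_def
      by (rule finprod_mem) (use assms permutes_in_image[OF permutes_inv[OF p]] in auto)
    finally have "(\<Prod>i = 0..<n. A i (p i)) \<in> iprod a" .
    moreover have "(signof p :: 'k) \<in> Ok" by (auto simp: sign_def)
    ultimately show "signof p * (\<Prod>i = 0..<n. A i (p i)) \<in> iprod a" using K.osub_scale[OF o] by blast
  qed
  finally show ?thesis .
qed

lemma det_ideal_pseudo_basis: assumes "pseudo_basis x a L" shows "det_ideal L = imul (pr (coord_det x)) (iprod a)"
proof -
  have x: "is_basis x" and a: "\<And>i. i < n \<Longrightarrow> frac (a i)"
    and L: "L = {\<Sum>i<n. smul (c i) (x i) | c. \<forall>i<n. c i \<in> a i}" using assms by (auto simp: pseudo_basis_def)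
  have o: "osubK (iprod a)" unfolding iprod_def by (intro frac_osub finprod_frac) (use a in auto)
  have eq: "imul (pr (coord_det x)) (iprod a) = (\<lambda>y. coord_det x * y) ` iprod a" by (rule imul_pr[OF o])
  show ?thesis
  proof
    show "det_ideal L \<subseteq> imul (pr (coord_det x)) (iprod a)"
    proof (rule det_ideal_least[OF osub_imul])
      fix v assume "\<And>i. i < n \<Longrightarrow> v i \<in> L"
      then have "\<forall>i. \<exists>c. i < n \<longrightarrow> v i = (\<Sum>j<n. smul (c j) (x j)) \<and> (\<forall>j<n. c j \<in> a j)"
        unfolding L by blast
      then obtain A where A: "\<And>i. i < n \<Longrightarrow> v i = (\<Sum>j<n. smul (A i j) (x j)) \<and> (\<forall>j<n. A i j \<in> a j)" by metis
      then have "coord_det v = Determinant.det (Matrix.mat n n (\<lambda>(i, j). A i j)) * coord_det x" by (intro coord_det_comb) auto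
      moreover have "Determinant.det (Matrix.mat n n (\<lambda>(i, j). A i j)) \<in> iprod a" by (rule det_mem_iprod) (use a A in auto)
      ultimately show "coord_det v \<in> imul (pr (coord_det x)) (iprod a)" unfolding eq by (auto simp: mult.commute)
    qed
    show "imul (pr (coord_det x)) (iprod a) \<subseteq> det_ideal L"
      unfolding eq
    proof (intro image_subsetI)
      fix y assume y: "y \<in> iprod a"
      show "coord_det x * y \<in> det_ideal L"
      proof (rule finprod_least[OF _ osub_det_ideal _ _ y[unfolded iprod_def]])
        fix c assume c: "\<And>i. i \<in> {..<n} \<Longrightarrow> c i \<in> a i"
        \<comment> \<open>Diagonal tuples already realise every product of one element from each
          coefficient ideal.\<close>
        have "coord_det (\<lambda>i. smul (c i) (x i)) = Determinant.det (Matrix.mat n n (\<lambda>(i, j). if i = j then c i else 0)) * coord_det x"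
        proof (rule coord_det_comb)
          fix i assume "i < n"
          then show "smul (c i) (x i) = (\<Sum>j<n. smul (if i = j then c i else 0) (x j))"
            by (simp add: if_distrib[of "\<lambda>c. smul c _"] cong: if_cong)
        qed
        also have "Determinant.det (Matrix.mat n n (\<lambda>(i, j). if i = j then c i else 0)) = (\<Prod>i<n. c i)"
          by (subst det_upper_triangular[of _ n])
            (auto simp: upper_triangular_def diag_mat_def prod.list_conv_set_nth lessThan_atLeast0 intro!: prod.cong)
        finally have "coord_det x * prod c {..<n} = coord_det (\<lambda>i. smul (c i) (x i))" by simp
        also have "\<dots> \<in> det_ideal L"
        proof (rule det_ideal_mem)
          fix i assume i: "i < n"
          have "smul (c i) (x i) = (\<Sum>j<n. smul (if i = j then c i else 0) (x j))"
            using i by (simp add: if_distrib[of "\<lambda>c. smul c _"] cong: if_cong)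
          moreover have "\<forall>j<n. (if i = j then c i else 0) \<in> a j"
            using c a K.osub_0[OF frac_osub] by auto
          ultimately show "smul (c i) (x i) \<in> L"
            unfolding L by (intro CollectI exI[of _ "\<lambda>j. if i = j then c i else 0"]) auto
        qed
        finally show "coord_det x * prod c {..<n} \<in> det_ideal L" .
      qed (use a in auto)
    qed
  qed
qed

lemma frac_iprod: "pseudo_basis x a L \<Longrightarrow> frac (iprod a)"
  unfolding iprod_def by (rule finprod_frac) (auto simp: pseudo_basis_def)

lemma frac_det_ideal_pseudo_basis: "pseudo_basis x a L \<Longrightarrow> frac (det_ideal L)"
  unfolding det_ideal_pseudo_basis using is_basis_coord_det frac_iprod by (auto simp: pseudo_basis_def intro!: frac_imul frac_pr)

section \<open>Existence of pseudo-bases, and the Steinitz class\<close>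

abbreviation latt :: "'v set \<Rightarrow> bool" where "latt \<equiv> is_lattice smul"

lemma latt_iff: "latt L \<longleftrightarrow> fg smul L \<and> span L = UNIV" by (simp add: is_lattice_def fg_def)

text \<open>The target may be another space, so that the lemma serves functionals into K as well as
  endomorphisms of V.\<close>

lemma fg_image:
  assumes f: "\<And>x y. f (x + y) = f x + f y" "\<And>c x. f (smul c x) = smul' c (f x)"
    and V: "iq_space D s smul'" and L: "fg smul L"
  shows "fg smul' (f ` L)"
proof -
  interpret V': iq_space D s smul' by (rule V)
  obtain X where X: "finite X" "L = o_span smul X" using L unfolding fg_def by blast
  have f0: "f 0 = 0" using f(1)[of 0 0] by simp
  have "f ` L = o_span smul' (f ` X)"
  proof
    have "osub smul {x. f x \<in> o_span smul' (f ` X)}"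
      using V'.osub_o_span[of "f ` X"] unfolding osub_def by (auto simp: f f0)
    then have "o_span smul X \<subseteq> {x. f x \<in> o_span smul' (f ` X)}"
      by (rule o_span_least) (auto intro: V'.o_span_base)
    then show "f ` L \<subseteq> o_span smul' (f ` X)" unfolding X by blast
    have "osub smul' (f ` L)" using fg_osub[OF L] unfolding osub_def
      by (auto simp flip: f intro!: image_eqI[of 0 f 0] f0[symmetric])
    then show "o_span smul' (f ` X) \<subseteq> f ` L"
      by (rule V'.o_span_least) (use X o_span_base in auto)
  qed
  then show ?thesis using X(1) unfolding fg_def by blast
qed

(* A linear functional maps M onto a fractional ideal, which is invertible, hence projective,
   so it splits off as a direct summand. *)
lemma pseudo_basis_step:
  assumes M: "fg smul M" and f: "\<And>x y. f (x + y) = f x + f y" "\<And>c x. f (smul c x) = c * f x"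
    and ne: "f ` M \<noteq> {0}"
  obtains x where "f x = 1" "frac (f ` M)" "x \<in> span M"
    "M = {smul c x + y | c y. c \<in> f ` M \<and> y \<in> M \<and> f y = 0}" "fg smul {y \<in> M. f y = 0}"
proof -
  have oM: "osub smul M" by (rule fg_osub[OF M])
  have fgf: "fg (*) (f ` M)" by (rule fg_image[OF f K.iq_space_axioms M])
  then have fr: "frac (f ` M)" using ne by (simp add: frac_iff)
  obtain J where J: "frac J" "imul J (f ` M) = Ok" using frac_inverse[OF fr] by blast
  \<comment> \<open>From 1 = sum of c u f(m) with u in the inverse ideal \<open>J\<close>, the
    vector x = sum of c u m satisfies f x = 1, and b x stays in \<open>M\<close> for every value b
    of \<open>f\<close> on \<open>M\<close> because u b is integral.\<close>
  have "1 \<in> o_span (*) {x * y | x y. x \<in> J \<and> y \<in> f ` M}" using J(2) O_1 unfolding imul_def by blast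
  then obtain F c where F: "finite F" "F \<subseteq> {x * y | x y. x \<in> J \<and> y \<in> f ` M}" "\<forall>z\<in>F. c z \<in> Ok"
    "1 = (\<Sum>z\<in>F. c z * z)" unfolding o_span_def by blast
  have "\<forall>z\<in>F. \<exists>u m. u \<in> J \<and> m \<in> M \<and> z = u * f m" using F(2) by blast
  then obtain u m where um: "\<And>z. z \<in> F \<Longrightarrow> u z \<in> J \<and> m z \<in> M \<and> z = u z * f (m z)" by metis
  have f0: "f 0 = 0" using f(1)[of 0 0] by simp
  have fsum: "f (sum g A) = (\<Sum>i\<in>A. f (g i))" for g and A :: "'k set"
    by (induction A rule: infinite_finite_induct) (simp_all add: f f0)
  define x where "x = (\<Sum>z\<in>F. smul (c z * u z) (m z))"
  have fx: "f x = 1"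
  proof -
    have "f x = (\<Sum>z\<in>F. c z * (u z * f (m z)))" by (simp add: x_def fsum f mult.assoc)
    also have "\<dots> = (\<Sum>z\<in>F. c z * z)" using um by (intro sum.cong) auto
    finally show ?thesis using F(4) by simp
  qed
  have xs: "x \<in> span M" unfolding x_def using um by (intro span_sum span_scale span_base) auto
  have bx: "smul b x \<in> M" if b: "b \<in> f ` M" for b
  proof -
    have "smul b x = (\<Sum>z\<in>F. smul (c z * (u z * b)) (m z))"
      by (simp add: x_def scale_sum_right mult_ac)
    also have "\<dots> \<in> M"
    proof (rule osub_sum[OF oM], rule osub_scale[OF oM])
      fix z assume z: "z \<in> F"
      have "u z * b \<in> Ok" using imulI[of "u z" J b "f ` M"] um[OF z] b J(2) by auto
      then show "c z * (u z * b) \<in> Ok" using F(3) z by auto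
    qed (use um in auto)
    finally show ?thesis .
  qed
  \<comment> \<open>The projection onto the kernel of \<open>f\<close> along \<open>x\<close>. It
    maps \<open>M\<close> onto the part of the kernel inside \<open>M\<close>, which is thus
    finitely generated.\<close>
  define g where "g y = y - smul (f y) x" for y
  have gK: "g y \<in> {y \<in> M. f y = 0}" if y: "y \<in> M" for y
  proof -
    have "f y = f (g y + smul (f y) x)" by (simp add: g_def)
    also have "\<dots> = f (g y) + f y" by (simp only: f fx mult_1_right)
    finally have "f (g y) = 0" by simp
    moreover have "g y \<in> M" unfolding g_def by (rule osub_diff[OF oM y bx]) (use y in blast)
    ultimately show ?thesis by simp
  qed
  have "g ` M = {y \<in> M. f y = 0}"
  proof (intro subset_antisym subsetI)
    fix y assume "y \<in> {y \<in> M. f y = 0}"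
    then show "y \<in> g ` M" by (intro image_eqI[of _ _ y]) (auto simp: g_def)
  qed (use gK in auto)
  moreover have "fg smul (g ` M)"
    by (rule fg_image[OF _ _ iq_space_axioms M])
      (simp_all add: g_def f scale_left_distrib scale_right_diff_distrib)
  ultimately have "fg smul {y \<in> M. f y = 0}" by simp
  moreover have "M = {smul c x + y | c y. c \<in> f ` M \<and> y \<in> M \<and> f y = 0}"
  proof (intro subset_antisym subsetI)
    fix y assume "y \<in> M"
    then show "y \<in> {smul c x + y | c y. c \<in> f ` M \<and> y \<in> M \<and> f y = 0}"
      using gK[of y] by (intro CollectI exI[of _ "f y"] exI[of _ "g y"]) (auto simp: g_def)
  qed (use bx osub_add[OF oM] in auto)
  ultimately show thesis using that fx fr xs by blast
qed

text \<open>Induction on the number of coordinates that may be nonzero on \<open>M\<close>: each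
  step splits off the values of the last of them, or does nothing if that coordinate vanishes on
  \<open>M\<close>.\<close>

lemma pseudo_basis_flag:
  assumes "fg smul M" "k \<le> n" "\<And>v j. v \<in> M \<Longrightarrow> k \<le> j \<Longrightarrow> j < n \<Longrightarrow> co v j = 0"
  shows "\<exists>B a. finite B \<and> independent B \<and> B \<subseteq> span M \<and> (\<forall>x\<in>B. frac (a x)) \<and>
     M = {\<Sum>x\<in>B. smul (c x) x | c. \<forall>x\<in>B. c x \<in> a x}"
  using assms
proof (induction k arbitrary: M)
  case 0
  have "v = 0" if "v \<in> M" for v using 0(3)[OF that] co_eqI[of v 0] by simp
  then have "M = {0}" using osub_0[OF fg_osub[OF 0(1)]] by blast
  then show ?case by (intro exI[of _ "{}"]) (auto simp: independent_empty)
next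
  case (Suc k)
  define f where "f v = co v k" for v
  have f: "f (x + y) = f x + f y" "f (smul c x) = c * f x" for x y c by (simp_all add: f_def)
  show ?case
  proof (cases "f ` M = {0}")
    case True
    have "co v j = 0" if "v \<in> M" "k \<le> j" "j < n" for v j
      using Suc.prems(3)[of v j] that True by (cases "j = k") (auto simp: f_def)
    then show ?thesis using Suc by auto
  next
    case False
    obtain x where x: "f x = 1" "frac (f ` M)" "x \<in> span M"
      and M: "M = {smul c x + y | c y. c \<in> f ` M \<and> y \<in> M \<and> f y = 0}"
      and fgM': "fg smul {y \<in> M. f y = 0}" using pseudo_basis_step[OF Suc.prems(1) f False] by blast
    let ?M' = "{y \<in> M. f y = 0}"
    have "co v j = 0" if "v \<in> ?M'" "k \<le> j" "j < n" for v j
      using Suc.prems(3)[of v j] that by (cases "j = k") (auto simp: f_def)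
    then obtain B a where B: "finite B" "independent B" "B \<subseteq> span ?M'" "\<forall>x\<in>B. frac (a x)"
      "?M' = {\<Sum>x\<in>B. smul (c x) x | c. \<forall>x\<in>B. c x \<in> a x}"
      using Suc.IH[OF fgM'] Suc.prems(2) by auto
    have "span ?M' \<subseteq> {v. f v = 0}"
      by (rule span_minimal) (auto simp: subspace_def f, simp add: f_def)
    then have "span B \<subseteq> {v. f v = 0}" using span_mono[OF B(3)] by (simp add: span_span)
    then have xB: "x \<notin> span B" using x(1) by auto
    then have xB': "x \<notin> B" using span_base by blast
    have eq: "M = {\<Sum>z\<in>insert x B. smul (c z) z | c. \<forall>z\<in>insert x B. c z \<in> (a(x := f ` M)) z}"
    proof (intro subset_antisym subsetI)
      fix v assume "v \<in> M"
      then obtain c0 y where v: "v = smul c0 x + y" "c0 \<in> f ` M" "y \<in> ?M'" using M by blast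
      then obtain c where c: "y = (\<Sum>z\<in>B. smul (c z) z)" "\<forall>z\<in>B. c z \<in> a z" using B(5) by blast
      have "v = (\<Sum>z\<in>insert x B. smul ((c(x := c0)) z) z)"
        using v c xB' B(1) by (subst sum.insert) (auto intro!: sum.cong)
      moreover have "\<forall>z\<in>insert x B. (c(x := c0)) z \<in> (a(x := f ` M)) z" using v c by auto
      ultimately show "v \<in> {\<Sum>z\<in>insert x B. smul (c z) z | c. \<forall>z\<in>insert x B. c z \<in> (a(x := f ` M)) z}" by blast
    next
      fix v assume "v \<in> {\<Sum>z\<in>insert x B. smul (c z) z | c. \<forall>z\<in>insert x B. c z \<in> (a(x := f ` M)) z}"
      then obtain c where c: "v = (\<Sum>z\<in>insert x B. smul (c z) z)" "\<forall>z\<in>insert x B. c z \<in> (a(x := f ` M)) z" by blast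
      have "c z \<in> a z" if "z \<in> B" for z
        using c(2)[rule_format, of z] that xB' by (cases "z = x") auto
      then have "(\<Sum>z\<in>B. smul (c z) z) \<in> ?M'" unfolding B(5) by blast
      moreover have "v = smul (c x) x + (\<Sum>z\<in>B. smul (c z) z)" using c(1) xB' B(1) by simp
      moreover have "c x \<in> f ` M" using c(2) by simp
      ultimately show "v \<in> M" using M by blast
    qed
    show ?thesis
    proof (intro exI[of _ "insert x B"] exI[of _ "a(x := f ` M)"] conjI)
      show "independent (insert x B)" using B(2) xB xB' by (simp add: independent_insert)
      show "insert x B \<subseteq> span M" using x(3) B(3) span_mono[of ?M' M] by auto
    qed (use B x eq in auto)
  qed
qed

lemma card_basis: assumes "independent B" "span B = UNIV" shows "card B = n"
proof -
  have "card B = dim (UNIV :: 'v set)" using assms dim_eq_card[of B UNIV] by simp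
  also have "\<dots> = card (bs ` {..<n})" using dim_eq_card[of "bs ` {..<n}" UNIV] bs_indep bs_span by simp
  finally show ?thesis using card_image[OF bs_inj] by simp
qed

lemma pseudo_basis_of_set:
  assumes B: "finite B" "independent B" "span B = UNIV" "\<forall>x\<in>B. frac (a x)"
    "L = {\<Sum>x\<in>B. smul (c x) x | c. \<forall>x\<in>B. c x \<in> a x}"
  obtains x where "pseudo_basis x (a \<circ> x) L" "iprod (a \<circ> x) = finprod ideal_group a B"
proof -
  obtain x where x: "bij_betw x {..<n} B"
    using ex_bij_betw_nat_finite[OF B(1)] card_basis[OF B(2,3)] by (auto simp: lessThan_atLeast0)
  have inj: "inj_on x {..<n}" and im: "x ` {..<n} = B" using x by (auto simp: bij_betw_def)
  have "L = {\<Sum>i<n. smul (c i) (x i) | c. \<forall>i<n. c i \<in> (a \<circ> x) i}"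
    unfolding B(5)
  proof (intro subset_antisym subsetI)
    fix v assume "v \<in> {\<Sum>x\<in>B. smul (c x) x | c. \<forall>x\<in>B. c x \<in> a x}"
    then obtain c where c: "v = (\<Sum>x\<in>B. smul (c x) x)" "\<forall>x\<in>B. c x \<in> a x" by blast
    then have "v = (\<Sum>i<n. smul ((c \<circ> x) i) (x i))" using sum.reindex[OF inj] im by auto
    moreover have "\<forall>i<n. (c \<circ> x) i \<in> (a \<circ> x) i" using c im by auto
    ultimately show "v \<in> {\<Sum>i<n. smul (c i) (x i) | c. \<forall>i<n. c i \<in> (a \<circ> x) i}" by blast
  next
    fix v assume "v \<in> {\<Sum>i<n. smul (c i) (x i) | c. \<forall>i<n. c i \<in> (a \<circ> x) i}"
    then obtain c where c: "v = (\<Sum>i<n. smul (c i) (x i))" "\<forall>i<n. c i \<in> a (x i)" by auto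
    let ?d = "\<lambda>b. c (the_inv_into {..<n} x b)"
    have "v = (\<Sum>b\<in>B. smul (?d b) b)"
      unfolding c(1) im[symmetric] by (simp add: sum.reindex inj the_inv_into_f_f)
    moreover have "\<forall>b\<in>B. ?d b \<in> a b" using c(2) inj unfolding im[symmetric] by (auto simp: the_inv_into_f_f)
    ultimately show "v \<in> {\<Sum>x\<in>B. smul (c x) x | c. \<forall>x\<in>B. c x \<in> a x}"
      by (intro CollectI exI[of _ ?d]) simp
  qed
  then have "pseudo_basis x (a \<circ> x) L" using B inj im by (auto simp: pseudo_basis_def is_basis_def)
  moreover have "iprod (a \<circ> x) = finprod ideal_group a B"
    unfolding iprod_def im[symmetric]
    by (subst IG.finprod_reindex) (use B(4) im inj in \<open>auto simp: o_def\<close>)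
  ultimately show thesis using that by blast
qed

lemma pseudo_basis_set:
  assumes "latt L"
  obtains B a where "finite B" "independent B" "span B = UNIV" "\<forall>x\<in>B. frac (a x)"
    "L = {\<Sum>x\<in>B. smul (c x) x | c. \<forall>x\<in>B. c x \<in> a x}"
proof -
  have L: "fg smul L" "span L = UNIV" using assms by (auto simp: latt_iff)
  obtain B a where B: "finite B" "independent B" "B \<subseteq> span L" "\<forall>x\<in>B. frac (a x)"
     "L = {\<Sum>x\<in>B. smul (c x) x | c. \<forall>x\<in>B. c x \<in> a x}"
    using pseudo_basis_flag[OF L(1) order_refl] by auto
  have "(\<Sum>x\<in>B. smul (c x) x) \<in> span B" for c by (intro span_sum span_scale span_base)
  then have "L \<subseteq> span B" unfolding B(5) by blast
  then have "span B = UNIV" using span_mono[of L "span B"] L(2) by (auto simp: span_span)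
  then show thesis using that B by blast
qed

lemma pseudo_basis: assumes "latt L" obtains x a where "pseudo_basis x a L"
proof -
  obtain B a where "finite B" "independent B" "span B = UNIV" "\<forall>x\<in>B. frac (a x)"
    "L = {\<Sum>x\<in>B. smul (c x) x | c. \<forall>x\<in>B. c x \<in> a x}"
    using pseudo_basis_set[OF assms] by blast
  then obtain x where "pseudo_basis x (a \<circ> x) L" using pseudo_basis_of_set by blast
  then show thesis by (rule that)
qed

lemma frac_det_ideal: "latt L \<Longrightarrow> frac (det_ideal L)" by (erule pseudo_basis) (rule frac_det_ideal_pseudo_basis)

text \<open>Every pseudo-basis gives the determinant ideal up to the principal factor (det x), so
  the class that \<open>steinitz_class\<close> selects exists and is unique.\<close>

lemma steinitz_eq: assumes "latt L" shows "steinitz_class smul L = icl (det_ideal L)"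
proof -
  have *: "icl (finprod ideal_group a B) = icl (det_ideal L)"
    if B: "finite B" "independent B" "span B = UNIV" "\<forall>x\<in>B. frac (a x)"
    "L = {\<Sum>x\<in>B. smul (c x) x | c. \<forall>x\<in>B. c x \<in> a x}" for B a
  proof -
    obtain x where x: "pseudo_basis x (a \<circ> x) L" "iprod (a \<circ> x) = finprod ideal_group a B"
      using pseudo_basis_of_set[OF B] by blast
    have "coord_det x \<noteq> 0" using x(1) is_basis_coord_det by (simp add: pseudo_basis_def)
    then show ?thesis unfolding det_ideal_pseudo_basis[OF x(1)] x(2)[symmetric]
      by (intro icl_pr_mult[symmetric] frac_iprod[OF x(1)])
  qed
  show ?thesis unfolding steinitz_class_def
  proof (rule the_equality)
    obtain B a where B: "finite B" "independent B" "span B = UNIV" "\<forall>x\<in>B. frac (a x)"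
      "L = {\<Sum>x\<in>B. smul (c x) x | c. \<forall>x\<in>B. c x \<in> a x}" using pseudo_basis_set[OF assms] .
    then show "\<exists>B a. finite B \<and> independent B \<and> span B = UNIV \<and> (\<forall>x\<in>B. frac (a x)) \<and>
      L = {\<Sum>x\<in>B. smul (c x) x | c. \<forall>x\<in>B. c x \<in> a x} \<and> icl (det_ideal L) = icl (finprod ideal_group a B)"
      using *[OF B] by (intro exI[of _ B] exI[of _ a]) simp
  qed (use * in blast)
qed

text \<open>Cramer's rule. With \<open>v\<close> in place of the i-th vector, a diagonal tuple has
  determinant det(x) y_i times the product of the other coefficients. This lies in det(L) = det(M),
  so y_i A is contained in a_i A for \<open>A\<close> the product of the other ideals, and
  \<open>A\<close> cancels.\<close>

lemma det_ideal_eq_imp_eq: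
  assumes M: "latt M" and L: "osub smul L" and sub: "M \<subseteq> L" and eq: "det_ideal M = det_ideal L"
  shows "M = L"
proof (rule subset_antisym[OF sub], rule subsetI)
  fix v assume v: "v \<in> L"
  obtain x a where xa: "pseudo_basis x a M" using pseudo_basis[OF M] .
  have x: "is_basis x" and a: "\<And>i. i < n \<Longrightarrow> frac (a i)"
    and Meq: "M = {\<Sum>i<n. smul (c i) (x i) | c. \<forall>i<n. c i \<in> a i}" using xa by (auto simp: pseudo_basis_def)
  have Dx: "coord_det x \<noteq> 0" by (rule is_basis_coord_det[OF x])
  obtain y where y: "v = (\<Sum>i<n. smul (y i) (x i))" using is_basis_expand[OF x] by blast
  have memM: "smul t (x i) \<in> M" if i: "i < n" "t \<in> a i" for i t
  proof -
    have "smul t (x i) = (\<Sum>j<n. smul (if i = j then t else 0) (x j))"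
      using i by (simp add: if_distrib[of "\<lambda>c. smul c _"] cong: if_cong)
    moreover have "\<forall>j<n. (if i = j then t else 0) \<in> a j" using i a K.osub_0[OF frac_osub] by auto
    ultimately show ?thesis unfolding Meq by (intro CollectI exI[of _ "\<lambda>j. if i = j then t else 0"]) auto
  qed
  have "y i \<in> a i" if i: "i < n" for i
  proof -
    define A where "A = finprod ideal_group a ({..<n} - {i})"
    have fA: "frac A" unfolding A_def by (rule finprod_frac) (use a in auto)
    have "finprod ideal_group a (insert i ({..<n} - {i})) = imul (a i) A"
      unfolding A_def by (subst IG.finprod_insert) (use a i in auto)
    then have ip: "iprod a = imul (a i) A" using i by (simp add: iprod_def insert_absorb)
    have key: "y i * z \<in> iprod a" if z: "z \<in> A" for z
    proof (rule finprod_least[OF _ _ _ _ z[unfolded A_def]])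
      show "osubK (iprod a)" by (rule frac_osub[OF frac_iprod[OF xa]])
      fix c assume c: "\<And>j. j \<in> {..<n} - {i} \<Longrightarrow> c j \<in> a j"
      define w where "w = (\<lambda>j. smul (c j) (x j))(i := v)"
      have wL: "w j \<in> L" if "j < n" for j
        using that v memM c sub unfolding w_def by auto
      have "coord_det w = Determinant.det (Matrix.mat n n (\<lambda>(j, k). if j = i then y k else if j = k then c j else 0)) * coord_det x"
      proof (rule coord_det_comb)
        fix j assume "j < n"
        then show "w j = (\<Sum>k<n. smul (if j = i then y k else if j = k then c j else 0) (x k))"
          using y by (auto simp: w_def if_distrib[of "\<lambda>c. smul c _"] cong: if_cong)
      qed
      also have "Determinant.det (Matrix.mat n n (\<lambda>(j, k). if j = i then y k else if j = k then c j else 0)) = y i * prod c ({..<n} - {i})"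
      proof -
        let ?N = "Matrix.mat n n (\<lambda>(j, k). if j = i then y k else if j = k then c j else 0)"
        have "Determinant.det ?N = (\<Sum>p\<in>{p. p permutes {0..<n}}. signof p * (\<Prod>j = 0..<n. ?N $$ (j, p j)))"
          by (subst det_def'[of _ n]) auto
        \<comment> \<open>All rows except the i-th are diagonal, so a permutation with a nonzero
          term fixes every j \<noteq> i, and then also i.\<close>
        also have "\<dots> = (\<Sum>p\<in>{id}. signof p * (\<Prod>j = 0..<n. ?N $$ (j, p j)))"
        proof (rule sum.mono_neutral_right)
          show "\<forall>p\<in>{p. p permutes {0..<n}} - {id}. signof p * (\<Prod>j = 0..<n. ?N $$ (j, p j)) = 0"
          proof
            fix p assume "p \<in> {p. p permutes {0..<n}} - {id}"
            then have p: "p permutes {0..<n}" "p \<noteq> id" by auto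
            have "\<exists>j<n. j \<noteq> i \<and> p j \<noteq> j"
            proof (rule ccontr)
              assume "\<not> (\<exists>j<n. j \<noteq> i \<and> p j \<noteq> j)"
              then have f: "p j = j" if "j \<noteq> i" for j using that p(1) permutes_not_in[of p "{0..<n}" j] by (cases "j < n") auto
              have "p i = i"
              proof (rule ccontr)
                assume "p i \<noteq> i"
                then have "p (p i) = p i" using f by blast
                then show False using \<open>p i \<noteq> i\<close> permutes_inj[OF p(1)] by (auto dest: injD)
              qed
              then have "p j = id j" for j using f by (cases "j = i") auto
              then have "p = id" by (rule ext)
              then show False using p by simp
            qed
            then obtain j where j: "j < n" "j \<noteq> i" "p j \<noteq> j" by blast
            then have "p j < n" using permutes_in_image[OF p(1), of j] by simp
            then have "?N $$ (j, p j) = 0" using j by auto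
            then have "(\<Prod>j = 0..<n. ?N $$ (j, p j)) = 0" using j(1) by (intro prod_zero) auto
            then show "signof p * (\<Prod>j = 0..<n. ?N $$ (j, p j)) = 0" by simp
          qed
        qed (auto simp: finite_permutations permutes_id)
        also have "\<dots> = (\<Prod>j<n. if j = i then y i else c j)"
          by (auto simp: lessThan_atLeast0 intro!: prod.cong)
        also have "\<dots> = y i * prod c ({..<n} - {i})"
          using i by (subst prod.remove[of _ i]) (auto intro!: prod.cong)
        finally show ?thesis .
      qed
      finally have "coord_det x * (y i * prod c ({..<n} - {i})) = coord_det w" by simp
      also have "\<dots> \<in> det_ideal M" unfolding eq using wL by (rule det_ideal_mem)
      finally have "coord_det x * (y i * prod c ({..<n} - {i})) \<in> (\<lambda>t. coord_det x * t) ` iprod a"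
        unfolding det_ideal_pseudo_basis[OF xa] imul_pr[OF frac_osub[OF frac_iprod[OF xa]]] .
      then show "y i * prod c ({..<n} - {i}) \<in> iprod a" using Dx by auto
    qed (use a in auto)
    obtain A' where A': "frac A'" "imul A' A = Ok" using frac_inverse[OF fA] by blast
    have sub1: "imul (pr (y i)) A \<subseteq> imul (a i) A"
      unfolding imul_pr[OF frac_osub[OF fA]] using key ip by auto
    have "pr (y i) = imul (imul (pr (y i)) A) A'"
      using A' by (simp add: imul_assoc imul_comm[of A] imul_comm[of _ Ok] osub_pr)
    also have "\<dots> \<subseteq> imul (imul (a i) A) A'" by (rule imul_mono[OF sub1 order_refl])
    also have "\<dots> = a i" using A' frac_osub[OF a[OF i]] by (simp add: imul_assoc imul_comm[of A] imul_comm[of _ Ok])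
    finally show ?thesis using prI by blast
  qed
  then show "v \<in> M" unfolding Meq y by blast
qed

text \<open>A linear map multiplies all determinants of n-tuples by its own determinant, which is
  that of its values on \<open>bs\<close>.\<close>

lemma det_ideal_image:
  assumes f: "\<And>x y. f (x + y) = f x + f y" "\<And>c x. f (smul c x) = smul c (f x)"
  shows "det_ideal (f ` L) = imul (pr (coord_det (f \<circ> bs))) (det_ideal L)"
proof -
  have f0: "f 0 = 0" using f(1)[of 0 0] by simp
  have fsum: "f (sum g A) = (\<Sum>i\<in>A. f (g i))" for g and A :: "nat set"
    by (induction A rule: infinite_finite_induct) (simp_all add: f f0)
  have Dtf: "coord_det (f \<circ> v) = coord_det (f \<circ> bs) * coord_det v" for v
  proof -
    have "coord_det (f \<circ> v) = Determinant.det (Matrix.mat n n (\<lambda>(i, j). co (v i) j)) * coord_det (f \<circ> bs)"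
    proof (rule coord_det_comb)
      fix i
      have "f (v i) = f (\<Sum>j<n. smul (co (v i) j) (bs j))" by (simp add: co_expand)
      then show "(f \<circ> v) i = (\<Sum>j<n. smul (co (v i) j) ((f \<circ> bs) j))" by (simp add: fsum f)
    qed
    then show ?thesis by (simp add: coord_det_def cm_def)
  qed
  have eq: "imul (pr (coord_det (f \<circ> bs))) (det_ideal L) = (\<lambda>y. coord_det (f \<circ> bs) * y) ` det_ideal L" by (rule imul_pr[OF osub_det_ideal])
  show ?thesis
  proof
    show "det_ideal (f ` L) \<subseteq> imul (pr (coord_det (f \<circ> bs))) (det_ideal L)"
    proof (rule det_ideal_least[OF osub_imul])
      fix v assume "\<And>i. i < n \<Longrightarrow> v i \<in> f ` L"
      then have "\<forall>i. \<exists>w. i < n \<longrightarrow> w \<in> L \<and> v i = f w" by blast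
      then obtain w where w: "\<And>i. i < n \<Longrightarrow> w i \<in> L \<and> v i = f (w i)" by metis
      then have "coord_det v = coord_det (f \<circ> w)" by (intro coord_det_cong) auto
      also have "\<dots> = coord_det (f \<circ> bs) * coord_det w" by (rule Dtf)
      finally show "coord_det v \<in> imul (pr (coord_det (f \<circ> bs))) (det_ideal L)" unfolding eq using det_ideal_mem[of w L] w by auto
    qed
    have "det_ideal L \<subseteq> {y. coord_det (f \<circ> bs) * y \<in> det_ideal (f ` L)}"
    proof (rule det_ideal_least)
      show "osubK {y. coord_det (f \<circ> bs) * y \<in> det_ideal (f ` L)}"
        using osub_det_ideal[of "f ` L"] unfolding osub_def by (auto simp: distrib_left mult.left_commute)
      fix v assume "\<And>i. i < n \<Longrightarrow> v i \<in> L"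
      then have "coord_det (f \<circ> v) \<in> det_ideal (f ` L)" by (intro det_ideal_mem) auto
      then show "coord_det v \<in> {y. coord_det (f \<circ> bs) * y \<in> det_ideal (f ` L)}" using Dtf[of v] by simp
    qed
    then show "imul (pr (coord_det (f \<circ> bs))) (det_ideal L) \<subseteq> det_ideal (f ` L)" unfolding eq by blast
  qed
qed

lemma latt_image:
  assumes f: "\<And>x y. f (x + y) = f x + f y" "\<And>c x. f (smul c x) = smul c (f x)" and "surj f" "latt L"
  shows "latt (f ` L)"
proof -
  have "fg smul (f ` L)" using assms(4) by (intro fg_image[OF f iq_space_axioms]) (simp add: latt_iff)
  moreover have "span (f ` L) = UNIV"
  proof -
    have "span L \<subseteq> {v. f v \<in> span (f ` L)}"
    proof (rule span_minimal)
      have "f 0 = 0" using f(1)[of 0 0] by simp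
      then show "subspace {v. f v \<in> span (f ` L)}"
        by (auto simp: subspace_def f span_zero intro: span_add span_scale)
    qed (auto intro: span_base)
    then have "f v \<in> span (f ` L)" for v using assms(4) by (auto simp: latt_iff)
    then show ?thesis using assms(3) by (metis UNIV_eq_I surjD)
  qed
  ultimately show ?thesis by (simp add: latt_iff)
qed

lemma steinitz_image:
  assumes f: "\<And>x y. f (x + y) = f x + f y" "\<And>c x. f (smul c x) = smul c (f x)" and "surj f" "latt L"
  shows "steinitz_class smul (f ` L) = steinitz_class smul L"
proof -
  have l: "latt (f ` L)" by (rule latt_image[OF assms])
  have "coord_det (f \<circ> bs) \<noteq> 0"
  proof
    assume "coord_det (f \<circ> bs) = 0"
    then have "det_ideal (f ` L) \<subseteq> {0}" unfolding det_ideal_image[OF f] imul_pr[OF osub_det_ideal] by auto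
    then show False using frac_det_ideal[OF l] frac_nonzero by blast
  qed
  then show ?thesis
    using frac_det_ideal[OF assms(4)] by (simp add: steinitz_eq[OF l] steinitz_eq[OF assms(4)] det_ideal_image[OF f] icl_pr_mult)
qed

end

section \<open>Sublattices of prime colength\<close>

context imag_quad
begin

text \<open>The last conjunct says that o / P is the prime field with \<open>p\<close> elements;
  primality and maximality of \<open>P\<close> are consequences.\<close>

definition degree_one :: "'k set \<Rightarrow> nat \<Rightarrow> bool" where
  "degree_one P p \<longleftrightarrow> osubK P \<and> P \<subseteq> Ok \<and> prime p \<and> of_nat p \<in> P \<and> 1 \<notin> P \<and> (\<forall>x\<in>Ok. \<exists>m::int. x - of_int m \<in> P)"

lemma degree_oneD:
  assumes "degree_one P p"
  shows "osubK P" "P \<subseteq> Ok" "prime p" "of_nat p \<in> P" "1 \<notin> P" "of_nat p \<noteq> (0::'k)"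
  using assms by (auto simp: degree_one_def prime_gt_0_nat)

lemma degree_one_residue: assumes "degree_one P p" "x \<in> Ok" obtains m :: int where "x - of_int m \<in> P"
  using assms unfolding degree_one_def by blast

lemma degree_one_int_iff: assumes P: "degree_one P p" shows "of_int m \<in> P \<longleftrightarrow> int p dvd m"
proof
  assume m: "of_int m \<in> P"
  show "int p dvd m"
  proof (rule ccontr)
    assume "\<not> int p dvd m"
    then have "coprime (int p) m" using degree_oneD(3)[OF P] by (intro prime_imp_coprime) auto
    then obtain u v where uv: "u * int p + v * m = 1" using coprime_iff_gcd_eq_1 bezout_int by metis
    have "of_int u * of_nat p + of_int v * of_int m \<in> P"
      using m degree_oneD(4)[OF P] by (intro K.osub_add[OF degree_oneD(1)[OF P]] K.osub_scale[OF degree_oneD(1)[OF P]]) auto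
    also have "of_int u * of_nat p + of_int v * of_int m = (of_int (u * int p + v * m) :: 'k)" by simp
    finally show False using uv degree_oneD(5)[OF P] by simp
  qed
next
  assume "int p dvd m"
  then obtain k where "m = k * int p" by (metis dvd_def mult.commute)
  then have "of_int m = of_int k * (of_nat p :: 'k)" by simp
  then show "of_int m \<in> P" using K.osub_scale[OF degree_oneD(1)[OF P], of "of_int k"] degree_oneD(4)[OF P] by simp
qed

lemma degree_one_unit: assumes P: "degree_one P p" and x: "x \<in> Ok" "x \<notin> P" obtains y where "y \<in> Ok" "1 - y * x \<in> P"
proof -
  obtain m :: int where m: "x - of_int m \<in> P" using degree_one_residue[OF P x(1)] .
  have "of_int m \<notin> P" using x(2) K.osub_add[OF degree_oneD(1)[OF P] m, of "of_int m"] by auto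
  then have "\<not> int p dvd m" using degree_one_int_iff[OF P] by blast
  then have "coprime (int p) m" using degree_oneD(3)[OF P] by (intro prime_imp_coprime) auto
  then obtain u v where uv: "u * int p + v * m = 1" using coprime_iff_gcd_eq_1 bezout_int by metis
  have "of_int u * of_nat p - of_int v * (x - of_int m) \<in> P"
    by (rule K.osub_diff[OF degree_oneD(1)[OF P] K.osub_scale[OF degree_oneD(1)[OF P] O_int degree_oneD(4)[OF P]]
        K.osub_scale[OF degree_oneD(1)[OF P] O_int m]])
  also have "of_int u * of_nat p - of_int v * (x - of_int m) = of_int (u * int p + v * m) - of_int v * x"
    by (simp add: algebra_simps)
  finally show thesis using that[of "of_int v"] uv by simp
qed

lemma degree_one_prime: assumes P: "degree_one P p" and "x \<in> Ok" "y \<in> Ok" "x * y \<in> P" shows "x \<in> P \<or> y \<in> P"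
proof (rule ccontr)
  assume "\<not> (x \<in> P \<or> y \<in> P)"
  then have n: "x \<notin> P" "y \<notin> P" by auto
  obtain z where z: "z \<in> Ok" "1 - z * x \<in> P" using degree_one_unit[OF P assms(2) n(1)] .
  have "y * (1 - z * x) + z * (x * y) \<in> P"
    by (rule K.osub_add[OF degree_oneD(1)[OF P] K.osub_scale[OF degree_oneD(1)[OF P] assms(3) z(2)]
        K.osub_scale[OF degree_oneD(1)[OF P] z(1) assms(4)]])
  also have "y * (1 - z * x) + z * (x * y) = y" by (simp add: algebra_simps)
  finally show False using n(2) by blast
qed

lemma degree_one_maximal:
  assumes P: "degree_one P p" and J: "osubK J" "P \<subseteq> J" "J \<subseteq> Ok" "J \<noteq> P" shows "J = Ok"
proof -
  obtain x where x: "x \<in> J" "x \<notin> P" using J by blast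
  obtain y where y: "y \<in> Ok" "1 - y * x \<in> P" using degree_one_unit[OF P _ x(2)] x(1) J by blast
  have "(1 - y * x) + y * x \<in> J"
    using x y J by (intro K.osub_add[OF J(1)] K.osub_scale[OF J(1)]) auto
  then have "pr 1 \<subseteq> J" using pr_subset[OF J(1), of 1] by simp
  then show ?thesis using J by auto
qed

lemma degree_one_frac: "degree_one P p \<Longrightarrow> frac P"
  by (rule fracI[of P "of_nat p" 1]) (use degree_oneD[of P p] in auto)

lemma degree_one_cj: assumes P: "degree_one P p" shows "degree_one (cj ` P) p"
  unfolding degree_one_def
proof (intro conjI ballI)
  show "osubK (cj ` P)" by (rule osub_cj[OF degree_oneD(1)[OF P]])
  show "cj ` P \<subseteq> Ok" using degree_oneD(2)[OF P] by auto
  show "\<exists>m::int. x - of_int m \<in> cj ` P" if x: "x \<in> Ok" for x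
  proof -
    have "cj x \<in> Ok" using x by simp
    then obtain m :: int where "cj x - of_int m \<in> P" using degree_one_residue[OF P] by blast
    then show ?thesis by (intro exI[of _ m]) (simp add: cj_mem)
  qed
qed (use degree_oneD[OF P] in \<open>auto simp: cj_mem\<close>)

text \<open>I / P I is a line over o / P and \<open>t\<close> spans it: some \<open>z\<close> in the
  inverse of \<open>I\<close> makes t z a unit modulo \<open>P\<close>, and if \<open>e\<close>
  inverts it the coefficient is e z c.\<close>

lemma degree_one_generator:
  assumes P: "degree_one P p" and I: "frac I" and t: "t \<in> I" "t \<notin> imul P I" and c: "c \<in> I"
  obtains r where "r \<in> Ok" "c - r * t \<in> imul P I"
proof -
  obtain J where J: "frac J" "imul J I = Ok" using frac_inverse[OF I] by blast
  have "\<exists>z\<in>J. t * z \<notin> P"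
  proof (rule ccontr)
    assume "\<not> (\<exists>z\<in>J. t * z \<notin> P)"
    then have "imul (pr t) J \<subseteq> P" unfolding imul_pr[OF frac_osub[OF J(1)]] by auto
    then have "imul (imul (pr t) J) I \<subseteq> imul P I" by (rule imul_mono) simp
    then have "pr t \<subseteq> imul P I" using J(2) by (simp add: imul_assoc imul_comm[of _ Ok] osub_pr)
    then show False using t(2) prI by blast
  qed
  then obtain z where z: "z \<in> J" "t * z \<notin> P" by blast
  have "t * z \<in> Ok" using imulI[OF z(1) t(1)] J(2) by (simp add: mult.commute)
  then obtain e where e: "e \<in> Ok" "1 - e * (t * z) \<in> P" using degree_one_unit[OF P _ z(2)] by blast
  have "z * c \<in> Ok" using imulI[OF z(1) c] J(2) by simp
  then have "e * (z * c) \<in> Ok" using e by auto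
  moreover have "c - e * (z * c) * t = (1 - e * (t * z)) * c" by (simp add: algebra_simps)
  ultimately show thesis using that imulI[OF e(2) c] by metis
qed

lemma degree_one_proper: assumes P: "degree_one P p" and I: "frac I" obtains t where "t \<in> I" "t \<notin> imul P I"
proof -
  have "\<not> I \<subseteq> imul P I"
  proof
    assume le: "I \<subseteq> imul P I"
    obtain J where J: "frac J" "imul J I = Ok" using frac_inverse[OF I] by blast
    have "imul J I \<subseteq> imul J (imul P I)" by (rule imul_mono[OF order_refl le])
    also have "imul J (imul P I) = imul P (imul J I)" by (metis imul_assoc imul_comm)
    also have "\<dots> = P" using J degree_oneD(1)[OF P] by (simp add: imul_comm[of _ Ok])
    finally show False using J(2) degree_oneD(5)[OF P] O_1 by auto
  qed
  then show thesis using that by blast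
qed

end

(* The sublattices of Z^n of index p containing p Z^n; vectors are functions on nat whose entries
   beyond n play no role. *)
definition hyperplanes :: "nat \<Rightarrow> nat \<Rightarrow> (nat \<Rightarrow> int) set set" where
  "hyperplanes n p = {S. (\<forall>a\<in>S. \<forall>b\<in>S. (\<lambda>i. a i + b i) \<in> S) \<and> (\<forall>a\<in>S. \<forall>c. (\<lambda>i. c * a i) \<in> S) \<and>
     (\<forall>a. (\<forall>i<n. int p dvd a i) \<longrightarrow> a \<in> S) \<and> S \<noteq> UNIV \<and> (\<exists>w. \<forall>a. \<exists>c. (\<lambda>i. a i - c * w i) \<in> S)}"

lemma hyperplanes_add: "S \<in> hyperplanes n p \<Longrightarrow> a \<in> S \<Longrightarrow> b \<in> S \<Longrightarrow> (\<lambda>i. a i + b i) \<in> S"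
  and hyperplanes_scale: "S \<in> hyperplanes n p \<Longrightarrow> a \<in> S \<Longrightarrow> (\<lambda>i. c * a i) \<in> S"
  and hyperplanes_multiples: "S \<in> hyperplanes n p \<Longrightarrow> \<forall>i<n. int p dvd a i \<Longrightarrow> a \<in> S"
  and hyperplanes_proper: "S \<in> hyperplanes n p \<Longrightarrow> S \<noteq> UNIV"
  and hyperplanes_generator: "S \<in> hyperplanes n p \<Longrightarrow> \<exists>w. \<forall>a. \<exists>c. (\<lambda>i. a i - c * w i) \<in> S"
  unfolding hyperplanes_def by blast+

text \<open>A hyperplane is determined by the reduced vectors in it, those with entries from 0 to p
  - 1 in the first \<open>n\<close> places and 0 beyond.\<close>

lemma finite_hyperplanes: assumes "p > 0" shows "finite (hyperplanes n p)"
proof -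
  define R where "R = {a :: nat \<Rightarrow> int. (\<forall>i<n. a i \<in> {0..<int p}) \<and> (\<forall>i\<ge>n. a i = 0)}"
  have "R \<subseteq> (\<lambda>f i. if i < n then f i else 0) ` ({..<n} \<rightarrow>\<^sub>E {0..<int p})"
  proof
    fix a assume "a \<in> R"
    then have "a = (\<lambda>f i. if i < n then f i else 0) (restrict a {..<n})" "restrict a {..<n} \<in> {..<n} \<rightarrow>\<^sub>E {0..<int p}"
      unfolding R_def by (auto simp: fun_eq_iff)
    then show "a \<in> (\<lambda>f i. if i < n then f i else 0) ` ({..<n} \<rightarrow>\<^sub>E {0..<int p})" by blast
  qed
  then have finR: "finite R" by (rule finite_subset) (intro finite_imageI finite_PiE, auto)
  have le: "S \<subseteq> S'" if S: "S \<in> hyperplanes n p" "S' \<in> hyperplanes n p" "S \<inter> R = S' \<inter> R" for S S'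
  proof
    fix a assume a: "a \<in> S"
    define r where "r i = (if i < n then a i mod int p else 0)" for i
    have rR: "r \<in> R" unfolding R_def r_def using assms by auto
    have dv: "int p dvd r i - a i" "int p dvd a i - r i" if "i < n" for i
      using that by (simp_all add: r_def mod_eq_dvd_iff[symmetric] dvd_minus_mod)
    have d: "(\<lambda>i. r i - a i) \<in> S" "(\<lambda>i. a i - r i) \<in> S'"
      using dv by (auto intro!: hyperplanes_multiples[OF S(1)] hyperplanes_multiples[OF S(2)])
    have "(\<lambda>i. a i + (r i - a i)) \<in> S" by (rule hyperplanes_add[OF S(1) a d(1)])
    then have "r \<in> S'" using rR S(3) by auto
    then have "(\<lambda>i. r i + (a i - r i)) \<in> S'" by (rule hyperplanes_add[OF S(2) _ d(2)])
    then show "a \<in> S'" by simp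
  qed
  have "inj_on (\<lambda>S. S \<inter> R) (hyperplanes n p)" by (rule inj_onI) (use le in blast)
  moreover have "finite ((\<lambda>S. S \<inter> R) ` hyperplanes n p)" by (rule finite_subset[of _ "Pow R"]) (use finR in auto)
  ultimately show ?thesis by (rule finite_imageD[rotated])
qed

text \<open>Makes the common degree of the neighbour relation positive, so that it can be
  cancelled.\<close>

lemma hyperplanes_nonempty: assumes "p > 1" "n > 0" shows "hyperplanes n p \<noteq> {}"
proof -
  have "{a. int p dvd a 0} \<noteq> (UNIV :: (nat \<Rightarrow> int) set)"
  proof
    assume *: "{a. int p dvd a 0} = (UNIV :: (nat \<Rightarrow> int) set)"
    have "(\<lambda>_. 1) \<in> {a :: nat \<Rightarrow> int. int p dvd a 0}" unfolding * by simp
    then show False using assms by simp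
  qed
  moreover have "\<exists>w. \<forall>a. \<exists>c. (\<lambda>i. a i - c * w i) \<in> {a :: nat \<Rightarrow> int. int p dvd a 0}"
    by (intro exI[of _ "\<lambda>_. 1"] allI) (metis diff_self dvd_0_right mem_Collect_eq mult.right_neutral)
  ultimately have "{a. int p dvd a 0} \<in> hyperplanes n p" unfolding hyperplanes_def using assms by auto
  then show ?thesis by blast
qed

context fd_space
begin

text \<open>Encodes that L / M is isomorphic to o / P when \<open>P\<close> is a maximal ideal: the
  quotient is nonzero, killed by \<open>P\<close>, and cyclic.\<close>

definition prime_colength :: "'k set \<Rightarrow> 'v set \<Rightarrow> 'v set \<Rightarrow> bool" where
  "prime_colength P M L \<longleftrightarrow> osub smul M \<and> M \<subseteq> L \<and> M \<noteq> L \<and> (\<forall>c\<in>P. \<forall>x\<in>L. smul c x \<in> M) \<and>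
     (\<exists>w\<in>L. \<forall>x\<in>L. \<exists>c\<in>Ok. x - smul c w \<in> M)"

lemma latt_osub: "latt L \<Longrightarrow> osub smul L" by (simp add: latt_iff fg_osub)

lemma latt_between:
  assumes L: "latt L" and M: "osub smul M" "M \<subseteq> L" and m: "m \<noteq> 0"
    and mL: "\<And>x. x \<in> L \<Longrightarrow> smul (of_int m) x \<in> M"
  shows "latt M"
proof -
  have "fg smul M" using fg_between[OF _ M m mL] L by (simp add: latt_iff)
  moreover have "L \<subseteq> span M"
  proof
    fix x assume "x \<in> L"
    then have "smul (1 / of_int m) (smul (of_int m) x) \<in> span M" by (intro span_scale span_base mL)
    then show "x \<in> span M" using m by simp
  qed
  then have "span M = UNIV" using L span_mono[of L "span M"] by (auto simp: latt_iff span_span)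
  ultimately show ?thesis by (simp add: latt_iff)
qed

lemma prime_colength_latt: assumes P: "degree_one P p" and L: "latt L" and H: "prime_colength P H L" shows "latt H"
  by (rule latt_between[OF L, of H "int p"])
    (use H degree_oneD[OF P] in \<open>auto simp: prime_colength_def\<close>)

text \<open>As o / P is a field, every \<open>v\<close> outside \<open>H\<close> generates L / H,
  and not only the vector provided by the definition.\<close>

lemma prime_colength_generator:
  assumes P: "degree_one P p" and L: "latt L" and H: "prime_colength P H L" and v: "v \<in> L" "v \<notin> H" and x: "x \<in> L"
  obtains c where "c \<in> Ok" "x - smul c v \<in> H"
proof -
  have oH: "osub smul H" using H by (simp add: prime_colength_def)
  have PL: "smul c x \<in> H" if "c \<in> P" "x \<in> L" for c x using H that by (simp add: prime_colength_def)
  obtain w where w: "w \<in> L" "\<And>x. x \<in> L \<Longrightarrow> \<exists>c\<in>Ok. x - smul c w \<in> H" using H unfolding prime_colength_def by blast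
  obtain d where d: "d \<in> Ok" "v - smul d w \<in> H" using w(2)[OF v(1)] by blast
  obtain c where c: "c \<in> Ok" "x - smul c w \<in> H" using w(2)[OF x] by blast
  have "d \<notin> P"
  proof
    assume "d \<in> P"
    then have "(v - smul d w) + smul d w \<in> H" using osub_add[OF oH d(2)] PL w(1) by blast
    then show False using v by simp
  qed
  then obtain e where e: "e \<in> Ok" "1 - e * d \<in> P" using degree_one_unit[OF P d(1)] by blast
  have "smul c (smul (1 - e * d) w) \<in> H" by (rule osub_scale[OF oH c(1) PL[OF e(2) w(1)]])
  moreover have "smul (c * e) (v - smul d w) \<in> H" by (rule osub_scale[OF oH O_mult[OF c(1) e(1)] d(2)])
  ultimately have "(x - smul c w) + (smul c (smul (1 - e * d) w) - smul (c * e) (v - smul d w)) \<in> H"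
    by (rule osub_add[OF oH c(2) osub_diff[OF oH]])
  also have "(x - smul c w) + (smul c (smul (1 - e * d) w) - smul (c * e) (v - smul d w)) = x - smul (c * e) v"
    by (simp add: scale_right_diff_distrib scale_left_diff_distrib algebra_simps)
  finally show thesis using that c e by blast
qed

text \<open>Elimination with one vector outside \<open>H\<close> moves the other vectors of a tuple
  into \<open>H\<close>, so P det(L) lies in det(H). Then J = det(H) / det(L) satisfies P
  \<subseteq> J \<subseteq> o. It is not o, because nested lattices with equal determinant ideals
  coincide, and maximality of \<open>P\<close> leaves J = P.\<close>

lemma det_ideal_prime_colength: assumes P: "degree_one P p" and L: "latt L" and H: "prime_colength P H L" shows "det_ideal H = imul P (det_ideal L)"
proof -
  have lH: "latt H" by (rule prime_colength_latt[OF P L H])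
  have oH: "osub smul H" by (rule latt_osub[OF lH])
  have sub: "H \<subseteq> L" "H \<noteq> L" and PL: "\<And>c x. c \<in> P \<Longrightarrow> x \<in> L \<Longrightarrow> smul c x \<in> H"
    using H by (auto simp: prime_colength_def)
  have le: "imul P (det_ideal L) \<subseteq> det_ideal H"
  proof (rule imul_least[OF osub_det_ideal])
    fix a y assume a: "a \<in> P" and y: "y \<in> det_ideal L"
    have aO: "a \<in> Ok" using a degree_oneD(2)[OF P] by blast
    have "det_ideal L \<subseteq> {y. a * y \<in> det_ideal H}"
    proof (rule det_ideal_least)
      show "osubK {y. a * y \<in> det_ideal H}"
        using osub_det_ideal[of H] unfolding osub_def by (auto simp: distrib_left mult.left_commute)
      fix v assume v: "\<And>i. i < n \<Longrightarrow> v i \<in> L"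
      show "coord_det v \<in> {y. a * y \<in> det_ideal H}"
      proof (cases "\<forall>i<n. v i \<in> H")
        case True
        then show ?thesis using K.osub_scale[OF osub_det_ideal aO, of "coord_det v" H] det_ideal_mem[of v H] by simp
      next
        case False
        then obtain i where i: "i < n" "v i \<notin> H" by blast
        have "\<forall>j. \<exists>c. j < n \<longrightarrow> c \<in> Ok \<and> v j - smul c (v i) \<in> H"
          using prime_colength_generator[OF P L H v[OF i(1)] i(2)] v by metis
        then obtain d where d: "\<And>j. j < n \<Longrightarrow> v j - smul (d j) (v i) \<in> H" by metis
        define w where "w = (\<lambda>j. if j \<in> {..<n} - {i} then v j - smul (d j) (v i) else v j)"
        have "coord_det w = coord_det v" unfolding w_def by (rule coord_det_elim) (use i in auto)
        moreover have "w = w(i := v i)" by (auto simp: w_def fun_eq_iff)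
        ultimately have "a * coord_det v = coord_det (w(i := smul a (v i)))" using coord_det_scale_row[OF i(1), of w a "v i"] by metis
        also have "\<dots> \<in> det_ideal H"
          by (rule det_ideal_mem) (use d PL[OF a v[OF i(1)]] in \<open>auto simp: w_def\<close>)
        finally show ?thesis by simp
      qed
    qed
    then show "a * y \<in> det_ideal H" using y by blast
  qed
  have fL: "frac (det_ideal L)" and fH: "frac (det_ideal H)" using frac_det_ideal L lH by blast+
  define I where "I = inv\<^bsub>ideal_group\<^esub> (det_ideal L)"
  have I: "frac I" "imul (det_ideal L) I = Ok"
    using IG.inv_closed[of "det_ideal L"] IG.r_inv[of "det_ideal L"] fL by (simp_all add: I_def)
  define J where "J = imul (det_ideal H) I"
  have oJ: "osubK J" unfolding J_def by (rule osub_imul)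
  have JD: "imul J (det_ideal L) = det_ideal H"
    unfolding J_def using I(2) frac_osub[OF fH] by (simp add: imul_assoc imul_comm[of I] imul_comm[of _ Ok])
  have "imul (imul P (det_ideal L)) I \<subseteq> J" unfolding J_def by (rule imul_mono[OF le order_refl])
  then have PJ: "P \<subseteq> J" using I(2) degree_oneD(1)[OF P] by (simp add: imul_assoc imul_comm[of _ Ok])
  have JO: "J \<subseteq> Ok" unfolding J_def I(2)[symmetric] by (rule imul_mono[OF det_ideal_mono[OF sub(1)] order_refl])
  have "J \<noteq> Ok"
  proof
    assume "J = Ok"
    then have "det_ideal H = det_ideal L" using JD frac_osub[OF fL] by simp
    then show False using det_ideal_eq_imp_eq[OF lH latt_osub[OF L] sub(1)] sub(2) by simp
  qed
  then have "J = P" using degree_one_maximal[OF P oJ PJ JO] by blast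
  then show ?thesis using JD by simp
qed

text \<open>L / P L is a space over F_p with basis t_i x_i, where t_i lies in a_i but not in P a_i,
  and the sublattices correspond to its hyperplanes. The target depends on \<open>n\<close> and
  \<open>p\<close> alone; hence all lattices, and both \<open>P\<close> and conj(P), give the same
  count.\<close>

lemma card_prime_colength:
  assumes P: "degree_one P p" and L: "latt L"
  shows "\<exists>f. bij_betw f {H. prime_colength P H L} (hyperplanes n p)"
proof -
  obtain x a where xa: "pseudo_basis x a L" using pseudo_basis[OF L] .
  have x: "is_basis x" and a: "\<And>i. i < n \<Longrightarrow> frac (a i)"
    and Leq: "L = {\<Sum>i<n. smul (c i) (x i) | c. \<forall>i<n. c i \<in> a i}" using xa by (auto simp: pseudo_basis_def)
  have oL: "osub smul L" by (rule latt_osub[OF L])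
  have "\<forall>i. \<exists>t. i < n \<longrightarrow> t \<in> a i \<and> t \<notin> imul P (a i)" using degree_one_proper[OF P] a by metis
  then obtain t where t: "\<And>i. i < n \<Longrightarrow> t i \<in> a i \<and> t i \<notin> imul P (a i)" by metis
  \<comment> \<open>\<open>Q\<close> is P L; \<open>Qeq\<close> describes it by the same
    pseudo-basis with coefficient ideals P a_i.\<close>
  define Q where "Q = o_span smul {smul c y | c y. c \<in> P \<and> y \<in> L}"
  have oQ: "osub smul Q" unfolding Q_def by (rule osub_o_span)
  have Qi: "smul c y \<in> Q" if "c \<in> P" "y \<in> L" for c y unfolding Q_def using that by (intro o_span_base) blast
  have xL: "smul c (x i) \<in> L" if "i < n" "c \<in> a i" for i c
  proof -
    have "smul c (x i) = (\<Sum>j<n. smul (if i = j then c else 0) (x j))"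
      using that by (simp add: if_distrib[of "\<lambda>c. smul c _"] cong: if_cong)
    moreover have "\<forall>j<n. (if i = j then c else 0) \<in> a j" using that a K.osub_0[OF frac_osub] by auto
    ultimately show ?thesis unfolding Leq by (intro CollectI exI[of _ "\<lambda>j. if i = j then c else 0"]) auto
  qed
  have Qeq: "Q = {\<Sum>i<n. smul (c i) (x i) | c. \<forall>i<n. c i \<in> imul P (a i)}" (is "_ = ?Q")
  proof
    have "osub smul ?Q" unfolding osub_def
    proof (intro conjI ballI)
      show "0 \<in> ?Q" by (intro CollectI exI[of _ "\<lambda>_. 0"]) (auto intro: K.osub_0[OF osub_imul])
    next
      fix u v assume "u \<in> ?Q" "v \<in> ?Q"
      then obtain c d where "u = (\<Sum>i<n. smul (c i) (x i))" "\<forall>i<n. c i \<in> imul P (a i)"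
        "v = (\<Sum>i<n. smul (d i) (x i))" "\<forall>i<n. d i \<in> imul P (a i)" by blast
      then show "u + v \<in> ?Q" by (intro CollectI exI[of _ "\<lambda>i. c i + d i"])
          (auto simp: scale_left_distrib sum.distrib intro: K.osub_add[OF osub_imul])
    next
      fix r u assume "r \<in> Ok" "u \<in> ?Q"
      then obtain c where "r \<in> Ok" "u = (\<Sum>i<n. smul (c i) (x i))" "\<forall>i<n. c i \<in> imul P (a i)" by blast
      then show "smul r u \<in> ?Q" by (intro CollectI exI[of _ "\<lambda>i. r * c i"])
          (auto simp: scale_sum_right intro: K.osub_scale[OF osub_imul])
    qed
    then show "Q \<subseteq> ?Q" unfolding Q_def
    proof (rule o_span_least)
      show "{smul c y | c y. c \<in> P \<and> y \<in> L} \<subseteq> ?Q"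
      proof
        fix z assume "z \<in> {smul c y | c y. c \<in> P \<and> y \<in> L}"
        then obtain c y where z: "z = smul c y" "c \<in> P" "y \<in> L" by blast
        then obtain d where d: "y = (\<Sum>i<n. smul (d i) (x i))" "\<forall>i<n. d i \<in> a i" unfolding Leq by blast
        have "z = (\<Sum>i<n. smul (c * d i) (x i))" by (simp add: z d(1) scale_sum_right)
        moreover have "\<forall>i<n. c * d i \<in> imul P (a i)" using z d by (auto intro: imulI)
        ultimately show "z \<in> ?Q" by (intro CollectI exI[of _ "\<lambda>i. c * d i"]) simp
      qed
    qed
    have "smul d (x i) \<in> Q" if "i < n" "d \<in> imul P (a i)" for i d
    proof -
      have "osubK {d. smul d (x i) \<in> Q}" using oQ unfolding osub_def
        by (auto simp: scale_left_distrib simp flip: scale_scale)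
      then have "imul P (a i) \<subseteq> {d. smul d (x i) \<in> Q}"
      proof (rule imul_least)
        fix c d assume "c \<in> P" "d \<in> a i"
        then show "c * d \<in> {d. smul d (x i) \<in> Q}" using Qi[of c "smul d (x i)"] xL that(1) by simp
      qed
      then show ?thesis using that(2) by blast
    qed
    then show "?Q \<subseteq> Q" by (auto intro!: osub_sum[OF oQ])
  qed
  have QL: "Q \<subseteq> L" unfolding Q_def
    by (rule o_span_least[OF oL]) (use degree_oneD(2)[OF P] osub_scale[OF oL] in auto)
  \<comment> \<open>\<open>\<Phi>\<close> induces an isomorphism from F_p^n to L / Q:
    \<open>cover\<close> is surjectivity and \<open>\<Phi>Q\<close> describes the kernel.\<close>
  define \<Phi> where "\<Phi> m = (\<Sum>i<n. smul (of_int (m i) * t i) (x i))" for m :: "nat \<Rightarrow> int"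
  have \<Phi>_add: "\<Phi> (\<lambda>i. m i + m' i) = \<Phi> m + \<Phi> m'" for m m'
    by (simp add: \<Phi>_def distrib_right scale_left_distrib sum.distrib)
  have \<Phi>_scale: "\<Phi> (\<lambda>i. c * m i) = smul (of_int c) (\<Phi> m)" for m c
    by (simp add: \<Phi>_def scale_sum_right mult.assoc)
  have \<Phi>_diff: "\<Phi> (\<lambda>i. m i - c * m' i) = \<Phi> m - smul (of_int c) (\<Phi> m')" for m m' c
    by (simp add: \<Phi>_def scale_sum_right mult.assoc left_diff_distrib scale_left_diff_distrib sum_subtractf)
  have \<Phi>L: "\<Phi> m \<in> L" for m
    unfolding \<Phi>_def
  proof (rule osub_sum[OF oL])
    fix i assume "i \<in> {..<n}"
    then have i: "i < n" by simp
    have "of_int (m i) * t i \<in> a i" by (rule K.osub_scale[OF frac_osub[OF a[OF i]] O_int]) (use t[OF i] in blast)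
    then show "smul (of_int (m i) * t i) (x i) \<in> L" by (rule xL[OF i])
  qed
  have cover: "\<exists>m. y - \<Phi> m \<in> Q" if y: "y \<in> L" for y
  proof -
    obtain c where c: "y = (\<Sum>i<n. smul (c i) (x i))" "\<forall>i<n. c i \<in> a i" using y unfolding Leq by blast
    have "\<exists>m::int. c i - of_int m * t i \<in> imul P (a i)" if i: "i < n" for i
    proof -
      obtain r where r: "r \<in> Ok" "c i - r * t i \<in> imul P (a i)"
        using degree_one_generator[OF P a[OF i], of "t i" "c i"] t[OF i] c(2) i by blast
      obtain m :: int where m: "r - of_int m \<in> P" using degree_one_residue[OF P r(1)] .
      have "(c i - r * t i) + (r - of_int m) * t i \<in> imul P (a i)"
        using imulI[OF m] t[OF i] by (intro K.osub_add[OF osub_imul r(2)]) auto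
      then show ?thesis by (intro exI[of _ m]) (simp add: algebra_simps)
    qed
    then obtain m :: "nat \<Rightarrow> int" where m: "\<And>i. i < n \<Longrightarrow> c i - of_int (m i) * t i \<in> imul P (a i)" by metis
    have "y - \<Phi> m = (\<Sum>i<n. smul (c i - of_int (m i) * t i) (x i))"
      by (simp add: c(1) \<Phi>_def scale_left_diff_distrib sum_subtractf)
    then have "y - \<Phi> m \<in> Q" unfolding Qeq using m by (intro CollectI exI[of _ "\<lambda>i. c i - of_int (m i) * t i"]) simp
    then show ?thesis by blast
  qed
  have \<Phi>Q: "\<Phi> m \<in> Q \<longleftrightarrow> (\<forall>i<n. int p dvd m i)" for m
  proof
    assume "\<Phi> m \<in> Q"
    then obtain c where c: "\<Phi> m = (\<Sum>i<n. smul (c i) (x i))" "\<forall>i<n. c i \<in> imul P (a i)" unfolding Qeq by blast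
    show "\<forall>i<n. int p dvd m i"
    proof (intro allI impI)
      fix i assume i: "i < n"
      have "of_int (m i) * t i = c i" by (rule is_basis_unique[OF x c(1)[unfolded \<Phi>_def] i])
      then have mt: "of_int (m i) * t i \<in> imul P (a i)" using c(2) i by auto
      show "int p dvd m i"
      proof (rule ccontr)
        assume "\<not> int p dvd m i"
        then have "of_int (m i) \<notin> P" using degree_one_int_iff[OF P] by blast
        then obtain e where e: "e \<in> Ok" "1 - e * of_int (m i) \<in> P" using degree_one_unit[OF P O_int] by blast
        have "(1 - e * of_int (m i)) * t i + e * (of_int (m i) * t i) \<in> imul P (a i)"
          using imulI[OF e(2)] t[OF i] K.osub_scale[OF osub_imul e(1) mt] by (intro K.osub_add[OF osub_imul]) auto
        then have "t i \<in> imul P (a i)" by (simp add: algebra_simps)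
        then show False using t[OF i] by blast
      qed
    qed
  next
    assume "\<forall>i<n. int p dvd m i"
    then have "\<forall>i<n. of_int (m i) * t i \<in> imul P (a i)"
      using t degree_one_int_iff[OF P] by (auto intro!: imulI)
    then show "\<Phi> m \<in> Q" unfolding Qeq \<Phi>_def by (intro CollectI exI[of _ "\<lambda>i. of_int (m i) * t i"]) simp
  qed
  have QH: "Q \<subseteq> H" if "prime_colength P H L" for H
    unfolding Q_def using that by (intro o_span_least) (auto simp: prime_colength_def)
  define pre where "pre H = {m. \<Phi> m \<in> H}" for H
  have "bij_betw pre {H. prime_colength P H L} (hyperplanes n p)"
  proof (rule bij_betwI[where g = "\<lambda>S. {\<Phi> m + y | m y. m \<in> S \<and> y \<in> Q}"])
    show "pre \<in> {H. prime_colength P H L} \<rightarrow> hyperplanes n p"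
    proof
      fix H assume "H \<in> {H. prime_colength P H L}"
      then have H: "prime_colength P H L" by simp
      have oH: "osub smul H" and HL: "H \<subseteq> L" "H \<noteq> L" using H by (auto simp: prime_colength_def)
      have "pre H \<noteq> UNIV"
      proof
        assume u: "pre H = UNIV"
        have "L \<subseteq> H"
        proof
          fix y assume "y \<in> L"
          then obtain m where m: "y - \<Phi> m \<in> Q" using cover by blast
          moreover have "\<Phi> m \<in> H" using u unfolding pre_def by blast
          ultimately have "(y - \<Phi> m) + \<Phi> m \<in> H" using QH[OF H] by (intro osub_add[OF oH]) auto
          then show "y \<in> H" by simp
        qed
        then show False using HL by blast
      qed
      moreover have "\<exists>w. \<forall>m. \<exists>c. (\<lambda>i. m i - c * w i) \<in> pre H"
      proof -
        obtain w where w: "w \<in> L" "\<And>x. x \<in> L \<Longrightarrow> \<exists>c\<in>Ok. x - smul c w \<in> H" using H unfolding prime_colength_def by blast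
        obtain w0 where w0: "w - \<Phi> w0 \<in> Q" using cover[OF w(1)] by blast
        have "\<exists>c. (\<lambda>i. m i - c * w0 i) \<in> pre H" for m
        proof -
          obtain c where c: "c \<in> Ok" "\<Phi> m - smul c w \<in> H" using w(2)[OF \<Phi>L] by blast
          obtain k :: int where k: "c - of_int k \<in> P" using degree_one_residue[OF P c(1)] .
          have "(\<Phi> m - smul c w) + (smul (c - of_int k) w + smul (of_int k) (w - \<Phi> w0)) \<in> H"
            using c k w(1) w0 QH[OF H] H
            by (intro osub_add[OF oH]) (auto intro!: osub_scale[OF oH] simp: prime_colength_def)
          then have "\<Phi> m - smul (of_int k) (\<Phi> w0) \<in> H"
            by (simp add: scale_left_diff_distrib scale_right_diff_distrib)
          then show ?thesis unfolding pre_def \<Phi>_diff[symmetric] by blast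
        qed
        then show ?thesis by blast
      qed
      moreover have "m \<in> pre H" if "\<forall>i<n. int p dvd m i" for m
        using that \<Phi>Q[of m] QH[OF H] unfolding pre_def by blast
      ultimately show "pre H \<in> hyperplanes n p"
        unfolding hyperplanes_def using osub_add[OF oH] osub_scale[OF oH O_int]
        by (auto simp: pre_def \<Phi>_add \<Phi>_scale)
    qed
    show "(\<lambda>S. {\<Phi> m + y | m y. m \<in> S \<and> y \<in> Q}) \<in> hyperplanes n p \<rightarrow> {H. prime_colength P H L}"
    proof
      fix S assume S: "S \<in> hyperplanes n p"
      note Sadd = hyperplanes_add[OF S] and Sscale = hyperplanes_scale[OF S] and Sp = hyperplanes_multiples[OF S]
      let ?H = "{\<Phi> m + y | m y. m \<in> S \<and> y \<in> Q}"
      have mem: "\<Phi> m \<in> ?H \<longleftrightarrow> m \<in> S" for m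
      proof
        assume "\<Phi> m \<in> ?H"
        then obtain m' y where m': "\<Phi> m = \<Phi> m' + y" "m' \<in> S" "y \<in> Q" by blast
        then have "\<Phi> (\<lambda>i. m i - 1 * m' i) \<in> Q" unfolding \<Phi>_diff by simp
        then have "(\<lambda>i. m i - 1 * m' i) \<in> S" unfolding \<Phi>Q by (rule Sp)
        from Sadd[OF this m'(2)] show "m \<in> S" by simp
      next
        assume "m \<in> S"
        then show "\<Phi> m \<in> ?H" using osub_0[OF oQ] by force
      qed
      have oH: "osub smul ?H" unfolding osub_def
      proof (intro conjI ballI)
        have "(\<lambda>_. 0) \<in> S" using Sp[of "\<lambda>_. 0"] by simp
        moreover have "\<Phi> (\<lambda>_. 0) = 0" by (simp add: \<Phi>_def)
        ultimately show "0 \<in> ?H" using osub_0[OF oQ] by force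
      next
        fix u v assume "u \<in> ?H" "v \<in> ?H"
        then obtain m y m' y' where *: "u = \<Phi> m + y" "m \<in> S" "y \<in> Q" "v = \<Phi> m' + y'" "m' \<in> S" "y' \<in> Q" by blast
        then have "u + v = \<Phi> (\<lambda>i. m i + m' i) + (y + y')" unfolding \<Phi>_add by (simp add: algebra_simps)
        then show "u + v \<in> ?H" using Sadd[OF *(2,5)] osub_add[OF oQ *(3,6)] by blast
      next
        fix r u assume r: "r \<in> Ok" and "u \<in> ?H"
        then obtain m y where *: "u = \<Phi> m + y" "m \<in> S" "y \<in> Q" by blast
        obtain k :: int where k: "r - of_int k \<in> P" using degree_one_residue[OF P r] .
        have "smul r u = \<Phi> (\<lambda>i. k * m i) + (smul (r - of_int k) (\<Phi> m) + smul r y)"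
          unfolding \<Phi>_scale by (simp add: * scale_right_distrib scale_left_diff_distrib)
        moreover have "smul (r - of_int k) (\<Phi> m) + smul r y \<in> Q"
          by (intro osub_add[OF oQ] Qi[OF k \<Phi>L] osub_scale[OF oQ r *(3)])
        ultimately show "smul r u \<in> ?H" using Sscale[OF *(2)] by blast
      qed
      have HL: "?H \<subseteq> L" using \<Phi>L QL by (auto intro: osub_add[OF oL])
      have "?H \<noteq> L"
      proof
        assume "?H = L"
        then have "S = UNIV" using mem \<Phi>L by blast
        then show False using hyperplanes_proper[OF S] by blast
      qed
      moreover have "smul c y \<in> ?H" if "c \<in> P" "y \<in> L" for c y
      proof -
        have "(\<lambda>_. 0) \<in> S" using Sp[of "\<lambda>_. 0"] by simp
        moreover have "\<Phi> (\<lambda>_. 0) = 0" by (simp add: \<Phi>_def)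
        ultimately show ?thesis using Qi[OF that] by force
      qed
      moreover have "\<exists>w\<in>L. \<forall>y\<in>L. \<exists>c\<in>Ok. y - smul c w \<in> ?H"
      proof -
        obtain w where w: "\<forall>m. \<exists>c. (\<lambda>i. m i - c * w i) \<in> S" using hyperplanes_generator[OF S] by blast
        have "\<exists>c\<in>Ok. y - smul c (\<Phi> w) \<in> ?H" if y: "y \<in> L" for y
        proof -
          obtain m where m: "y - \<Phi> m \<in> Q" using cover[OF y] by blast
          obtain c where c: "(\<lambda>i. m i - c * w i) \<in> S" using w by blast
          have "y - smul (of_int c) (\<Phi> w) = \<Phi> (\<lambda>i. m i - c * w i) + (y - \<Phi> m)" unfolding \<Phi>_diff by simp
          then show ?thesis using c m O_int by blast
        qed
        then show ?thesis using \<Phi>L by blast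
      qed
      ultimately show "?H \<in> {H. prime_colength P H L}" using oH HL unfolding prime_colength_def by simp
    qed
    show "{\<Phi> m + y | m y. m \<in> pre H \<and> y \<in> Q} = H" if "H \<in> {H. prime_colength P H L}" for H
    proof -
      have H: "prime_colength P H L" using that by simp
      have oH: "osub smul H" and HL: "H \<subseteq> L" using H by (auto simp: prime_colength_def)
      show ?thesis
      proof (intro subset_antisym subsetI)
        fix y assume y: "y \<in> H"
        then obtain m where m: "y - \<Phi> m \<in> Q" using cover HL by blast
        have "y - \<Phi> m \<in> H" using m QH[OF H] by blast
        from osub_diff[OF oH y this] have "\<Phi> m \<in> H" by simp
        then have "m \<in> pre H" unfolding pre_def by simp
        moreover have "y = \<Phi> m + (y - \<Phi> m)" by simp
        ultimately show "y \<in> {\<Phi> m + y | m y. m \<in> pre H \<and> y \<in> Q}" using m by blast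
      qed (use QH[OF H] osub_add[OF oH] in \<open>auto simp: pre_def\<close>)
    qed
    show "pre {\<Phi> m + y | m y. m \<in> S \<and> y \<in> Q} = S" if S: "S \<in> hyperplanes n p" for S
    proof (intro subset_antisym subsetI)
      fix m assume "m \<in> pre {\<Phi> m + y | m y. m \<in> S \<and> y \<in> Q}"
      then obtain m' y where m': "\<Phi> m = \<Phi> m' + y" "m' \<in> S" "y \<in> Q" unfolding pre_def by blast
      then have "\<Phi> (\<lambda>i. m i - 1 * m' i) \<in> Q" unfolding \<Phi>_diff by simp
      then have "(\<lambda>i. m i - 1 * m' i) \<in> S" unfolding \<Phi>Q by (rule hyperplanes_multiples[OF S])
      from hyperplanes_add[OF S this m'(2)] show "m \<in> S" by simp
    next
      fix m assume "m \<in> S"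
      then show "m \<in> pre {\<Phi> m + y | m y. m \<in> S \<and> y \<in> Q}" unfolding pre_def using osub_0[OF oQ] by force
    qed
  qed
  then show ?thesis by blast
qed

lemma card_prime_colength_eq:
  assumes P: "degree_one P p" and L: "latt L"
  shows "finite {H. prime_colength P H L}" "card {H. prime_colength P H L} = card (hyperplanes n p)"
proof -
  obtain f where f: "bij_betw f {H. prime_colength P H L} (hyperplanes n p)" using card_prime_colength[OF assms] by blast
  show "card {H. prime_colength P H L} = card (hyperplanes n p)" by (rule bij_betw_same_card[OF f])
  show "finite {H. prime_colength P H L}"
    using bij_betw_finite[OF f] finite_hyperplanes[of p n] degree_oneD(3)[OF P] prime_gt_0_nat by auto
qed

end

section \<open>Unimodular lattices and neighbours\<close>

context imag_quad
begin

(* The last conjunct says that P and conj P are comaximal, i.e. that p is not ramified. *)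
definition split :: "'k set \<Rightarrow> nat \<Rightarrow> bool" where
  "split P p \<longleftrightarrow> degree_one P p \<and> imul P (cj ` P) = pr (of_nat p) \<and> (\<exists>a\<in>P. 1 - a \<in> cj ` P)"

lemma split_cj: assumes "split P p" shows "split (cj ` P) p"
proof -
  obtain a where a: "a \<in> P" "1 - a \<in> cj ` P" using assms unfolding split_def by blast
  have "\<exists>a\<in>cj ` P. 1 - a \<in> P" using a by (intro bexI[of _ "1 - a"]) auto
  then show ?thesis using assms degree_one_cj by (auto simp: split_def imul_comm)
qed

end

text \<open>\<open>n_pos\<close> is what makes hyperplanes, and hence neighbours, exist.\<close>

locale herm_space = fd_space D s smul bs n
  for D and s :: "'k::field_char_0" and smul :: "'k \<Rightarrow> 'v::ab_group_add \<Rightarrow> 'v" and bs n +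
  fixes h :: "'v \<Rightarrow> 'v \<Rightarrow> 'k"
  assumes h_add_left: "h (x + y) z = h x z + h y z"
    and h_scale_left: "h (smul c x) y = c * h x y"
    and h_cj: "h x y = cj (h y x)"
    and h_pos: "x \<noteq> 0 \<Longrightarrow> \<exists>q>0. h x x = of_rat q"
    and n_pos: "n > 0"
begin

lemma h_add_right: "h x (y + z) = h x y + h x z"
  by (subst (1 2 3) h_cj) (simp add: h_add_left)
lemma h_scale_right: "h x (smul c y) = cj c * h x y"
  by (subst (1 2) h_cj) (simp add: h_scale_left)
lemma h_0_left [simp]: "h 0 y = 0" using h_scale_left[of 0 0 y] by simp
lemma h_0_right [simp]: "h y 0 = 0" using h_scale_right[of y 0 0] by simp
lemma h_diff_left: "h (x - y) z = h x z - h y z"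
  using h_add_left[of "x - y" y z] by simp
lemma h_diff_right: "h x (y - z) = h x y - h x z"
  using h_add_right[of x "y - z" z] by simp
lemma h_sum_left: "h (sum f A) z = (\<Sum>i\<in>A. h (f i) z)"
  by (induction A rule: infinite_finite_induct) (simp_all add: h_add_left)
lemma h_sum_right: "h z (sum f A) = (\<Sum>i\<in>A. h z (f i))"
  by (induction A rule: infinite_finite_induct) (simp_all add: h_add_right)
lemma h_eq_0: "h x x = 0 \<longleftrightarrow> x = 0"
proof
  assume e: "h x x = 0"
  show "x = 0"
  proof (rule ccontr)
    assume "x \<noteq> 0"
    then obtain q where "q > 0" "h x x = of_rat q" using h_pos by blast
    then show False using e by simp
  qed
qed simp

section \<open>Dual lattices and dual bases\<close>

abbreviation dual where "dual \<equiv> dual_lattice h"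
abbreviation unim where "unim \<equiv> unimodular h"

lemma dual_iff: "x \<in> dual L \<longleftrightarrow> (\<forall>y\<in>L. h x y \<in> Ok)" by (simp add: dual_lattice_def)
lemma h_O_sym: "h x y \<in> Ok \<longleftrightarrow> h y x \<in> Ok" by (metis h_cj O_cj)
lemma osub_dual: "osub smul (dual L)"
  unfolding osub_def by (auto simp: dual_iff h_add_left h_scale_left)
lemma unimD: "unim L \<Longrightarrow> x \<in> L \<Longrightarrow> y \<in> L \<Longrightarrow> h x y \<in> Ok"
  unfolding unimodular_def using dual_iff by blast
lemma unimI: "unim L \<Longrightarrow> (\<And>y. y \<in> L \<Longrightarrow> h x y \<in> Ok) \<Longrightarrow> x \<in> L"
  unfolding unimodular_def using dual_iff by blast

text \<open>The map T v = sum of h(v, x_i) x_i is injective by definiteness, hence surjective by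
  dimension; preimages of the x_i form the dual basis.\<close>

lemma dual_basis: assumes x: "is_basis x"
  obtains y where "\<And>i j. i < n \<Longrightarrow> j < n \<Longrightarrow> h (y i) (x j) = (if i = j then 1 else 0)"
proof -
  interpret FD: finite_dimensional_vector_space smul "bs ` {..<n}"
    by unfold_locales (use bs_indep bs_span in auto)
  define T where "T v = (\<Sum>i<n. smul (h v (x i)) (x i))" for v
  have lin: "Vector_Spaces.linear smul smul T"
    by unfold_locales (simp_all add: T_def h_add_left h_scale_left scale_left_distrib sum.distrib scale_sum_right)
  have "inj T"
  proof (rule injI)
    fix u v assume "T u = T v"
    then have "h u (x i) = h v (x i)" if "i < n" for i
      using is_basis_unique[OF x _ that, of "\<lambda>i. h u (x i)" "\<lambda>i. h v (x i)"] by (simp add: T_def)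
    then have *: "h (u - v) (x i) = 0" if "i < n" for i using that by (simp add: h_diff_left)
    obtain c where "u - v = (\<Sum>i<n. smul (c i) (x i))" using is_basis_expand[OF x] by blast
    then have "h (u - v) (u - v) = (\<Sum>i<n. cj (c i) * h (u - v) (x i))"
      by (simp add: h_sum_right h_scale_right)
    also have "\<dots> = 0" using * by simp
    finally show "u = v" by (simp add: h_eq_0)
  qed
  then have surj: "surj T" by (rule FD.linear_inj_imp_surj[OF lin])
  have "\<forall>k. \<exists>v. T v = x k" using surj by (metis surjD)
  then obtain y where y: "\<And>k. T (y k) = x k" by metis
  have "h (y i) (x j) = (if i = j then 1 else 0)" if "i < n" "j < n" for i j
  proof -
    have "(\<Sum>k<n. smul (if i = k then 1 else 0) (x k)) = x i"
      using that by (simp add: if_distrib[of "\<lambda>c. smul c _"] cong: if_cong)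
    then show ?thesis
      using is_basis_unique[OF x _ that(2), of "\<lambda>k. h (y i) (x k)" "\<lambda>k. if i = k then 1 else 0"] y[of i]
      by (simp add: T_def)
  qed
  then show thesis by (rule that)
qed

lemma pseudo_basis_mem: assumes "pseudo_basis x a L" "i < n" "c \<in> a i" shows "smul c (x i) \<in> L"
proof -
  have "smul c (x i) = (\<Sum>j<n. smul (if i = j then c else 0) (x j))"
    using assms by (simp add: if_distrib[of "\<lambda>c. smul c _"] cong: if_cong)
  moreover have "\<forall>j<n. (if i = j then c else 0) \<in> a j"
    using assms K.osub_0[OF frac_osub] by (auto simp: pseudo_basis_def)
  ultimately have "\<exists>d. smul c (x i) = (\<Sum>j<n. smul (d j) (x j)) \<and> (\<forall>j<n. d j \<in> a j)"
    by (intro exI[of _ "\<lambda>j. if i = j then c else 0"]) simp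
  then show ?thesis using assms(1) unfolding pseudo_basis_def by blast
qed

text \<open>One inclusion in the description of the dual lattice by the dual basis with coefficient
  ideals conj(a_i)^-1.\<close>

lemma dual_basis_mem:
  assumes xa: "pseudo_basis x a L" and y: "\<And>i j. i < n \<Longrightarrow> j < n \<Longrightarrow> h (y i) (x j) = (if i = j then 1 else 0)"
    and J: "imul J (a i) = Ok" and i: "i < n" and z: "z \<in> J"
  shows "smul (cj z) (y i) \<in> dual L"
  unfolding dual_iff
proof
  fix v assume "v \<in> L"
  then obtain c where c: "v = (\<Sum>j<n. smul (c j) (x j))" "\<forall>j<n. c j \<in> a j" using xa unfolding pseudo_basis_def by blast
  have "h (smul (cj z) (y i)) v = (\<Sum>j<n. cj z * (cj (c j) * h (y i) (x j)))"
    by (simp add: c(1) h_sum_right h_scale_left h_scale_right sum_distrib_left mult.left_commute)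
  also have "\<dots> = (\<Sum>j<n. if i = j then cj (z * c j) else 0)"
    using y i by (intro sum.cong) auto
  also have "\<dots> = cj (z * c i)" using i by simp
  finally have e: "h (smul (cj z) (y i)) v = cj (z * c i)" .
  have "z * c i \<in> imul J (a i)" using z c(2) i by (intro imulI) auto
  then show "h (smul (cj z) (y i)) v \<in> Ok" unfolding e O_cj J .
qed

text \<open>The contrapositive of biduality. A coefficient c_i outside a_i becomes non-integral
  after multiplication by some \<open>z\<close> in the inverse of a_i, and conj(z) y_i brings this
  out.\<close>

lemma dual_separates: assumes L: "latt L" and v: "v \<notin> L"
  obtains y where "y \<in> dual L" "h v y \<notin> Ok"
proof -
  obtain x a where xa: "pseudo_basis x a L" using pseudo_basis[OF L] .
  have x: "is_basis x" and a: "\<And>i. i < n \<Longrightarrow> frac (a i)"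
    and Leq: "L = {\<Sum>i<n. smul (c i) (x i) | c. \<forall>i<n. c i \<in> a i}" using xa by (auto simp: pseudo_basis_def)
  obtain y where y: "\<And>i j. i < n \<Longrightarrow> j < n \<Longrightarrow> h (y i) (x j) = (if i = j then 1 else 0)"
    using dual_basis[OF x] by blast
  obtain c where c: "v = (\<Sum>i<n. smul (c i) (x i))" using is_basis_expand[OF x] by blast
  obtain i where i: "i < n" "c i \<notin> a i" using v c unfolding Leq by blast
  obtain J where J: "frac J" "imul J (a i) = Ok" using frac_inverse[OF a[OF i(1)]] by blast
  have "\<exists>z\<in>J. z * c i \<notin> Ok"
  proof (rule ccontr)
    assume "\<not> (\<exists>z\<in>J. z * c i \<notin> Ok)"
    then have "imul (pr (c i)) J \<subseteq> Ok" unfolding imul_pr[OF frac_osub[OF J(1)]] by (auto simp: mult.commute)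
    then have "imul (imul (pr (c i)) J) (a i) \<subseteq> imul Ok (a i)" by (rule imul_mono) simp
    then have "pr (c i) \<subseteq> a i"
      using J(2) frac_osub[OF a[OF i(1)]] by (simp add: imul_assoc imul_comm[of _ Ok] osub_pr)
    then show False using i(2) prI by blast
  qed
  then obtain z where z: "z \<in> J" "z * c i \<notin> Ok" by blast
  have "h v (smul (cj z) (y i)) = (\<Sum>j<n. z * (c j * h (x j) (y i)))"
    by (simp add: c h_sum_left h_scale_left h_scale_right sum_distrib_left mult.left_commute)
  also have "\<dots> = (\<Sum>j<n. if i = j then z * c j else 0)"
  proof (rule sum.cong[OF refl])
    fix j assume "j \<in> {..<n}"
    then have "h (x j) (y i) = (if i = j then 1 else 0)" using y[OF i(1), of j] by (subst h_cj) auto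
    then show "z * (c j * h (x j) (y i)) = (if i = j then z * c j else 0)" by simp
  qed
  also have "\<dots> = z * c i" using i by simp
  finally show thesis using that[OF dual_basis_mem[OF xa y J(2) i(1) z(1)]] z(2) by metis
qed

section \<open>Gram determinants and the Steinitz classes of unimodular lattices\<close>

text \<open>The conjugation comes from expanding the second argument of \<open>h\<close> through the
  transposed conjugate Gram matrix, as \<open>det_gram\<close> does.\<close>

definition gram_det :: 'k where "gram_det = cj (Determinant.det (Matrix.mat n n (\<lambda>(i, j). h (bs i) (bs j))))"

lemma det_gram_left:
  "Determinant.det (Matrix.mat n n (\<lambda>(i, j). h (v i) (w j)))
   = coord_det v * Determinant.det (Matrix.mat n n (\<lambda>(i, j). h (bs i) (w j)))"
proof -
  have "Matrix.mat n n (\<lambda>(i, j). h (v i) (w j)) = cm v * Matrix.mat n n (\<lambda>(i, j). h (bs i) (w j))"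
  proof (rule eq_matI)
    fix i j assume ij: "i < dim_row (cm v * Matrix.mat n n (\<lambda>(i, j). h (bs i) (w j)))"
      "j < dim_col (cm v * Matrix.mat n n (\<lambda>(i, j). h (bs i) (w j)))"
    then have ij': "i < n" "j < n" by (simp_all add: cm_def)
    have "h (v i) (w j) = h (\<Sum>k<n. smul (co (v i) k) (bs k)) (w j)" by (simp add: co_expand)
    also have "\<dots> = (\<Sum>k<n. co (v i) k * h (bs k) (w j))" by (simp add: h_sum_left h_scale_left)
    finally show "Matrix.mat n n (\<lambda>(i, j). h (v i) (w j)) $$ (i, j) = (cm v * Matrix.mat n n (\<lambda>(i, j). h (bs i) (w j))) $$ (i, j)"
      using ij' by (simp add: cm_def scalar_prod_def lessThan_atLeast0)
  qed (simp_all add: cm_def)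
  then show ?thesis by (simp add: Determinant.det_mult[of _ n] coord_det_def)
qed

lemma det_gram: "Determinant.det (Matrix.mat n n (\<lambda>(i, j). h (v i) (w j))) = coord_det v * cj (coord_det w) * gram_det"
proof -
  interpret cjh: comm_ring_hom cj by unfold_locales simp_all
  have "Matrix.mat n n (\<lambda>(i, j). h (bs i) (w j)) = transpose_mat (map_mat cj (Matrix.mat n n (\<lambda>(i, j). h (w i) (bs j))))"
    by (rule eq_matI) (auto intro: h_cj)
  then have "Determinant.det (Matrix.mat n n (\<lambda>(i, j). h (bs i) (w j)))
      = cj (Determinant.det (Matrix.mat n n (\<lambda>(i, j). h (w i) (bs j))))"
    by (simp add: Determinant.det_transpose[of _ n])
  then show ?thesis unfolding det_gram_left[of v w] det_gram_left[of w bs] by (simp add: gram_det_def)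
qed

lemma det_O: assumes "\<And>i j. i < n \<Longrightarrow> j < n \<Longrightarrow> A i j \<in> Ok"
  shows "Determinant.det (Matrix.mat n n (\<lambda>(i, j). A i j)) \<in> Ok"
proof -
  have "iprod (\<lambda>_. Ok) = Ok" unfolding iprod_def
    using IG.finprod_one[of "{..<n}"] by simp
  then show ?thesis using det_mem_iprod[of "\<lambda>_. Ok" A] assms frac_O by simp
qed

text \<open>Gram determinants of tuples in \<open>L\<close> are integral, which gives one inclusion.
  For the other, tuples c_i x_i along the pseudo-basis and conj(z_i) y_i along the dual basis, with
  z_i in the inverse of a_i, both lie in \<open>L\<close> by unimodularity; their Gram matrix is
  diagonal with entries c_i z_i, and products of such entries generate o.\<close>

lemma unim_det_ideal:
  assumes L: "latt L" "unim L" shows "imul (imul (det_ideal L) (cj ` det_ideal L)) (pr gram_det) = Ok"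
proof -
  obtain x a where xa: "pseudo_basis x a L" using pseudo_basis[OF L(1)] .
  have x: "is_basis x" and a: "\<And>i. i < n \<Longrightarrow> frac (a i)" using xa by (auto simp: pseudo_basis_def)
  obtain y where y: "\<And>i j. i < n \<Longrightarrow> j < n \<Longrightarrow> h (y i) (x j) = (if i = j then 1 else 0)"
    using dual_basis[OF x] by blast
  define M where "M = imul (imul (det_ideal L) (cj ` det_ideal L)) (pr gram_det)"
  have oM: "osubK M" unfolding M_def by (rule osub_imul)
  have "det_ideal L \<subseteq> {u. \<forall>w\<in>det_ideal L. u * cj w * gram_det \<in> Ok}"
  proof (rule det_ideal_least)
    show "osubK {u. \<forall>w\<in>det_ideal L. u * cj w * gram_det \<in> Ok}"
      unfolding osub_def by (auto simp: distrib_right mult.assoc)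
    fix v assume v: "\<And>i. i < n \<Longrightarrow> v i \<in> L"
    have "det_ideal L \<subseteq> {w. coord_det v * cj w * gram_det \<in> Ok}"
    proof (rule det_ideal_least)
      show "osubK {w. coord_det v * cj w * gram_det \<in> Ok}"
        unfolding osub_def by (auto simp: distrib_right distrib_left mult.assoc mult.left_commute[of "coord_det v" "cj _"])
      fix w assume w: "\<And>i. i < n \<Longrightarrow> w i \<in> L"
      show "coord_det w \<in> {w. coord_det v * cj w * gram_det \<in> Ok}"
        unfolding mem_Collect_eq det_gram[symmetric] by (rule det_O) (use unimD[OF L(2)] v w in auto)
    qed
    then show "coord_det v \<in> {u. \<forall>w\<in>det_ideal L. u * cj w * gram_det \<in> Ok}" by blast
  qed
  then have "imul (det_ideal L) (cj ` det_ideal L) \<subseteq> {u. u * gram_det \<in> Ok}"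
    by (intro imul_least) (auto simp: osub_def distrib_right mult.assoc)
  then have "M \<subseteq> Ok"
    unfolding M_def by (subst imul_comm) (subst imul_pr[OF osub_imul], auto simp: mult.commute)
  moreover have "Ok \<subseteq> M"
  proof -
    define a' where "a' i = inv\<^bsub>ideal_group\<^esub> (a i)" for i
    have a': "frac (a' i)" "imul (a' i) (a i) = Ok" if "i < n" for i
      using IG.inv_closed[of "a i"] IG.l_inv[of "a i"] a[OF that] by (simp_all add: a'_def)
    have key: "prod c {..<n} * prod z {..<n} \<in> M"
      if c: "\<And>i. i < n \<Longrightarrow> c i \<in> a i" and z: "\<And>i. i < n \<Longrightarrow> z i \<in> a' i" for c z
    proof -
      define v w where "v i = smul (c i) (x i)" and "w i = smul (cj (z i)) (y i)" for i
      have vL: "v i \<in> L" if "i < n" for i unfolding v_def by (rule pseudo_basis_mem[OF xa that c[OF that]])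
      have wL: "w i \<in> L" if "i < n" for i
        using dual_basis_mem[OF xa y a'(2)[OF that] that z[OF that]] L(2) by (simp add: w_def unimodular_def)
      have "Matrix.mat n n (\<lambda>(i, j). h (v i) (w j)) = Matrix.mat n n (\<lambda>(i, j). if i = j then c i * z i else 0)"
      proof (rule eq_matI)
        fix i j assume "i < dim_row (Matrix.mat n n (\<lambda>(i, j). if i = j then c i * z i else 0))"
          "j < dim_col (Matrix.mat n n (\<lambda>(i, j). if i = j then c i * z i else 0))"
        then have ij: "i < n" "j < n" by simp_all
        have "h (x i) (y j) = (if i = j then 1 else 0)" using y[OF ij(2,1)] by (subst h_cj) auto
        then show "Matrix.mat n n (\<lambda>(i, j). h (v i) (w j)) $$ (i, j) = Matrix.mat n n (\<lambda>(i, j). if i = j then c i * z i else 0) $$ (i, j)"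
          using ij by (simp add: v_def w_def h_scale_left h_scale_right)
      qed simp_all
      moreover have "Determinant.det (Matrix.mat n n (\<lambda>(i, j). if i = j then c i * z i else 0)) = (\<Prod>i<n. c i * z i)"
        by (subst det_upper_triangular[of _ n])
          (auto simp: upper_triangular_def diag_mat_def prod.list_conv_set_nth lessThan_atLeast0 intro!: prod.cong)
      ultimately have "prod c {..<n} * prod z {..<n} = coord_det v * cj (coord_det w) * gram_det"
        using det_gram[of v w] by (simp add: prod.distrib)
      also have "\<dots> \<in> M" unfolding M_def
        by (intro imulI prI imageI det_ideal_mem vL wL)
      finally show ?thesis .
    qed
    have 1: "u * w \<in> M" if u: "u \<in> iprod a" and w: "w \<in> iprod a'" for u w
    proof (rule finprod_least[OF _ oM _ _ w[unfolded iprod_def]])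
      fix z assume z: "\<And>i. i \<in> {..<n} \<Longrightarrow> z i \<in> a' i"
      have "prod z {..<n} * u \<in> M"
        by (rule finprod_least[OF _ oM _ _ u[unfolded iprod_def]])
          (use a key[of _ z] z in \<open>auto simp: mult.commute\<close>)
      then show "u * prod z {..<n} \<in> M" by (simp add: mult.commute)
    qed (use a' in auto)
    have "iprod (\<lambda>i. imul (a i) (a' i)) = imul (iprod a) (iprod a')"
      unfolding iprod_def using IG.finprod_multf[of a "{..<n}" a'] a a' by (auto simp: Pi_iff)
    moreover have "iprod (\<lambda>i. imul (a i) (a' i)) = Ok"
    proof -
      have "iprod (\<lambda>i. imul (a i) (a' i)) = finprod ideal_group (\<lambda>_. Ok) {..<n}"
        unfolding iprod_def by (rule IG.finprod_cong') (use a' frac_O in \<open>auto simp: imul_comm\<close>)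
      also have "\<dots> = Ok" using IG.finprod_one[of "{..<n}"] by simp
      finally show ?thesis .
    qed
    ultimately have "Ok = imul (iprod a) (iprod a')" by simp
    also have "\<dots> \<subseteq> M" by (rule imul_least[OF oM 1])
    finally show ?thesis .
  qed
  ultimately show ?thesis unfolding M_def by blast
qed

lemma steinitz_unim:
  assumes L: "latt L" "unim L" and N: "latt N" "unim N"
  obtains c where "c \<in> class_squares" "steinitz_class smul N = c \<otimes>\<^bsub>class_group\<^esub> steinitz_class smul L"
proof -
  have fL: "frac (det_ideal L)" and fN: "frac (det_ideal N)" using frac_det_ideal L N by blast+
  define J where "J = inv\<^bsub>ideal_group\<^esub> (det_ideal L)"
  have J: "frac J" "imul J (det_ideal L) = Ok"
    using IG.inv_closed[of "det_ideal L"] IG.l_inv[of "det_ideal L"] fL by (simp_all add: J_def)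
  define C where "C = imul (det_ideal N) J"
  have fC: "frac C" unfolding C_def by (intro frac_imul fN J)
  have g: "gram_det \<noteq> 0"
  proof
    assume "gram_det = 0"
    then have "imul (imul (det_ideal L) (cj ` det_ideal L)) (pr gram_det) \<subseteq> {0}"
      by (intro imul_least) (auto simp: pr_def osub_def)
    then show False using unim_det_ideal[OF L] O_1 by (metis singletonD subsetD zero_neq_one)
  qed
  \<comment> \<open>The factor \<open>gram_det\<close> belongs to the space and not to the lattice,
    so it cancels.\<close>
  have same: "imul (det_ideal N) (cj ` det_ideal N) = imul (det_ideal L) (cj ` det_ideal L)"
    using unim_det_ideal[OF L] unim_det_ideal[OF N] g IG.right_cancel[of "pr gram_det" "imul (det_ideal N) (cj ` det_ideal N)" "imul (det_ideal L) (cj ` det_ideal L)"]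
      frac_imul frac_cj frac_pr[OF g] fL fN by simp
  have "imul C (cj ` C) = imul (imul (det_ideal N) (cj ` det_ideal N)) (imul J (cj ` J))"
    unfolding C_def cj_imul by (rule imul_interchange)
  also have "\<dots> = imul (imul J (det_ideal L)) (cj ` imul J (det_ideal L))"
    unfolding same cj_imul by (metis imul_comm imul_interchange)
  also have "\<dots> = Ok" using J(2) osub_O by simp
  finally have n1: "imul C (cj ` C) = Ok" .
  obtain B where B: "frac B" "imul C (cj ` B) = B" using hilbert90_ideal[OF fC n1] by metis
  have "det_ideal N = imul C (det_ideal L)"
    unfolding C_def using J(2) frac_osub[OF fN] by (simp add: imul_assoc imul_comm[of _ Ok])
  then have "icl (det_ideal N) = icl C \<otimes>\<^bsub>class_group\<^esub> icl (det_ideal L)" using icl_mult[OF fC fL] by simp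
  moreover have "icl C = icl B \<otimes>\<^bsub>class_group\<^esub> icl B"
  proof -
    have "icl C \<otimes>\<^bsub>class_group\<^esub> icl (cj ` B) = icl B" using icl_mult[OF fC frac_cj[OF B(1)]] B(2) by simp
    then show ?thesis
      using CG.inv_solve_right[of "icl C" "icl B" "icl (cj ` B)"] icl_cj[OF B(1)] fC B(1) frac_cj[OF B(1)] by simp
  qed
  moreover have "icl B \<otimes>\<^bsub>class_group\<^esub> icl B \<in> class_squares" unfolding class_squares_def using B(1) by auto
  ultimately show thesis using that L(1) N(1) by (simp add: steinitz_eq)
qed

section \<open>Neighbours with respect to a split prime\<close>

definition neighbour :: "'k set \<Rightarrow> 'v set \<Rightarrow> 'v set \<Rightarrow> bool" where
  "neighbour P L N \<longleftrightarrow> latt L \<and> latt N \<and> unim L \<and> unim N \<and> prime_colength P (L \<inter> N) L \<and> prime_colength (cj ` P) (L \<inter> N) N"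

text \<open>Lets one counting lemma serve both sides of the relation, with conj(P) in place of
  \<open>P\<close>.\<close>

lemma neighbour_sym: "neighbour P L N \<longleftrightarrow> neighbour (cj ` P) N L"
  unfolding neighbour_def by (auto simp: Int_commute)

text \<open>P det(L) and conj(P) det(N) are both the determinant ideal of the intersection, and
  conj(P) has the class inverse to that of \<open>P\<close>.\<close>

lemma neighbour_steinitz:
  assumes P: "split P p" and N: "neighbour P L N"
  shows "steinitz_class smul N = (icl P \<otimes>\<^bsub>class_group\<^esub> icl P) \<otimes>\<^bsub>class_group\<^esub> steinitz_class smul L"
proof -
  have d: "degree_one P p" and d': "degree_one (cj ` P) p" using P degree_one_cj by (auto simp: split_def)
  have L: "latt L" "latt N" "prime_colength P (L \<inter> N) L" "prime_colength (cj ` P) (L \<inter> N) N" using N by (auto simp: neighbour_def)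
  have fP: "frac P" "frac (cj ` P)" using degree_one_frac d d' by blast+
  have f: "frac (det_ideal L)" "frac (det_ideal N)" using frac_det_ideal L by blast+
  have "imul P (det_ideal L) = imul (cj ` P) (det_ideal N)"
    using det_ideal_prime_colength[OF d L(1,3)] det_ideal_prime_colength[OF d' L(2,4)] by simp
  then have e: "icl P \<otimes>\<^bsub>class_group\<^esub> icl (det_ideal L) = icl (cj ` P) \<otimes>\<^bsub>class_group\<^esub> icl (det_ideal N)"
    using icl_mult fP f by simp
  have "icl (det_ideal N) = (icl P \<otimes>\<^bsub>class_group\<^esub> icl (cj ` P)) \<otimes>\<^bsub>class_group\<^esub> icl (det_ideal N)"
    using icl_cj_mult[OF fP(1)] f by simp
  also have "\<dots> = icl P \<otimes>\<^bsub>class_group\<^esub> (icl P \<otimes>\<^bsub>class_group\<^esub> icl (det_ideal L))"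
    unfolding e using fP f by (simp add: CG.m_assoc)
  also have "\<dots> = (icl P \<otimes>\<^bsub>class_group\<^esub> icl P) \<otimes>\<^bsub>class_group\<^esub> icl (det_ideal L)"
    using fP f by (simp add: CG.m_assoc)
  finally show ?thesis using L by (simp add: steinitz_eq)
qed

text \<open>The neighbour is recovered from H = L \<inter> N as H + P H#. Comaximality is used in y
  = (1 - a) y + a y: the factor 1 - a is in conj(P), which carries N into H, and a is in
  \<open>P\<close>.\<close>

lemma neighbour_unique:
  assumes P: "split P p" and N: "neighbour P L N" "neighbour P L N'" and eq: "L \<inter> N = L \<inter> N'"
  shows "N = N'"
proof -
  obtain a where a: "a \<in> P" "1 - a \<in> cj ` P" using P unfolding split_def by blast
  have "M = {x + smul b z | x b z. x \<in> L \<inter> M \<and> b \<in> P \<and> z \<in> dual (L \<inter> M)}" if M: "neighbour P L M" for M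
  proof (intro subset_antisym subsetI)
    have uM: "unim M" and oM: "osub smul M" and PM: "\<And>c x. c \<in> cj ` P \<Longrightarrow> x \<in> M \<Longrightarrow> smul c x \<in> L \<inter> M"
      using M latt_osub by (auto simp: neighbour_def prime_colength_def)
    fix y assume y: "y \<in> M"
    have "y = smul (1 - a) y + smul a y" by (simp add: scale_left_diff_distrib)
    moreover have "smul (1 - a) y \<in> L \<inter> M" by (rule PM[OF a(2) y])
    moreover have "y \<in> dual (L \<inter> M)" using unimD[OF uM y] by (auto simp: dual_iff)
    ultimately show "y \<in> {x + smul b z | x b z. x \<in> L \<inter> M \<and> b \<in> P \<and> z \<in> dual (L \<inter> M)}" using a(1) by blast
  next
    have uM: "unim M" and oM: "osub smul M" and PM: "\<And>c x. c \<in> cj ` P \<Longrightarrow> x \<in> M \<Longrightarrow> smul c x \<in> L \<inter> M"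
      using M latt_osub by (auto simp: neighbour_def prime_colength_def)
    fix y assume "y \<in> {x + smul b z | x b z. x \<in> L \<inter> M \<and> b \<in> P \<and> z \<in> dual (L \<inter> M)}"
    then obtain x b z where *: "y = x + smul b z" "x \<in> L \<inter> M" "b \<in> P" "z \<in> dual (L \<inter> M)" by blast
    have "smul b z \<in> M"
    proof (rule unimI[OF uM])
      fix w assume w: "w \<in> M"
      have "h (smul b z) w = h z (smul (cj b) w)" by (simp add: h_scale_left h_scale_right)
      then show "h (smul b z) w \<in> Ok" using PM[of "cj b" w] * w by (auto simp: dual_iff)
    qed
    then show "y \<in> M" using * osub_add[OF oM] by auto
  qed
  from this[OF N(1)] this[OF N(2)] show ?thesis unfolding eq by simp
qed

text \<open>Take \<open>y\<close> in the dual of \<open>H\<close> with h(x0, y) not integral.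
  Multiples of \<open>y\<close> by conj(P) lie in \<open>L\<close>, and for one of them,
  \<open>v\<close>, the value h(x0, v) is outside \<open>P\<close>. Modulo \<open>P\<close> the
  functional x \<mapsto> h(x, v) is then nonzero on \<open>L\<close> and vanishes on
  \<open>H\<close>, so \<open>H\<close> is its kernel.\<close>

lemma hyperplane_vector:
  assumes P: "split P p" and L: "latt L" "unim L" and H: "prime_colength P H L"
  obtains v where "v \<in> L" "H = {x \<in> L. h x v \<in> P}"
proof -
  have d: "degree_one P p" and d': "degree_one (cj ` P) p" using P degree_one_cj by (auto simp: split_def)
  have lH: "latt H" by (rule prime_colength_latt[OF d L(1) H])
  have oH: "osub smul H" and HL: "H \<subseteq> L" "H \<noteq> L" and PL: "\<And>c x. c \<in> P \<Longrightarrow> x \<in> L \<Longrightarrow> smul c x \<in> H"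
    using H by (auto simp: prime_colength_def)
  obtain x0 where x0: "x0 \<in> L" "x0 \<notin> H" using HL by blast
  obtain y where y: "y \<in> dual H" "h x0 y \<notin> Ok" using dual_separates[OF lH x0(2)] .
  have cyL: "smul c y \<in> L" if c: "c \<in> cj ` P" for c
  proof (rule unimI[OF L(2)])
    fix x assume x: "x \<in> L"
    have "smul (cj c) x \<in> H" using PL[of "cj c" x] c x by (simp add: cj_mem)
    then have "h y (smul (cj c) x) \<in> Ok" using y(1) by (simp add: dual_iff)
    then show "h (smul c y) x \<in> Ok" by (simp add: h_scale_left h_scale_right)
  qed
  have PP: "imul P (cj ` P) = pr (of_nat p)" using P by (simp add: split_def)
  have p0: "of_nat p \<noteq> (0::'k)" by (rule degree_oneD(6)[OF d])
  \<comment> \<open>Otherwise P h(x0, y) would lie in \<open>P\<close>; multiplying by conj(P) would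
    put p h(x0, y) into (p), and h(x0, y) would be integral.\<close>
  have "\<exists>c\<in>cj ` P. h x0 (smul c y) \<notin> P"
  proof (rule ccontr)
    assume n: "\<not> (\<exists>c\<in>cj ` P. h x0 (smul c y) \<notin> P)"
    have "imul P (cj ` P) \<subseteq> {t. t * h x0 y \<in> pr (of_nat p)}"
    proof (rule imul_least)
      show "osubK {t. t * h x0 y \<in> pr (of_nat p)}"
        using osub_pr[of "of_nat p"] unfolding osub_def by (auto simp: distrib_right mult.assoc)
      fix c e assume c: "c \<in> P" and e: "e \<in> cj ` P"
      have "h x0 (smul (cj c) y) \<in> P" using n c by blast
      then have "(c * h x0 y) * e \<in> imul P (cj ` P)" using e by (intro imulI) (simp_all add: h_scale_right)
      then show "c * e \<in> {t. t * h x0 y \<in> pr (of_nat p)}" unfolding PP by (simp add: mult_ac)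
    qed
    then have "of_nat p * h x0 y \<in> pr (of_nat p)" unfolding PP using prI by blast
    then show False using y(2) p0 by (simp add: pr_mem)
  qed
  then obtain c where c: "c \<in> cj ` P" "h x0 (smul c y) \<notin> P" by blast
  define v where "v = smul c y"
  have vL: "v \<in> L" unfolding v_def by (rule cyL[OF c(1)])
  have "H = {x \<in> L. h x v \<in> P}"
  proof (intro subset_antisym subsetI)
    fix x assume x: "x \<in> H"
    have "h x y \<in> Ok" using y(1) x h_O_sym by (auto simp: dual_iff)
    then have "h x y * cj c \<in> P" using c(1) by (intro K.osub_scale[OF degree_oneD(1)[OF d]]) (auto simp: cj_mem)
    then show "x \<in> {x \<in> L. h x v \<in> P}" using HL x by (auto simp: v_def h_scale_right mult.commute)
  next
    fix x assume "x \<in> {x \<in> L. h x v \<in> P}"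
    then have x: "x \<in> L" "h x v \<in> P" by auto
    show "x \<in> H"
    proof (rule ccontr)
      assume "x \<notin> H"
      then obtain e where e: "e \<in> Ok" "x0 - smul e x \<in> H" using prime_colength_generator[OF d L(1) H x(1) _ x0(1)] by blast
      have "h (x0 - smul e x) y \<in> Ok" using y(1) e(2) h_O_sym by (auto simp: dual_iff)
      then have "h (x0 - smul e x) y * cj c \<in> P" using c(1) by (intro K.osub_scale[OF degree_oneD(1)[OF d]]) (auto simp: cj_mem)
      then have "h (x0 - smul e x) v \<in> P" by (simp add: v_def h_scale_right mult.commute)
      moreover have "e * h x v \<in> P" by (rule K.osub_scale[OF degree_oneD(1)[OF d] e(1) x(2)])
      ultimately have "h (x0 - smul e x) v + e * h x v \<in> P" by (rule K.osub_add[OF degree_oneD(1)[OF d]])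
      then show False using c(2) by (simp add: h_diff_left h_scale_left v_def)
    qed
  qed
  then show thesis using that vL by blast
qed

lemma h_self_int: assumes "h x x \<in> Ok" obtains q :: int where "h x x = of_int q"
proof -
  have "cj (h x x) = h x x" by (metis h_cj)
  then have e: "h x x = of_rat (rp (h x x))" by (rule cj_fixed)
  then have "rp (h x x) \<in> \<int>" using assms O_rat by metis
  then obtain q where "rp (h x x) = of_int q" by (auto elim: Ints_cases)
  then show thesis using that[of q] e by simp
qed

text \<open>The vector defining \<open>H\<close> matters only modulo conj(P) L. If \<open>p\<close>
  divides h(v, v), add c w with \<open>c\<close> in conj(P) but not in \<open>P\<close> and h(w, v)
  outside \<open>P\<close>: this keeps \<open>H\<close> and makes h(u, u) congruent to c h(w, v)
  modulo \<open>P\<close>, which is not 0. With h(u, u) prime to \<open>p\<close> the vector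
  \<open>u\<close> splits off orthogonally at \<open>p\<close>.\<close>

lemma hyperplane_unit_vector:
  assumes P: "split P p" and L: "latt L" "unim L" and H: "prime_colength P H L"
  obtains u q where "u \<in> L" "H = {x \<in> L. h x u \<in> P}" "h u u = of_int q" "\<not> int p dvd q"
proof -
  have d: "degree_one P p" and d': "degree_one (cj ` P) p" using P degree_one_cj by (auto simp: split_def)
  note oP = degree_oneD(1)[OF d]
  obtain v where v: "v \<in> L" "H = {x \<in> L. h x v \<in> P}" using hyperplane_vector[OF P L H] .
  obtain q where q: "h v v = of_int q" using h_self_int[OF unimD[OF L(2) v(1) v(1)]] .
  show thesis
  proof (cases "int p dvd q")
    case False
    then show thesis using that v q by blast
  next
    case True
    then have vP: "h v v \<in> P" using q degree_one_int_iff[OF d] by simp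
    obtain w where w: "w \<in> L" "h w v \<notin> P" using H v(2) by (auto simp: prime_colength_def)
    obtain a where a: "a \<in> P" "1 - a \<in> cj ` P" using P unfolding split_def by blast
    define c where "c = 1 - a"
    have c: "cj c \<in> P" "c \<notin> P" "c \<in> Ok"
    proof -
      show "cj c \<in> P" using a(2) by (simp add: c_def cj_mem)
      show "c \<notin> P"
      proof
        assume "c \<in> P"
        then have "c + a \<in> P" using K.osub_add[OF oP _ a(1)] by blast
        then show False using degree_oneD(5)[OF d] by (simp add: c_def)
      qed
      show "c \<in> Ok" using a(1) degree_oneD(2)[OF d] by (auto simp: c_def)
    qed
    define u where "u = v + smul c w"
    have uL: "u \<in> L" unfolding u_def using osub_add[OF latt_osub[OF L(1)] v(1)] osub_scale[OF latt_osub[OF L(1)] c(3) w(1)] by blast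
    have cong: "h x u - h x v \<in> P" if "x \<in> L" for x
    proof -
      have "h x u - h x v = h x w * cj c" by (simp add: u_def h_add_right h_scale_right mult.commute)
      then show ?thesis using K.osub_scale[OF oP unimD[OF L(2) that w(1)] c(1)] by simp
    qed
    have "h x u \<in> P \<longleftrightarrow> h x v \<in> P" if "x \<in> L" for x
      using cong[OF that] K.osub_add[OF oP cong[OF that], of "h x v"] K.osub_diff[OF oP _ cong[OF that], of "h x u"] by auto
    then have Hu: "H = {x \<in> L. h x u \<in> P}" using v(2) by blast
    obtain r where r: "h u u = of_int r" using h_self_int[OF unimD[OF L(2) uL uL]] .
    have "\<not> int p dvd r"
    proof
      assume "int p dvd r"
      then have "h u u \<in> P" using r degree_one_int_iff[OF d] by simp
      then have "h u v \<in> P" using K.osub_diff[OF oP _ cong[OF uL], of "h u u"] by simp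
      then have "h u v - h v v \<in> P" using K.osub_diff[OF oP _ vP] by blast
      then have "c * h w v \<in> P" by (simp add: u_def h_add_left h_scale_left)
      then show False using degree_one_prime[OF d c(3) unimD[OF L(2) w(1) v(1)]] c(2) w(2) by blast
    qed
    then show thesis using that uL Hu r by blast
  qed
qed

end

section \<open>Completions and local isometries\<close>

lemma coprime_power_inverse:
  fixes u :: int assumes "prime p" "\<not> int p dvd u" shows "\<exists>w t. w * u = 1 + int p ^ k * t"
proof -
  have "coprime (int p ^ k) u" using assms by (intro coprime_power_left_iff[THEN iffD2] disjI1 prime_imp_coprime) auto
  then obtain a b where "a * int p ^ k + b * u = 1" using coprime_iff_gcd_eq_1 bezout_int by metis
  then have "b * u = 1 + int p ^ k * (- a)" by (simp add: algebra_simps)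
  then show ?thesis by blast
qed

context iq_space
begin

abbreviation lc :: "nat \<Rightarrow> 'v set \<Rightarrow> 'v set" where "lc \<equiv> localization smul"

lemma lc_iff: "v \<in> lc p L \<longleftrightarrow> (\<exists>u::int. \<not> int p dvd u \<and> smul (of_int u) v \<in> L)"
  by (simp add: localization_def)

lemma lc_base: "prime p \<Longrightarrow> v \<in> L \<Longrightarrow> v \<in> lc p L"
  unfolding lc_iff by (intro exI[of _ 1]) (auto dest: not_prime_unit)

lemma osub_lc: assumes p: "prime p" and L: "osub smul L" shows "osub smul (lc p L)"
  unfolding osub_def
proof (intro conjI ballI)
  show "0 \<in> lc p L" by (rule lc_base[OF p osub_0[OF L]])
next
  fix x y assume "x \<in> lc p L" "y \<in> lc p L"
  then obtain u w :: int where uw: "\<not> int p dvd u" "smul (of_int u) x \<in> L" "\<not> int p dvd w" "smul (of_int w) y \<in> L"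
    unfolding lc_iff by blast
  have "\<not> int p dvd u * w" using uw p by (simp add: prime_dvd_mult_iff)
  moreover have "smul (of_int w) (smul (of_int u) x) + smul (of_int u) (smul (of_int w) y) \<in> L"
    by (rule osub_add[OF L osub_scale[OF L O_int uw(2)] osub_scale[OF L O_int uw(4)]])
  then have "smul (of_int (u * w)) (x + y) \<in> L" by (simp add: scale_right_distrib mult.commute)
  ultimately show "x + y \<in> lc p L" unfolding lc_iff by blast
next
  fix c x assume c: "c \<in> Ok" and "x \<in> lc p L"
  then obtain u :: int where u: "\<not> int p dvd u" "smul (of_int u) x \<in> L" unfolding lc_iff by blast
  then have "smul (of_int u) (smul c x) \<in> L" using osub_scale[OF L c u(2)] by (simp add: mult.commute)
  then show "smul c x \<in> lc p L" using u(1) unfolding lc_iff by blast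
qed

lemma lc_descend:
  assumes p: "prime p" and u: "\<not> int p dvd u" "smul (of_int u) x \<in> lc p L" shows "x \<in> lc p L"
proof -
  obtain w :: int where w: "\<not> int p dvd w" "smul (of_int w) (smul (of_int u) x) \<in> L" using u(2) unfolding lc_iff by blast
  then have "smul (of_int (w * u)) x \<in> L" by simp
  moreover have "\<not> int p dvd w * u" using p u(1) w(1) by (simp add: prime_dvd_mult_iff)
  ultimately show ?thesis unfolding lc_iff by blast
qed

text \<open>The integers \<open>u\<close> with u x in \<open>L\<close> form an ideal of Z that is
  contained in no (p), so 1 belongs to it.\<close>

lemma lc_global: assumes L: "osub smul L" and x: "\<And>p. prime p \<Longrightarrow> x \<in> lc p L" shows "x \<in> L"
proof -
  define I where "I = {u::int. smul (of_int u) x \<in> L}"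
  have I_add: "a + b \<in> I" if "a \<in> I" "b \<in> I" for a b
    using osub_add[OF L] that by (simp add: I_def scale_left_distrib)
  have I_mult: "c * a \<in> I" if "a \<in> I" for a c
    using osub_scale[OF L O_int[of c], of "smul (of_int a) x"] that by (simp add: I_def)
  obtain u0 where "u0 \<in> I" "\<not> int 2 dvd u0" using x[of 2] unfolding lc_iff I_def by auto
  then have u0: "u0 \<in> I" "u0 \<noteq> 0" by auto
  define P where "P k \<longleftrightarrow> k > 0 \<and> int k \<in> I" for k :: nat
  have "\<bar>u0\<bar> \<in> I" using I_mult[OF u0(1), of "sgn u0"] by (metis abs_sgn mult.commute)
  then have "P (nat \<bar>u0\<bar>)" unfolding P_def using u0(2) by simp
  define g where "g = (LEAST k. P k)"
  have g: "P g" unfolding g_def by (rule LeastI) fact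
  have dvd: "int g dvd u" if "u \<in> I" for u
  proof -
    define r where "r = u mod int g"
    have rI: "r \<in> I"
      using I_add[OF that I_mult[of "int g" "- (u div int g)"]] g
      by (simp add: P_def r_def minus_div_mult_eq_mod)
    have r: "r < int g" "0 \<le> r" using g by (simp_all add: P_def r_def)
    have "r = 0"
    proof (rule ccontr)
      assume "r \<noteq> 0"
      then have "P (nat r)" using r(2) rI by (simp add: P_def)
      then have "g \<le> nat r" unfolding g_def by (rule Least_le)
      then show False using r by linarith
    qed
    then show ?thesis unfolding r_def by (rule dvd_eq_mod_eq_0[THEN iffD2])
  qed
  have "g = 1"
  proof (rule ccontr)
    assume "g \<noteq> 1"
    then obtain p where p: "prime p" "p dvd g" by (metis prime_factor_nat)
    obtain u where "u \<in> I" "\<not> int p dvd u" using x[OF p(1)] unfolding lc_iff I_def by blast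
    then show False using dvd p(2) by (meson dvd_trans int_dvd_int_iff)
  qed
  then show ?thesis using g unfolding P_def I_def by simp
qed

text \<open>With w u = 1 + p^k t, the vector x equals w (u x) - p^k t x, and both terms lie in p^k
  L. So for vectors of \<open>L\<close> membership in p^k L is decided at \<open>p\<close>
  alone.\<close>

lemma lc_power: assumes p: "prime p" and L: "osub smul L" and x: "x \<in> L" "x \<in> lc p (smul (of_nat p ^ k) ` L)"
  shows "x \<in> smul (of_nat p ^ k) ` L"
proof -
  obtain u :: int where u: "\<not> int p dvd u" "smul (of_int u) x \<in> smul (of_nat p ^ k) ` L" using x(2) unfolding lc_iff by blast
  then obtain y where y: "y \<in> L" "smul (of_int u) x = smul (of_nat p ^ k) y" by blast
  obtain w t where wt: "w * u = 1 + int p ^ k * t" using coprime_power_inverse[OF p u(1)] by blast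
  have "x = smul (of_int (w * u)) x - smul (of_int (int p ^ k * t)) x" unfolding wt by (simp add: scale_left_distrib)
  also have "smul (of_int (w * u)) x = smul (of_int w) (smul (of_int u) x)" by simp
  also have "\<dots> = smul (of_nat p ^ k) (smul (of_int w) y)" unfolding y(2) by (simp add: mult.commute)
  also have "smul (of_int (int p ^ k * t)) x = smul (of_nat p ^ k) (smul (of_int t) x)" by simp
  finally have "x = smul (of_nat p ^ k) (smul (of_int w) y - smul (of_int t) x)" by (simp add: scale_right_diff_distrib)
  moreover have "smul (of_int w) y - smul (of_int t) x \<in> L"
    by (intro osub_diff[OF L] osub_scale[OF L O_int] y x)
  ultimately show ?thesis by blast
qed

lemma latt_multiple: assumes L: "is_lattice smul L" shows "\<exists>m::int. m > 0 \<and> smul (of_int m) v \<in> L"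
proof -
  have oL: "osub smul L" using L fg_osub unfolding is_lattice_def fg_def by blast
  have "span L \<subseteq> {v. \<exists>m::int. m > 0 \<and> smul (of_int m) v \<in> L}"
  proof (rule span_minimal)
    show "L \<subseteq> {v. \<exists>m::int. m > 0 \<and> smul (of_int m) v \<in> L}" by (auto intro!: exI[of _ 1])
    show "subspace {v. \<exists>m::int. m > 0 \<and> smul (of_int m) v \<in> L}"
      unfolding subspace_def
    proof (intro conjI ballI allI)
      show "0 \<in> {v. \<exists>m::int. m > 0 \<and> smul (of_int m) v \<in> L}" using osub_0[OF oL] by (auto intro!: exI[of _ 1])
    next
      fix x y assume "x \<in> {v. \<exists>m::int. m > 0 \<and> smul (of_int m) v \<in> L}" "y \<in> {v. \<exists>m::int. m > 0 \<and> smul (of_int m) v \<in> L}"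
      then obtain a b :: int where ab: "a > 0" "smul (of_int a) x \<in> L" "b > 0" "smul (of_int b) y \<in> L" by blast
      have "smul (of_int b) (smul (of_int a) x) + smul (of_int a) (smul (of_int b) y) \<in> L"
        by (rule osub_add[OF oL osub_scale[OF oL O_int ab(2)] osub_scale[OF oL O_int ab(4)]])
      then have "smul (of_int (a * b)) (x + y) \<in> L" by (simp add: scale_right_distrib mult.commute)
      moreover have "a * b > 0" using ab by simp
      ultimately show "x + y \<in> {v. \<exists>m::int. m > 0 \<and> smul (of_int m) v \<in> L}" by blast
    next
      fix c x assume "x \<in> {v. \<exists>m::int. m > 0 \<and> smul (of_int m) v \<in> L}"
      then obtain a :: int where a: "a > 0" "smul (of_int a) x \<in> L" by blast
      obtain k where k: "k > 0" "of_int k * c \<in> Ok" using int_multiple_in_O by blast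
      have "smul (of_int k * c) (smul (of_int a) x) \<in> L" by (rule osub_scale[OF oL k(2) a(2)])
      then have "smul (of_int (k * a)) (smul c x) \<in> L" by (simp add: mult_ac)
      moreover have "k * a > 0" using a k by simp
      ultimately show "smul c x \<in> {v. \<exists>m::int. m > 0 \<and> smul (of_int m) v \<in> L}" by blast
    qed
  qed
  then show ?thesis using L unfolding is_lattice_def by auto
qed

lemma is_lattice_osub: "is_lattice smul L \<Longrightarrow> osub smul L"
  using fg_osub unfolding is_lattice_def fg_def by blast

lemma latt_commensurable:
  assumes L: "is_lattice smul L" and L': "is_lattice smul L'"
  shows "\<exists>m::int. m > 0 \<and> (\<forall>x\<in>L. smul (of_int m) x \<in> L')"
proof -
  obtain X where X: "finite X" "L = o_span smul X" using L unfolding is_lattice_def by blast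
  have oL': "osub smul L'" by (rule is_lattice_osub[OF L'])
  from X(1) have "\<exists>m::int. m > 0 \<and> (\<forall>x\<in>X. smul (of_int m) x \<in> L')"
  proof (induction X)
    case empty show ?case by (rule exI[of _ 1]) simp
  next
    case (insert x X)
    then obtain a :: int where a: "a > 0" "\<forall>x\<in>X. smul (of_int a) x \<in> L'" by blast
    obtain b :: int where b: "b > 0" "smul (of_int b) x \<in> L'" using latt_multiple[OF L'] by blast
    have "smul (of_int (a * b)) y \<in> L'" if "y \<in> insert x X" for y
    proof (cases "y = x")
      case True
      then show ?thesis using osub_scale[OF oL' O_int[of a] b(2)] by simp
    next
      case False
      then have "smul (of_int a) y \<in> L'" using a(2) that by blast
      from osub_scale[OF oL' O_int[of b] this] show ?thesis by (simp add: mult.commute)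
    qed
    then show ?case using a(1) b(1) by (intro exI[of _ "a * b"]) simp
  qed
  then obtain m :: int where m: "m > 0" "\<forall>x\<in>X. smul (of_int m) x \<in> L'" by blast
  have "osub smul {x. smul (of_int m) x \<in> L'}"
    using oL' unfolding osub_def by (auto simp: scale_right_distrib mult.commute) (metis mult.commute scale_scale)
  then have "L \<subseteq> {x. smul (of_int m) x \<in> L'}" unfolding X(2) by (rule o_span_least) (use m in auto)
  then show ?thesis using m(1) by blast
qed

text \<open>Powers of \<open>p\<close> tend to 0 uniformly on a lattice; this makes error terms p^i
  v_i with all v_i in one lattice null.\<close>

lemma latt_power_lc:
  assumes p: "prime p" and L: "is_lattice smul L" and L': "is_lattice smul L'"
  shows "\<exists>k. \<forall>x\<in>L. \<forall>j\<ge>k. smul (of_nat p ^ j) x \<in> lc p L'"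
proof -
  obtain m :: int where m: "m > 0" "\<forall>x\<in>L. smul (of_int m) x \<in> L'" using latt_commensurable[OF L L'] by blast
  obtain m' where m': "m = int p ^ multiplicity (int p) m * m'" "\<not> int p dvd m'"
    using multiplicity_decompose'[of m "int p"] m(1) p by (metis less_irrefl not_prime_unit prime_int_nat_transfer prime_nat_int_transfer)
  have "smul (of_nat p ^ j) x \<in> lc p L'" if xj: "x \<in> L" "j \<ge> multiplicity (int p) m" for x j
  proof -
    obtain i where i: "j = i + multiplicity (int p) m" using xj(2) by (metis le_add_diff_inverse2)
    have "smul (of_int m) (smul (of_nat p ^ i) x) \<in> L'"
      using m(2) osub_scale[OF is_lattice_osub[OF L] O_nat[of "p ^ i"] xj(1)] by (simp del: scale_scale)
    also have "smul (of_int m) (smul (of_nat p ^ i) x) = smul (of_int m') (smul (of_nat p ^ j) x)"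
      by (subst m'(1)) (simp add: i power_add mult_ac)
    finally show ?thesis using m'(2) unfolding lc_iff by blast
  qed
  then show ?thesis by blast
qed

section \<open>Null sequences, Cauchy sequences and completions\<close>

abbreviation nullp where "nullp \<equiv> padic_null smul"
abbreviation cauchyp where "cauchyp \<equiv> padic_Cauchy smul"
abbreviation clsp where "clsp \<equiv> padic_class smul"
abbreviation compl where "compl \<equiv> padic_completion smul"

lemma null_add: assumes p: "prime p" and "nullp p x" "nullp p y" shows "nullp p (\<lambda>i. x i + y i)"
  unfolding padic_null_def
proof (intro allI impI)
  fix L assume L: "is_lattice smul L"
  obtain M where M: "\<forall>n\<ge>M. x n \<in> lc p L" using assms(2) L unfolding padic_null_def by blast
  obtain M' where M': "\<forall>n\<ge>M'. y n \<in> lc p L" using assms(3) L unfolding padic_null_def by blast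
  show "\<exists>M. \<forall>n\<ge>M. x n + y n \<in> lc p L"
    using M M' osub_add[OF osub_lc[OF p is_lattice_osub[OF L]]] by (intro exI[of _ "max M M'"]) auto
qed

lemma null_uminus: assumes p: "prime p" and "nullp p x" shows "nullp p (\<lambda>i. - x i)"
  using assms(2) osub_minus[OF osub_lc[OF p is_lattice_osub]] unfolding padic_null_def by meson

lemma null_diff: "prime p \<Longrightarrow> nullp p x \<Longrightarrow> nullp p y \<Longrightarrow> nullp p (\<lambda>i. x i - y i)"
  using null_add[of p x "\<lambda>i. - y i"] null_uminus[of p y] by simp

lemma null_0: "prime p \<Longrightarrow> nullp p (\<lambda>_. 0)"
  unfolding padic_null_def using lc_base osub_0[OF is_lattice_osub] by blast

lemma cauchy_const: "prime p \<Longrightarrow> cauchyp p (\<lambda>_. x)"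
  unfolding padic_Cauchy_def using lc_base osub_0[OF is_lattice_osub] by auto

lemma cauchy_null: assumes p: "prime p" and x: "cauchyp p x" and d: "nullp p (\<lambda>i. x i - y i)" shows "cauchyp p y"
  unfolding padic_Cauchy_def
proof (intro allI impI)
  fix L assume L: "is_lattice smul L"
  note o = osub_lc[OF p is_lattice_osub[OF L]]
  obtain M where M: "\<forall>m\<ge>M. \<forall>n\<ge>M. x m - x n \<in> lc p L" using x L unfolding padic_Cauchy_def by blast
  obtain M' where M': "\<forall>n\<ge>M'. x n - y n \<in> lc p L" using d L unfolding padic_null_def by blast
  have "y m - y n \<in> lc p L" if "m \<ge> max M M'" "n \<ge> max M M'" for m n
  proof -
    have "(x m - x n) - (x m - y m) + (x n - y n) \<in> lc p L"
      by (rule osub_add[OF o osub_diff[OF o]]) (use M M' that in auto)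
    then show ?thesis by (simp add: algebra_simps)
  qed
  then show "\<exists>M. \<forall>m\<ge>M. \<forall>n\<ge>M. y m - y n \<in> lc p L" by blast
qed

lemma cls_self: "prime p \<Longrightarrow> cauchyp p x \<Longrightarrow> x \<in> clsp p x"
  unfolding padic_class_def using null_0 by simp

lemma cls_eq: assumes p: "prime p" and d: "nullp p (\<lambda>i. x i - y i)" shows "clsp p x = clsp p y"
proof -
  have "nullp p (\<lambda>i. x i - z i) \<longleftrightarrow> nullp p (\<lambda>i. y i - z i)" for z
  proof
    assume "nullp p (\<lambda>i. x i - z i)"
    from null_diff[OF p this d] show "nullp p (\<lambda>i. y i - z i)" by simp
  next
    assume "nullp p (\<lambda>i. y i - z i)"
    from null_add[OF p d this] show "nullp p (\<lambda>i. x i - z i)" by simp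
  qed
  then show ?thesis unfolding padic_class_def by simp
qed

text \<open>If u x_i lies in \<open>L\<close> and w u = 1 + p^i t, then w u x_i lies in
  \<open>L\<close> and differs from x_i by p^i t x_i, a null sequence. Hence the completion depends
  on the localization only.\<close>

lemma compl_subset:
  assumes p: "prime p" and N: "is_lattice smul N" and L: "osub smul L" and sub: "N \<subseteq> lc p L"
  shows "compl p N \<subseteq> compl p L"
proof
  fix X assume "X \<in> compl p N"
  then obtain x where x: "X = clsp p x" "cauchyp p x" "range x \<subseteq> N" unfolding padic_completion_def by blast
  have "\<exists>y t. y \<in> L \<and> x i - y = smul (of_nat p ^ i) (smul (of_int t) (x i))" for i
  proof -
    have "x i \<in> lc p L" using sub x(3) by blast
    then obtain u :: int where u: "\<not> int p dvd u" "smul (of_int u) (x i) \<in> L" unfolding lc_iff by blast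
    obtain w t where wt: "w * u = 1 + int p ^ i * t" using coprime_power_inverse[OF p u(1)] by blast
    have "smul (of_int (w * u)) (x i) \<in> L" using osub_scale[OF L O_int[of w] u(2)] by simp
    moreover have "x i - smul (of_int (w * u)) (x i) = smul (of_nat p ^ i) (smul (of_int (- t)) (x i))"
      unfolding wt by (simp add: scale_left_distrib scale_minus_left)
    ultimately show ?thesis by blast
  qed
  then obtain y t where y: "\<And>i. y i \<in> L" "\<And>i. x i - y i = smul (of_nat p ^ i) (smul (of_int (t i)) (x i))" by metis
  have d: "nullp p (\<lambda>i. x i - y i)" unfolding padic_null_def
  proof (intro allI impI)
    fix L' assume L': "is_lattice smul L'"
    obtain k where k: "\<forall>x\<in>N. \<forall>j\<ge>k. smul (of_nat p ^ j) x \<in> lc p L'" using latt_power_lc[OF p N L'] by blast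
    have "smul (of_int (t i)) (x i) \<in> N" for i
      by (rule osub_scale[OF is_lattice_osub[OF N] O_int]) (use x(3) in blast)
    then have "x i - y i \<in> lc p L'" if "i \<ge> k" for i
      unfolding y(2) using k that by blast
    then show "\<exists>M. \<forall>n\<ge>M. x n - y n \<in> lc p L'" by blast
  qed
  have "X = clsp p y" unfolding x(1) by (rule cls_eq[OF p d])
  moreover have "cauchyp p y" by (rule cauchy_null[OF p x(2) d])
  ultimately show "X \<in> compl p L" unfolding padic_completion_def using y(1) by blast
qed

lemma compl_eq:
  assumes "prime p" "is_lattice smul N" "is_lattice smul L" "lc p N = lc p L"
  shows "compl p N = compl p L"
  using compl_subset[of p N L] compl_subset[of p L N] assms is_lattice_osub lc_base
  by (metis subsetI subset_antisym)

end

lemma (in imag_quad) lattice_pr: assumes c: "c \<noteq> 0" shows "is_lattice (*) (pr c)"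
proof -
  have "t \<in> K.span (pr c)" for t
    using K.span_scale[OF K.span_base[OF prI], of "t / c" c] c by simp
  then have "K.span (pr c) = UNIV" by auto
  then show ?thesis using frac_pr[OF c] by (simp add: is_lattice_def frac_iff fg_def)
qed

lemma (in imag_quad) lattice_O: "is_lattice (*) Ok"
  using lattice_pr[of 1] by simp

lemma locally_isometric_trans:
  assumes "locally_isometric smul h p M N" "locally_isometric smul h p N L"
  shows "locally_isometric smul h p M L"
proof -
  obtain \<phi> where f: "bij_betw \<phi> (padic_completion smul p M) (padic_completion smul p N)"
    "\<And>X Y. X \<in> padic_completion smul p M \<Longrightarrow> Y \<in> padic_completion smul p M \<Longrightarrow>
      \<phi> (loc_add smul p X Y) = loc_add smul p (\<phi> X) (\<phi> Y) \<and> loc_form h p (\<phi> X) (\<phi> Y) = loc_form h p X Y"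
    "\<And>A X. A \<in> padic_completion (*) p int_ring \<Longrightarrow> X \<in> padic_completion smul p M \<Longrightarrow>
      \<phi> (loc_scale smul p A X) = loc_scale smul p A (\<phi> X)"
    using assms(1) unfolding locally_isometric_def by blast
  obtain \<psi> where g: "bij_betw \<psi> (padic_completion smul p N) (padic_completion smul p L)"
    "\<And>X Y. X \<in> padic_completion smul p N \<Longrightarrow> Y \<in> padic_completion smul p N \<Longrightarrow>
      \<psi> (loc_add smul p X Y) = loc_add smul p (\<psi> X) (\<psi> Y) \<and> loc_form h p (\<psi> X) (\<psi> Y) = loc_form h p X Y"
    "\<And>A X. A \<in> padic_completion (*) p int_ring \<Longrightarrow> X \<in> padic_completion smul p N \<Longrightarrow>
      \<psi> (loc_scale smul p A X) = loc_scale smul p A (\<psi> X)"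
    using assms(2) unfolding locally_isometric_def by blast
  have m: "\<phi> X \<in> padic_completion smul p N" if "X \<in> padic_completion smul p M" for X
    using bij_betwE[OF f(1)] that by blast
  show ?thesis unfolding locally_isometric_def
    by (intro exI[of _ "\<psi> \<circ> \<phi>"] conjI ballI bij_betw_trans[OF f(1) g(1)])
      (simp_all add: f g m)
qed

context herm_space
begin

section \<open>Isometries of the space and their action on completions\<close>

abbreviation UV where "UV \<equiv> unitary_group smul h"

lemma UV_D: assumes "\<sigma> \<in> UV"
  shows "\<sigma> (x + y) = \<sigma> x + \<sigma> y" "\<sigma> (smul c x) = smul c (\<sigma> x)" "bij \<sigma>" "h (\<sigma> x) (\<sigma> y) = h x y"
proof -
  have "Vector_Spaces.linear smul smul \<sigma>" using assms by (simp add: unitary_group_def)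
  then interpret l: Vector_Spaces.linear smul smul \<sigma> .
  show "\<sigma> (x + y) = \<sigma> x + \<sigma> y" "\<sigma> (smul c x) = smul c (\<sigma> x)" by (rule l.add, rule l.scale)
qed (use assms in \<open>auto simp: unitary_group_def\<close>)

lemma UV_I:
  assumes "\<And>x y. \<sigma> (x + y) = \<sigma> x + \<sigma> y" "\<And>c x. \<sigma> (smul c x) = smul c (\<sigma> x)" "bij \<sigma>"
    "\<And>x y. h (\<sigma> x) (\<sigma> y) = h x y"
  shows "\<sigma> \<in> UV"
proof -
  have "Vector_Spaces.linear smul smul \<sigma>" by unfold_locales (simp_all add: assms)
  then show ?thesis using assms by (simp add: unitary_group_def)
qed

lemma UV_id: "id \<in> UV" by (rule UV_I) auto
lemma UV_comp: "\<sigma> \<in> UV \<Longrightarrow> \<tau> \<in> UV \<Longrightarrow> \<sigma> \<circ> \<tau> \<in> UV"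
  by (rule UV_I) (auto simp: UV_D intro: bij_comp)
lemma UV_inv: assumes s: "\<sigma> \<in> UV" shows "inv_into UNIV \<sigma> \<in> UV"
proof (rule UV_I)
  have b: "bij \<sigma>" by (rule UV_D(3)[OF s])
  have i: "\<sigma> (inv_into UNIV \<sigma> x) = x" "inv_into UNIV \<sigma> (\<sigma> x) = x" for x
    using b by (simp_all add: bij_is_surj surj_f_inv_f bij_is_inj)
  show "inv_into UNIV \<sigma> (x + y) = inv_into UNIV \<sigma> x + inv_into UNIV \<sigma> y" for x y
    using i(2)[of "inv_into UNIV \<sigma> x + inv_into UNIV \<sigma> y"] by (simp add: UV_D[OF s] i)
  show "inv_into UNIV \<sigma> (smul c x) = smul c (inv_into UNIV \<sigma> x)" for c x
    using i(2)[of "smul c (inv_into UNIV \<sigma> x)"] by (simp add: UV_D[OF s] i)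
  show "bij (inv_into UNIV \<sigma>)" by (rule bij_imp_bij_inv[OF b])
  show "h (inv_into UNIV \<sigma> x) (inv_into UNIV \<sigma> y) = h x y" for x y
    using UV_D(4)[OF s, of "inv_into UNIV \<sigma> x" "inv_into UNIV \<sigma> y"] by (simp add: i)
qed

lemma UV_latt: assumes s: "\<sigma> \<in> UV" shows "latt L \<Longrightarrow> latt (\<sigma> ` L)"
  using latt_image[of \<sigma> L] UV_D[OF s] bij_is_surj by blast

lemma UV_diff: "\<sigma> \<in> UV \<Longrightarrow> \<sigma> (x - y) = \<sigma> x - \<sigma> y"
  using UV_D(1)[of \<sigma> "x - y" y] by simp

lemma lc_UV: assumes s: "\<sigma> \<in> UV" shows "\<sigma> x \<in> lc p (\<sigma> ` L) \<longleftrightarrow> x \<in> lc p L"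
  unfolding lc_iff UV_D(2)[OF s, symmetric] using UV_D(3)[OF s] by (auto simp: bij_is_inj inj_image_mem_iff)

lemma UV_latt_preimage: assumes s: "\<sigma> \<in> UV" and L: "latt L" obtains L' where "latt L'" "L = \<sigma> ` L'"
proof
  show "latt (inv_into UNIV \<sigma> ` L)" by (rule UV_latt[OF UV_inv[OF s] L])
  show "L = \<sigma> ` inv_into UNIV \<sigma> ` L"
    using UV_D(3)[OF s] by (simp add: image_image bij_is_surj surj_f_inv_f)
qed

lemma null_UV: assumes s: "\<sigma> \<in> UV" shows "nullp p (\<lambda>i. \<sigma> (x i)) \<longleftrightarrow> nullp p x"
proof
  assume n: "nullp p (\<lambda>i. \<sigma> (x i))"
  show "nullp p x" unfolding padic_null_def
  proof (intro allI impI)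
    fix L assume "latt L"
    then have "latt (\<sigma> ` L)" by (rule UV_latt[OF s])
    then show "\<exists>M. \<forall>n\<ge>M. x n \<in> lc p L" using n lc_UV[OF s] unfolding padic_null_def by blast
  qed
next
  assume n: "nullp p x"
  show "nullp p (\<lambda>i. \<sigma> (x i))" unfolding padic_null_def
  proof (intro allI impI)
    fix L assume "latt L"
    then obtain L' where L': "latt L'" "L = \<sigma> ` L'" using UV_latt_preimage[OF s] by blast
    then show "\<exists>M. \<forall>n\<ge>M. \<sigma> (x n) \<in> lc p L" using n lc_UV[OF s] unfolding padic_null_def by blast
  qed
qed

lemma cauchy_UV: assumes s: "\<sigma> \<in> UV" shows "cauchyp p (\<lambda>i. \<sigma> (x i)) \<longleftrightarrow> cauchyp p x"
proof
  assume n: "cauchyp p (\<lambda>i. \<sigma> (x i))"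
  show "cauchyp p x" unfolding padic_Cauchy_def
  proof (intro allI impI)
    fix L assume "latt L"
    then have "latt (\<sigma> ` L)" by (rule UV_latt[OF s])
    then show "\<exists>M. \<forall>m\<ge>M. \<forall>n\<ge>M. x m - x n \<in> lc p L"
      using n lc_UV[OF s] unfolding padic_Cauchy_def UV_diff[OF s, symmetric] by blast
  qed
next
  assume n: "cauchyp p x"
  show "cauchyp p (\<lambda>i. \<sigma> (x i))" unfolding padic_Cauchy_def
  proof (intro allI impI)
    fix L assume "latt L"
    then obtain L' where L': "latt L'" "L = \<sigma> ` L'" using UV_latt_preimage[OF s] by blast
    then show "\<exists>M. \<forall>m\<ge>M. \<forall>n\<ge>M. \<sigma> (x m) - \<sigma> (x n) \<in> lc p L"
      using n lc_UV[OF s] unfolding padic_Cauchy_def UV_diff[OF s, symmetric] by blast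
  qed
qed

lemma cls_UV: assumes s: "\<sigma> \<in> UV" shows "(\<lambda>y i. \<sigma> (y i)) ` clsp p x = clsp p (\<lambda>i. \<sigma> (x i))"
proof (intro subset_antisym subsetI)
  fix z assume "z \<in> (\<lambda>y i. \<sigma> (y i)) ` clsp p x"
  then obtain y where "z = (\<lambda>i. \<sigma> (y i))" "cauchyp p y" "nullp p (\<lambda>i. x i - y i)" unfolding padic_class_def by blast
  then show "z \<in> clsp p (\<lambda>i. \<sigma> (x i))"
    unfolding padic_class_def by (simp add: cauchy_UV[OF s] UV_diff[OF s, symmetric] null_UV[OF s])
next
  fix z assume z: "z \<in> clsp p (\<lambda>i. \<sigma> (x i))"
  define y where "y i = inv_into UNIV \<sigma> (z i)" for i
  have zy: "z = (\<lambda>i. \<sigma> (y i))" unfolding y_def using UV_D(3)[OF s] by (simp add: bij_is_surj surj_f_inv_f)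
  then have "y \<in> clsp p x" using z unfolding padic_class_def
    by (simp add: cauchy_UV[OF s] UV_diff[OF s, symmetric] null_UV[OF s])
  then show "z \<in> (\<lambda>y i. \<sigma> (y i)) ` clsp p x" using zy by blast
qed

text \<open>An isometry of V acts term by term on sequences. All local isometries constructed below
  come from this lemma and from composition; the image of \<open>N\<close> has to agree with
  \<open>L\<close> only after localization at \<open>p\<close>.\<close>

lemma locally_isometric_UV:
  assumes p: "prime p" and s: "\<sigma> \<in> UV" and N: "latt N" and L: "latt L" and eq: "lc p (\<sigma> ` N) = lc p L"
  shows "locally_isometric smul h p N L"
proof -
  define \<phi> where "\<phi> X = (\<lambda>y i. \<sigma> (y i)) ` X" for X :: "(nat \<Rightarrow> 'v) set"
  have inj: "inj (\<lambda>y i. \<sigma> (y i) :: 'v)"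
    using UV_D(3)[OF s] by (auto intro!: injI simp: fun_eq_iff bij_is_inj inj_eq)
  have \<phi>cls: "\<phi> (clsp p x) = clsp p (\<lambda>i. \<sigma> (x i))" for x unfolding \<phi>_def by (rule cls_UV[OF s])
  have "\<phi> ` compl p N = compl p (\<sigma> ` N)"
  proof (intro subset_antisym subsetI)
    fix Z assume "Z \<in> \<phi> ` compl p N"
    then obtain x where x: "Z = clsp p (\<lambda>i. \<sigma> (x i))" "cauchyp p x" "range x \<subseteq> N"
      unfolding padic_completion_def by (auto simp: \<phi>cls)
    then show "Z \<in> compl p (\<sigma> ` N)"
      unfolding padic_completion_def using cauchy_UV[OF s, of p x] by (intro CollectI exI[of _ "\<lambda>i. \<sigma> (x i)"]) auto
  next
    fix Z assume "Z \<in> compl p (\<sigma> ` N)"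
    then obtain z where z: "Z = clsp p z" "cauchyp p z" "\<And>i. z i \<in> \<sigma> ` N"
      unfolding padic_completion_def by blast
    then have "\<forall>i. \<exists>x. x \<in> N \<and> z i = \<sigma> x" by blast
    then obtain x where x: "\<And>i. x i \<in> N" "\<And>i. z i = \<sigma> (x i)" by metis
    then have "z = (\<lambda>i. \<sigma> (x i))" by auto
    then have "Z = \<phi> (clsp p x)" "cauchyp p x" using z cauchy_UV[OF s] by (auto simp: \<phi>cls)
    then show "Z \<in> \<phi> ` compl p N" unfolding padic_completion_def using x(1) by blast
  qed
  also have "\<dots> = compl p L" by (rule compl_eq[OF p UV_latt[OF s N] L eq])
  finally have im: "\<phi> ` compl p N = compl p L" .
  have "inj \<phi>" by (rule injI) (simp add: \<phi>_def inj_image_eq_iff[OF inj])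
  then have "bij_betw \<phi> (compl p N) (compl p L)" using im by (auto simp: bij_betw_def inj_on_def)
  moreover have "\<phi> (loc_add smul p X Y) = loc_add smul p (\<phi> X) (\<phi> Y)" for X Y
  proof -
    have "\<phi> (loc_add smul p X Y) = (\<Union>x\<in>X. \<Union>y\<in>Y. \<phi> (clsp p (\<lambda>i. x i + y i)))"
      unfolding loc_add_def \<phi>_def by (simp add: image_UN)
    also have "\<dots> = loc_add smul p (\<phi> X) (\<phi> Y)"
      unfolding \<phi>cls loc_add_def by (simp add: \<phi>_def UV_D[OF s])
    finally show ?thesis .
  qed
  moreover have "loc_form h p (\<phi> X) (\<phi> Y) = loc_form h p X Y" for X Y
    unfolding loc_form_def \<phi>_def by (simp add: UV_D[OF s])
  moreover have "\<phi> (loc_scale smul p A X) = loc_scale smul p A (\<phi> X)" for A X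
  proof -
    have "\<phi> (loc_scale smul p A X) = (\<Union>a\<in>A. \<Union>x\<in>X. \<phi> (clsp p (\<lambda>i. smul (a i) (x i))))"
      unfolding loc_scale_def \<phi>_def by (simp add: image_UN)
    also have "\<dots> = loc_scale smul p A (\<phi> X)"
      unfolding \<phi>cls loc_scale_def by (simp add: \<phi>_def UV_D[OF s])
    finally show ?thesis .
  qed
  ultimately show ?thesis unfolding locally_isometric_def by (intro exI[of _ \<phi>]) simp
qed

lemma locally_isometric_lc:
  assumes "prime p" "latt N" "latt L" "lc p N = lc p L"
  shows "locally_isometric smul h p N L"
  using locally_isometric_UV[OF assms(1) UV_id assms(2,3)] assms(4) by simp

section \<open>Unimodularity passes to the whole genus\<close>

abbreviation lcK where "lcK \<equiv> localization ((*) :: 'k \<Rightarrow> 'k \<Rightarrow> 'k)"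

lemma h_lc:
  assumes p: "prime p" and J: "osubK J" and "\<And>x y. x \<in> M \<Longrightarrow> y \<in> L \<Longrightarrow> h x y \<in> J" and "x \<in> lc p M" "y \<in> lc p L"
  shows "h x y \<in> lcK p J"
proof -
  obtain u :: int where u: "\<not> int p dvd u" "smul (of_int u) x \<in> M" using assms(4) unfolding lc_iff by blast
  obtain w :: int where w: "\<not> int p dvd w" "smul (of_int w) y \<in> L" using assms(5) unfolding lc_iff by blast
  have "h (smul (of_int u) x) (smul (of_int w) y) \<in> J" using assms(3) u w by blast
  then have "of_int (u * w) * h x y \<in> J" by (simp add: h_scale_left h_scale_right mult_ac)
  moreover have "\<not> int p dvd u * w" using u w p by (simp add: prime_dvd_mult_iff)
  ultimately show ?thesis unfolding K.lc_iff by blast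
qed

lemma cls_lc_eventually:
  assumes p: "prime p" and L: "latt L" and "range z \<subseteq> L" "x \<in> clsp p z"
  shows "\<exists>M. \<forall>i\<ge>M. x i \<in> lc p L"
proof -
  note o = osub_lc[OF p latt_osub[OF L]]
  have "nullp p (\<lambda>i. z i - x i)" using assms(4) unfolding padic_class_def by blast
  then obtain M where M: "\<forall>i\<ge>M. z i - x i \<in> lc p L" using L unfolding padic_null_def by blast
  have "x i \<in> lc p L" if "i \<ge> M" for i
  proof -
    have "z i \<in> lc p L" using assms(3) lc_base[OF p] by blast
    then have "z i - (z i - x i) \<in> lc p L" by (rule osub_diff[OF o]) (use M that in blast)
    then show ?thesis by simp
  qed
  then show ?thesis by blast
qed

lemma const_compl: "prime p \<Longrightarrow> x \<in> N \<Longrightarrow> clsp p (\<lambda>_. x) \<in> compl p N"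
  unfolding padic_completion_def using cauchy_const by blast

lemma latt_scale: assumes c: "c \<noteq> 0" and L: "latt L" shows "latt (smul c ` L)"
proof (rule latt_image[OF _ _ _ L])
  show "surj (smul c)"
  proof (rule surjI)
    fix x show "smul c (smul (1 / c) x) = x" using c by simp
  qed
qed (simp_all add: scale_right_distrib mult.commute)

text \<open>Turns an equality of form values in the completion into a statement in K. The constant
  sequence h(x, y) belongs to the right side, so up to a null sequence it is h(x'_i, y'_i) for
  representatives of the left side, which eventually lie in the localizations of \<open>M\<close>
  and \<open>L\<close>.\<close>

lemma form_const_mem:
  assumes p: "prime p" and J: "is_lattice (*) J" and N: "range z \<subseteq> M" "latt M" "range w \<subseteq> L" "latt L"
    and hJ: "\<And>x y. x \<in> M \<Longrightarrow> y \<in> L \<Longrightarrow> h x y \<in> J"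
    and eq: "loc_form h p (clsp p z) (clsp p w) = loc_form h p (clsp p (\<lambda>_. x)) (clsp p (\<lambda>_. y))"
  shows "h x y \<in> lcK p J"
proof -
  have oJ: "osubK J" by (rule K.is_lattice_osub[OF J])
  have "(\<lambda>_. h x y) \<in> padic_class (*) p (\<lambda>_. h x y)" by (rule K.cls_self[OF p K.cauchy_const[OF p]])
  then have "(\<lambda>_. h x y) \<in> loc_form h p (clsp p (\<lambda>_. x)) (clsp p (\<lambda>_. y))"
    unfolding loc_form_def using cls_self[OF p cauchy_const[OF p]] by blast
  then have "(\<lambda>_. h x y) \<in> loc_form h p (clsp p z) (clsp p w)" unfolding eq .
  then obtain x' y' where xy: "x' \<in> clsp p z" "y' \<in> clsp p w" "(\<lambda>_. h x y) \<in> padic_class (*) p (\<lambda>i. h (x' i) (y' i))"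
    unfolding loc_form_def by blast
  obtain M1 where M1: "\<forall>i\<ge>M1. x' i \<in> lc p M" using cls_lc_eventually[OF p N(2,1) xy(1)] by blast
  obtain M2 where M2: "\<forall>i\<ge>M2. y' i \<in> lc p L" using cls_lc_eventually[OF p N(4,3) xy(2)] by blast
  have "padic_null (*) p (\<lambda>i. h (x' i) (y' i) - h x y)" using xy(3) unfolding padic_class_def by simp
  then obtain M3 where M3: "\<forall>i\<ge>M3. h (x' i) (y' i) - h x y \<in> lcK p J" using J unfolding padic_null_def by blast
  define i where "i = max M1 (max M2 M3)"
  have "h (x' i) (y' i) \<in> lcK p J"
    using M1 M2 by (intro h_lc[OF p oJ hJ]) (auto simp: i_def)
  moreover have "h (x' i) (y' i) - h x y \<in> lcK p J" using M3 by (simp add: i_def)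
  ultimately have "h (x' i) (y' i) - (h (x' i) (y' i) - h x y) \<in> lcK p J"
    by (rule K.osub_diff[OF K.osub_lc[OF p oJ]])
  then show ?thesis by simp
qed

text \<open>\<open>loc_scale\<close> is a union over all representatives; since all of them give the
  same class, multiplication by a constant may be computed term by term.\<close>

lemma scale_class:
  assumes p: "prime p" and c: "c \<in> Ok" and L: "latt L" and z: "range z \<subseteq> L" "cauchyp p z"
  shows "loc_scale smul p (padic_class (*) p (\<lambda>_. c)) (clsp p z) = clsp p (\<lambda>i. smul c (z i))"
proof -
  have "clsp p (\<lambda>i. smul (a i) (x i)) = clsp p (\<lambda>i. smul c (z i))"
    if a: "a \<in> padic_class (*) p (\<lambda>_. c)" and x: "x \<in> clsp p z" for a x
  proof (rule cls_eq[OF p], unfold padic_null_def, intro allI impI)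
    fix L' assume L': "latt L'"
    note o' = osub_lc[OF p latt_osub[OF L']]
    \<comment> \<open>A change of the scalar by a multiple of p^k moves vectors of \<open>L\<close>
      by elements of \<open>L'\<close> at \<open>p\<close>.\<close>
    obtain k where k: "\<forall>x\<in>L. \<forall>j\<ge>k. smul (of_nat p ^ j) x \<in> lc p L'" using latt_power_lc[OF p L L'] by blast
    have p0: "(of_nat p ^ k :: 'k) \<noteq> 0" using prime_gt_0_nat[OF p] by simp
    have J: "is_lattice (*) (pr (of_nat p ^ k))" by (rule lattice_pr[OF p0])
    obtain M1 where M1: "\<forall>i\<ge>M1. c - a i \<in> lcK p (pr (of_nat p ^ k))"
      using a J unfolding padic_class_def padic_null_def by blast
    obtain M2 where M2: "\<forall>i\<ge>M2. x i \<in> lc p L" using cls_lc_eventually[OF p L z(1) x] by blast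
    have "nullp p (\<lambda>i. z i - x i)" using x unfolding padic_class_def by blast
    then obtain M3 where M3: "\<forall>i\<ge>M3. z i - x i \<in> lc p L'" using L' unfolding padic_null_def by blast
    have "smul (a i) (x i) - smul c (z i) \<in> lc p L'" if i: "i \<ge> max M1 (max M2 M3)" for i
    proof -
      obtain u :: int where u: "\<not> int p dvd u" "of_int u * (c - a i) \<in> pr (of_nat p ^ k)"
        using M1 i unfolding K.lc_iff by auto
      then obtain e where e: "e \<in> Ok" "of_int u * (c - a i) = of_nat p ^ k * e" unfolding pr_def by blast
      obtain w :: int where w: "\<not> int p dvd w" "smul (of_int w) (x i) \<in> L" using M2 i unfolding lc_iff by auto
      have "smul (of_nat p ^ k) (smul e (smul (of_int w) (x i))) \<in> lc p L'"
        using k osub_scale[OF latt_osub[OF L] e(1) w(2)] by blast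
      also have "smul (of_nat p ^ k) (smul e (smul (of_int w) (x i))) = smul (of_int (u * w)) (smul (c - a i) (x i))"
        using e(2) by (simp add: mult_ac)
      finally have 1: "smul (c - a i) (x i) \<in> lc p L'"
        by (rule lc_descend[OF p, rotated]) (use u w p in \<open>simp add: prime_dvd_mult_iff\<close>)
      have "smul c (z i - x i) \<in> lc p L'" using M3 i by (intro osub_scale[OF o' c]) auto
      from osub_add[OF o' 1 this] have "smul c (z i) - smul (a i) (x i) \<in> lc p L'"
        by (simp add: scale_left_diff_distrib scale_right_diff_distrib)
      from osub_minus[OF o' this] show ?thesis by simp
    qed
    then show "\<exists>M. \<forall>i\<ge>M. smul (a i) (x i) - smul c (z i) \<in> lc p L'" by blast
  qed
  moreover have "(\<lambda>_. c) \<in> padic_class (*) p (\<lambda>_. c)" by (rule K.cls_self[OF p K.cauchy_const[OF p]])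
  moreover have "z \<in> clsp p z" by (rule cls_self[OF p z(2)])
  ultimately show ?thesis unfolding loc_scale_def by blast
qed

lemma locally_isometric_unim_le:
  assumes p: "prime p" and N: "latt N" and L: "latt L" "unim L" and iso: "locally_isometric smul h p N L"
    and xy: "x \<in> N" "y \<in> N"
  shows "h x y \<in> lcK p Ok"
proof -
  obtain \<phi> where f: "bij_betw \<phi> (compl p N) (compl p L)"
    "\<And>X Y. X \<in> compl p N \<Longrightarrow> Y \<in> compl p N \<Longrightarrow> loc_form h p (\<phi> X) (\<phi> Y) = loc_form h p X Y"
    using iso unfolding locally_isometric_def by blast
  have c: "clsp p (\<lambda>_. x) \<in> compl p N" "clsp p (\<lambda>_. y) \<in> compl p N" using const_compl[OF p] xy by blast+
  then have "\<phi> (clsp p (\<lambda>_. x)) \<in> compl p L" "\<phi> (clsp p (\<lambda>_. y)) \<in> compl p L" using bij_betwE[OF f(1)] by blast+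
  then obtain z w where z: "\<phi> (clsp p (\<lambda>_. x)) = clsp p z" "range z \<subseteq> L"
    "\<phi> (clsp p (\<lambda>_. y)) = clsp p w" "range w \<subseteq> L" unfolding padic_completion_def by blast
  show ?thesis
    by (rule form_const_mem[OF p lattice_O z(2) L(1) z(4) L(1)])
      (use unimD[OF L(2)] f(2)[OF c] z in auto)
qed

text \<open>Up to a factor prime to \<open>p\<close>, the vector p^k x is an element
  \<open>y\<close> of \<open>N\<close>. Its image under \<open>\<phi>\<close> pairs with all of
  \<open>L\<close> into multiples of p^k, because \<open>\<phi>\<close> is surjective and preserves
  the form; as \<open>L\<close> is unimodular, the image is p^k times an element of the completion
  of \<open>L\<close>. Pulling that element back and using that \<open>\<phi>\<close> is injective
  shows that \<open>y\<close> is p^k times an element of the completion of \<open>N\<close>, so x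
  lies in \<open>N\<close> at \<open>p\<close>.\<close>

lemma locally_isometric_unim_ge:
  assumes p: "prime p" and N: "latt N" and L: "latt L" "unim L" and iso: "locally_isometric smul h p N L"
    and x: "x \<in> dual N"
  shows "x \<in> lc p N"
proof -
  obtain \<phi> where f: "bij_betw \<phi> (compl p N) (compl p L)"
    "\<And>X Y. X \<in> compl p N \<Longrightarrow> Y \<in> compl p N \<Longrightarrow> loc_form h p (\<phi> X) (\<phi> Y) = loc_form h p X Y"
    "\<And>A X. A \<in> padic_completion (*) p Ok \<Longrightarrow> X \<in> compl p N \<Longrightarrow> \<phi> (loc_scale smul p A X) = loc_scale smul p A (\<phi> X)"
    using iso unfolding locally_isometric_def by blast
  obtain m :: int where m: "m > 0" "smul (of_int m) x \<in> N" using latt_multiple[OF N] by blast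
  define k where "k = multiplicity (int p) m"
  obtain m' where m': "m = int p ^ k * m'" "\<not> int p dvd m'"
    using multiplicity_decompose'[of m "int p"] m(1) p unfolding k_def
    by (metis less_irrefl not_prime_unit prime_int_nat_transfer prime_nat_int_transfer)
  define x' where "x' = smul (of_int m') x"
  define c where "c = (of_nat p ^ k :: 'k)"
  have c: "c \<in> Ok" "c \<noteq> 0" unfolding c_def using prime_gt_0_nat[OF p] O_nat[of "p ^ k"] by simp_all
  have x'd: "x' \<in> dual N" unfolding x'_def by (rule osub_scale[OF osub_dual O_int x])
  define y where "y = smul c x'"
  have y: "y \<in> N" using m(2) m'(1) by (simp add: y_def x'_def c_def mult.commute)
  have cls_y: "clsp p (\<lambda>_. y) \<in> compl p N" by (rule const_compl[OF p y])
  then have "\<phi> (clsp p (\<lambda>_. y)) \<in> compl p L" using bij_betwE[OF f(1)] by blast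
  then obtain z where z: "\<phi> (clsp p (\<lambda>_. y)) = clsp p z" "cauchyp p z" "range z \<subseteq> L"
    unfolding padic_completion_def by blast
  have cL: "latt (smul c ` L)" by (rule latt_scale[OF c(2) L(1)])
  \<comment> \<open>Surjectivity of \<open>\<phi>\<close> gives a class \<open>W\<close> over
    \<open>w\<close>; the values of \<open>h\<close> at \<open>y\<close> and at vectors of
    \<open>N\<close> are multiples of \<open>c\<close> because x' is in the dual of
    \<open>N\<close>.\<close>
  have ev: "\<exists>M. \<forall>i\<ge>M. h (z i) w \<in> lcK p (pr c)" if w: "w \<in> L" for w
  proof -
    have cw: "clsp p (\<lambda>_. w) \<in> compl p L" by (rule const_compl[OF p w])
    then obtain W where W: "W \<in> compl p N" "\<phi> W = clsp p (\<lambda>_. w)" using f(1) by (metis bij_betw_imp_surj_on imageE)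
    then obtain v where v: "W = clsp p v" "range v \<subseteq> N" "cauchyp p v" unfolding padic_completion_def by blast
    have "loc_form h p (clsp p z) (clsp p (\<lambda>_. w)) = loc_form h p (clsp p (\<lambda>_. y)) (clsp p v)"
      using f(2)[OF cls_y W(1)] z(1) W(2) v(1) by simp
    moreover have "(\<lambda>_. w) \<in> clsp p (\<lambda>_. w)" "z \<in> clsp p z"
      using cls_self[OF p] cauchy_const[OF p] z(2) by blast+
    ultimately have "padic_class (*) p (\<lambda>i. h (z i) w) \<subseteq> loc_form h p (clsp p (\<lambda>_. y)) (clsp p v)"
      unfolding loc_form_def by blast
    \<comment> \<open>The class of a sequence that is not Cauchy is empty, and the inclusion above
      would then say nothing; so h(z_i, w) has to be shown to be Cauchy.\<close>
    moreover have "padic_class (*) p (\<lambda>i. h (z i) w) \<noteq> {}"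
    proof -
      have "padic_Cauchy (*) p (\<lambda>i. h (z i) w)" unfolding padic_Cauchy_def
      proof (intro allI impI)
        fix J :: "'k set" assume J: "is_lattice (*) J"
        obtain k where k: "\<forall>t\<in>Ok. \<forall>j\<ge>k. of_nat p ^ j * t \<in> lcK p J"
          using K.latt_power_lc[OF p lattice_O J] by auto
        have "of_nat p ^ k \<noteq> (0::'k)" using prime_gt_0_nat[OF p] by simp
        then have "latt (smul (of_nat p ^ k) ` L)" by (rule latt_scale[OF _ L(1)])
        then obtain M where M: "\<forall>a\<ge>M. \<forall>b\<ge>M. z a - z b \<in> lc p (smul (of_nat p ^ k) ` L)"
          using z(2) unfolding padic_Cauchy_def by blast
        have "h (z a) w - h (z b) w \<in> lcK p J" if ab: "a \<ge> M" "b \<ge> M" for a b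
        proof -
          obtain u :: int where u: "\<not> int p dvd u" "smul (of_int u) (z a - z b) \<in> smul (of_nat p ^ k) ` L"
            using M ab unfolding lc_iff by blast
          then obtain t where t: "t \<in> L" "smul (of_int u) (z a - z b) = smul (of_nat p ^ k) t" by blast
          have "of_int u * (h (z a) w - h (z b) w) = h (smul (of_int u) (z a - z b)) w"
            by (simp add: h_scale_left h_diff_left)
          also have "\<dots> = of_nat p ^ k * h t w" unfolding t(2) by (simp add: h_scale_left)
          also have "\<dots> \<in> lcK p J" using k unimD[OF L(2) t(1) w] by blast
          finally show ?thesis by (rule K.lc_descend[OF p u(1)])
        qed
        then show "\<exists>M. \<forall>a\<ge>M. \<forall>b\<ge>M. h (z a) w - h (z b) w \<in> lcK p J" by blast
      qed
      then show ?thesis using K.cls_self[OF p] by blast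
    qed
    ultimately obtain g y' v' where g: "g \<in> padic_class (*) p (\<lambda>i. h (z i) w)"
      "y' \<in> clsp p (\<lambda>_. y)" "v' \<in> clsp p v" "g \<in> padic_class (*) p (\<lambda>i. h (y' i) (v' i))"
      unfolding loc_form_def by blast
    have prl: "is_lattice (*) (pr c)" by (rule lattice_pr[OF c(2)])
    note oc = K.osub_lc[OF p osub_pr[of c]]
    define cN where "cN = {t. \<forall>v\<in>N. h t v \<in> pr c}"
    have "y \<in> cN"
    proof -
      have "h y v = c * h x' v" for v by (simp add: y_def h_scale_left)
      then show ?thesis unfolding cN_def using x'd c(2) by (auto simp: dual_iff pr_def)
    qed
    \<comment> \<open>\<open>kk\<close> controls the error made in the form by replacing the
      representative y'_i by the constant \<open>y\<close>; the values of \<open>h\<close> on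
      \<open>N\<close> are integral at \<open>p\<close> by
      \<open>locally_isometric_unim_le\<close>.\<close>
    have "\<exists>kk. \<forall>t\<in>N. \<forall>v\<in>N. \<forall>j\<ge>kk. of_nat p ^ j * h t v \<in> lcK p (pr c)"
    proof -
      have "\<forall>t\<in>N. \<forall>v\<in>N. h t v \<in> lcK p Ok" using locally_isometric_unim_le[OF p N L iso] by blast
      moreover have "of_nat p ^ j * t \<in> lcK p (pr c)" if t: "t \<in> lcK p Ok" and j: "j \<ge> k" for t j
      proof -
        obtain u :: int where u: "\<not> int p dvd u" "of_int u * t \<in> Ok" using t unfolding K.lc_iff by blast
        have "of_int u * (of_nat p ^ j * t) = c * (of_nat (p ^ (j - k)) * (of_int u * t))"
          using j by (simp add: c_def mult_ac flip: power_add)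
        moreover have "of_nat (p ^ (j - k)) * (of_int u * t) \<in> Ok" using u(2) by (rule O_mult[OF O_nat])
        ultimately have "of_int u * (of_nat p ^ j * t) \<in> pr c" unfolding pr_def by blast
        then show ?thesis using u(1) unfolding K.lc_iff by blast
      qed
      ultimately show ?thesis by blast
    qed
    then obtain kk where kk: "\<forall>t\<in>N. \<forall>v\<in>N. of_nat p ^ kk * h t v \<in> lcK p (pr c)" by blast
    have pk0: "of_nat p ^ kk \<noteq> (0::'k)" using prime_gt_0_nat[OF p] by simp
    have "nullp p (\<lambda>i. y - y' i)" using g(2) unfolding padic_class_def by blast
    then obtain M1 where M1: "\<forall>i\<ge>M1. y - y' i \<in> lc p (smul (of_nat p ^ kk) ` N)"
      using latt_scale[OF pk0 N] unfolding padic_null_def by blast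
    obtain M2 where M2: "\<forall>i\<ge>M2. v' i \<in> lc p N" using cls_lc_eventually[OF p N v(2) g(3)] by blast
    obtain M3 where M3: "\<forall>i\<ge>M3. h (z i) w - g i \<in> lcK p (pr c)"
      using g(1) prl unfolding padic_class_def padic_null_def by blast
    obtain M4 where M4: "\<forall>i\<ge>M4. h (y' i) (v' i) - g i \<in> lcK p (pr c)"
      using g(4) prl unfolding padic_class_def padic_null_def by blast
    have "h (z i) w \<in> lcK p (pr c)" if i: "i \<ge> max (max M1 M2) (max M3 M4)" for i
    proof -
      have i': "i \<ge> M1" "i \<ge> M2" "i \<ge> M3" "i \<ge> M4" using i by auto
      obtain ww :: int where ww: "\<not> int p dvd ww" "smul (of_int ww) (v' i) \<in> N" using M2 i' unfolding lc_iff by blast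
      have 1: "h y (v' i) \<in> lcK p (pr c)"
      proof -
        have "of_int ww * h y (v' i) = h y (smul (of_int ww) (v' i))" by (simp add: h_scale_right)
        also have "\<dots> \<in> pr c" using \<open>y \<in> cN\<close> ww(2) unfolding cN_def by blast
        finally show ?thesis using ww(1) unfolding K.lc_iff by blast
      qed
      obtain u :: int where u: "\<not> int p dvd u" "smul (of_int u) (y - y' i) \<in> smul (of_nat p ^ kk) ` N"
        using M1 i' unfolding lc_iff by blast
      then obtain t where t: "t \<in> N" "smul (of_int u) (y - y' i) = smul (of_nat p ^ kk) t" by blast
      have "of_int (u * ww) * h (y - y' i) (v' i) = h (smul (of_int u) (y - y' i)) (smul (of_int ww) (v' i))"
        by (simp add: h_scale_left h_scale_right mult_ac)
      also have "\<dots> = of_nat p ^ kk * h t (smul (of_int ww) (v' i))" unfolding t(2) by (simp add: h_scale_left)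
      also have "\<dots> \<in> lcK p (pr c)" using kk t(1) ww(2) by blast
      finally have 2: "h (y - y' i) (v' i) \<in> lcK p (pr c)"
        by (rule K.lc_descend[OF p, rotated]) (use u(1) ww(1) p in \<open>simp add: prime_dvd_mult_iff\<close>)
      have "h y (v' i) - h (y - y' i) (v' i) - (h (y' i) (v' i) - g i) + (h (z i) w - g i) \<in> lcK p (pr c)"
        by (rule K.osub_add[OF oc K.osub_diff[OF oc K.osub_diff[OF oc 1 2]]]) (use M3 M4 i' in auto)
      then show ?thesis by (simp add: h_diff_left)
    qed
    then show ?thesis by blast
  qed
  have "\<exists>M. \<forall>i\<ge>M. z i \<in> smul c ` L"
  proof -
    obtain X where X: "finite X" "L = o_span smul X" using L(1) unfolding is_lattice_def by blast
    have XL: "X \<subseteq> L" using X(2) o_span_base by blast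
    \<comment> \<open>The threshold in \<open>ev\<close> depends on \<open>w\<close>; finitely many
      generators of \<open>L\<close> have a common one.\<close>
    have "\<exists>M. \<forall>i\<ge>M. \<forall>w\<in>X. h (z i) w \<in> lcK p (pr c)"
      using X(1) XL
    proof (induction X)
      case (insert w X)
      then obtain M where M: "\<forall>i\<ge>M. \<forall>w\<in>X. h (z i) w \<in> lcK p (pr c)" by blast
      obtain M' where "\<forall>i\<ge>M'. h (z i) w \<in> lcK p (pr c)" using ev[of w] insert by blast
      then show ?case using M by (intro exI[of _ "max M M'"]) auto
    qed simp
    then obtain M where M: "\<forall>i\<ge>M. \<forall>w\<in>X. h (z i) w \<in> lcK p (pr c)" by blast
    have "z i \<in> smul c ` L" if i: "i \<ge> M" for i
    proof -
      have "\<exists>u::int. \<not> int p dvd u \<and> (\<forall>w\<in>X. of_int u * h (z i) w \<in> pr c)"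
      proof -
        have "\<forall>w\<in>X. h (z i) w \<in> lcK p (pr c)" using M i by blast
        with X(1) show ?thesis
        proof (induction X)
          case empty
          show ?case using p by (intro exI[of _ 1]) (auto dest: not_prime_unit)
        next
          case (insert w X)
          then obtain u :: int where u: "\<not> int p dvd u" "\<forall>w\<in>X. of_int u * h (z i) w \<in> pr c" by auto
          obtain u' :: int where u': "\<not> int p dvd u'" "of_int u' * h (z i) w \<in> pr c"
            using insert.prems unfolding K.lc_iff by auto
          have "of_int (u * u') * h (z i) w' \<in> pr c" if "w' \<in> insert w X" for w'
          proof (cases "w' = w")
            case True
            then show ?thesis using K.osub_scale[OF osub_pr O_int u'(2), of u] by (simp add: mult.assoc)
          next
            case False
            then have "of_int u * h (z i) w' \<in> pr c" using u(2) that by blast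
            from K.osub_scale[OF osub_pr O_int this, of u'] show ?thesis by (simp add: mult_ac)
          qed
          moreover have "\<not> int p dvd u * u'" using u u' p by (simp add: prime_dvd_mult_iff)
          ultimately show ?case by blast
        qed
      qed
      then obtain u :: int where u: "\<not> int p dvd u" "\<forall>w\<in>X. of_int u * h (z i) w \<in> pr c" by blast
      have ol: "osub smul {w. of_int u * h (z i) w \<in> pr c}"
        unfolding osub_def
      proof (intro conjI ballI)
        show "0 \<in> {w. of_int u * h (z i) w \<in> pr c}" using K.osub_0[OF osub_pr] by simp
      next
        fix a b assume "a \<in> {w. of_int u * h (z i) w \<in> pr c}" "b \<in> {w. of_int u * h (z i) w \<in> pr c}"
        then show "a + b \<in> {w. of_int u * h (z i) w \<in> pr c}"
          using K.osub_add[OF osub_pr] by (simp add: h_add_right distrib_left)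
      next
        fix e b assume "e \<in> Ok" "b \<in> {w. of_int u * h (z i) w \<in> pr c}"
        then show "smul e b \<in> {w. of_int u * h (z i) w \<in> pr c}"
          using K.osub_scale[OF osub_pr, of "cj e" "of_int u * h (z i) b" c] by (simp add: h_scale_right mult_ac)
      qed
      have all: "of_int u * h (z i) w \<in> pr c" if "w \<in> L" for w
        using o_span_least[OF ol, of X] u(2) that X(2) by blast
      have "smul (of_int u / c) (z i) \<in> L"
      proof (rule unimI[OF L(2)])
        fix w assume "w \<in> L"
        then show "h (smul (of_int u / c) (z i)) w \<in> Ok" using all[of w] c(2) by (simp add: pr_mem h_scale_left)
      qed
      moreover have "smul (of_int u) (z i) = smul c (smul (of_int u / c) (z i))" using c(2) by simp
      ultimately have "smul (of_int u) (z i) \<in> smul c ` L" by blast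
      then have "z i \<in> lc p (smul c ` L)" using u(1) unfolding lc_iff by blast
      then show ?thesis using lc_power[OF p latt_osub[OF L(1)], of "z i" k] z(3) unfolding c_def by blast
    qed
    then show ?thesis by blast
  qed
  then obtain M where M: "\<forall>i\<ge>M. z i \<in> smul c ` L" by blast
  \<comment> \<open>The value 0 below the threshold keeps every term in \<open>L\<close>, and
    finitely many terms do not change the class.\<close>
  define z' where "z' i = (if i \<ge> M then smul (1 / c) (z i) else 0)" for i
  have z'L: "z' i \<in> L" for i using M c(2) osub_0[OF latt_osub[OF L(1)]] unfolding z'_def by auto
  have z'c: "smul c (z' i) = z i" if "i \<ge> M" for i using that c(2) by (simp add: z'_def)
  have cz': "cauchyp p z'" unfolding padic_Cauchy_def
  proof (intro allI impI)
    fix L' assume L': "latt L'"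
    obtain M' where M': "\<forall>a\<ge>M'. \<forall>b\<ge>M'. z a - z b \<in> lc p (smul c ` L')"
      using z(2) latt_scale[OF c(2) L'] unfolding padic_Cauchy_def by blast
    have "z' a - z' b \<in> lc p L'" if ab: "a \<ge> max M M'" "b \<ge> max M M'" for a b
    proof -
      have "z a - z b \<in> lc p (smul c ` L')" using M' ab by simp
      then obtain u :: int where u: "\<not> int p dvd u" "smul (of_int u) (z a - z b) \<in> smul c ` L'" unfolding lc_iff by blast
      then obtain t where t: "t \<in> L'" "smul (of_int u) (z a - z b) = smul c t" by blast
      have "smul c (smul (of_int u) (z' a - z' b)) = smul (of_int u) (smul c (z' a) - smul c (z' b))"
        by (simp add: scale_right_diff_distrib mult.commute)
      also have "\<dots> = smul c t" using z'c ab t(2) by simp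
      finally have "smul (of_int u) (z' a - z' b) = t" using c(2) by (rule scale_left_imp_eq[rotated])
      then show ?thesis using u(1) t(1) unfolding lc_iff by blast
    qed
    then show "\<exists>M. \<forall>a\<ge>M. \<forall>b\<ge>M. z' a - z' b \<in> lc p L'" by blast
  qed
  have "clsp p z' \<in> compl p L" unfolding padic_completion_def using cz' z'L by blast
  then obtain X where X: "X \<in> compl p N" "\<phi> X = clsp p z'" using f(1) by (metis bij_betw_imp_surj_on imageE)
  then obtain v where v: "X = clsp p v" "cauchyp p v" "range v \<subseteq> N" unfolding padic_completion_def by blast
  let ?C = "padic_class (*) p (\<lambda>_. c)"
  have Cc: "?C \<in> padic_completion (*) p Ok"
    unfolding padic_completion_def using K.cauchy_const[OF p] c(1) by blast
  have "\<phi> (loc_scale smul p ?C X) = loc_scale smul p ?C (\<phi> X)" by (rule f(3)[OF Cc X(1)])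
  also have "\<dots> = clsp p (\<lambda>i. smul c (z' i))"
    unfolding X(2) by (rule scale_class[OF p c(1) L(1) _ cz']) (use z'L in blast)
  also have "\<dots> = clsp p z"
  proof (rule cls_eq[OF p])
    show "nullp p (\<lambda>i. smul c (z' i) - z i)" unfolding padic_null_def
    proof (intro allI impI)
      fix L' assume "latt L'"
      then have "smul c (z' i) - z i \<in> lc p L'" if "i \<ge> M" for i
        using z'c[OF that] lc_base[OF p osub_0[OF latt_osub]] by simp
      then show "\<exists>M. \<forall>i\<ge>M. smul c (z' i) - z i \<in> lc p L'" by blast
    qed
  qed
  also have "\<dots> = \<phi> (clsp p (\<lambda>_. y))" using z(1) by simp
  finally have e: "\<phi> (loc_scale smul p ?C X) = \<phi> (clsp p (\<lambda>_. y))" .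
  have sc: "loc_scale smul p ?C X = clsp p (\<lambda>i. smul c (v i))"
    unfolding v(1) by (rule scale_class[OF p c(1) N v(3,2)])
  have cv: "cauchyp p (\<lambda>i. smul c (v i))" unfolding padic_Cauchy_def
  proof (intro allI impI)
    fix L' assume L': "latt L'"
    note o' = osub_lc[OF p latt_osub[OF L']]
    obtain M where "\<forall>a\<ge>M. \<forall>b\<ge>M. v a - v b \<in> lc p L'" using v(2) L' unfolding padic_Cauchy_def by blast
    then have "\<forall>a\<ge>M. \<forall>b\<ge>M. smul c (v a) - smul c (v b) \<in> lc p L'"
      using osub_scale[OF o' c(1)] by (simp flip: scale_right_diff_distrib)
    then show "\<exists>M. \<forall>a\<ge>M. \<forall>b\<ge>M. smul c (v a) - smul c (v b) \<in> lc p L'" by blast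
  qed
  have "range (\<lambda>i. smul c (v i)) \<subseteq> N" using v(3) osub_scale[OF latt_osub[OF N] c(1)] by blast
  then have "loc_scale smul p ?C X \<in> compl p N"
    unfolding sc padic_completion_def using cv by blast
  then have "clsp p (\<lambda>i. smul c (v i)) = clsp p (\<lambda>_. y)"
    using e cls_y f(1) sc by (metis bij_betw_imp_inj_on inj_onD)
  then have "(\<lambda>_. y) \<in> clsp p (\<lambda>i. smul c (v i))" using cls_self[OF p cauchy_const[OF p]] by blast
  then have "nullp p (\<lambda>i. smul c (v i) - y)" unfolding padic_class_def by blast
  then obtain M' where "\<forall>i\<ge>M'. smul c (v i) - y \<in> lc p (smul c ` N)"
    using latt_scale[OF c(2) N] unfolding padic_null_def by blast
  then have d: "smul c (v M') - y \<in> lc p (smul c ` N)" by blast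
  have "smul c (v M') \<in> lc p (smul c ` N)" by (rule lc_base[OF p]) (use v(3) in blast)
  then have "smul c (v M') - (smul c (v M') - y) \<in> lc p (smul c ` N)"
    by (rule osub_diff[OF osub_lc[OF p latt_osub[OF latt_scale[OF c(2) N]]] _ d])
  then have "y \<in> lc p (smul c ` N)" by simp
  then obtain u :: int where u: "\<not> int p dvd u" "smul (of_int u) y \<in> smul c ` N" unfolding lc_iff by blast
  then obtain t where t: "t \<in> N" "smul (of_int u) y = smul c t" by blast
  have "smul c (smul (of_int (u * m')) x) = smul c t" using t(2) by (simp add: y_def x'_def mult_ac)
  then have "smul (of_int (u * m')) x = t" using c(2) by (rule scale_left_imp_eq[rotated])
  moreover have "\<not> int p dvd u * m'" using u(1) m'(2) p by (simp add: prime_dvd_mult_iff)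
  ultimately show ?thesis using t(1) unfolding lc_iff by blast
qed

lemma genus_unim:
  assumes N: "latt N" and L: "latt L" "unim L" and iso: "\<And>p. prime p \<Longrightarrow> locally_isometric smul h p N L"
  shows "unim N"
  unfolding unimodular_def
proof (intro subset_antisym subsetI)
  fix x assume x: "x \<in> N"
  show "x \<in> dual N" unfolding dual_iff
  proof
    fix y assume "y \<in> N"
    then show "h x y \<in> Ok"
      using locally_isometric_unim_le[OF _ N L iso x] by (intro K.lc_global[OF osub_O]) blast
  qed
next
  fix x assume "x \<in> dual N"
  then show "x \<in> N"
    using locally_isometric_unim_ge[OF _ N L iso] by (intro lc_global[OF latt_osub[OF N]]) blast
qed

end

section \<open>Construction of neighbours\<close>

context imag_quad
begin

lemma imul_cj_subset_O: assumes "I \<subseteq> Ok" shows "imul I (cj ` I) \<subseteq> Ok"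
proof (rule imul_least[OF osub_O])
  fix x y assume x: "x \<in> I" and "y \<in> cj ` I"
  then have "cj y \<in> Ok" using assms by (auto simp: cj_mem)
  then show "x * y \<in> Ok" using x assms by auto
qed

lemma splitD:
  assumes "split P p" shows "degree_one P p" "degree_one (cj ` P) p" "imul P (cj ` P) = pr (of_nat p)"
  using assms degree_one_cj by (auto simp: split_def)

lemma split_mult: assumes P: "split P p" and "x \<in> P" "y \<in> cj ` P" shows "x * y / of_nat p \<in> Ok"
  using imulI[OF assms(2,3)] splitD(3)[OF P] degree_oneD(6)[OF splitD(1)[OF P]] by (simp add: pr_mem)

lemma split_inter: assumes P: "split P p" and x: "x \<in> P" "x \<in> cj ` P" shows "x / of_nat p \<in> Ok"
proof -
  obtain a where a: "a \<in> P" "1 - a \<in> cj ` P" using P unfolding split_def by blast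
  have "x * (1 - a) / of_nat p + a * x / of_nat p \<in> Ok"
    by (rule O_add[OF split_mult[OF P x(1) a(2)] split_mult[OF P a(1) x(2)]])
  then show ?thesis by (simp add: algebra_simps add_divide_distrib[symmetric])
qed

text \<open>Such an element generates \<open>P\<close> locally at \<open>p\<close>. Any
  \<open>x\<close> in \<open>P\<close> outside (p) has norm divisible by \<open>p\<close>. If p^2
  divides it, x + p works: the norm changes by p tr(x) + p^2, and \<open>p\<close> does not divide
  tr(x), as otherwise conj(x) = tr(x) - x would lie in \<open>P\<close> and x in P \<inter> conj(P)
  = (p).\<close>

lemma split_uniformizer:
  assumes P: "split P p"
  obtains b m where "b \<in> P" "b * cj b = of_int (int p * m)" "\<not> int p dvd m"
proof -
  note d = splitD(1)[OF P]
  note oP = degree_oneD(1)[OF d]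
  have p0: "of_nat p \<noteq> (0::'k)" by (rule degree_oneD(6)[OF d])
  obtain a where a: "a \<in> P" "1 - a \<in> cj ` P" using P unfolding split_def by blast
  have "\<exists>x\<in>P. x / of_nat p \<notin> Ok"
  proof (rule ccontr)
    assume n: "\<not> (\<exists>x\<in>P. x / of_nat p \<notin> Ok)"
    have "a / of_nat p \<in> Ok" using n a by blast
    moreover have "cj (1 - a) / of_nat p \<in> Ok" using n a(2) unfolding cj_mem by blast
    then have "cj (cj (1 - a) / of_nat p) \<in> Ok" by (simp only: O_cj)
    then have "(1 - a) / of_nat p \<in> Ok" by simp
    ultimately have "a / of_nat p + (1 - a) / of_nat p \<in> Ok" by (rule O_add)
    then have "of_int 1 / of_int (int p) \<in> Ok" by (simp add: add_divide_distrib[symmetric])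
    then have "int p dvd 1" by (rule int_div_in_O) (use degree_oneD(3)[OF d] in auto)
    then show False using degree_oneD(3)[OF d] by (auto dest: not_prime_unit)
  qed
  then obtain x where x: "x \<in> P" "x / of_nat p \<notin> Ok" by blast
  have xO: "x \<in> Ok" using x degree_oneD(2)[OF d] by blast
  obtain N where N: "nrm x = of_int N" using O_nrm[OF xO] by (auto elim: Ints_cases)
  obtain t where t: "tr x = of_int t" using O_tr[OF xO] by (auto elim: Ints_cases)
  have xx: "x * cj x = of_int N" using nrm_eq[of x] N by simp
  have "of_int N / of_int (int p) \<in> Ok" using split_mult[OF P x(1), of "cj x"] x(1) xx by simp
  then have "int p dvd N" by (rule int_div_in_O) (use p0 in auto)
  then obtain k where k: "N = int p * k" by blast
  show thesis
  proof (cases "int p dvd k")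
    case False
    then show thesis using that[of x k] x xx k by simp
  next
    case True
    have nt: "\<not> int p dvd t"
    proof
      assume "int p dvd t"
      then have "of_int t - x \<in> P" using degree_one_int_iff[OF d] x(1) by (intro K.osub_diff[OF oP]) auto
      moreover have "of_int t - x = cj x" using tr_eq[of x] t by (simp add: algebra_simps)
      ultimately have "x \<in> cj ` P" by (simp add: cj_mem)
      then show False using split_inter[OF P x(1)] x(2) by blast
    qed
    have "(x + of_nat p) * cj (x + of_nat p) = x * cj x + of_nat p * (x + cj x) + of_nat p * of_nat p"
      by (simp add: algebra_simps)
    also have "\<dots> = of_int (int p * (k + t + int p))" unfolding xx k tr_eq t by (simp add: algebra_simps)
    finally have "(x + of_nat p) * cj (x + of_nat p) = of_int (int p * (k + t + int p))" .
    moreover have "\<not> int p dvd k + t + int p" using True nt by (simp add: dvd_add_right_iff)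
    moreover have "x + of_nat p \<in> P" by (rule K.osub_add[OF oP x(1) degree_oneD(4)[OF d]])
    ultimately show thesis using that by blast
  qed
qed

section \<open>Squares of classes are generated by split primes\<close>

text \<open>Induction on the norm of an integral ideal, in place of prime factorization. Let
  \<open>p\<close> divide the norm. If \<open>I\<close> lies in (p), dividing by p leaves the class
  unchanged; inert primes are disposed of here. Otherwise P = I + (p) has residue degree one and
  norm p, and I = P I' with I' of norm N / p. Either conj(P) = P and [P]^2 is trivial, or
  \<open>P\<close> is split.\<close>

lemma square_class_induct_aux:
  fixes Good :: "'k set set \<Rightarrow> bool"
  assumes one: "Good \<one>\<^bsub>class_group\<^esub>"
    and mult: "\<And>a b. a \<in> carrier class_group \<Longrightarrow> b \<in> carrier class_group \<Longrightarrow> Good a \<Longrightarrow> Good b \<Longrightarrow> Good (a \<otimes>\<^bsub>class_group\<^esub> b)"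
    and split: "\<And>P p. split P p \<Longrightarrow> Good (icl P \<otimes>\<^bsub>class_group\<^esub> icl P)"
  shows "frac I \<Longrightarrow> I \<subseteq> Ok \<Longrightarrow> N > 0 \<Longrightarrow> imul I (cj ` I) = pr (of_nat N) \<Longrightarrow> Good (icl I \<otimes>\<^bsub>class_group\<^esub> icl I)"
proof (induction N arbitrary: I rule: less_induct)
  case (less N)
  note fI = less.prems(1) and IO = less.prems(2) and N = less.prems(3) and IN = less.prems(4)
  have oI: "osubK I" by (rule frac_osub[OF fI])
  show ?case
  proof (cases "N = 1")
    case True
    have "imul I (cj ` I) \<subseteq> imul I Ok" by (rule imul_mono[OF order_refl]) (use IO in auto)
    then have "Ok \<subseteq> I" using IN True oI by (simp add: imul_comm[of _ Ok])
    then have "I = Ok" using IO by blast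
    then show ?thesis using one by (simp add: icl_one)
  next
    case False
    then obtain p where p: "prime p" "p dvd N" by (metis prime_factor_nat)
    have p0: "of_nat p \<noteq> (0::'k)" using prime_gt_0_nat[OF p(1)] by simp
    have N0: "of_nat N \<noteq> (0::'k)" using N by simp
    obtain N1 where N1: "N = p * N1" using p(2) by blast
    have N1p: "N1 > 0" using N N1 by (metis gr0I mult_0_right less_irrefl)
    have II: "x * cj y / of_nat p \<in> Ok" if xy: "x \<in> I" "y \<in> I" for x y
    proof -
      have "x * cj y \<in> pr (of_nat N)" using xy unfolding IN[symmetric] by (intro imulI) auto
      then obtain e where e: "e \<in> Ok" "x * cj y = of_nat N * e" unfolding pr_def by blast
      have "x * cj y / of_nat p = of_nat N1 * e" using p0 unfolding e(2) N1 by simp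
      then show ?thesis using O_mult[OF O_nat e(1)] by simp
    qed
    show ?thesis
    proof (cases "I \<subseteq> pr (of_nat p)")
      case True
      define I' where "I' = imul (pr (1 / of_nat p)) I"
      have I': "I' = (\<lambda>x. 1 / of_nat p * x) ` I" unfolding I'_def by (rule imul_pr[OF oI])
      have fI': "frac I'" unfolding I'_def using p0 by (intro frac_imul frac_pr fI) simp
      have I'O: "I' \<subseteq> Ok" unfolding I' using True p0 by (auto simp: pr_mem)
      have "imul I' (cj ` I') = imul (imul (pr (1 / of_nat p)) (pr (1 / of_nat p))) (imul I (cj ` I))"
        unfolding I'_def cj_imul by (simp only: cj_pr) (simp add: imul_interchange[of _ I])
      also have "\<dots> = pr (of_nat N / (of_nat p * of_nat p))" unfolding IN by simp
      finally have n: "imul I' (cj ` I') = pr (of_nat N / (of_nat p * of_nat p))" .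
      have "imul I' (cj ` I') \<subseteq> Ok" by (rule imul_cj_subset_O[OF I'O])
      then have "of_int (int N) / of_int (int p * int p) \<in> Ok" unfolding n using prI by force
      then have "int p * int p dvd int N" by (rule int_div_in_O) (use p0 in auto)
      then have "p * p dvd N" by (simp flip: of_nat_mult)
      then obtain N' where N': "N = p * p * N'" by blast
      have "p * p > 1" by (rule less_1_mult[OF prime_gt_1_nat[OF p(1)] prime_gt_1_nat[OF p(1)]])
      then have "N' < N" "N' > 0" using N N' by (auto intro!: Nat.gr0I)
      moreover have "imul I' (cj ` I') = pr (of_nat N')" unfolding n N' using p0 by simp
      ultimately have "Good (icl I' \<otimes>\<^bsub>class_group\<^esub> icl I')" using less.IH fI' I'O by blast
      moreover have "icl I' = icl I" unfolding I'_def using p0 fI by (intro icl_pr_mult) auto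
      ultimately show ?thesis by simp
    next
      case False
      then obtain x0 where x0: "x0 \<in> I" "x0 \<notin> pr (of_nat p)" by blast
      define P where "P = {x + of_nat p * y | x y. x \<in> I \<and> y \<in> Ok}"
      have oP: "osubK P" unfolding osub_def
      proof (intro conjI ballI)
        have "0 + of_nat p * 0 \<in> P" unfolding P_def using K.osub_0[OF oI] by blast
        then show "0 \<in> P" by simp
      next
        fix g h assume "g \<in> P" "h \<in> P"
        then obtain x y x' y' where *: "g = x + of_nat p * y" "x \<in> I" "y \<in> Ok" "h = x' + of_nat p * y'" "x' \<in> I" "y' \<in> Ok"
          unfolding P_def by blast
        then have "g + h = (x + x') + of_nat p * (y + y')" by (simp add: algebra_simps)
        then show "g + h \<in> P" unfolding P_def using K.osub_add[OF oI *(2,5)] O_add[OF *(3,6)] by blast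
      next
        fix c g assume c: "c \<in> Ok" and "g \<in> P"
        then obtain x y where *: "g = x + of_nat p * y" "x \<in> I" "y \<in> Ok" unfolding P_def by blast
        then have "c * g = c * x + of_nat p * (c * y)" by (simp add: algebra_simps)
        then show "c * g \<in> P" unfolding P_def using K.osub_scale[OF oI c *(2)] O_mult[OF c *(3)] by blast
      qed
      have IP: "I \<subseteq> P" unfolding P_def using O_0 by force
      have PO: "P \<subseteq> Ok" unfolding P_def using IO by (auto intro!: O_add O_mult[OF O_nat])
      have "0 + of_nat p * 1 \<in> P" unfolding P_def using K.osub_0[OF oI] by blast
      then have pP: "of_nat p \<in> P" by simp
      have fP: "frac P" by (rule frac_sub[OF oP pP p0 frac_O PO])
      have PP: "g * cj h / of_nat p \<in> Ok" if gh: "g \<in> P" "h \<in> P" for g h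
      proof -
        obtain x y x' y' where *: "g = x + of_nat p * y" "x \<in> I" "y \<in> Ok" "h = x' + of_nat p * y'" "x' \<in> I" "y' \<in> Ok"
          using gh unfolding P_def by blast
        have "g * cj h / of_nat p = x * cj x' / of_nat p + (y * cj x' + cj y' * g)"
          unfolding *(1,4) using p0 by (simp add: field_simps)
        moreover have "x' \<in> Ok" "g \<in> Ok" using * IO gh PO by blast+
        ultimately show ?thesis using II[OF *(2,5)] * by (auto intro!: O_add O_mult)
      qed
      have not1: "1 \<notin> P"
      proof
        assume "1 \<in> P"
        then have "of_int 1 / of_int (int p) \<in> Ok" using PP[of 1 1] by simp
        then have "int p dvd 1" by (rule int_div_in_O) (use p0 in auto)
        then show False using p(1) by (auto dest: not_prime_unit)
      qed
      have d: "degree_one P p" unfolding degree_one_def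
      proof (intro conjI ballI)
        obtain a b where ab: "x0 = of_int a + of_int b * om" using x0(1) IO unfolding O_eq by blast
        have x0P: "x0 \<in> P" using x0 IP by blast
        have mult_P: "of_int k \<in> P" if "int p dvd k" for k
        proof -
          obtain l where "k = int p * l" using \<open>int p dvd k\<close> by blast
          then show ?thesis using K.osub_scale[OF oP O_int[of l] pP] by (simp add: mult.commute)
        qed
        \<comment> \<open>If \<open>p\<close> divided \<open>b\<close>, then either x0 would lie in
          (p), against its choice, or \<open>P\<close> would contain an integer prime to
          \<open>p\<close> and so 1. Once \<open>b\<close> is invertible modulo \<open>p\<close>,
          the element x0 of \<open>P\<close> expresses \<open>om\<close> by a rational integer
          modulo \<open>P\<close>.\<close>
        have nb: "\<not> int p dvd b"
        proof
          assume pseudo_basis: "int p dvd b"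
          have "om * of_int b \<in> P" by (rule K.osub_scale[OF oP O_om mult_P[OF pseudo_basis]])
          from K.osub_diff[OF oP x0P this] have aP: "of_int a \<in> P" by (simp add: ab mult.commute)
          show False
          proof (cases "int p dvd a")
            case True
            obtain a' b' where "a = int p * a'" "b = int p * b'" using True pseudo_basis by blast
            then have "x0 = of_nat p * (of_int a' + of_int b' * om)" unfolding ab by (simp add: algebra_simps)
            moreover have "of_int a' + of_int b' * om \<in> Ok" by (intro O_add O_mult) auto
            ultimately show False using x0(2) unfolding pr_def by blast
          next
            case False
            then have "coprime (int p) a" using p(1) by (intro prime_imp_coprime) auto
            then obtain u v where uv: "u * int p + v * a = 1" using coprime_iff_gcd_eq_1 bezout_int by metis
            have "of_int u * of_nat p + of_int v * of_int a \<in> P"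
              by (rule K.osub_add[OF oP K.osub_scale[OF oP O_int pP] K.osub_scale[OF oP O_int aP]])
            also have "of_int u * of_nat p + of_int v * of_int a = (of_int (u * int p + v * a) :: 'k)" by simp
            finally show False using not1 unfolding uv by simp
          qed
        qed
        then have "coprime (int p) b" using p(1) by (intro prime_imp_coprime) auto
        then obtain u v where uv: "u * int p + v * b = 1" using coprime_iff_gcd_eq_1 bezout_int by metis
        have vb: "of_int v * of_int b = 1 - of_int u * (of_nat p :: 'k)"
          using arg_cong[OF uv, of "of_int :: int \<Rightarrow> 'k"] by (simp add: algebra_simps)
        have "of_int v * x0 + (of_int u * om) * of_nat p \<in> P"
          by (rule K.osub_add[OF oP K.osub_scale[OF oP O_int x0P] K.osub_scale[OF oP O_mult[OF O_int O_om] pP]])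
        also have "of_int v * x0 + (of_int u * om) * of_nat p = of_int (v * a) + (of_int v * of_int b) * om + of_int u * of_nat p * om"
          unfolding ab by (simp add: algebra_simps)
        also have "\<dots> = om - of_int (- (v * a))" unfolding vb by (simp add: algebra_simps)
        finally have omP: "om - of_int (- (v * a)) \<in> P" .
        fix x :: 'k assume "x \<in> Ok"
        then obtain e f where ef: "x = of_int e + of_int f * om" unfolding O_eq by blast
        have "x - of_int (e - f * (v * a)) = of_int f * (om - of_int (- (v * a)))"
          unfolding ef by (simp add: algebra_simps)
        then show "\<exists>m::int. x - of_int m \<in> P" using K.osub_scale[OF oP O_int[of f] omP] by metis
      qed (use oP PO p pP not1 in auto)
      \<comment> \<open>P conj(P) lies in (p) and contains p^2, so its generator is p k with k
        dividing p; k = p would put x0 into (p).\<close>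
      have PPp: "imul P (cj ` P) = pr (of_nat p)"
      proof -
        obtain g where g: "g > 0" "imul P (cj ` P) = pr (of_rat g)" using ideal_norm[OF fP] by blast
        have g0: "of_rat g \<noteq> (0::'k)" using g(1) by simp
        have "imul P (cj ` P) \<subseteq> pr (of_nat p)"
          using PP p0 by (intro imul_least[OF osub_pr]) (auto simp: pr_mem)
        then have "of_rat g \<in> pr (of_nat p)" unfolding g(2) using prI by blast
        then have "of_rat (g / of_nat p) \<in> Ok" using p0 by (simp add: pr_mem of_rat_divide)
        then obtain k where k: "g / of_nat p = of_int k" unfolding O_rat by (auto elim: Ints_cases)
        then have gk: "g = of_nat p * of_int k" using p0 by (simp add: field_simps)
        have "of_nat p * cj (of_nat p) \<in> imul P (cj ` P)" by (rule imulI[OF pP imageI[OF pP]])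
        then have "of_nat p * of_nat p / of_rat g \<in> Ok" unfolding g(2) using g0 by (simp add: pr_mem)
        also have "of_nat p * of_nat p / of_rat g = (of_int (int p) / of_int k :: 'k)"
          unfolding gk using p0 by (simp add: of_rat_mult)
        finally have "k dvd int p" by (rule int_div_in_O) (use g(1) gk in auto)
        moreover have kpos: "k > 0" using g(1) gk prime_gt_0_nat[OF p(1)] by (simp add: zero_less_mult_iff)
        ultimately have "nat k dvd p" by (simp add: nat_dvd_iff)
        then have "nat k = 1 \<or> nat k = p" using p(1) by (meson prime_nat_iff)
        moreover have "nat k \<noteq> p"
        proof
          assume "nat k = p"
          then have kp: "k = int p" using kpos by simp
          have "x0 * cj (of_nat p) \<in> imul P (cj ` P)" by (rule imulI[OF subsetD[OF IP x0(1)] imageI[OF pP]])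
          then have "x0 * of_nat p / of_rat g \<in> Ok" unfolding g(2) using g0 by (simp add: pr_mem)
          also have "x0 * of_nat p / of_rat g = x0 / of_nat p" unfolding gk kp using p0 by (simp add: of_rat_mult)
          finally show False using x0(2) p0 by (simp add: pr_mem)
        qed
        ultimately have "k = 1" using kpos by simp
        then show ?thesis unfolding g(2) gk by simp
      qed
      \<comment> \<open>The ideal conj(P) / p is the inverse of \<open>P\<close>.\<close>
      define I' where "I' = imul (pr (1 / of_nat p)) (imul (cj ` P) I)"
      have fI': "frac I'" unfolding I'_def using p0 by (intro frac_imul frac_pr frac_cj fP fI) simp
      have "I' \<subseteq> Ok"
      proof -
        have "imul (cj ` P) I \<subseteq> {z. 1 / of_nat p * z \<in> Ok}"
        proof (rule imul_least)
          show "osubK {z. 1 / of_nat p * z \<in> Ok}"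
            unfolding osub_def by (auto simp: add_divide_distrib simp flip: times_divide_eq_right intro: O_add O_mult)
          fix u x assume u: "u \<in> cj ` P" and x: "x \<in> I"
          then have "x * cj (cj u) / of_nat p \<in> Ok" using IP by (intro PP) (auto simp: cj_mem)
          then show "u * x \<in> {z. 1 / of_nat p * z \<in> Ok}" by (simp add: mult.commute)
        qed
        then show ?thesis unfolding I'_def imul_pr[OF osub_imul] by auto
      qed
      moreover have "imul I' (cj ` I') = pr (of_nat N1)"
      proof -
        have "imul I' (cj ` I') = imul (imul (pr (1 / of_nat p)) (pr (1 / of_nat p))) (imul (imul (cj ` P) P) (imul I (cj ` I)))"
          unfolding I'_def cj_imul cj_cj_image by (simp only: cj_pr imul_interchange) (simp add: imul_interchange)
        also have "imul (cj ` P) P = pr (of_nat p)" using PPp imul_comm by metis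
        also have "imul (imul (pr (1 / of_nat p)) (pr (1 / of_nat p))) (imul (pr (of_nat p)) (imul I (cj ` I))) = pr (of_nat N1)"
          unfolding IN imul_pr_pr N1 using p0 by (simp add: field_simps)
        finally show ?thesis .
      qed
      moreover have "N1 < N" using N1 N1p prime_gt_1_nat[OF p(1)] by simp
      ultimately have g': "Good (icl I' \<otimes>\<^bsub>class_group\<^esub> icl I')" using less.IH fI' N1p by blast
      have "imul P I' = imul (pr (1 / of_nat p)) (imul (imul P (cj ` P)) I)"
        unfolding I'_def by (metis imul_assoc imul_comm)
      also have "\<dots> = I" unfolding PPp using p0 oI by (simp flip: imul_assoc)
      finally have IPI: "icl I = icl P \<otimes>\<^bsub>class_group\<^esub> icl I'" using icl_mult[OF fP fI'] by simp
      have sq: "icl I \<otimes>\<^bsub>class_group\<^esub> icl I = (icl P \<otimes>\<^bsub>class_group\<^esub> icl P) \<otimes>\<^bsub>class_group\<^esub> (icl I' \<otimes>\<^bsub>class_group\<^esub> icl I')"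
        unfolding IPI using fP fI' by (simp add: CG.m_ac)
      have "Good (icl P \<otimes>\<^bsub>class_group\<^esub> icl P)"
      proof (cases "cj ` P = P")
        case True
        then show ?thesis using icl_cj_mult[OF fP] one by simp
      next
        case False
        have "\<not> cj ` P \<subseteq> P" using False cj_image_subset[of P P] by blast
        then obtain t where t: "t \<in> cj ` P" "t \<notin> P" by blast
        have "t \<in> Ok" using t(1) PO by auto
        then obtain y where y: "y \<in> Ok" "1 - y * t \<in> P" using degree_one_unit[OF d _ t(2)] by blast
        have "1 - (1 - y * t) \<in> cj ` P" using K.osub_scale[OF osub_cj[OF oP] y(1) t(1)] by simp
        then have "split P p" unfolding split_def using d PPp y(2) by blast
        then show ?thesis by (rule split)
      qed
      then show ?thesis unfolding sq by (rule mult[OF _ _ _ g', rotated 2]) (use fP fI' in simp_all)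
    qed
  qed
qed

lemma square_class_induct:
  fixes Good :: "'k set set \<Rightarrow> bool"
  assumes c: "c \<in> class_squares" and one: "Good \<one>\<^bsub>class_group\<^esub>"
    and mult: "\<And>a b. a \<in> carrier class_group \<Longrightarrow> b \<in> carrier class_group \<Longrightarrow> Good a \<Longrightarrow> Good b \<Longrightarrow> Good (a \<otimes>\<^bsub>class_group\<^esub> b)"
    and split: "\<And>P p. split P p \<Longrightarrow> Good (icl P \<otimes>\<^bsub>class_group\<^esub> icl P)"
  shows "Good c"
proof -
  obtain I where I: "frac I" "c = icl I \<otimes>\<^bsub>class_group\<^esub> icl I" using c unfolding class_squares_def class_carrier by blast
  obtain m :: int where m: "m > 0" "\<And>x. x \<in> I \<Longrightarrow> of_int m * x \<in> Ok" using frac_denom[OF I(1)] by blast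
  define I' where "I' = imul (pr (of_int m)) I"
  have I'O: "I' \<subseteq> Ok" unfolding I'_def imul_pr[OF frac_osub[OF I(1)]] using m(2) by auto
  have fI': "frac I'" unfolding I'_def using m(1) by (intro frac_imul frac_pr I) simp
  have eq: "icl I' = icl I" unfolding I'_def using m(1) I by (intro icl_pr_mult) auto
  obtain g where g: "g > 0" "imul I' (cj ` I') = pr (of_rat g)" using ideal_norm[OF fI'] by blast
  have "imul I' (cj ` I') \<subseteq> Ok" by (rule imul_cj_subset_O[OF I'O])
  then have "of_rat g \<in> Ok" unfolding g(2) using prI by blast
  then obtain k where k: "g = of_int k" unfolding O_rat by (auto elim: Ints_cases)
  have "k > 0" using g(1) k by simp
  then have "imul I' (cj ` I') = pr (of_nat (nat k))" unfolding g(2) k by simp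
  moreover have "nat k > 0" using \<open>k > 0\<close> by simp
  ultimately have "Good (icl I' \<otimes>\<^bsub>class_group\<^esub> icl I')"
    by (intro square_class_induct_aux[where Good = Good, OF one mult split fI' I'O])
  then show ?thesis using I(2) eq by simp
qed

end

context herm_space
begin

section \<open>Quasi-reflections and the construction of neighbours\<close>

text \<open>For h(u, u) \<noteq> 0 this multiplies \<open>u\<close> by \<open>e\<close> and fixes
  the orthogonal complement of \<open>u\<close>.\<close>

definition quasi_refl :: "'v \<Rightarrow> 'k \<Rightarrow> 'v \<Rightarrow> 'v" where
  "quasi_refl u e x = x + smul ((e - 1) * h x u / h u u) u"

lemma quasi_refl_comp:
  assumes u: "h u u \<noteq> 0" and e: "e * f = 1" shows "quasi_refl u f (quasi_refl u e x) = x"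
proof -
  have hu: "h (quasi_refl u e x) u = e * h x u"
  proof -
    have "(e - 1) * h x u / h u u * h u u = (e - 1) * h x u" using u by simp
    then show ?thesis by (simp add: quasi_refl_def h_add_left h_scale_left algebra_simps)
  qed
  have "quasi_refl u f (quasi_refl u e x)
      = x + smul ((e - 1) * h x u / h u u + (f - 1) * (e * h x u) / h u u) u"
    unfolding quasi_refl_def[of u f] hu by (simp add: quasi_refl_def scale_left_distrib add.assoc)
  also have "(e - 1) * h x u / h u u + (f - 1) * (e * h x u) / h u u = (e * f - 1) * h x u / h u u"
    by (simp add: algebra_simps add_divide_distrib[symmetric] diff_divide_distrib[symmetric])
  finally show ?thesis by (simp add: e)
qed

lemma quasi_refl_UV:
  assumes u: "h u u \<noteq> 0" and e: "e * cj e = 1" shows "quasi_refl u e \<in> UV"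
proof (rule UV_I)
  show "quasi_refl u e (x + y) = quasi_refl u e x + quasi_refl u e y" for x y
    by (simp add: quasi_refl_def h_add_left distrib_left add_divide_distrib scale_left_distrib add_ac)
  show "quasi_refl u e (smul c x) = smul c (quasi_refl u e x)" for c x
    by (simp add: quasi_refl_def h_scale_left scale_right_distrib mult_ac)
  have e': "cj e * e = 1" using e by (simp add: mult.commute)
  show "bij (quasi_refl u e)"
    by (rule o_bij[of "quasi_refl u (cj e)"]) (auto simp: fun_eq_iff quasi_refl_comp[OF u e] quasi_refl_comp[OF u e'])
  show "h (quasi_refl u e x) (quasi_refl u e y) = h x y" for x y
  proof -
    define a b where "a = h x u / h u u" and "b = h y u / h u u"
    have xu: "h x u = a * h u u" and yu: "h y u = b * h u u" using u by (simp_all add: a_def b_def)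
    have uy: "h u y = cj b * h u u" using yu h_cj[of u y] h_cj[of u u] by (metis cj_mult)
    have "quasi_refl u e x = x + smul ((e - 1) * a) u" "quasi_refl u e y = y + smul ((e - 1) * b) u"
      by (simp_all add: quasi_refl_def a_def b_def)
    then have "h (quasi_refl u e x) (quasi_refl u e y) = h x y + cj ((e - 1) * b) * h x u
       + (e - 1) * a * h u y + (e - 1) * a * (cj ((e - 1) * b) * h u u)"
      by (simp add: h_add_left h_add_right h_scale_left h_scale_right distrib_left)
    also have "\<dots> = h x y + (e * cj e - 1) * (a * cj b * h u u)"
      unfolding xu uy by (simp add: algebra_simps)
    finally show ?thesis using e by simp
  qed
qed

lemma lc_away:
  assumes l: "prime l" and M: "osub smul M" and m: "\<not> int l dvd m" "\<And>x. x \<in> N \<Longrightarrow> smul (of_int m) x \<in> M"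
  shows "lc l N \<subseteq> lc l M"
proof
  fix x assume "x \<in> lc l N"
  then obtain u :: int where u: "\<not> int l dvd u" "smul (of_int u) x \<in> N" unfolding lc_iff by blast
  have "smul (of_int (m * u)) x \<in> M" using m(2)[OF u(2)] by simp
  moreover have "\<not> int l dvd m * u" using u m l by (simp add: prime_dvd_mult_iff)
  ultimately show "x \<in> lc l M" unfolding lc_iff by blast
qed

lemma lc_subset: assumes l: "prime l" and M: "osub smul M" and N: "\<And>x. x \<in> N \<Longrightarrow> x \<in> lc l M" shows "lc l N \<subseteq> lc l M"
proof
  fix x assume "x \<in> lc l N"
  then obtain u :: int where u: "\<not> int l dvd u" "smul (of_int u) x \<in> N" unfolding lc_iff by blast
  show "x \<in> lc l M" by (rule lc_descend[OF l u(1) N[OF u(2)]])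
qed

(* At p the lattice L splits as o_p u + u^perp, and the neighbour is obtained by rescaling u by the
   idele b / conj b, where b generates P locally at p; away from p nothing changes. *)
lemma neighbour_construct:
  assumes P: "split P p" and L: "latt L" "unim L" and H: "prime_colength P H L"
  obtains N where "neighbour P L N" "L \<inter> N = H" "\<And>l. prime l \<Longrightarrow> locally_isometric smul h l N L"
proof -
  note d = splitD(1)[OF P] and d' = splitD(2)[OF P]
  note oP = degree_oneD(1)[OF d]
  have p: "prime p" by (rule degree_oneD(3)[OF d])
  have p0: "of_nat p \<noteq> (0::'k)" by (rule degree_oneD(6)[OF d])
  have oL: "osub smul L" by (rule latt_osub[OF L(1)])
  have oH: "osub smul H" and HL: "H \<subseteq> L" and PL: "\<And>c x. c \<in> P \<Longrightarrow> x \<in> L \<Longrightarrow> smul c x \<in> H"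
    using H by (auto simp: prime_colength_def)
  have lH: "latt H" by (rule prime_colength_latt[OF d L(1) H])
  obtain u q where u: "u \<in> L" "H = {x \<in> L. h x u \<in> P}" "h u u = of_int q" "\<not> int p dvd q"
    using hyperplane_unit_vector[OF P L H] .
  have q0: "of_int q \<noteq> (0::'k)" using u(4) by auto
  obtain b m where b: "b \<in> P" "b * cj b = of_int (int p * m)" "\<not> int p dvd m" using split_uniformizer[OF P] .
  have m0: "of_int m \<noteq> (0::'k)" using b(3) by auto
  have b0: "b \<noteq> 0" using b(2) p0 m0 by auto
  obtain a where a: "a \<in> P" "1 - a \<in> cj ` P" using P unfolding split_def by blast
  have pP: "of_nat p \<in> P" "of_nat p \<in> cj ` P" using degree_oneD(4)[OF d] degree_oneD(4)[OF d'] by auto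
  \<comment> \<open>\<open>R\<close> is the quotient P / conj(P), the coefficient ideal by which
    \<open>u\<close> is adjoined to \<open>H\<close> to form \<open>N\<close>.\<close>
  define R where "R = {c. \<forall>t\<in>cj ` P. c * t \<in> P}"
  have oR: "osubK R" unfolding R_def by (rule osub_colon[OF oP])
  have PR: "P \<subseteq> R" unfolding R_def
    using K.osub_scale[OF oP] degree_oneD(2)[OF d'] by (auto simp: mult.commute[of _ "cj _"])
  have PPR: "x * y / of_nat p \<in> R" if xy: "x \<in> P" "y \<in> P" for x y
    unfolding R_def
  proof (intro CollectI ballI)
    fix t assume t: "t \<in> cj ` P"
    have "(x * t / of_nat p) * y \<in> P" by (rule K.osub_scale[OF oP split_mult[OF P xy(1) t] xy(2)])
    then show "x * y / of_nat p * t \<in> P" by (simp add: mult_ac)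
  qed
  have RP: "c * t \<in> P" if "c \<in> R" "t \<in> cj ` P" for c t using that unfolding R_def by blast
  have Rp: "of_nat p * c \<in> P" if "c \<in> R" for c using RP[OF that pP(2)] by (simp add: mult.commute)
  have fR: "frac R"
    by (rule fracI[OF oR subsetD[OF PR pP(1)] p0, of "int p"]) (use Rp degree_oneD(2)[OF d] p0 in auto)
  \<comment> \<open>Up to the factor \<open>m\<close> prime to \<open>p\<close> this is b / conj(b),
    the local generator of \<open>R\<close> at \<open>p\<close>; by \<open>Rgen\<close> it generates
    \<open>R\<close> modulo \<open>P\<close>.\<close>
  define w where "w = b * b / of_nat p"
  have wR: "w \<in> R" unfolding w_def by (rule PPR[OF b(1) b(1)])
  have wO: "w \<notin> Ok"
  proof
    assume "w \<in> Ok"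
    then have "w * of_nat p \<in> cj ` P" by (rule K.osub_scale[OF degree_oneD(1)[OF d'] _ pP(2)])
    then have "b * b \<in> cj ` P" using p0 by (simp add: w_def)
    then have "b \<in> cj ` P" using degree_one_prime[OF d'] b(1) degree_oneD(2)[OF d] by blast
    then have bp: "b / of_nat p \<in> Ok" by (rule split_inter[OF P b(1)])
    then have "cj (b / of_nat p) \<in> Ok" by (simp only: O_cj)
    with bp have "(b / of_nat p) * cj (b / of_nat p) \<in> Ok" by (rule O_mult)
    also have "(b / of_nat p) * cj (b / of_nat p) = (b * cj b) / (of_nat p * of_nat p)" by simp
    also have "\<dots> = of_int m / of_int (int p)" unfolding b(2) using p0 by simp
    finally have "int p dvd m" by (rule int_div_in_O) (use p0 in auto)
    then show False using b(3) by blast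
  qed
  have wP: "w \<notin> P" using wO degree_oneD(2)[OF d] by blast
  have P'R: "imul (cj ` P) R = P"
  proof
    show "imul (cj ` P) R \<subseteq> P" by (rule imul_least[OF oP]) (use RP in \<open>auto simp: mult.commute\<close>)
    show "P \<subseteq> imul (cj ` P) R"
    proof
      fix x assume x: "x \<in> P"
      have "(1 - a) * x + of_nat p * (a * x / of_nat p) \<in> imul (cj ` P) R"
        by (intro K.osub_add[OF osub_imul] imulI a pP PPR x subsetD[OF PR x])
      also have "(1 - a) * x + of_nat p * (a * x / of_nat p) = x" using p0 by (simp add: algebra_simps)
      finally show "x \<in> imul (cj ` P) R" .
    qed
  qed
  have Rgen: "\<exists>r\<in>Ok. c - r * w \<in> P" if c: "c \<in> R" for c
  proof -
    obtain r where "r \<in> Ok" "c - r * w \<in> imul (cj ` P) R"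
      using degree_one_generator[OF d' fR wR _ c] wP P'R by blast
    then show ?thesis unfolding P'R by blast
  qed
  define N where "N = {x + smul c u | x c. x \<in> H \<and> c \<in> R}"
  have NI: "x + smul c u \<in> N" if "x \<in> H" "c \<in> R" for x c unfolding N_def using that by blast
  have oN: "osub smul N" unfolding osub_def
  proof (intro conjI ballI)
    show "0 \<in> N" using NI[OF osub_0[OF oH] K.osub_0[OF oR]] by simp
  next
    fix v v' assume "v \<in> N" "v' \<in> N"
    then obtain x c x' c' where *: "v = x + smul c u" "x \<in> H" "c \<in> R" "v' = x' + smul c' u" "x' \<in> H" "c' \<in> R"
      unfolding N_def by blast
    then have "v + v' = (x + x') + smul (c + c') u" by (simp add: scale_left_distrib algebra_simps)
    then show "v + v' \<in> N" using NI[OF osub_add[OF oH *(2,5)] K.osub_add[OF oR *(3,6)]] by simp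
  next
    fix r v assume r: "r \<in> Ok" and "v \<in> N"
    then obtain x c where *: "v = x + smul c u" "x \<in> H" "c \<in> R" unfolding N_def by blast
    then have "smul r v = smul r x + smul (r * c) u" by (simp add: scale_right_distrib)
    then show "smul r v \<in> N" using NI[OF osub_scale[OF oH r *(2)] K.osub_scale[OF oR r *(3)]] by simp
  qed
  have HN: "H \<subseteq> N" using NI[OF _ K.osub_0[OF oR]] by auto
  have pNL: "smul (of_int (int p)) v \<in> L" if v: "v \<in> N" for v
  proof -
    obtain x c where *: "v = x + smul c u" "x \<in> H" "c \<in> R" using v unfolding N_def by blast
    have "of_nat p * c \<in> Ok" using Rp[OF *(3)] degree_oneD(2)[OF d] by blast
    then have "smul (of_nat p) x + smul (of_nat p * c) u \<in> L"
      using *(2) HL by (intro osub_add[OF oL osub_scale[OF oL O_nat] osub_scale[OF oL _ u(1)]]) auto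
    then show ?thesis by (simp add: *(1) scale_right_distrib)
  qed
  have pLN: "smul (of_int (int p)) v \<in> N" if "v \<in> L" for v using PL[OF pP(1) that] HN by auto
  have lN: "latt N"
  proof (rule latt_between[OF latt_scale[OF _ L(1), of "1 / of_nat p"] oN])
    show "1 / of_nat p \<noteq> (0::'k)" using p0 by simp
    show "N \<subseteq> smul (1 / of_nat p) ` L"
    proof
      fix v assume "v \<in> N"
      then have "smul (of_int (int p)) v \<in> L" by (rule pNL)
      moreover have "v = smul (1 / of_nat p) (smul (of_int (int p)) v)" using p0 by simp
      ultimately show "v \<in> smul (1 / of_nat p) ` L" by blast
    qed
    show "int p * int p \<noteq> 0" using p0 by auto
    fix v assume "v \<in> smul (1 / of_nat p) ` L"
    then obtain y where "y \<in> L" "v = smul (1 / of_nat p) y" by blast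
    then show "smul (of_int (int p * int p)) v \<in> N" using pLN[of y] p0 by simp
  qed
  have LN: "L \<inter> N = H"
  proof (intro subset_antisym subsetI)
    fix v assume "v \<in> L \<inter> N"
    then obtain x c where *: "v \<in> L" "v = x + smul c u" "x \<in> H" "c \<in> R" unfolding N_def by blast
    have "smul c u \<in> L" using osub_diff[OF oL *(1), of x] *(2,3) HL by auto
    then have "h (smul c u) u \<in> Ok" using unimD[OF L(2) _ u(1)] by blast
    then have cq: "c * of_int q \<in> Ok" by (simp add: h_scale_left u(3))
    \<comment> \<open>Comaximality again: c (1 - a) lies in \<open>P\<close> because 1 - a is in
      conj(P), and c q is integral by \<open>cq\<close>.\<close>
    have "of_int q * (c * (1 - a)) + (c * of_int q) * a \<in> P"
      by (rule K.osub_add[OF oP K.osub_scale[OF oP O_int RP[OF *(4) a(2)]] K.osub_scale[OF oP cq a(1)]])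
    then have "c * of_int q \<in> P" by (simp add: algebra_simps)
    moreover have "h x u \<in> P" using *(3) u(2) by blast
    ultimately have "h v u \<in> P" using K.osub_add[OF oP, of "h x u" "c * of_int q"]
      by (simp add: *(2) h_add_left h_scale_left u(3))
    then show "v \<in> H" using *(1) u(2) by blast
  qed (use HL HN in auto)
  have cN: "prime_colength (cj ` P) H N" unfolding prime_colength_def
  proof (intro conjI ballI oH HN)
    have "smul w u \<notin> L"
    proof
      assume "smul w u \<in> L"
      then have "h (smul w u) u \<in> Ok" using unimD[OF L(2) _ u(1)] by blast
      then have wq: "of_int q * w \<in> Ok" by (simp add: h_scale_left u(3) mult.commute)
      have wp: "of_nat p * w \<in> Ok" using Rp[OF wR] degree_oneD(2)[OF d] by blast
      have "coprime (int p) q" using p u(4) by (intro prime_imp_coprime) auto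
      then obtain r t where rt: "r * int p + t * q = 1" using coprime_iff_gcd_eq_1 bezout_int by metis
      have "of_int r * (of_nat p * w) + of_int t * (of_int q * w) \<in> Ok"
        by (rule O_add[OF O_mult[OF O_int wp] O_mult[OF O_int wq]])
      also have "of_int r * (of_nat p * w) + of_int t * (of_int q * w) = of_int (r * int p + t * q) * w"
        by (simp add: algebra_simps)
      finally show False using wO rt by simp
    qed
    moreover have "smul w u \<in> N" using NI[OF osub_0[OF oH] wR] by simp
    ultimately show "H \<noteq> N" using HL by blast
    show "smul t v \<in> H" if t: "t \<in> cj ` P" and v: "v \<in> N" for t v
    proof -
      obtain x c where *: "v = x + smul c u" "x \<in> H" "c \<in> R" using v unfolding N_def by blast
      have "t \<in> Ok" using t degree_oneD(2)[OF d'] by blast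
      then have "smul t x + smul (c * t) u \<in> H"
        by (rule osub_add[OF oH osub_scale[OF oH _ *(2)] PL[OF RP[OF *(3) t] u(1)]])
      then show ?thesis by (simp add: *(1) scale_right_distrib mult.commute)
    qed
    have "\<exists>r\<in>Ok. v - smul r (smul w u) \<in> H" if v: "v \<in> N" for v
    proof -
      obtain x c where *: "v = x + smul c u" "x \<in> H" "c \<in> R" using v unfolding N_def by blast
      obtain r where r: "r \<in> Ok" "c - r * w \<in> P" using Rgen[OF *(3)] by blast
      have "x + smul (c - r * w) u \<in> H" by (rule osub_add[OF oH *(2) PL[OF r(2) u(1)]])
      then have "v - smul r (smul w u) \<in> H" by (simp add: *(1) scale_left_diff_distrib add_diff_eq)
      then show ?thesis using r(1) by blast
    qed
    then show "\<exists>w\<in>N. \<forall>x\<in>N. \<exists>c\<in>Ok. x - smul c w \<in> H" using \<open>smul w u \<in> N\<close> by blast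
  qed
  have iso: "locally_isometric smul h l N L" if l: "prime l" for l
  proof (cases "l = p")
    case False
    have "\<not> int l dvd int p" using False l p by (auto dest: primes_dvd_imp_eq)
    then have "lc l N = lc l L"
      using lc_away[OF l oL _ pNL] lc_away[OF l oN _ pLN] by blast
    then show ?thesis by (rule locally_isometric_lc[OF l lN L(1)])
  next
    case True
    \<comment> \<open>The quasi-reflection along \<open>u\<close> with factor f = conj(b) / b undoes
      the rescaling by \<open>R\<close> and carries \<open>N\<close> to \<open>L\<close> at
      \<open>p\<close>; the integers q and m are prime to \<open>p\<close> and clear the
      denominators.\<close>
    define e where "e = b / cj b"
    define f where "f = cj b / b"
    have cb0: "cj b \<noteq> 0" using b0 by simp
    have ef: "e * f = 1" "f * e = 1" using b0 cb0 by (simp_all add: e_def f_def)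
    have cjf: "cj f = e" "f * cj f = 1" using b0 cb0 by (simp_all add: e_def f_def)
    have huu: "h u u \<noteq> 0" using u(3) q0 by simp
    have fUV: "quasi_refl u f \<in> UV" by (rule quasi_refl_UV[OF huu cjf(2)])
    have mf: "of_int m * f = cj b * cj b / of_nat p" and me: "of_int m * e = w"
    proof -
      have "of_int m = b * cj b / of_nat p" unfolding b(2) using p0 by simp
      then show "of_int m * f = cj b * cj b / of_nat p" "of_int m * e = w"
        using b0 cb0 by (simp_all add: f_def e_def w_def)
    qed
    have cbP: "cj b \<in> cj ` P" using b(1) by blast
    have 1: "quasi_refl u f v \<in> lc p L" if v: "v \<in> N" for v
    proof -
      obtain x c where *: "v = x + smul c u" "x \<in> H" "c \<in> R" using v unfolding N_def by blast
      have hx: "h x u \<in> P" "h x u \<in> Ok" "x \<in> L" using *(2) u(2) degree_oneD(2)[OF d] by auto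
      have mf1: "of_int m * f * h x u \<in> Ok"
      proof -
        have "cj b * (h x u * cj b / of_nat p) \<in> Ok"
          using split_mult[OF P hx(1) cbP] b(1) degree_oneD(2)[OF d] by (intro O_mult) auto
        then show ?thesis unfolding mf by (simp add: mult_ac)
      qed
      have mf2: "of_int m * f * c \<in> Ok"
      proof -
        have "c * cj b * cj b / of_nat p \<in> Ok" by (rule split_mult[OF P RP[OF *(3) cbP] cbP])
        then show ?thesis unfolding mf by (simp add: mult_ac)
      qed
      have "quasi_refl u f v = x + smul (f * c + (f - 1) * h x u / of_int q) u"
        using q0 by (simp add: quasi_refl_def *(1) u(3) h_add_left h_scale_left scale_left_distrib[symmetric]
            add.assoc) (simp add: field_simps)
      then have "smul (of_int (q * m)) (quasi_refl u f v) = smul (of_int (q * m)) x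
          + smul (of_int q * (of_int m * f * c) + (of_int m * f * h x u - of_int m * h x u)) u"
        using q0 by (simp add: scale_right_distrib) (simp add: field_simps)
      also have "\<dots> \<in> L"
        using mf1 mf2 hx by (intro osub_add[OF oL osub_scale[OF oL O_int hx(3)] osub_scale[OF oL _ u(1)]] O_add O_diff) auto
      finally have "smul (of_int (q * m)) (quasi_refl u f v) \<in> L" .
      moreover have "\<not> int p dvd q * m" using u(4) b(3) p by (simp add: prime_dvd_mult_iff)
      ultimately show ?thesis unfolding lc_iff by blast
    qed
    have 2: "y \<in> lc p (quasi_refl u f ` N)" if y: "y \<in> L" for y
    proof -
      \<comment> \<open>This is q times the component of \<open>y\<close> orthogonal to
        \<open>u\<close>; it lies in \<open>H\<close> because its product with \<open>u\<close> is
        0.\<close>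
      define y0 where "y0 = smul (of_int q) y - smul (h y u) u"
      have hyO: "h y u \<in> Ok" by (rule unimD[OF L(2) y u(1)])
      have y0L: "y0 \<in> L" unfolding y0_def
        by (rule osub_diff[OF oL osub_scale[OF oL O_int y] osub_scale[OF oL hyO u(1)]])
      have "h y0 u = 0" by (simp add: y0_def h_diff_left h_scale_left u(3) mult.commute)
      then have y0H: "y0 \<in> H" using y0L u(2) K.osub_0[OF oP] by simp
      have eq: "smul (of_int (q * m)) (quasi_refl u e y) = smul (of_int m) y0 + smul (h y u * w) u"
      proof -
        have "smul (of_int (q * m)) (quasi_refl u e y)
            = smul (of_int (q * m)) y + smul (of_int m * (e - 1) * h y u) u"
          using q0 by (simp add: quasi_refl_def u(3) scale_right_distrib mult_ac)
        also have "of_int m * (e - 1) * h y u = h y u * w - of_int m * h y u"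
          unfolding me[symmetric] by (simp add: algebra_simps)
        finally show ?thesis
          by (simp add: y0_def scale_right_diff_distrib scale_left_diff_distrib mult.commute)
      qed
      have "smul (of_int (q * m)) (quasi_refl u e y) \<in> N"
        unfolding eq by (rule NI[OF osub_scale[OF oH O_int y0H] K.osub_scale[OF oR hyO wR]])
      then have "quasi_refl u f (smul (of_int (q * m)) (quasi_refl u e y)) \<in> quasi_refl u f ` N" by blast
      then have "smul (of_int (q * m)) y \<in> quasi_refl u f ` N"
        by (simp only: UV_D(2)[OF fUV] quasi_refl_comp[OF huu ef(1)])
      moreover have "\<not> int p dvd q * m" using u(4) b(3) p by (simp add: prime_dvd_mult_iff)
      ultimately show ?thesis unfolding lc_iff by blast
    qed
    have oN': "osub smul (quasi_refl u f ` N)" by (rule latt_osub[OF UV_latt[OF fUV lN]])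
    have "lc p (quasi_refl u f ` N) = lc p L"
      by (intro subset_antisym lc_subset[OF p oL] lc_subset[OF p oN']) (use 1 2 in auto)
    then show ?thesis unfolding True by (rule locally_isometric_UV[OF p fUV lN L(1)])
  qed
  have "unim N" by (rule genus_unim[OF lN L iso])
  then have "neighbour P L N" unfolding neighbour_def LN using L lN H cN by simp
  then show thesis using that LN iso by blast
qed

text \<open>By uniqueness every neighbour is the one constructed from its intersection with
  \<open>L\<close>.\<close>

lemma neighbour_locally_isometric:
  assumes P: "split P p" and N: "neighbour P L N" and l: "prime l" shows "locally_isometric smul h l N L"
proof -
  have "latt L" "unim L" "prime_colength P (L \<inter> N) L" using N by (auto simp: neighbour_def)
  then obtain N' where N': "neighbour P L N'" "L \<inter> N' = L \<inter> N" "\<And>l. prime l \<Longrightarrow> locally_isometric smul h l N' L"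
    using neighbour_construct[OF P] by metis
  then show ?thesis using neighbour_unique[OF P N N'(1)] l by simp
qed

lemma card_neighbour:
  assumes P: "split P p" and L: "latt L" "unim L"
  shows "finite {N. neighbour P L N}" "card {N. neighbour P L N} = card (hyperplanes n p)"
proof -
  have "bij_betw (\<lambda>N. L \<inter> N) {N. neighbour P L N} {H. prime_colength P H L}"
    unfolding bij_betw_def
  proof
    show "inj_on (\<lambda>N. L \<inter> N) {N. neighbour P L N}" by (rule inj_onI) (use neighbour_unique[OF P] in blast)
    show "(\<lambda>N. L \<inter> N) ` {N. neighbour P L N} = {H. prime_colength P H L}"
    proof (intro subset_antisym subsetI)
      fix H assume "H \<in> {H. prime_colength P H L}"
      then obtain N where "neighbour P L N" "L \<inter> N = H" using neighbour_construct[OF P L] by blast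
      then show "H \<in> (\<lambda>N. L \<inter> N) ` {N. neighbour P L N}" by blast
    qed (auto simp: neighbour_def)
  qed
  then show "finite {N. neighbour P L N}" "card {N. neighbour P L N} = card (hyperplanes n p)"
    using card_prime_colength_eq[OF splitD(1)[OF P] L(1)] bij_betw_finite bij_betw_same_card by metis+
qed

end

section \<open>Masses\<close>

text \<open>A divergent sum is 0 by convention, and so is \<open>enn2real\<close> of \<infinity>;
  hence identities between masses in \<open>ennreal\<close> pass to the reals in either
  case.\<close>

lemma infsum_eq_enn2real:
  fixes f :: "'a \<Rightarrow> real"
  assumes f: "\<And>x. f x \<ge> 0"
  shows "infsum f A = enn2real (\<integral>\<^sup>+x. ennreal (f x) \<partial>count_space A)"
proof (cases "integrable (count_space A) f")
  case True
  then have abs: "Infinite_Set_Sum.abs_summable_on f A" by (simp add: Infinite_Set_Sum.abs_summable_on_def)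
  then have "infsum f A = infsetsum f A" by (simp add: infsetsum_infsum)
  also have "\<dots> = integral\<^sup>L (count_space A) f" by (simp add: infsetsum_def)
  also have "\<dots> = enn2real (\<integral>\<^sup>+x. ennreal (f x) \<partial>count_space A)"
    by (rule integral_eq_nn_integral) (use f in auto)
  finally show ?thesis .
next
  case False
  have "\<not> f summable_on A"
  proof
    assume "f summable_on A"
    then have "(\<lambda>x. norm (f x)) summable_on A" using f by simp
    then have "Infinite_Set_Sum.abs_summable_on f A" using abs_summable_equivalent by blast
    then show False using False by (simp add: Infinite_Set_Sum.abs_summable_on_def)
  qed
  then have "infsum f A = 0" by (rule infsum_not_exists)
  moreover have "(\<integral>\<^sup>+x. ennreal (f x) \<partial>count_space A) = \<infinity>"
  proof (rule ccontr)
    assume "(\<integral>\<^sup>+x. ennreal (f x) \<partial>count_space A) \<noteq> \<infinity>"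
    then have "integrable (count_space A) f"
      by (intro integrableI_bounded) (use f in \<open>auto simp: less_top\<close>)
    then show False using False by simp
  qed
  ultimately show ?thesis by simp
qed

lemma nn_integral_count_space_finite_support:
  assumes "finite F" "F \<subseteq> A" "\<And>x. x \<in> A \<Longrightarrow> x \<notin> F \<Longrightarrow> f x = 0"
  shows "(\<integral>\<^sup>+x. f x \<partial>count_space A) = (\<Sum>x\<in>F. f x)"
  by (rule nn_integral_count_space') (use assms in auto)

text \<open>Extension by 0 to the whole types reduces this to iterated sums over pairs.\<close>

lemma nn_integral_count_space_swap:
  fixes f :: "'a \<Rightarrow> 'b \<Rightarrow> ennreal"
  shows "(\<integral>\<^sup>+x. (\<integral>\<^sup>+y. f x y \<partial>count_space B) \<partial>count_space A) = (\<integral>\<^sup>+y. (\<integral>\<^sup>+x. f x y \<partial>count_space A) \<partial>count_space B)"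
proof -
  define g where "g x y = f x y * indicator A x * indicator B y" for x y
  have "(\<integral>\<^sup>+x. (\<integral>\<^sup>+y. f x y \<partial>count_space B) \<partial>count_space A) = (\<integral>\<^sup>+x. (\<integral>\<^sup>+y. g x y \<partial>count_space UNIV) \<partial>count_space UNIV)"
    by (subst nn_integral_count_space_indicator, simp, subst nn_integral_count_space_indicator, simp,
        subst nn_integral_multc[symmetric]) (auto simp: g_def mult_ac intro!: nn_integral_cong)
  also have "\<dots> = (\<integral>\<^sup>+y. (\<integral>\<^sup>+x. g x y \<partial>count_space UNIV) \<partial>count_space UNIV)"
    using nn_integral_fst_count_space[of "\<lambda>(x, y). g x y"] nn_integral_snd_count_space[of "\<lambda>(x, y). g x y"] by simp
  also have "\<dots> = (\<integral>\<^sup>+y. (\<integral>\<^sup>+x. f x y \<partial>count_space A) \<partial>count_space B)"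
    by (subst (2) nn_integral_count_space_indicator, simp, subst (2) nn_integral_count_space_indicator, simp,
        subst nn_integral_multc[symmetric]) (auto simp: g_def mult_ac intro!: nn_integral_cong)
  finally show ?thesis .
qed

lemma nn_integral_count_space_partition:
  assumes I: "finite I" and disj: "\<And>i j. i \<in> I \<Longrightarrow> j \<in> I \<Longrightarrow> i \<noteq> j \<Longrightarrow> A i \<inter> A j = {}"
  shows "(\<integral>\<^sup>+x. f x \<partial>count_space (\<Union>i\<in>I. A i)) = (\<Sum>i\<in>I. (\<integral>\<^sup>+x. f x \<partial>count_space (A i)))"
proof -
  have ind: "indicator (\<Union>i\<in>I. A i) x = (\<Sum>i\<in>I. indicator (A i) x :: ennreal)" for x
  proof (cases "\<exists>i\<in>I. x \<in> A i")
    case True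
    then obtain i where i: "i \<in> I" "x \<in> A i" by blast
    have "(\<Sum>j\<in>I. indicator (A j) x :: ennreal) = (\<Sum>j\<in>{i}. indicator (A j) x)"
      using disj i I by (intro sum.mono_neutral_right) (auto simp: indicator_def)
    then show ?thesis using i by (auto simp: indicator_def)
  next
    case False
    then have "(\<Sum>j\<in>I. indicator (A j) x :: ennreal) = 0" by (intro sum.neutral) (auto simp: indicator_def)
    then show ?thesis using False by (auto simp: indicator_def)
  qed
  have "(\<integral>\<^sup>+x. f x \<partial>count_space (\<Union>i\<in>I. A i)) = (\<integral>\<^sup>+x. (\<Sum>i\<in>I. f x * indicator (A i) x) \<partial>count_space UNIV)"
    by (subst nn_integral_count_space_indicator) (simp_all add: ind sum_distrib_left)
  also have "\<dots> = (\<Sum>i\<in>I. (\<integral>\<^sup>+x. f x * indicator (A i) x \<partial>count_space UNIV))"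
    by (rule nn_integral_sum) simp
  also have "\<dots> = (\<Sum>i\<in>I. (\<integral>\<^sup>+x. f x \<partial>count_space (A i)))"
    by (intro sum.cong refl nn_integral_count_space_indicator[symmetric]) simp
  finally show ?thesis .
qed

context herm_space
begin

abbreviation aut where "aut \<equiv> lattice_aut smul h"

section \<open>Isometry classes and weighted double counting\<close>

definition irel :: "'v set set \<Rightarrow> ('v set \<times> 'v set) set" where
  "irel G = {(L, N). L \<in> G \<and> N \<in> G \<and> (\<exists>\<sigma>\<in>UV. \<sigma> ` L = N)}"

lemma isometry_classes_eq: "isometry_classes smul h G = G // irel G"
  by (simp add: isometry_classes_def irel_def)

lemma UV_inv_image: assumes s: "\<sigma> \<in> UV" shows "inv_into UNIV \<sigma> ` \<sigma> ` L = L" "\<sigma> ` inv_into UNIV \<sigma> ` L = L"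
  using UV_D(3)[OF s] by (simp_all add: image_image bij_is_surj surj_f_inv_f bij_is_inj)

lemma equiv_irel: "equiv G (irel G)"
proof (rule equivI)
  show "refl_on G (irel G)"
  proof (rule refl_onI)
    fix L assume "L \<in> G"
    moreover have "id ` L = L" by simp
    ultimately show "(L, L) \<in> irel G" unfolding irel_def using UV_id by blast
  qed
  show "irel G \<subseteq> G \<times> G" by (auto simp: irel_def)
  show "sym (irel G)"
  proof (rule symI)
    fix L N assume "(L, N) \<in> irel G"
    then obtain \<sigma> where s: "L \<in> G" "N \<in> G" "\<sigma> \<in> UV" "\<sigma> ` L = N" unfolding irel_def by blast
    have "inv_into UNIV \<sigma> ` N = L" using UV_inv_image(1)[OF s(3), of L] s(4) by simp
    then show "(N, L) \<in> irel G" unfolding irel_def using s UV_inv[OF s(3)] by blast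
  qed
  show "trans (irel G)"
  proof (rule transI)
    fix L M N assume "(L, M) \<in> irel G" "(M, N) \<in> irel G"
    then obtain \<sigma> \<tau> where s: "L \<in> G" "N \<in> G" "\<sigma> \<in> UV" "\<tau> \<in> UV" "\<tau> ` \<sigma> ` L = N" unfolding irel_def by auto
    have "(\<tau> \<circ> \<sigma>) ` L = N" using s(5) by (simp add: image_comp)
    then show "(L, N) \<in> irel G" unfolding irel_def using s UV_comp[OF s(4,3)] by blast
  qed
qed

text \<open>Closure under isometries makes the isometry classes inside \<open>G\<close> full orbits,
  so that a genus and its partial genera have literally the same sets as classes.\<close>

definition stable :: "'v set set \<Rightarrow> bool" where
  "stable G \<longleftrightarrow> (\<forall>\<sigma>\<in>UV. \<forall>L\<in>G. \<sigma> ` L \<in> G)"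

lemma irel_class: assumes "stable G" "L \<in> G" shows "irel G `` {L} = {\<sigma> ` L | \<sigma>. \<sigma> \<in> UV}"
  using assms unfolding irel_def stable_def by auto

definition wt :: "'v set set \<Rightarrow> real" where "wt C = 1 / real (card (aut (SOME L. L \<in> C)))"

definition emass :: "'v set set \<Rightarrow> ennreal" where
  "emass G = (\<integral>\<^sup>+C. ennreal (wt C) \<partial>count_space (G // irel G))"

lemma mass_eq: "mass smul h G = enn2real (emass G)"
  unfolding mass_def emass_def isometry_classes_eq
  by (subst infsum_eq_enn2real) (auto simp: wt_def)

lemma class_rep:
  assumes "stable G" "C \<in> G // irel G"
  shows "(SOME L. L \<in> C) \<in> G" "C = {\<sigma> ` (SOME L. L \<in> C) | \<sigma>. \<sigma> \<in> UV}"
proof -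
  obtain L where L: "L \<in> G" "C = irel G `` {L}" using assms(2) by (rule quotientE)
  have "L \<in> C" unfolding L(2) using equiv_class_self[OF equiv_irel L(1)] .
  then have r: "(SOME L. L \<in> C) \<in> C" by (rule someI)
  moreover have "C \<subseteq> G" unfolding L(2) by (auto simp: irel_def)
  ultimately show G: "(SOME L. L \<in> C) \<in> G" by blast
  have "(L, SOME L. L \<in> C) \<in> irel G" using r L(2) by blast
  then have "irel G `` {L} = irel G `` {SOME L. L \<in> C}" by (rule equiv_class_eq[OF equiv_irel])
  from trans[OF L(2) this] show "C = {\<sigma> ` (SOME L. L \<in> C) | \<sigma>. \<sigma> \<in> UV}"
    by (rule trans[OF _ irel_class[OF assms(1) G]])
qed

text \<open>Orbit and stabilizer: each nonempty fibre of the map that sends \<sigma> to the image of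
  \<open>N\<close> is a coset of the automorphism group of \<open>N\<close>.\<close>

lemma transporter_count:
  assumes aut: "finite (aut N)"
    and fin: "finite {N' \<in> {\<sigma> ` N | \<sigma>. \<sigma> \<in> UV}. R N'}"
  shows "card {\<sigma> \<in> UV. R (\<sigma> ` N)} = card (aut N) * card {N' \<in> {\<sigma> ` N | \<sigma>. \<sigma> \<in> UV}. R N'}"
proof -
  let ?X = "{\<sigma> \<in> UV. R (\<sigma> ` N)}"
  have im: "(\<lambda>\<sigma>. \<sigma> ` N) ` ?X = {N' \<in> {\<sigma> ` N | \<sigma>. \<sigma> \<in> UV}. R N'}" by blast
  have fib: "bij_betw (\<lambda>\<rho>. \<tau> \<circ> \<rho>) (aut N) {\<sigma> \<in> ?X. \<sigma> ` N = \<tau> ` N}" if t: "\<tau> \<in> UV" "R (\<tau> ` N)" for \<tau>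
  proof (rule bij_betwI[where g = "\<lambda>\<sigma>. inv_into UNIV \<tau> \<circ> \<sigma>"])
    have b: "bij \<tau>" by (rule UV_D(3)[OF t(1)])
    have im: "(\<tau> \<circ> \<rho>) ` N = \<tau> ` \<rho> ` N" "(inv_into UNIV \<tau> \<circ> \<rho>) ` N = inv_into UNIV \<tau> ` \<rho> ` N" for \<rho>
      by (simp_all only: image_comp)
    show "(\<lambda>\<rho>. \<tau> \<circ> \<rho>) \<in> aut N \<rightarrow> {\<sigma> \<in> ?X. \<sigma> ` N = \<tau> ` N}"
    proof
      fix \<rho> assume "\<rho> \<in> aut N"
      then have r: "\<rho> \<in> UV" "\<rho> ` N = N" by (auto simp: lattice_aut_def)
      have "(\<tau> \<circ> \<rho>) ` N = \<tau> ` N" unfolding im r(2) ..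
      then show "\<tau> \<circ> \<rho> \<in> {\<sigma> \<in> ?X. \<sigma> ` N = \<tau> ` N}" using t UV_comp[OF t(1) r(1)] by simp
    qed
    show "(\<lambda>\<sigma>. inv_into UNIV \<tau> \<circ> \<sigma>) \<in> {\<sigma> \<in> ?X. \<sigma> ` N = \<tau> ` N} \<rightarrow> aut N"
    proof
      fix \<sigma> assume "\<sigma> \<in> {\<sigma> \<in> ?X. \<sigma> ` N = \<tau> ` N}"
      then have r: "\<sigma> \<in> UV" "\<sigma> ` N = \<tau> ` N" by auto
      have "(inv_into UNIV \<tau> \<circ> \<sigma>) ` N = N" unfolding im r(2) by (rule UV_inv_image(1)[OF t(1)])
      then show "inv_into UNIV \<tau> \<circ> \<sigma> \<in> aut N" using UV_comp[OF UV_inv[OF t(1)] r(1)] by (simp add: lattice_aut_def)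
    qed
    show "inv_into UNIV \<tau> \<circ> (\<tau> \<circ> \<rho>) = \<rho>" for \<rho> using b by (auto simp: fun_eq_iff bij_is_inj)
    show "\<tau> \<circ> (inv_into UNIV \<tau> \<circ> \<sigma>) = \<sigma>" for \<sigma> using b by (auto simp: fun_eq_iff bij_is_surj surj_f_inv_f)
  qed
  have c: "card {\<sigma> \<in> ?X. \<sigma> ` N = y} = card (aut N)" "finite {\<sigma> \<in> ?X. \<sigma> ` N = y}" if y: "y \<in> (\<lambda>\<sigma>. \<sigma> ` N) ` ?X" for y
  proof -
    obtain \<tau> where t: "\<tau> \<in> UV" "R (\<tau> ` N)" "y = \<tau> ` N" using y by blast
    show "card {\<sigma> \<in> ?X. \<sigma> ` N = y} = card (aut N)" "finite {\<sigma> \<in> ?X. \<sigma> ` N = y}"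
      using bij_betw_same_card[OF fib[OF t(1,2)]] bij_betw_finite[OF fib[OF t(1,2)]] aut unfolding t(3) by simp_all
  qed
  have "?X = (\<Union>y\<in>(\<lambda>\<sigma>. \<sigma> ` N) ` ?X. {\<sigma> \<in> ?X. \<sigma> ` N = y})" by blast
  moreover have "finite (\<Union>y\<in>(\<lambda>\<sigma>. \<sigma> ` N) ` ?X. {\<sigma> \<in> ?X. \<sigma> ` N = y})"
    using fin c(2) unfolding im[symmetric] by (intro finite_UN_I) auto
  ultimately have "finite ?X" by simp
  from card_const_fibres[OF this c(1)] show ?thesis unfolding im .
qed

(* For representatives L, N of two classes, the set of all g with R L (g N) has
   |aut N| * #(neighbours of L in the class of N) elements and equally
   |aut L| * #(neighbours of N in the class of L) elements. *)
lemma emass_eq_by_correspondence: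
  assumes S: "stable S" and T: "stable T"
    and aut: "\<And>L. L \<in> S \<union> T \<Longrightarrow> finite (aut L)"
    and R: "\<And>\<sigma> L N. \<sigma> \<in> UV \<Longrightarrow> R L N \<Longrightarrow> R (\<sigma> ` L) (\<sigma> ` N)"
    and deg: "\<And>L. L \<in> S \<Longrightarrow> finite {N \<in> T. R L N} \<and> card {N \<in> T. R L N} = c"
    and deg': "\<And>N. N \<in> T \<Longrightarrow> finite {L \<in> S. R L N} \<and> card {L \<in> S. R L N} = c"
    and c: "c > 0"
  shows "emass S = emass T"
proof -
  define rp where "rp C = (SOME L. L \<in> C)" for C :: "'v set set"
  define a where "a C C' = card {N \<in> C'. R (rp C) N}" for C C'
  define b where "b C C' = card {L \<in> C. R L (rp C')}" for C C'
  have key: "card (aut (rp C')) * a C C' = card (aut (rp C)) * b C C'"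
    if C: "C \<in> S // irel S" and C': "C' \<in> T // irel T" for C C'
  proof -
    note r = class_rep[OF S C, folded rp_def] and r' = class_rep[OF T C', folded rp_def]
    have "{N' \<in> {\<sigma> ` rp C' | \<sigma>. \<sigma> \<in> UV}. R (rp C) N'} \<subseteq> {N \<in> T. R (rp C) N}"
      using r'(1) T unfolding stable_def by blast
    then have fin: "finite {N' \<in> {\<sigma> ` rp C' | \<sigma>. \<sigma> \<in> UV}. R (rp C) N'}"
      by (rule finite_subset) (use deg[OF r(1)] in blast)
    have "{L' \<in> {\<sigma> ` rp C | \<sigma>. \<sigma> \<in> UV}. R L' (rp C')} \<subseteq> {L \<in> S. R L (rp C')}"
      using r(1) S unfolding stable_def by blast
    then have fin': "finite {L' \<in> {\<sigma> ` rp C | \<sigma>. \<sigma> \<in> UV}. R L' (rp C')}"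
      by (rule finite_subset) (use deg'[OF r'(1)] in blast)
    have 1: "card {\<sigma> \<in> UV. R (rp C) (\<sigma> ` rp C')} = card (aut (rp C')) * a C C'"
      using transporter_count[OF aut fin] r'(1) unfolding a_def by (subst (2) r'(2)) simp
    have 2: "card {\<sigma> \<in> UV. R (\<sigma> ` rp C) (rp C')} = card (aut (rp C)) * b C C'"
      using transporter_count[OF aut fin'] r(1) unfolding b_def by (subst (2) r(2)) simp
    \<comment> \<open>Applying the inverse of \<sigma> to both lattices moves it from the second
      argument of \<open>R\<close> to the first, so inversion matches the two sets.\<close>
    have "bij_betw (inv_into UNIV) {\<sigma> \<in> UV. R (rp C) (\<sigma> ` rp C')} {\<sigma> \<in> UV. R (\<sigma> ` rp C) (rp C')}"
    proof (rule bij_betwI[where g = "inv_into UNIV"])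
      show "inv_into UNIV \<in> {\<sigma> \<in> UV. R (rp C) (\<sigma> ` rp C')} \<rightarrow> {\<sigma> \<in> UV. R (\<sigma> ` rp C) (rp C')}"
      proof
        fix \<sigma> assume "\<sigma> \<in> {\<sigma> \<in> UV. R (rp C) (\<sigma> ` rp C')}"
        then have s: "\<sigma> \<in> UV" "R (rp C) (\<sigma> ` rp C')" by auto
        then show "inv_into UNIV \<sigma> \<in> {\<sigma> \<in> UV. R (\<sigma> ` rp C) (rp C')}"
          using R[OF UV_inv[OF s(1)] s(2)] UV_inv[OF s(1)] UV_inv_image(1)[OF s(1), of "rp C'"] by simp
      qed
      show "inv_into UNIV \<in> {\<sigma> \<in> UV. R (\<sigma> ` rp C) (rp C')} \<rightarrow> {\<sigma> \<in> UV. R (rp C) (\<sigma> ` rp C')}"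
      proof
        fix \<sigma> assume "\<sigma> \<in> {\<sigma> \<in> UV. R (\<sigma> ` rp C) (rp C')}"
        then have s: "\<sigma> \<in> UV" "R (\<sigma> ` rp C) (rp C')" by auto
        then show "inv_into UNIV \<sigma> \<in> {\<sigma> \<in> UV. R (rp C) (\<sigma> ` rp C')}"
          using R[OF UV_inv[OF s(1)] s(2)] UV_inv[OF s(1)] UV_inv_image(1)[OF s(1), of "rp C"] by simp
      qed
    qed (auto simp: inv_inv_eq UV_D(3))
    then have "card {\<sigma> \<in> UV. R (rp C) (\<sigma> ` rp C')} = card {\<sigma> \<in> UV. R (\<sigma> ` rp C) (rp C')}"
      by (rule bij_betw_same_card)
    then show ?thesis using 1 2 by simp
  qed
  have autpos: "card (aut L) > 0" if "L \<in> S \<union> T" for L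
  proof -
    have "id \<in> aut L" using UV_id by (simp add: lattice_aut_def)
    then show ?thesis using aut[OF that] by (auto simp: card_gt_0_iff)
  qed
  have w: "ennreal (wt C) * of_nat (a C C') = ennreal (wt C') * of_nat (b C C')"
    if C: "C \<in> S // irel S" and C': "C' \<in> T // irel T" for C C'
  proof -
    note r = class_rep(1)[OF S C, folded rp_def] and r' = class_rep(1)[OF T C', folded rp_def]
    have p: "card (aut (rp C)) > 0" "card (aut (rp C')) > 0" using autpos r r' by auto
    have "real (card (aut (rp C'))) * real (a C C') = real (card (aut (rp C))) * real (b C C')"
      using key[OF C C'] by (simp flip: of_nat_mult)
    then have "wt C * real (a C C') = wt C' * real (b C C')"
      using p unfolding wt_def rp_def[symmetric] by (simp add: field_simps)
    moreover have "wt C \<ge> 0" "wt C' \<ge> 0" by (simp_all add: wt_def)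
    ultimately show ?thesis by (metis ennreal_mult ennreal_of_nat_eq_real_of_nat of_nat_0_le_iff)
  qed
  \<comment> \<open>A class with a nonzero contribution is the class of one of the \<open>c\<close>
    lattices satisfying \<open>Q\<close>, so the sum over all classes has finite support.\<close>
  have total: "(\<integral>\<^sup>+C'. of_nat (card {N \<in> C'. Q N}) \<partial>count_space (G // irel G)) = of_nat c"
    if G: "stable G" and Q: "finite {N \<in> G. Q N}" "card {N \<in> G. Q N} = c" for G Q
  proof -
    let ?F = "(\<lambda>N. irel G `` {N}) ` {N \<in> G. Q N}"
    have sub: "?F \<subseteq> G // irel G" by (auto intro: quotientI)
    have "(\<integral>\<^sup>+C'. of_nat (card {N \<in> C'. Q N}) \<partial>count_space (G // irel G)) = (\<Sum>C'\<in>?F. of_nat (card {N \<in> C'. Q N}))"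
    proof (rule nn_integral_count_space_finite_support)
      show "finite ?F" using Q(1) by simp
      fix C' assume C': "C' \<in> G // irel G" "C' \<notin> ?F"
      have "{N \<in> C'. Q N} = {}"
      proof (rule ccontr)
        assume "{N \<in> C'. Q N} \<noteq> {}"
        then obtain N where N: "N \<in> C'" "Q N" by blast
        obtain L where L: "L \<in> G" "C' = irel G `` {L}" using C'(1) by (rule quotientE)
        have "(L, N) \<in> irel G" using N L by blast
        then have "C' = irel G `` {N}" "N \<in> G" using equiv_class_eq[OF equiv_irel] L(2) by (auto simp: irel_def)
        then show False using C'(2) N(2) by blast
      qed
      then show "of_nat (card {N \<in> C'. Q N}) = (0::ennreal)" by (simp only: card.empty of_nat_0)
    qed (rule sub)
    also have "\<dots> = of_nat (\<Sum>C'\<in>?F. card {N \<in> C'. Q N})" by simp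
    also have "(\<Sum>C'\<in>?F. card {N \<in> C'. Q N}) = card (\<Union>C'\<in>?F. {N \<in> C'. Q N})"
    proof (rule card_UN_disjoint[symmetric])
      show "finite ?F" using Q(1) by simp
      show "\<forall>C'\<in>?F. finite {N \<in> C'. Q N}"
        using Q(1) by (auto intro!: finite_subset[OF _ Q(1)] simp: irel_def)
      show "\<forall>C1\<in>?F. \<forall>C2\<in>?F. C1 \<noteq> C2 \<longrightarrow> {N \<in> C1. Q N} \<inter> {N \<in> C2. Q N} = {}"
        using quotient_disj[OF equiv_irel[of G]] sub by blast
    qed
    also have "(\<Union>C'\<in>?F. {N \<in> C'. Q N}) = {N \<in> G. Q N}"
      using equiv_class_self[OF equiv_irel[of G]] by (auto simp: irel_def)
    finally show ?thesis using Q(2) by simp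
  qed
  have tot: "(\<integral>\<^sup>+C'. of_nat (a C C') \<partial>count_space (T // irel T)) = of_nat c" if C: "C \<in> S // irel S" for C
    unfolding a_def using deg[OF class_rep(1)[OF S C]] by (intro total T) (auto simp: rp_def)
  have tot': "(\<integral>\<^sup>+C. of_nat (b C C') \<partial>count_space (S // irel S)) = of_nat c" if C': "C' \<in> T // irel T" for C'
    unfolding b_def using deg'[OF class_rep(1)[OF T C']] by (intro total S) (auto simp: rp_def)
  \<comment> \<open>The factor \<open>c\<close> is spread over the classes of \<open>T\<close> by
    \<open>tot\<close>, the weights are exchanged by \<open>w\<close>, and \<open>tot'\<close>
    collects the sum over the classes of \<open>S\<close>. Being finite and positive,
    \<open>c\<close> cancels at the end.\<close>
  have "emass S * of_nat c = (\<integral>\<^sup>+C. ennreal (wt C) * of_nat c \<partial>count_space (S // irel S))"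
    unfolding emass_def by (rule nn_integral_multc[symmetric]) simp
  also have "\<dots> = (\<integral>\<^sup>+C. (\<integral>\<^sup>+C'. ennreal (wt C) * of_nat (a C C') \<partial>count_space (T // irel T)) \<partial>count_space (S // irel S))"
  proof (rule nn_integral_cong)
    fix C assume "C \<in> space (count_space (S // irel S))"
    then have C: "C \<in> S // irel S" by simp
    show "ennreal (wt C) * of_nat c = (\<integral>\<^sup>+C'. ennreal (wt C) * of_nat (a C C') \<partial>count_space (T // irel T))"
      unfolding tot[OF C, symmetric] by (rule nn_integral_cmult[symmetric]) simp
  qed
  also have "\<dots> = (\<integral>\<^sup>+C. (\<integral>\<^sup>+C'. ennreal (wt C') * of_nat (b C C') \<partial>count_space (T // irel T)) \<partial>count_space (S // irel S))"
    using w by (intro nn_integral_cong) simp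
  also have "\<dots> = (\<integral>\<^sup>+C'. (\<integral>\<^sup>+C. ennreal (wt C') * of_nat (b C C') \<partial>count_space (S // irel S)) \<partial>count_space (T // irel T))"
    by (rule nn_integral_count_space_swap)
  also have "\<dots> = (\<integral>\<^sup>+C'. ennreal (wt C') * of_nat c \<partial>count_space (T // irel T))"
  proof (rule nn_integral_cong)
    fix C' assume "C' \<in> space (count_space (T // irel T))"
    then have C': "C' \<in> T // irel T" by simp
    show "(\<integral>\<^sup>+C. ennreal (wt C') * of_nat (b C C') \<partial>count_space (S // irel S)) = ennreal (wt C') * of_nat c"
      unfolding tot'[OF C', symmetric] by (rule nn_integral_cmult) simp
  qed
  also have "\<dots> = emass T * of_nat c" unfolding emass_def by (rule nn_integral_multc) simp
  finally have "of_nat c * emass S = of_nat c * emass T" by (simp add: mult.commute)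
  then show ?thesis using c by (simp add: ennreal_mult_cancel_left)
qed

section \<open>Finiteness of automorphism groups\<close>

lemma finite_O_nrm: "finite {z \<in> Ok. nrm z \<le> B}"
proof -
  \<comment> \<open>Comes from |t| \<le> t^2 + 1 for twice the coordinates, whose squares are at
    most 4 |B|; doubling accounts for half-integral coordinates when \<open>D\<close> is 1 modulo
    4.\<close>
  define K where "K = \<lceil>4 * \<bar>B\<bar> + 4\<rceil>"
  have sq: "\<bar>t\<bar> \<le> of_int K" if "t * t \<le> 4 * \<bar>B\<bar>" for t :: rat
  proof -
    have "\<bar>t\<bar> \<le> t * t + 1"
    proof (cases "\<bar>t\<bar> \<le> 1")
      case False
      then have "\<bar>t\<bar> * 1 \<le> \<bar>t\<bar> * \<bar>t\<bar>" by (intro mult_left_mono) auto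
      then show ?thesis by simp
    qed (use zero_le_square[of t] in linarith)
    then have "\<bar>t\<bar> \<le> 4 * \<bar>B\<bar> + 4" using that by linarith
    then show ?thesis unfolding K_def by linarith
  qed
  have "{z \<in> Ok. nrm z \<le> B} \<subseteq> (\<lambda>(i, j). of_int i + of_int j * om) ` ({-(2*K)..2*K} \<times> {-(2*K)..2*K})"
  proof
    fix z assume "z \<in> {z \<in> Ok. nrm z \<le> B}"
    then have z: "z \<in> Ok" "nrm z \<le> B" by auto
    then obtain i j where ij: "z = of_int i + of_int j * om" unfolding O_eq by blast
    have D1: "(of_int D :: rat) \<le> -1" using D_neg by linarith
    have "of_int D * (ip z * ip z) \<le> -1 * (ip z * ip z)" using D1 by (intro mult_right_mono) auto
    then have "rp z * rp z + ip z * ip z \<le> \<bar>B\<bar>" using z(2) unfolding nrm_def by linarith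
    then have b: "(2 * rp z) * (2 * rp z) \<le> 4 * \<bar>B\<bar>" "(2 * ip z) * (2 * ip z) \<le> 4 * \<bar>B\<bar>"
      using zero_le_square[of "rp z"] zero_le_square[of "ip z"] by linarith+
    have "\<bar>2 * rp z\<bar> \<le> of_int K" "\<bar>2 * ip z\<bar> \<le> of_int K" using sq[OF b(1)] sq[OF b(2)] .
    then have "\<bar>of_int j :: rat\<bar> \<le> of_int K" "\<bar>2 * of_int i :: rat\<bar> \<le> of_int K + of_int K"
      unfolding ij rp_int_om ip_int_om by (auto split: if_splits)
    then have "\<bar>j\<bar> \<le> K" "\<bar>2 * i\<bar> \<le> K + K" by linarith+
    then have "i \<in> {-(2*K)..2*K}" "j \<in> {-(2*K)..2*K}" by auto
    then show "z \<in> (\<lambda>(i, j). of_int i + of_int j * om) ` ({-(2*K)..2*K} \<times> {-(2*K)..2*K})"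
      unfolding ij by (intro image_eqI[of _ _ "(i, j)"]) auto
  qed
  then show ?thesis by (rule finite_subset) auto
qed

lemma h_self: "h x x = of_rat (rp (h x x))" "rp (h x x) \<ge> 0"
proof -
  show e: "h x x = of_rat (rp (h x x))" by (rule cj_fixed) (metis h_cj)
  show "rp (h x x) \<ge> 0"
  proof (cases "x = 0")
    case True
    then show ?thesis using rp_rat[of 0] by simp
  next
    case False
    then obtain q where "q > 0" "h x x = of_rat q" using h_pos by blast
    then show ?thesis by simp
  qed
qed

text \<open>Positivity of h(v, v) for v = q y - h(y, x) x; both sides are taken in
  \<open>rat\<close>, where the order is available.\<close>

lemma cauchy_schwarz: "nrm (h y x) \<le> rp (h y y) * rp (h x x)"
proof (cases "x = 0")
  case False
  define q where "q = rp (h x x)"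
  have hq: "h x x = of_rat q" unfolding q_def by (rule h_self)
  have q: "q > 0" using h_pos[OF False] hq by auto
  have q0: "of_rat q \<noteq> (0::'k)" using q by simp
  define v where "v = smul (of_rat q) y - smul (h y x) x"
  have "h v v = of_rat q * (of_rat q * h y y - h y x * h x y)"
    unfolding v_def
    by (simp add: h_diff_left h_diff_right h_scale_left h_scale_right hq algebra_simps h_cj[of x y, symmetric])
  also have "h y x * h x y = of_rat (nrm (h y x))" using nrm_eq[of "h y x"] h_cj[of x y] by simp
  also have "of_rat q * (of_rat q * h y y - of_rat (nrm (h y x))) = of_rat (q * (q * rp (h y y) - nrm (h y x)))"
    by (subst h_self(1)) (simp add: of_rat_mult of_rat_diff)
  finally have "rp (h v v) = q * (q * rp (h y y) - nrm (h y x))" by simp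
  then have "0 \<le> q * (q * rp (h y y) - nrm (h y x))" using h_self(2)[of v] by simp
  then have "0 \<le> q * rp (h y y) - nrm (h y x)" using q by (simp add: zero_le_mult_iff)
  then show ?thesis unfolding q_def by (simp add: mult.commute)
qed (use rp_rat[of 0] in simp)

text \<open>An automorphism is determined by the images of finitely many generators and preserves
  their lengths, so it suffices that \<open>L\<close> has finitely many vectors of each length. Such
  a vector is determined by its products with the generators, which are integral and of bounded norm
  by Cauchy-Schwarz.\<close>

lemma finite_aut: assumes L: "latt L" "unim L" shows "finite (aut L)"
proof -
  obtain X where X: "finite X" "L = o_span smul X" using L(1) unfolding is_lattice_def by blast
  have XL: "X \<subseteq> L" using X(2) o_span_base by blast
  have spanX: "span X = UNIV"
  proof -
    have "osub smul (span X)" unfolding osub_def by (auto intro: span_zero span_add span_scale)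
    then have "L \<subseteq> span X" unfolding X(2) by (rule o_span_least) (auto intro: span_base)
    then have "span L \<subseteq> span X" using span_mono[of L "span X"] by (simp add: span_span)
    then show ?thesis using L(1) by (auto simp: latt_iff)
  qed
  have shell: "finite {y \<in> L. rp (h y y) = r}" for r
  proof -
    have "inj_on (\<lambda>y. restrict (\<lambda>x. h y x) X) {y \<in> L. rp (h y y) = r}"
    proof (rule inj_onI)
      fix y z assume "restrict (\<lambda>x. h y x) X = restrict (\<lambda>x. h z x) X"
      then have e: "h (y - z) x = 0" if "x \<in> X" for x
        using that by (simp add: h_diff_left) (metis restrict_apply')
      have "span X \<subseteq> {w. h (y - z) w = 0}"
        by (rule span_minimal) (use e in \<open>auto simp: subspace_def h_add_right h_scale_right\<close>)
      then have "h (y - z) (y - z) = 0" unfolding spanX by blast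
      then show "y = z" by (simp add: h_eq_0)
    qed
    moreover have "(\<lambda>y. restrict (\<lambda>x. h y x) X) ` {y \<in> L. rp (h y y) = r}
        \<subseteq> (\<Pi>\<^sub>E x\<in>X. {z \<in> Ok. nrm z \<le> r * rp (h x x)})"
      using unimD[OF L(2)] XL cauchy_schwarz by (fastforce simp: PiE_def)
    moreover have "finite (\<Pi>\<^sub>E x\<in>X. {z \<in> Ok. nrm z \<le> r * rp (h x x)})"
      using X(1) finite_O_nrm by (intro finite_PiE) auto
    ultimately show ?thesis using finite_imageD finite_subset by blast
  qed
  have "inj_on (\<lambda>\<sigma>. restrict \<sigma> X) (aut L)"
  proof (rule inj_onI)
    fix \<sigma> \<tau> assume s: "\<sigma> \<in> aut L" "\<tau> \<in> aut L" "restrict \<sigma> X = restrict \<tau> X"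
    then have U: "\<sigma> \<in> UV" "\<tau> \<in> UV" by (auto simp: lattice_aut_def)
    have e: "\<sigma> x = \<tau> x" if "x \<in> X" for x using s(3) that by (metis restrict_apply')
    have "\<sigma> 0 = 0" "\<tau> 0 = 0" using UV_diff[OF U(1), of 0 0] UV_diff[OF U(2), of 0 0] by simp_all
    then have "span X \<subseteq> {x. \<sigma> x = \<tau> x}"
      by (intro span_minimal) (use e in \<open>auto simp: subspace_def UV_D[OF U(1)] UV_D[OF U(2)]\<close>)
    then show "\<sigma> = \<tau>" unfolding spanX by auto
  qed
  moreover have "(\<lambda>\<sigma>. restrict \<sigma> X) ` aut L \<subseteq> (\<Pi>\<^sub>E x\<in>X. {y \<in> L. rp (h y y) = rp (h x x)})"
  proof (rule image_subsetI)
    fix \<sigma> assume s: "\<sigma> \<in> aut L"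
    then have U: "\<sigma> \<in> UV" "\<sigma> ` L = L" by (auto simp: lattice_aut_def)
    show "restrict \<sigma> X \<in> (\<Pi>\<^sub>E x\<in>X. {y \<in> L. rp (h y y) = rp (h x x)})"
      using XL U(2) UV_D(4)[OF U(1)] by auto
  qed
  moreover have "finite (\<Pi>\<^sub>E x\<in>X. {y \<in> L. rp (h y y) = rp (h x x)})"
    using X(1) shell by (intro finite_PiE) auto
  ultimately show ?thesis using finite_imageD finite_subset by blast
qed

lemma UV_prime_colength: assumes s: "\<sigma> \<in> UV" and H: "prime_colength P H L" shows "prime_colength P (\<sigma> ` H) (\<sigma> ` L)"
  unfolding prime_colength_def
proof (intro conjI ballI)
  have oH: "osub smul H" and HL: "H \<subseteq> L" "H \<noteq> L" and PL: "\<And>c x. c \<in> P \<Longrightarrow> x \<in> L \<Longrightarrow> smul c x \<in> H"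
    using H by (auto simp: prime_colength_def)
  have s0: "\<sigma> 0 = 0" using UV_diff[OF s, of 0 0] by simp
  show "osub smul (\<sigma> ` H)"
    using oH unfolding osub_def
    by (auto simp flip: UV_D(1,2)[OF s] intro: image_eqI[of _ _ 0] simp: s0)
  show "\<sigma> ` H \<subseteq> \<sigma> ` L" using HL by blast
  show "\<sigma> ` H \<noteq> \<sigma> ` L" using HL UV_D(3)[OF s] by (simp add: bij_is_inj inj_image_eq_iff)
  show "smul c x \<in> \<sigma> ` H" if "c \<in> P" "x \<in> \<sigma> ` L" for c x
    using that PL by (auto simp flip: UV_D(2)[OF s])
  obtain w where w: "w \<in> L" "\<And>x. x \<in> L \<Longrightarrow> \<exists>c\<in>Ok. x - smul c w \<in> H" using H unfolding prime_colength_def by blast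
  have "\<exists>c\<in>Ok. \<sigma> x - smul c (\<sigma> w) \<in> \<sigma> ` H" if x: "x \<in> L" for x
  proof -
    obtain c where "c \<in> Ok" "x - smul c w \<in> H" using w(2)[OF x] by blast
    then have "\<sigma> (x - smul c w) \<in> \<sigma> ` H" "c \<in> Ok" by auto
    then show ?thesis by (auto simp: UV_diff[OF s] UV_D(2)[OF s])
  qed
  then show "\<exists>w\<in>\<sigma> ` L. \<forall>x\<in>\<sigma> ` L. \<exists>c\<in>Ok. x - smul c w \<in> \<sigma> ` H" using w(1) by blast
qed

lemma UV_unim: assumes s: "\<sigma> \<in> UV" and L: "unim L" shows "unim (\<sigma> ` L)"
  unfolding unimodular_def
proof (intro subset_antisym subsetI)
  fix x assume "x \<in> \<sigma> ` L"
  then show "x \<in> dual (\<sigma> ` L)" using unimD[OF L] by (auto simp: dual_iff UV_D(4)[OF s])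
next
  fix x assume x: "x \<in> dual (\<sigma> ` L)"
  obtain y where y: "x = \<sigma> y" using UV_D(3)[OF s] by (metis bij_is_surj surjD)
  have "y \<in> L" by (rule unimI[OF L]) (use x in \<open>auto simp: dual_iff y UV_D(4)[OF s]\<close>)
  then show "x \<in> \<sigma> ` L" using y by blast
qed

lemma UV_neighbour: assumes s: "\<sigma> \<in> UV" and N: "neighbour P L N" shows "neighbour P (\<sigma> ` L) (\<sigma> ` N)"
proof -
  have "\<sigma> ` L \<inter> \<sigma> ` N = \<sigma> ` (L \<inter> N)"
    using UV_D(3)[OF s] by (simp add: image_Int bij_is_inj)
  then show ?thesis using N UV_latt[OF s] UV_unim[OF s] UV_prime_colength[OF s] unfolding neighbour_def by simp
qed

lemma locally_isometric_UV_image: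
  assumes p: "prime p" and s: "\<sigma> \<in> UV" and L: "latt L" shows "locally_isometric smul h p (\<sigma> ` L) L"
  by (rule locally_isometric_UV[OF p UV_inv[OF s] UV_latt[OF s L] L]) (simp add: UV_inv_image[OF s])

section \<open>The mass formula\<close>

lemma mass_partial_genus:
  assumes L: "latt L" "unim L" and G: "G = genus smul h L" and A: "A \<in> carrier class_group"
    and ne: "partial_genus smul G A \<noteq> {}"
  shows "mass smul h G = real (class_number TYPE('k)) / 2 ^ (num_ramified s - 1) * mass smul h (partial_genus smul G A)"
    and "\<And>B. B \<in> carrier class_group \<Longrightarrow> same_ideal_genus B A \<Longrightarrow>
       mass smul h (partial_genus smul G B) = mass smul h (partial_genus smul G A)"
proof -
  define S where "S B = partial_genus smul G B" for B
  have Gl: "latt N" "\<And>p. prime p \<Longrightarrow> locally_isometric smul h p N L" if "N \<in> G" for N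
    using that by (auto simp: G genus_def)
  have Gu: "unim N" if "N \<in> G" for N by (rule genus_unim[OF Gl(1)[OF that] L Gl(2)[OF that]])
  have GI: "M \<in> G" if "latt M" "N \<in> G" "\<And>p. prime p \<Longrightarrow> locally_isometric smul h p M N" for M N
    using that locally_isometric_trans[OF that(3) Gl(2)[OF that(2)]] by (simp add: G genus_def)
  have stG: "\<sigma> ` N \<in> G" if "\<sigma> \<in> UV" "N \<in> G" for \<sigma> N
    using GI[OF UV_latt[OF that(1) Gl(1)[OF that(2)]] that(2)] locally_isometric_UV_image[OF _ that(1) Gl(1)[OF that(2)]] by blast
  have stG': "stable G" using stG by (simp add: stable_def)
  have stS: "stable (S B)" for B
    unfolding stable_def
  proof (intro ballI)
    fix \<sigma> N assume s: "\<sigma> \<in> UV" and N: "N \<in> S B"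
    then have N': "N \<in> G" "steinitz_class smul N = B" by (auto simp: S_def partial_genus_def)
    have "steinitz_class smul (\<sigma> ` N) = steinitz_class smul N"
      by (rule steinitz_image[OF UV_D(1,2)[OF s] bij_is_surj[OF UV_D(3)[OF s]] Gl(1)[OF N'(1)]])
    then show "\<sigma> ` N \<in> S B" using stG[OF s N'(1)] N'(2) by (simp add: S_def partial_genus_def)
  qed
  have nbrG: "N \<in> G" if "split P p" "neighbour P M N" "M \<in> G" for P p M N
    using GI[of N M] neighbour_locally_isometric[OF that(1,2)] that(2,3) unfolding neighbour_def by blast
  \<comment> \<open>All neighbours of a lattice in \<open>S B\<close> lie in the partial genus of
    [P]^2 B, so its degree is the number of all its neighbours; in the other direction the same
    holds with conj(P).\<close>
  have step: "emass (S B) = emass (S ((icl P \<otimes>\<^bsub>class_group\<^esub> icl P) \<otimes>\<^bsub>class_group\<^esub> B))"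
    if P: "split P p" and B: "B \<in> carrier class_group" for P p B
  proof (rule emass_eq_by_correspondence[OF stS stS, where R = "neighbour P" and c = "card (hyperplanes n p)"])
    have fP: "frac P" by (rule degree_one_frac[OF splitD(1)[OF P]])
    have P': "split (cj ` P) p" by (rule split_cj[OF P])
    let ?B' = "(icl P \<otimes>\<^bsub>class_group\<^esub> icl P) \<otimes>\<^bsub>class_group\<^esub> B"
    show "finite (aut M)" if "M \<in> S B \<union> S ?B'" for M
      using that finite_aut Gl(1) Gu by (auto simp: S_def partial_genus_def)
    show "neighbour P (\<sigma> ` M) (\<sigma> ` N)" if "\<sigma> \<in> UV" "neighbour P M N" for \<sigma> M N by (rule UV_neighbour[OF that])
    show "finite {N \<in> S ?B'. neighbour P M N} \<and> card {N \<in> S ?B'. neighbour P M N} = card (hyperplanes n p)" if M: "M \<in> S B" for M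
    proof -
      have MG: "M \<in> G" "steinitz_class smul M = B" using M by (auto simp: S_def partial_genus_def)
      have "{N \<in> S ?B'. neighbour P M N} = {N. neighbour P M N}"
        using nbrG[OF P _ MG(1)] neighbour_steinitz[OF P, of M] MG(2) by (auto simp: S_def partial_genus_def)
      then show ?thesis using card_neighbour[OF P Gl(1)[OF MG(1)] Gu[OF MG(1)]] by simp
    qed
    show "finite {M \<in> S B. neighbour P M N} \<and> card {M \<in> S B. neighbour P M N} = card (hyperplanes n p)" if N: "N \<in> S ?B'" for N
    proof -
      have NG: "N \<in> G" "steinitz_class smul N = ?B'" using N by (auto simp: S_def partial_genus_def)
      have "steinitz_class smul M = B" if M: "neighbour P M N" for M
      proof -
        have "latt M" using M by (simp add: neighbour_def)
        then have c: "steinitz_class smul M \<in> carrier class_group" by (simp add: steinitz_eq frac_det_ideal)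
        have "?B' = (icl P \<otimes>\<^bsub>class_group\<^esub> icl P) \<otimes>\<^bsub>class_group\<^esub> steinitz_class smul M"
          using neighbour_steinitz[OF P M] NG(2) by simp
        then have "B \<otimes>\<^bsub>class_group\<^esub> (icl P \<otimes>\<^bsub>class_group\<^esub> icl P)
            = steinitz_class smul M \<otimes>\<^bsub>class_group\<^esub> (icl P \<otimes>\<^bsub>class_group\<^esub> icl P)"
          using CG.m_comm[of "icl P \<otimes>\<^bsub>class_group\<^esub> icl P" B]
            CG.m_comm[of "icl P \<otimes>\<^bsub>class_group\<^esub> icl P" "steinitz_class smul M"] c B fP by simp
        then show ?thesis using c B fP by simp
      qed
      then have "{M \<in> S B. neighbour P M N} = {M. neighbour (cj ` P) N M}"
        using nbrG[OF P' _ NG(1)] by (auto simp: S_def partial_genus_def neighbour_sym[of P])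
      then show ?thesis using card_neighbour[OF P' Gl(1)[OF NG(1)] Gu[OF NG(1)]] by simp
    qed
    have "prime p" by (rule degree_oneD(3)[OF splitD(1)[OF P]])
    then show "card (hyperplanes n p) > 0"
      using hyperplanes_nonempty[of p n] finite_hyperplanes[of p n] prime_gt_1_nat n_pos by (auto simp: card_gt_0_iff)
  qed
  have all: "emass (S (c \<otimes>\<^bsub>class_group\<^esub> B)) = emass (S B)" if c: "c \<in> class_squares" and B: "B \<in> carrier class_group" for c B
  proof -
    have "\<forall>B\<in>carrier class_group. emass (S (c \<otimes>\<^bsub>class_group\<^esub> B)) = emass (S B)"
    proof (rule square_class_induct[OF c])
      fix a b :: "'k set set" assume "a \<in> carrier class_group" "b \<in> carrier class_group"
        "\<forall>B\<in>carrier class_group. emass (S (a \<otimes>\<^bsub>class_group\<^esub> B)) = emass (S B)"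
        "\<forall>B\<in>carrier class_group. emass (S (b \<otimes>\<^bsub>class_group\<^esub> B)) = emass (S B)"
      then show "\<forall>B\<in>carrier class_group. emass (S ((a \<otimes>\<^bsub>class_group\<^esub> b) \<otimes>\<^bsub>class_group\<^esub> B)) = emass (S B)"
        by (simp add: CG.m_assoc)
    qed (use step in auto)
    then show ?thesis using B by blast
  qed
  have SqC: "class_squares \<subseteq> carrier class_group" unfolding class_squares_def by auto
  obtain L0 where L0: "L0 \<in> G" "steinitz_class smul L0 = A" using ne by (auto simp: partial_genus_def)
  \<comment> \<open>The only possible Steinitz classes in the genus: the products of
    \<open>A\<close> with squares, \<open>A\<close> being the class of the lattice
    \<open>L0\<close>.\<close>
  define I where "I = (\<lambda>c. c \<otimes>\<^bsub>class_group\<^esub> A) ` class_squares"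
  have injI: "inj_on (\<lambda>c. c \<otimes>\<^bsub>class_group\<^esub> A) class_squares"
    by (rule inj_onI) (use SqC A CG.right_cancel in blast)
  have finI: "finite I" unfolding I_def using finite_subset[OF SqC finite_class_group] by simp
  have GU: "G = (\<Union>B\<in>I. S B)"
  proof (intro subset_antisym subsetI)
    fix N assume N: "N \<in> G"
    obtain c where "c \<in> class_squares" "steinitz_class smul N = c \<otimes>\<^bsub>class_group\<^esub> steinitz_class smul L0"
      using steinitz_unim[OF Gl(1)[OF L0(1)] Gu[OF L0(1)] Gl(1)[OF N] Gu[OF N]] by blast
    then show "N \<in> (\<Union>B\<in>I. S B)" using N L0(2) unfolding I_def S_def partial_genus_def by blast
  qed (auto simp: S_def partial_genus_def)
  \<comment> \<open>Since the Steinitz class is invariant under isometries, the isometry class of a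
    lattice is the same set in \<open>G\<close> and in its partial genus. This is what turns the
    partition of \<open>G\<close> into one of the quotient.\<close>
  have cls: "irel G `` {N} = irel (S B) `` {N}" if "N \<in> S B" for N B
  proof -
    have N: "N \<in> G" using that by (simp add: S_def partial_genus_def)
    show ?thesis by (simp only: irel_class[OF stG' N] irel_class[OF stS that])
  qed
  have q: "G // irel G = (\<Union>B\<in>I. S B // irel (S B))"
  proof (intro subset_antisym subsetI)
    fix C assume "C \<in> G // irel G"
    then obtain N where N: "N \<in> G" "C = irel G `` {N}" by (rule quotientE)
    then obtain B where "B \<in> I" "N \<in> S B" using GU by blast
    then show "C \<in> (\<Union>B\<in>I. S B // irel (S B))" using N(2) cls quotientI[of N "S B" "irel (S B)"] by auto
  next
    fix C assume "C \<in> (\<Union>B\<in>I. S B // irel (S B))"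
    then obtain B where B: "B \<in> I" "C \<in> S B // irel (S B)" by blast
    then obtain N where N: "N \<in> S B" "C = irel (S B) `` {N}" by (meson quotientE)
    then have "N \<in> G" using GU B(1) by blast
    then show "C \<in> G // irel G" using N cls quotientI[of N G "irel G"] by auto
  qed
  have "emass G = (\<Sum>B\<in>I. emass (S B))"
    unfolding emass_def q
  proof (rule nn_integral_count_space_partition[OF finI])
    fix B B' :: "'k set set" assume "B \<noteq> B'"
    show "S B // irel (S B) \<inter> S B' // irel (S B') = {}"
    proof (rule ccontr)
      assume "S B // irel (S B) \<inter> S B' // irel (S B') \<noteq> {}"
      then obtain C where C: "C \<in> S B // irel (S B)" "C \<in> S B' // irel (S B')" by blast
      have "(SOME L. L \<in> C) \<in> S B" "(SOME L. L \<in> C) \<in> S B'"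
        using class_rep(1)[OF stS C(1)] class_rep(1)[OF stS C(2)] by auto
      then show False using \<open>B \<noteq> B'\<close> by (auto simp: S_def partial_genus_def)
    qed
  qed
  also have "\<dots> = (\<Sum>B\<in>I. emass (S A))" using all A unfolding I_def by (intro sum.cong) auto
  also have "\<dots> = of_nat (card class_squares) * emass (S A)" by (simp add: I_def card_image[OF injI])
  finally have "mass smul h G = real (card class_squares) * mass smul h (S A)"
    unfolding mass_eq by (simp add: enn2real_mult)
  then show "mass smul h G = real (class_number TYPE('k)) / 2 ^ (num_ramified s - 1) * mass smul h (partial_genus smul G A)"
    unfolding card_class_squares_real S_def .
  show "mass smul h (partial_genus smul G B) = mass smul h (partial_genus smul G A)"
    if B: "B \<in> carrier class_group" and g: "same_ideal_genus B A" for B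
  proof -
    define c where "c = B \<otimes>\<^bsub>class_group\<^esub> inv\<^bsub>class_group\<^esub> A"
    have c: "c \<in> class_squares" using g unfolding same_ideal_genus_def class_squares_def c_def .
    have "c \<otimes>\<^bsub>class_group\<^esub> A = B" unfolding c_def using B A by (simp add: CG.m_assoc)
    then have "emass (S B) = emass (S A)" using all[OF c A] by simp
    then show ?thesis unfolding mass_eq S_def by simp
  qed
qed

end

text \<open>Enumerating the basis given by \<open>hermitian_space\<close> provides the indexed basis
  of the locale; the nonzero vector makes the dimension positive.\<close>

lemma herm_space_exists:
  fixes s :: "'k::field_char_0" and smul :: "'k \<Rightarrow> 'v::ab_group_add \<Rightarrow> 'v"
  assumes iqf: "imag_quadratic_field D s" and H: "hermitian_space s smul h"
    and nz: "\<exists>x::'v. x \<noteq> 0" and pos: "positive_definite h"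
  shows "\<exists>bs n. herm_space D s smul bs n h"
proof -
  obtain B where fd: "finite_dimensional_vector_space smul B" using H unfolding hermitian_space_def by blast
  interpret FD: finite_dimensional_vector_space smul B by (rule fd)
  interpret IQ: imag_quad D s by unfold_locales (rule iqf)
  define n where "n = card B"
  obtain bs where bs: "bij_betw bs {..<n} B"
    using ex_bij_betw_nat_finite[OF FD.finite_Basis] by (auto simp: n_def lessThan_atLeast0)
  have im: "bs ` {..<n} = B" and inj: "inj_on bs {..<n}" using bs by (auto simp: bij_betw_def)
  have lin: "Vector_Spaces.linear smul (*) (\<lambda>x. h x y)" for y using H unfolding hermitian_space_def by blast
  have "n > 0"
  proof (rule ccontr)
    assume "\<not> n > 0"
    then have "B = {}" using FD.finite_Basis by (simp add: n_def)
    then have "(UNIV :: 'v set) = {0}" using FD.span_Basis FD.span_empty by simp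
    then show False using nz by auto
  qed
  have "herm_space D s smul bs n h"
  proof (unfold_locales)
    show "FD.independent (bs ` {..<n})" "FD.span (bs ` {..<n}) = UNIV"
      using im FD.independent_Basis FD.span_Basis by simp_all
    show "h (x + y) z = h x z + h y z" for x y z
    proof -
      interpret l: Vector_Spaces.linear smul "(*)" "\<lambda>x. h x z" by (rule lin)
      show ?thesis by (rule l.add)
    qed
    show "h (smul c x) y = c * h x y" for c x y
    proof -
      interpret l: Vector_Spaces.linear smul "(*)" "\<lambda>x. h x y" by (rule lin)
      show ?thesis by (rule l.scale)
    qed
    show "h x y = conjug s (h y x)" for x y using H unfolding hermitian_space_def by blast
    show "\<exists>q>0. h x x = of_rat q" if "x \<noteq> 0" for x using pos that by (auto simp: positive_definite_def)
  qed (use inj \<open>n > 0\<close> in auto)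
  then show ?thesis by blast
qed

theorem theorem4p1:
  fixes D :: int
    and s :: "'k::field_char_0"
    and smul :: "'k \<Rightarrow> 'v::ab_group_add \<Rightarrow> 'v"
    and h :: "'v \<Rightarrow> 'v \<Rightarrow> 'k"
    and L :: "'v set"
    and G :: "'v set set"
    and A :: "'k set set"
  assumes "imag_quadratic_field D s"
    and "hermitian_space s smul h"
    and "\<exists>x::'v. x \<noteq> 0"
    and "positive_definite h"
    and "is_lattice smul L"
    and "unimodular h L"
    and "G = genus smul h L"
    and "A \<in> carrier class_group"
    and "partial_genus smul G A \<noteq> {}"
  shows "mass smul h G =
           real (class_number TYPE('k)) / 2 ^ (num_ramified s - 1)
             * mass smul h (partial_genus smul G A)
         \<and> (\<forall>B \<in> carrier class_group. same_ideal_genus B A \<longrightarrow>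
               mass smul h (partial_genus smul G B) = mass smul h (partial_genus smul G A))"
proof -
  obtain bs n where "herm_space D s smul bs n h" using herm_space_exists[OF assms(1-4)] by blast
  then interpret herm_space D s smul bs n h .
  show ?thesis using mass_partial_genus[OF assms(5-9)] by blast
qed

end
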